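(* If $\omega=2$, one can list $t$ $4$-cliques in a graph with $m$ edges in time $$\begin{cases}\tilde O(m^{3/2}) & \text{if } t\le m^{5/4},\\ \tilde O(m\,t^{2/5}) & \text{if } m^{5/4}\le t\le m^{10/7},\\ \tilde O(m^{1/2}t^{3/4}) & \text{if } t\ge m^{10/7}.\end{cases}$$
   Context: Graphs are finite, simple and undirected; the model of computation is the word-RAM with $O(\log n)$-bit words; algorithms may be randomized, with output correct with high probability. $\tilde O$ hides polylogarithmic factors. $\omega$ denotes the matrix multiplication exponent; when $\omega=2$, the convention is that an $A\times B$ matrix can be multiplied by a $B\times C$ matrix in $\tilde O(AB+BC+AC)$ time. Listing $t$ $k$-cliques: given a graph and $t$, output $\min\{t,\Delta_k\}$ distinct $k$-cliques, where $\Delta_k$ is the number of $k$-cliques in the graph (equivalently, up to polylogarithmic factors in running time, list all $k$-cliques of a graph with $t$ $k$-cliques in total). *)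

theory Defs
  imports "HOL-Probability.Probability_Mass_Function" "Jordan_Normal_Form.Matrix"
begin

section \<open>A randomized word-RAM\<close>

text \<open>
  Words of length \<open>w\<close> are the natural numbers below \<open>2 ^ w\<close>. The machine has word registers and
  word-addressed arrays; registers and arrays are named by natural numbers occurring literally in
  the instructions, so that a given program uses only finitely many of them. (Finitely many arrays
  can be interleaved in a single one, so this is the usual word-RAM up to constant factors.)
\<close>

datatype binop = Add | Sub | Mul | Div | Mod | And | Or | Xor | Shl | Shr | Less | Equal

text \<open>As usual in HOL, \<open>x div 0 = 0\<close> and \<open>x mod 0 = x\<close>. The arguments are words.\<close>

fun binop_val :: "nat \<Rightarrow> binop \<Rightarrow> nat \<Rightarrow> nat \<Rightarrow> nat" where
  "binop_val w Add x y = (x + y) mod 2 ^ w"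
| "binop_val w Sub x y = (2 ^ w + x - y) mod 2 ^ w"
| "binop_val w Mul x y = (x * y) mod 2 ^ w"
| "binop_val w Div x y = x div y"
| "binop_val w Mod x y = x mod y"
| "binop_val w And x y = Bit_Operations.and x y"
| "binop_val w Or x y = Bit_Operations.or x y"
| "binop_val w Xor x y = Bit_Operations.xor x y"
| "binop_val w Shl x y = (x * 2 ^ y) mod 2 ^ w"
| "binop_val w Shr x y = x div 2 ^ y"
| "binop_val w Less x y = of_bool (x < y) mod 2 ^ w"
| "binop_val w Equal x y = of_bool (x = y) mod 2 ^ w"

datatype instr =
    Const nat nat           \<comment> \<open>target register, constant\<close>
  | Binop nat binop nat nat \<comment> \<open>target register, operation, argument registers\<close>
  | Load nat nat nat        \<comment> \<open>target register, array, register holding the index\<close>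
  | Store nat nat nat       \<comment> \<open>array, register holding the index, source register\<close>
  | Random nat              \<comment> \<open>target register, receives a uniformly random word\<close>
  | Jump nat
  | JumpIfZero nat nat      \<comment> \<open>tested register, jump target\<close>

record state =
  pc :: nat
  reg :: "nat \<Rightarrow> nat"
  mem :: "nat \<Rightarrow> nat \<Rightarrow> nat" \<comment> \<open>array, index\<close>

definition set_reg :: "nat \<Rightarrow> nat \<Rightarrow> state \<Rightarrow> state" where
  "set_reg r x s = s\<lparr>pc := Suc (pc s), reg := (reg s)(r := x)\<rparr>"

fun exec :: "nat \<Rightarrow> instr \<Rightarrow> state \<Rightarrow> state pmf" where
  "exec w (Const r k) s = return_pmf (set_reg r (k mod 2 ^ w) s)"
| "exec w (Binop r f r1 r2) s = return_pmf (set_reg r (binop_val w f (reg s r1) (reg s r2)) s)"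
| "exec w (Load r a i) s = return_pmf (set_reg r (mem s a (reg s i)) s)"
| "exec w (Store a i r) s =
     return_pmf (s\<lparr>pc := Suc (pc s), mem := (mem s)(a := (mem s a)(reg s i := reg s r))\<rparr>)"
| "exec w (Random r) s = map_pmf (\<lambda>x. set_reg r x s) (pmf_of_set {..<2 ^ w})"
| "exec w (Jump l) s = return_pmf (s\<lparr>pc := l\<rparr>)"
| "exec w (JumpIfZero r l) s = return_pmf (s\<lparr>pc := (if reg s r = 0 then l else Suc (pc s))\<rparr>)"

text \<open>A program halts by leaving its code; halted states are fixed points of \<open>step\<close>.\<close>

definition halted :: "instr list \<Rightarrow> state \<Rightarrow> bool" where
  "halted P s \<longleftrightarrow> length P \<le> pc s"

definition step :: "nat \<Rightarrow> instr list \<Rightarrow> state \<Rightarrow> state pmf" where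
  "step w P s = (if halted P s then return_pmf s else exec w (P ! pc s) s)"

primrec run :: "nat \<Rightarrow> instr list \<Rightarrow> nat \<Rightarrow> state \<Rightarrow> state pmf" where
  "run w P 0 s = return_pmf s"
| "run w P (Suc k) s = bind_pmf (step w P s) (run w P k)"

text \<open>The input is stored in array 0. All other storage initially holds arbitrary words.\<close>

definition initial :: "nat \<Rightarrow> nat list \<Rightarrow> state \<Rightarrow> bool" where
  "initial w xs s \<longleftrightarrow> pc s = 0 \<and> (\<forall>r. reg s r < 2 ^ w) \<and> (\<forall>a i. mem s a i < 2 ^ w) \<and>
     (\<forall>i < length xs. mem s 0 i = xs ! i)"

text \<open>The output is stored in array 1, and its length in register 0.\<close>

definition result :: "state \<Rightarrow> nat list" where
  "result s = map (mem s 1) [0..<reg s 0]"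


section \<open>Solving a problem in time \<open>O\<close>-tilde of a given bound\<close>

text \<open>
  A problem is given by its set \<open>I\<close> of instances, the size \<open>N x \<ge> 2\<close> of an instance \<open>x\<close>, the set
  \<open>enc x\<close> of its admissible input encodings, and the predicate \<open>ok x\<close> on correct outputs.
  Words have \<open>O(log N)\<close> bits for a constant chosen along with the program. The running time bound
  \<open>O(T \<cdot> polylog N)\<close> is worst-case, and the output is correct with high probability, i.e.\ for every
  constant \<open>a\<close> one can achieve probability at least \<open>1 - N powr (-a)\<close>.

  That the input fits into words and is addressable is part of the assertion: otherwise, a too small
  word length would leave no initial state and make the remaining requirements vacuous.
\<close>

definition solvable_in_soft_time ::
  "'i set \<Rightarrow> ('i \<Rightarrow> nat) \<Rightarrow> ('i \<Rightarrow> nat list set) \<Rightarrow> ('i \<Rightarrow> nat list \<Rightarrow> bool) \<Rightarrow> ('i \<Rightarrow> real) \<Rightarrow> bool"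
where
  "solvable_in_soft_time I N enc ok T \<longleftrightarrow>
     (\<forall>a::nat. \<exists>(P::instr list) (c::nat) (d::nat) (K::real).
        \<forall>x\<in>I. \<forall>xs\<in>enc x.
          let w = c * nat \<lceil>log 2 (real (N x))\<rceil>;
              k = nat \<lfloor>K * T x * log 2 (real (N x)) ^ d\<rfloor>
          in (\<forall>z\<in>set xs. z < 2 ^ w) \<and> length xs \<le> 2 ^ w \<and>
             (\<forall>s. initial w xs s \<longrightarrow>
                (\<forall>s'\<in>set_pmf (run w P k s). halted P s') \<and>
                measure_pmf.prob (run w P k s) {s'. ok x (result s')} \<ge> 1 - 1 / real (N x) ^ a))"


section \<open>Matrix multiplication\<close>

text \<open>
  Matrices have natural number entries; signed entries reduce to this case by splitting matrices into
  positive and negative parts. An instance \<open>(N, X, Y)\<close> asks for the product of \<open>X\<close> and \<open>Y\<close>, where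
  \<open>N\<close> bounds dimensions and entries. It need not be the least bound: when a multiplication occurs
  within an algorithm on a larger input, it is the latter that determines the word length, and the
  polylogarithmic factors are with respect to the latter.
\<close>

type_synonym matmul_instance = "nat \<times> nat mat \<times> nat mat"

definition matmul_instances :: "matmul_instance set" where
  "matmul_instances = {(N, X, Y). 2 \<le> N \<and> dim_col X = dim_row Y \<and>
     dim_row X \<in> {1..N} \<and> dim_col X \<in> {1..N} \<and> dim_col Y \<in> {1..N} \<and>
     elements_mat X \<subseteq> {..N} \<and> elements_mat Y \<subseteq> {..N}}"

definition row_major :: "nat mat \<Rightarrow> nat list" where
  "row_major X = concat (map (\<lambda>i. map (\<lambda>j. X $$ (i, j)) [0..<dim_col X]) [0..<dim_row X])"

definition matmul_enc :: "matmul_instance \<Rightarrow> nat list set" where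
  "matmul_enc = (\<lambda>(N, X, Y).
     {[dim_row X, dim_col X, dim_col Y] @ row_major X @ row_major Y})"

definition matmul_ok :: "matmul_instance \<Rightarrow> nat list \<Rightarrow> bool" where
  "matmul_ok = (\<lambda>(N, X, Y) zs. zs = row_major (X * Y))"

text \<open>\<open>T A B C\<close> bounds the time for multiplying an \<open>A \<times> B\<close> matrix by a \<open>B \<times> C\<close> matrix.\<close>

definition rect_matmul_in_soft_time :: "(nat \<Rightarrow> nat \<Rightarrow> nat \<Rightarrow> real) \<Rightarrow> bool" where
  "rect_matmul_in_soft_time T \<longleftrightarrow>
     solvable_in_soft_time matmul_instances fst matmul_enc matmul_ok
       (\<lambda>(N, X, Y). T (dim_row X) (dim_col X) (dim_col Y))"

definition square_matmul_in_soft_time :: "(nat \<Rightarrow> real) \<Rightarrow> bool" where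
  "square_matmul_in_soft_time T \<longleftrightarrow>
     solvable_in_soft_time
       {(N, X, Y) \<in> matmul_instances. square_mat X \<and> square_mat Y} fst matmul_enc matmul_ok
       (\<lambda>(N, X, Y). T (dim_row X))"

text \<open>Polylogarithmic factors do not affect the infimum.\<close>

definition matmul_exponent :: real ("\<omega>") where
  "\<omega> = Inf {\<tau>. square_matmul_in_soft_time (\<lambda>n. real n powr \<tau>)}"


section \<open>Listing cliques\<close>

definition simple_graph :: "nat \<Rightarrow> nat set set \<Rightarrow> bool" where
  "simple_graph n E \<longleftrightarrow> E \<subseteq> {e. e \<subseteq> {..<n} \<and> card e = 2}"

definition cliques :: "nat \<Rightarrow> nat \<Rightarrow> nat set set \<Rightarrow> nat set set" where
  "cliques k n E = {S. S \<subseteq> {..<n} \<and> card S = k \<and> (\<forall>u\<in>S. \<forall>v\<in>S. u \<noteq> v \<longrightarrow> {u, v} \<in> E)}"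

text \<open>
  An instance \<open>(n, E, t)\<close> asks for \<open>min t \<Delta>\<close> distinct cliques of the graph with vertices
  \<open>0, \<dots>, n - 1\<close> and edge set \<open>E\<close>, where \<open>\<Delta>\<close> is the total number of \<open>k\<close>-cliques. Edgeless graphs are
  excluded, as the time bounds vanish for \<open>card E = 0\<close>.
\<close>

type_synonym listing_instance = "nat \<times> nat set set \<times> nat"

definition listing_instances :: "listing_instance set" where
  "listing_instances = {(n, E, t). simple_graph n E \<and> E \<noteq> {}}"

text \<open>
  The target \<open>t\<close> is part of the input, hence words must be able to hold it.
  For \<open>t\<close> polynomial in \<open>n\<close> (the number of cliques is), \<open>log (max n t) = \<Theta>(log n)\<close>.
\<close>

definition listing_size :: "listing_instance \<Rightarrow> nat" where
  "listing_size = (\<lambda>(n, E, t). max n t)"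

text \<open>The edges are given in any order and orientation, without repetition (as \<open>length es = card E\<close>).\<close>

definition listing_enc :: "listing_instance \<Rightarrow> nat list set" where
  "listing_enc = (\<lambda>(n, E, t).
     {[n, card E, t] @ concat (map (\<lambda>(u, v). [u, v]) es) | es.
        length es = card E \<and> (\<lambda>(u, v). {u, v}) ` set es = E})"

definition listing_ok :: "nat \<Rightarrow> listing_instance \<Rightarrow> nat list \<Rightarrow> bool" where
  "listing_ok k = (\<lambda>(n, E, t) zs. \<exists>cs.
     zs = concat cs \<and> length cs = min t (card (cliques k n E)) \<and>
     distinct (map set cs) \<and> (\<forall>c\<in>set cs. length c = k \<and> set c \<in> cliques k n E))"

text \<open>\<open>T m t\<close> bounds the time for listing \<open>t\<close> cliques in a graph with \<open>m\<close> edges.\<close>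

definition clique_listing_in_soft_time :: "nat \<Rightarrow> (real \<Rightarrow> real \<Rightarrow> real) \<Rightarrow> bool" where
  "clique_listing_in_soft_time k T \<longleftrightarrow>
     solvable_in_soft_time listing_instances listing_size listing_enc (listing_ok k)
       (\<lambda>(n, E, t). T (real (card E)) (real t))"

end

theory Submission
  imports Defs
begin

text \<open>
  The edges are added one by one, and bisection over the prefixes of the edge list finds the largest prefix
  with at most \<open>t\<close> cliques; the last edge supplies the missing ones, so it suffices to list all cliques of a
  graph that has at most \<open>t\<close> of them, or to notice that there are more. For edges of a graph and a degree
  threshold halved from level to level, vertices of low degree are handled by enumerating their neighbourhoods.
  For vertices of high degree, a matrix product counts, for every pair of rows, the edges (potential witnesses)
  completing it to a 4-clique. Pairs with few witnesses are resolved by isolating the witnesses with random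
  multiplicative hashing and reading them off from weighted products; pairs with many witnesses are
  passed on to the next level. There are few of them, because each accounts for many of the \<open>t\<close> cliques. The same
  scheme is applied inside the neighbourhood of a vertex of low degree, and balancing the thresholds gives the
  three time bounds. As the multiplication program may fail or take its time on garbage, the word-RAM program
  is obtained by compiling a small structured language, whose logic \<open>sp\<close> bounds time and error
  probability simultaneously through a single clock.
\<close>

text \<open>Up to constants, the target \<open>B\<close> is the largest of m^(3/2), m t^(2/5) and
  m^(1/2) t^(3/4), which is the piecewise bound, and the degree threshold \<open>D\<close> is the
  larger of m^2/B and (t m/B)^(1/2). The program finds both by linear search on integer
  inequalities. The obstacle is that the work is small only if there are at most t cliques and no
  random choice fails. Hence every piece of work is charged to a budget before it is done, and an
  exhausted budget stops the search. This makes the time bound worst-case; and on a run without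
  failures an exhausted budget proves that there are too many cliques, which is the test that the
  bisection needs. The error of a multiplication is not reduced by repetition. The multiplication
  program is run with a size parameter \<open>N\<close> that is about a large fixed power of the
  input size, so that its guarantee 1 - 1/N survives a union bound over all steps.\<close>

abbreviation (input) iff_ascii (infixr "<->" 25) where "A <-> B == A = (B::bool)"

section \<open>Compiling a structured language to the word-RAM\<close>

datatype exp = Lit nat | Var nat | Op binop exp exp | Read nat exp

datatype com =
 Skip
 | Asg nat exp
 | Write nat exp exp
 | Draw nat nat
 | MatMul
 | Seq com com (infixr ";;" 60)
 | Cond exp com com
 | While exp com

text \<open>
 Registers and arrays of the multiplication program are interleaved with those of the surrounding
 program. Its input and output arrays are the arrays 2 and 3 of the structured language.
\<close>

definition var_reg :: "nat => nat" where "var_reg x = 3 * x"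
definition tmp_reg :: "nat => nat" where "tmp_reg k = 3 * k + 1"
definition sub_reg :: "nat => nat" where "sub_reg r = 3 * r + 2"
definition arr :: "nat => nat" where "arr a = (if a < 2 then a else if a < 4 then 2 * a - 1 else 2 * a)"
definition sub_arr :: "nat => nat" where "sub_arr a = 2 * a + 3"

lemma var_reg_eq [simp]: "var_reg x = var_reg y <-> x = y"
 and tmp_reg_eq [simp]: "tmp_reg x = tmp_reg y <-> x = y"
 and sub_reg_eq [simp]: "sub_reg x = sub_reg y <-> x = y"
 by (auto simp: var_reg_def tmp_reg_def sub_reg_def)

lemma reg_neq [simp]:
 "var_reg x ~= tmp_reg k" "tmp_reg k ~= var_reg x" "var_reg x ~= sub_reg r" "sub_reg r ~= var_reg x"
 "tmp_reg k ~= sub_reg r" "sub_reg r ~= tmp_reg k"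
 unfolding var_reg_def tmp_reg_def sub_reg_def by arith+

lemma arr_eq [simp]: "arr a = arr b <-> a = b"
 unfolding arr_def by (auto split: if_splits; arith)

text \<open>These two shared arrays are the whole interface to the multiplication program; its other
  arrays become odd numbers from 7 on, which \<open>arr\<close> avoids. Arrays 0 and 1 keep their
  numbers since \<open>initial\<close> and \<open>result\<close> fix them.\<close>

lemma sub_arr_0: "sub_arr 0 = arr 2" and sub_arr_1: "sub_arr (Suc 0) = arr 3"
 by (auto simp: arr_def sub_arr_def)

text \<open>The temporaries from \<open>k\<close> on form an evaluation stack. The machine has no
  copy instruction; \<open>Or\<close> of a register with itself replaces it.\<close>

fun ecode :: "nat => exp => instr list" where
 "ecode k (Lit n) = [Const (tmp_reg k) n]"
| "ecode k (Var x) = [Binop (tmp_reg k) Or (var_reg x) (var_reg x)]"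
| "ecode k (Op f d e) = ecode k d @ ecode (Suc k) e @ [Binop (tmp_reg k) f (tmp_reg k) (tmp_reg (Suc k))]"
| "ecode k (Read a e) = ecode k e @ [Load (tmp_reg k) (arr a) (tmp_reg k)]"

fun esize :: "exp => nat" where
 "esize (Lit n) = 1"
| "esize (Var x) = 1"
| "esize (Op f d e) = esize d + esize e + 1"
| "esize (Read a e) = esize e + 1"

lemma length_ecode [simp]: "length (ecode k e) = esize e"
 by (induction e arbitrary: k) auto

text \<open>A program may halt by jumping anywhere beyond its end. Clamping the targets to the
  length \<open>l\<close> makes every such exit land on the instruction following the embedded
  program.\<close>

fun relocate :: "nat => nat => instr => instr" where
 "relocate p l (Const r k) = Const (sub_reg r) k"
| "relocate p l (Binop r f r1 r2) = Binop (sub_reg r) f (sub_reg r1) (sub_reg r2)"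
| "relocate p l (Load r a i) = Load (sub_reg r) (sub_arr a) (sub_reg i)"
| "relocate p l (Store a i r) = Store (sub_arr a) (sub_reg i) (sub_reg r)"
| "relocate p l (Random r) = Random (sub_reg r)"
| "relocate p l (Jump j) = Jump (p + min j l)"
| "relocate p l (JumpIfZero r j) = JumpIfZero (sub_reg r) (p + min j l)"

fun code :: "instr list => nat => com => instr list" where
 "code M p Skip = []"
| "code M p (Asg x e) = ecode 0 e @ [Binop (var_reg x) Or (tmp_reg 0) (tmp_reg 0)]"
| "code M p (Write a i e) = ecode 0 i @ ecode 1 e @ [Store (arr a) (tmp_reg 0) (tmp_reg 1)]"
| "code M p (Draw a x) =
 [Const (tmp_reg 0) 0, Binop (tmp_reg 1) Less (tmp_reg 0) (var_reg x), JumpIfZero (tmp_reg 1) (p + 8),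
 Random (tmp_reg 2), Store (arr a) (tmp_reg 0) (tmp_reg 2), Const (tmp_reg 1) 1,
 Binop (tmp_reg 0) Add (tmp_reg 0) (tmp_reg 1), Jump (p + 1)]"
| "code M p MatMul = map (relocate p (length M)) M"
| "code M p (c ;; d) = code M p c @ code M (p + length (code M p c)) d"
| "code M p (Cond e c d) =
 (let c' = code M (p + esize e + 1) c;
 d' = code M (p + esize e + 1 + length c' + 1) d
 in ecode 0 e @ [JumpIfZero (tmp_reg 0) (p + esize e + 1 + length c' + 1)] @ c' @
 [Jump (p + esize e + 1 + length c' + 1 + length d')] @ d')"
| "code M p (While e c) =
 (let c' = code M (p + esize e + 1) c
 in ecode 0 e @ [JumpIfZero (tmp_reg 0) (p + esize e + 1 + length c' + 1)] @ c' @ [Jump p])"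

text \<open>Not the length of the code: this bounds the machine instructions that have to be paid by
  a single clock tick, which is why sequences take a maximum.\<close>

fun csize :: "com => nat" where
 "csize Skip = 1"
| "csize (Asg x e) = esize e + 1"
| "csize (Write a i e) = esize i + esize e + 1"
| "csize (Draw a x) = 10"
| "csize MatMul = 1"
| "csize (c ;; d) = max (csize c) (csize d)"
| "csize (Cond e c d) = max (esize e + 2) (max (csize c) (csize d))"
| "csize (While e c) = max (esize e + 2) (csize c)"

definition placed :: "instr list => nat => instr list => bool" where
 "placed P p is <-> (\<exists>us vs. P = us @ is @ vs & length us = p)"

lemma placed_iff_nth: "placed P p is <-> p + length is <= length P & (\<forall>i<length is. P ! (p + i) = is ! i)"
proof
 assume "placed P p is"
 thus "p + length is <= length P & (\<forall>i<length is. P ! (p + i) = is ! i)"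
 by (auto simp: placed_def nth_append)
next
 assume *: "p + length is <= length P & (\<forall>i<length is. P ! (p + i) = is ! i)"
 hence "take (length is) (drop p P) = is"
 by (intro nth_equalityI) auto
 hence "P = take p P @ is @ drop (p + length is) P"
 using append_take_drop_id[of p P] append_take_drop_id[of "length is" "drop p P"]
 by (simp add: add.commute)
 moreover have "length (take p P) = p" using * by simp
 ultimately show "placed P p is" unfolding placed_def by metis
qed

lemma placed_append: "placed P p (is @ js) <-> placed P p is & placed P (p + length is) js"
proof
 assume *: "placed P p (is @ js)"
 hence "P ! (p + i) = is ! i" if "i < length is" for i
 using that unfolding placed_iff_nth by (auto simp: nth_append dest: spec[of _ i])
 moreover have "P ! (p + length is + i) = js ! i" if "i < length js" for i
 using * that unfolding placed_iff_nth by (auto simp: nth_append add.assoc dest: spec[of _ "length is + i"])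
 ultimately show "placed P p is & placed P (p + length is) js"
 using * unfolding placed_iff_nth by auto
next
 assume *: "placed P p is & placed P (p + length is) js"
 have "P ! (p + i) = (is @ js) ! i" if "i < length is + length js" for i
 proof (cases "i < length is")
 case False
 then obtain k where "i = length is + k" using le_Suc_ex not_less by blast
 thus ?thesis using * that unfolding placed_iff_nth by (auto simp: add.assoc)
 qed (insert *, auto simp: placed_iff_nth nth_append)
 thus "placed P p (is @ js)" using * unfolding placed_iff_nth by auto
qed

lemma placed_Cons: "placed P p (i # is) <-> p < length P & P ! p = i & placed P (Suc p) is"
 using placed_append[of P p "[i]" "is"] by (auto simp: placed_iff_nth)

lemma placed_nth: "placed P p is ==> i < length is ==> p + i < length P & P ! (p + i) = is ! i"
 by (auto simp: placed_def nth_append)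

subsection \<open>Words\<close>

lemma bit_op_less_power:
 assumes "(x::nat) < 2 ^ w" "y < 2 ^ w"
 shows "Bit_Operations.and x y < 2 ^ w" "Bit_Operations.or x y < 2 ^ w" "Bit_Operations.xor x y < 2 ^ w"
proof -
 have "take_bit w (Bit_Operations.and x y) = Bit_Operations.and x y"
 "take_bit w (Bit_Operations.or x y) = Bit_Operations.or x y"
 "take_bit w (Bit_Operations.xor x y) = Bit_Operations.xor x y"
 using assms by (simp_all add: take_bit_nat_eq_self)
thus "Bit_Operations.and x y < 2 ^ w" "Bit_Operations.or x y < 2 ^ w" "Bit_Operations.xor x y < 2 ^ w"
 by (metis take_bit_nat_less_exp)+
qed

lemma binop_val_less:
 assumes "x < 2 ^ w" "y < 2 ^ w"
 shows "binop_val w f x y < 2 ^ w"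
proof (cases f)
 case Div
 thus ?thesis using assms by (auto intro: le_less_trans[OF div_le_dividend])
next
 case Mod
 thus ?thesis using assms by (auto intro: le_less_trans[OF mod_less_eq_dividend])
next
 case Shr
 thus ?thesis using assms by (auto intro: le_less_trans[OF div_le_dividend])
qed (use bit_op_less_power[OF assms] in auto)

definition words :: "nat => state => bool" where
 "words w s <-> (\<forall>r. reg s r < 2 ^ w) & (\<forall>a i. mem s a i < 2 ^ w)"

lemma words_exec: "words w s ==> s' : set_pmf (exec w i s) ==> words w s'"
 by (cases i) (auto simp: words_def set_reg_def binop_val_less lessThan_empty_iff)

lemma finite_set_pmf_exec: "finite (set_pmf (exec w i s))"
 by (cases i) (auto simp: lessThan_empty_iff)

section \<open>Halting time and error probability of machine programs\<close>

lemma halted_run: "halted P s ==> run w P k s = return_pmf s"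
 by (induction k) (auto simp: step_def bind_return_pmf)

lemma prob_bind_pmf:
 "measure_pmf.prob (bind_pmf p f) X = measure_pmf.expectation p (%x. measure_pmf.prob (f x) X)"
proof -
 have "ennreal (measure_pmf.prob (bind_pmf p f) X) = (\<integral>\<^sup>+x. ennreal (measure_pmf.prob (f x) X) \<partial>p)"
 by (simp add: measure_pmf.emeasure_eq_measure[symmetric])
 also have "... = ennreal (measure_pmf.expectation p (%x. measure_pmf.prob (f x) X))"
 by (intro nn_integral_eq_integral measure_pmf.integrable_const_bound[where B = 1]) auto
 finally show ?thesis by (subst (asm) ennreal_inj) (auto intro!: Bochner_Integration.integral_nonneg)
qed

text \<open>
 From \<open>s\<close>, the program halts within \<open>tu\<close> steps, with a result satisfying \<open>ok\<close> except with
 probability \<open>e\<close>. Nothing is claimed about the result if the flag \<open>b\<close> is raised.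
\<close>

definition fin :: "nat => instr list => (state => bool) => state => real => bool => real => bool" where
 "fin w P ok s tu b e <-> 0 <= tu & 0 <= e & (\<forall>k. tu <= real k -->
 (\<forall>s'\<in>set_pmf (run w P k s). halted P s') &
 (b | 1 - e <= measure_pmf.prob (run w P k s) {s'. ok s'}))"

lemma fin_mono:
 "fin w P ok s tu b e ==> tu <= tu' ==> (b ==> b') ==> e <= e' ==> fin w P ok s tu' b' e'"
 unfolding fin_def by (smt (verit))

lemma fin_halted: "halted P s ==> 0 <= tu ==> b | ok s ==> 0 <= e ==> fin w P ok s tu b e"
 by (auto simp: fin_def halted_run)

text \<open>Time is worst-case, so all successors share the bound \<open>tu\<close>; error
  probabilities only need to be bounded on average, so each outcome \<open>x\<close> may have its
  own \<open>f x\<close>.\<close>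

lemma fin_avg:
 assumes "pc s < length P"
 and exec: "exec w (P ! pc s) s = map_pmf g D" and fin_D: "finite (set_pmf D)"
 and fin: "!!x. x : set_pmf D ==> fin w P ok (g x) tu b (f x)"
 and avg: "measure_pmf.expectation D f <= e"
 shows "fin w P ok s (tu + 1) b e"
 unfolding fin_def
proof (intro conjI allI impI)
 obtain x0 where x0: "x0 : set_pmf D" using set_pmf_not_empty by fast
 have "0 <= tu" using fin[OF x0] by (auto simp: fin_def)
 thus "0 <= tu + 1" by simp
 have "0 <= measure_pmf.expectation D f"
 using fin by (intro integral_nonneg_AE) (auto simp: AE_measure_pmf_iff fin_def)
 thus "0 <= e" using avg by simp
 fix k :: nat assume "tu + 1 <= real k"
 with \<open>0 <= tu\<close> obtain j where j: "k = Suc j" "tu <= real j" by (cases k) auto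
 have run: "run w P k s = bind_pmf D (%x. run w P j (g x))"
 using assms(1) by (simp add: j step_def halted_def exec bind_map_pmf)
 show "\<forall>s'\<in>set_pmf (run w P k s). halted P s'"
 using fin j(2) unfolding run fin_def by fastforce
 show "b | 1 - e <= measure_pmf.prob (run w P k s) {s'. ok s'}"
 proof (cases b)
 case False
 have "1 - e <= 1 - measure_pmf.expectation D f" using avg by simp
 also have "... = measure_pmf.expectation D (%x. 1 - f x)"
 by (subst Bochner_Integration.integral_diff)
 (auto intro: integrable_measure_pmf_finite fin_D)
 also have "... <= measure_pmf.expectation D (%x. measure_pmf.prob (run w P j (g x)) {s'. ok s'})"
 using fin j False
 by (intro integral_mono_AE integrable_measure_pmf_finite fin_D)
 (auto simp: fin_def AE_measure_pmf_iff)
 also have "... = measure_pmf.prob (run w P k s) {s'. ok s'}"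
 unfolding run by (simp add: prob_bind_pmf)
 finally show ?thesis by simp
 qed simp
qed

lemma fin_det:
 assumes "pc s < length P" "exec w (P ! pc s) s = return_pmf s'" "fin w P ok s' tu b e"
 shows "fin w P ok s (tu + 1) b e"
 by (rule fin_avg[where f = "%_. e" and g = "%x. x" and D = "return_pmf s'"]) (use assms in auto)

lemma words_run: "words w s ==> s' : set_pmf (run w P k s) ==> words w s'"
proof (induction k arbitrary: s)
 case (Suc k)
 thus ?case by (auto simp: step_def words_exec split: if_splits dest: words_exec)
qed simp

text \<open>The state of the whole machine while the multiplication program, located at \<open>p\<close>, is in state \<open>t\<close>.\<close>

definition embed :: "nat => nat => state => state => state" where
 "embed p l s t = (|pc = p + min (pc t) l,
 reg = (%r. if r mod 3 = 2 then reg t (r div 3) else reg s r),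
 mem = (%a. if odd a & 3 <= a then mem t ((a - 3) div 2) else mem s a)|)"

text \<open>Since \<open>pc t < l\<close>, the next instruction has index at most \<open>l\<close>,
  so the clamping in \<open>embed\<close> leaves it alone; jumps are clamped in the same way on both
  sides.\<close>

lemma exec_relocate:
 assumes "pc t < l"
 shows "exec w (relocate p l i) (embed p l s t) = map_pmf (embed p l s) (exec w i t)"
proof -
 have sub_reg: "sub_reg r mod 3 = 2" "sub_reg r div 3 = r" for r
 unfolding sub_reg_def by (simp_all del: add_2_eq_Suc' add: mod_add_left_eq[symmetric])
 have sub_arr: "odd (sub_arr a)" "3 <= sub_arr a" "(sub_arr a - 3) div 2 = a" for a
 by (auto simp: sub_arr_def)
 have sub_reg': "r' = sub_reg r <-> r' mod 3 = 2 & r' div 3 = r" for r r'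
 using mult_div_mod_eq[of 3 r'] sub_reg[of r] by (metis sub_reg_def)
 have sub_arr': "a' = sub_arr a <-> odd a' & 3 <= a' & (a' - 3) div 2 = a" for a a'
 by (auto simp: sub_arr_def elim!: oddE)
 have reg: "(%r'. if r' mod 3 = 2 then reg t (r' div 3) else reg s r')(sub_reg r := x) =
 (%r'. if r' mod 3 = 2 then ((reg t)(r := x)) (r' div 3) else reg s r')" for r x
 by (rule ext) (simp add: sub_reg')
 have mem: "(%a'. if odd a' & 3 <= a' then mem t ((a' - 3) div 2) else mem s a')(sub_arr a := x) =
 (%a'. if odd a' & 3 <= a' then ((mem t)(a := x)) ((a' - 3) div 2) else mem s a')" for a x
 by (rule ext) (simp add: sub_arr')
 note [simp] = sub_reg sub_arr
 show ?thesis using assms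
 by (cases i) (simp_all add: embed_def set_reg_def map_pmf_comp reg mem Suc_le_eq cong: if_cong)
qed

text \<open>If \<open>g\<close> fails, the new error bound is at least 1 and nothing is claimed
  about the result any more. Averaging this over the runs of a subprogram adds its failure
  probability to the error.\<close>

lemma fin_branch:
 "fin w P ok s tu (b | ~g) e ==> fin w P ok s tu b (e + 1 - of_bool g)"
 unfolding fin_def by (cases g) (auto intro: order_trans[OF _ measure_nonneg])

text \<open>Induction over the steps of the embedded program: \<open>fin_branch\<close> applies
  where it has halted and \<open>fin_avg\<close> passes through its random instructions. Its failure
  probability adds to the error of the continuation.\<close>

lemma fin_relocate:
 assumes placed: "placed P p (map (relocate p (length M)) M)"
 and halt: "!!t'. t' : set_pmf (run w M k t) ==> halted M t'"
 and fin: "!!t'. t' : set_pmf (run w M k t) ==>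
 fin w P ok (embed p (length M) s t') tu (b | ~good t') e"
 shows "fin w P ok (embed p (length M) s t) (tu + real k) b
 (e + 1 - measure_pmf.prob (run w M k t) {t'. good t'})"
 using halt fin
proof (induction k arbitrary: t)
 case 0
 thus ?case using fin_branch[of w P ok _ tu b "good t"] by (simp add: indicator_def)
next
 case (Suc k)
 show ?case
 proof (cases "halted M t")
 case True
 hence "fin w P ok (embed p (length M) s t) tu b (e + 1 - of_bool (good t))"
 using Suc.prems(2) by (intro fin_branch) (simp add: halted_run del: run.simps)
 thus ?thesis using True
 by (auto simp: halted_run indicator_def simp del: run.simps elim!: fin_mono)
 next
 case False
 hence pct: "pc t < length M" by (simp add: halted_def)
 let ?D = "exec w (M ! pc t) t"
 have run: "run w M (Suc k) t = bind_pmf ?D (run w M k)" using False by (simp add: step_def)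
 have "pc (embed p (length M) s t) = p + pc t" using pct by (simp add: embed_def)
 moreover have "p + pc t < length P" "P ! (p + pc t) = relocate p (length M) (M ! pc t)"
 using placed_nth[OF placed, of "pc t"] pct by auto
 ultimately have *: "pc (embed p (length M) s t) < length P"
 "exec w (P ! pc (embed p (length M) s t)) (embed p (length M) s t) = map_pmf (embed p (length M) s) ?D"
 using exec_relocate[OF pct] by simp_all
 have "fin w P ok (embed p (length M) s t) (tu + real k + 1) b
 (e + 1 - measure_pmf.prob (run w M (Suc k) t) {t'. good t'})"
 proof (rule fin_avg[OF *(1) *(2) finite_set_pmf_exec])
 fix x assume x: "x : set_pmf ?D"
 show "fin w P ok (embed p (length M) s x) (tu + real k) b
 (e + 1 - measure_pmf.prob (run w M k x) {t'. good t'})"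
 using Suc.prems x by (intro Suc.IH) (auto simp: run simp del: run.simps)
 next
 show "measure_pmf.expectation ?D (%x. e + 1 - measure_pmf.prob (run w M k x) {t'. good t'})
 <= e + 1 - measure_pmf.prob (run w M (Suc k) t) {t'. good t'}"
 unfolding run prob_bind_pmf
 by (subst Bochner_Integration.integral_diff)
 (auto intro: integrable_measure_pmf_finite finite_set_pmf_exec)
 qed
 thus ?thesis by (simp add: add_ac del: run.simps)
 qed
qed

section \<open>Semantics of the structured language and its program logic\<close>

fun eval :: "nat => (nat => nat) => (nat => nat => nat) => exp => nat" where
 "eval w V A (Lit n) = n mod 2 ^ w"
| "eval w V A (Var x) = V x"
| "eval w V A (Op f d e) = binop_val w f (eval w V A d) (eval w V A e)"
| "eval w V A (Read a e) = A a (eval w V A e)"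

text \<open>Stated in continuation form, like \<open>sp\<close> below. Temporaries from
  \<open>k\<close> on may be overwritten, all other registers survive.\<close>

lemma fin_ecode:
 assumes "placed P (pc s) (ecode k e)"
 and "!!x. reg s (var_reg x) = V x" "!!a i. mem s (arr a) i = A a i" "words w s"
 and "!!s'. pc s' = pc s + esize e ==> mem s' = mem s ==> reg s' (tmp_reg k) = eval w V A e ==>
 (!!r. (!!j. k <= j ==> r ~= tmp_reg j) ==> reg s' r = reg s r) ==> words w s' ==> fin w P ok s' tu b ep"
 shows "fin w P ok s (tu + real (esize e)) b ep"
 using assms
proof (induction e arbitrary: k s tu)
 case (Lit n)
 let ?s = "set_reg (tmp_reg k) (n mod 2 ^ w) s"
 have "fin w P ok ?s tu b ep"
 by (rule Lit.prems(5)) (insert Lit.prems, auto simp: set_reg_def words_def)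
 thus ?case using Lit.prems(1)
 by (auto simp: placed_Cons intro!: fin_det)
next
 case (Var x)
 let ?s = "set_reg (tmp_reg k) (V x) s"
 have "fin w P ok ?s tu b ep"
 proof (rule Var.prems(5))
 have "V x < 2 ^ w" using Var.prems(2,4) by (metis words_def)
 thus "words w ?s" using Var.prems(4) by (auto simp: set_reg_def words_def)
 qed (auto simp: set_reg_def)
 thus ?case using Var.prems(1,2)
 by (auto simp: placed_Cons intro!: fin_det)
next
 case (Op f d e)
 have pl: "placed P (pc s) (ecode k d)" "placed P (pc s + esize d) (ecode (Suc k) e)"
 "pc s + esize d + esize e < length P"
 "P ! (pc s + esize d + esize e) = Binop (tmp_reg k) f (tmp_reg k) (tmp_reg (Suc k))"
 using Op.prems(1) by (auto simp: placed_append placed_Cons )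
 have "fin w P ok s (tu + 1 + real (esize e) + real (esize d)) b ep"
 proof (rule Op.IH(1)[OF pl(1) Op.prems(2-4)])
 fix s1
 assume s1: "pc s1 = pc s + esize d" "mem s1 = mem s" "reg s1 (tmp_reg k) = eval w V A d"
 "!!r. (!!j. k <= j ==> r ~= tmp_reg j) ==> reg s1 r = reg s r" "words w s1"
 show "fin w P ok s1 (tu + 1 + real (esize e)) b ep"
 proof (rule Op.IH(2)[where k = "Suc k"])
 show "placed P (pc s1) (ecode (Suc k) e)" using pl s1 by simp
 fix s2
 assume s2: "pc s2 = pc s1 + esize e" "mem s2 = mem s1" "reg s2 (tmp_reg (Suc k)) = eval w V A e"
 "!!r. (!!j. Suc k <= j ==> r ~= tmp_reg j) ==> reg s2 r = reg s1 r" "words w s2"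
 have k: "reg s2 (tmp_reg k) = eval w V A d" using s2(4)[of "tmp_reg k"] s1(3) by auto
 let ?s = "set_reg (tmp_reg k) (eval w V A (Op f d e)) s2"
 have "fin w P ok ?s tu b ep"
 proof (rule Op.prems(5))
 fix r assume r: "!!j. k <= j ==> r ~= tmp_reg j"
 show "reg ?s r = reg s r" using s1(4) s2(4) r[] by (simp add: set_reg_def)
next
 have "eval w V A d < 2 ^ w" "eval w V A e < 2 ^ w" using s2(3,5) k unfolding words_def by metis+
 thus "words w ?s" using s2(5) by (auto simp: words_def set_reg_def binop_val_less)
 qed (insert s1 s2, auto simp: set_reg_def)
 thus "fin w P ok s2 (tu + 1) b ep"
 using pl(3,4) s1(1) s2(1,3) k by (auto intro!: fin_det)
 qed (use s1 Op.prems in auto)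
 qed
 thus ?case by (simp add: add_ac)
next
 case (Read a e)
 have pl: "placed P (pc s) (ecode k e)" "pc s + esize e < length P"
 "P ! (pc s + esize e) = Load (tmp_reg k) (arr a) (tmp_reg k)"
 using Read.prems(1) by (auto simp: placed_append placed_Cons)
 have "fin w P ok s (tu + 1 + real (esize e)) b ep"
 proof (rule Read.IH[OF pl(1) Read.prems(2-4)])
 fix s1
 assume s1: "pc s1 = pc s + esize e" "mem s1 = mem s" "reg s1 (tmp_reg k) = eval w V A e"
 "!!r. (!!j. k <= j ==> r ~= tmp_reg j) ==> reg s1 r = reg s r" "words w s1"
 let ?s = "set_reg (tmp_reg k) (A a (eval w V A e)) s1"
 have "fin w P ok ?s tu b ep"
 proof (rule Read.prems(5))
 have "A a (eval w V A e) < 2 ^ w" using Read.prems(3,4) by (metis words_def)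
 thus "words w ?s" using s1(5) by (auto simp: words_def set_reg_def)
 next
 fix r assume "!!j. k <= j ==> r ~= tmp_reg j"
 thus "reg ?s r = reg s r" using s1(4)[] by (auto simp: set_reg_def)
 qed (insert s1, auto simp: set_reg_def)
 thus "fin w P ok s1 (tu + 1) b ep"
 using pl(2,3) s1 Read.prems(3) by (auto intro!: fin_det)
 qed
 thus ?case by (simp add: add_ac)
qed

text \<open>
 The abstract state: variables, arrays, a flag recording that some randomized step went wrong, and
 the remaining time budget, which at the same time is the remaining error budget.
\<close>

record cst =
 vl :: "nat => nat"
 ar :: "nat => nat => nat"
 bad :: bool
 clk :: real

text \<open>\<open>p@@S\<close> and \<open>p@@@S\<close> apply a predicate on variables and arrays (and the flag) to a state.\<close>

abbreviation (input) at2 :: "((nat => nat) => (nat => nat => nat) => 'a) => cst => 'a" ("_@@_" [1000, 1000] 1000)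
 where "p@@S == p (vl S) (ar S)"
abbreviation (input) at3 :: "((nat => nat) => (nat => nat => nat) => bool => 'a) => cst => 'a" ("_@@@_" [1000, 1000] 1000)
 where "p@@@S == p (vl S) (ar S) (bad S)"
abbreviation (input) ev :: "nat => cst => exp => nat" where "ev w S == eval w (vl S) (ar S)"
abbreviation (input) upd :: "cst => nat => nat => cst"
 where "upd S x v == S(|vl := (vl S)(x := v), clk := clk S - 1|)"

fun wvars :: "com => nat set" where
 "wvars (Asg x e) = {x}"
| "wvars (c ;; d) = wvars c Un wvars d"
| "wvars (Cond e c d) = wvars c Un wvars d"
| "wvars (While e c) = wvars c"
| "wvars _ = {}"

fun warrs :: "com => nat set" where
 "warrs (Write a i e) = {a}"
| "warrs (Draw a x) = {a}"
| "warrs MatMul = {2, 3}"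
| "warrs (c ;; d) = warrs c Un warrs d"
| "warrs (Cond e c d) = warrs c Un warrs d"
| "warrs (While e c) = warrs c"
| "warrs _ = {}"

definition frame :: "com => cst => cst => bool" where
 "frame c S S' <-> (\<forall>x. x ~: wvars c --> vl S' x = vl S x) &
 (\<forall>a. a ~: warrs c --> ar S' a = ar S a) & (bad S --> bad S') & clk S' <= clk S"

definition wstate :: "nat => cst => bool" where
 "wstate w S <-> (\<forall>x. vl S x < 2 ^ w) & (\<forall>a i. ar S a i < 2 ^ w)"

definition repr :: "nat => state => cst => bool" where
 "repr w s S <-> (\<forall>x. reg s (var_reg x) = vl S x) & (\<forall>a i. mem s (arr a) i = ar S a i) & words w s"

lemma repr_word_state: "repr w s S ==> wstate w S"
 unfolding repr_def wstate_def words_def by metis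

lemma frame_refl: "frame c S S"
 by (simp add: frame_def)

lemma frame_trans:
 "frame c S S' ==> frame c' S' S'' ==> wvars c Un wvars c' <= wvars d ==>
 warrs c Un warrs c' <= warrs d ==> frame d S S''"
 unfolding frame_def subset_iff Un_iff by (intro conjI ) (metis, metis, blast, linarith)

definition For :: "nat => nat => com => com" where
 "For x y c = Asg x (Lit 0) ;; While (Op Less (Var x) (Var y)) (c ;; Asg x (Op Add (Var x) (Lit 1)))"

lemma w_For: "wvars (For x y c) = insert x (wvars c)" "warrs (For x y c) = warrs c"
 by (auto simp: For_def)

text \<open>\<open>mu\<close> stands for the polylogarithmic overhead of the multiplication program
  \<open>M\<close>, which is always called with the size parameter \<open>N\<close>.
  \<open>ep\<close> bounds the error of one call and is also the error allowed per clock
  unit.\<close>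

locale ram =
 fixes w :: nat and M :: "instr list" and C :: nat and ep mu :: real and N :: nat
 assumes C: "10 <= C" and eps: "0 < ep" and mu: "1 <= mu"
 and mul: "(N, X, Y) : matmul_instances ==> xs : matmul_enc (N, X, Y) ==> initial w xs s ==>
 \<exists>k. real k <= mu * real (dim_row X * dim_col X + dim_col X * dim_col Y + dim_row X * dim_col Y) &
 (\<forall>s'\<in>set_pmf (run w M k s). halted M s') &
 1 - ep <= measure_pmf.prob (run w M k s) {s'. matmul_ok (N, X, Y) (result s')}"
begin

abbreviation (input) fin_at :: "instr list => (state => bool) => state => real => cst => bool"
 where "fin_at P ok s de S == fin w P ok s (real C * clk S + de) (bad S) (ep * clk S)"

text \<open>Continuation form: if the program finishes within the remaining budget from every state
  satisfying \<open>Q\<close>, then it does so from the start of \<open>c\<close>. The clock pays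
  time at rate \<open>C\<close> and error at rate \<open>ep\<close>. The slack \<open>de\<close>
  allows a rule to pay a closing jump from the tick spent at the head of the loop or
  conditional.\<close>

definition sp :: "com => cst => (cst => bool) => bool" where
 "sp c S Q <-> (\<forall>P ok p s de. placed P p (code M p c) --> csize c <= C --> repr w s S --> pc s = p -->
 (\<forall>s' S'. repr w s' S' --> pc s' = p + length (code M p c) --> frame c S S' --> Q S' -->
 fin_at P ok s' de S') -->
 fin_at P ok s de S)"

lemma spI:
 assumes "!!P ok s de. placed P (pc s) (code M (pc s) c) ==> csize c <= C ==> repr w s S ==>
 (!!s' S'. repr w s' S' ==> pc s' = pc s + length (code M (pc s) c) ==> frame c S S' ==> Q S' ==>
 fin_at P ok s' de S') ==>
 fin_at P ok s de S"
 shows "sp c S Q"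
 using assms unfolding sp_def by blast

lemma spD:
 assumes "sp c S Q" "placed P (pc s) (code M (pc s) c)" "csize c <= C" "repr w s S"
 and "!!s' S'. repr w s' S' ==> pc s' = pc s + length (code M (pc s) c) ==> frame c S S' ==> Q S' ==>
 fin_at P ok s' de S'"
 shows "fin_at P ok s de S"
 using assms unfolding sp_def by blast

lemma sp_weak:
 assumes "sp c S Q" "!!S'. wstate w S' ==> frame c S S' ==> Q S' ==> Q' S'"
 shows "sp c S Q'"
proof (rule spI)
 fix P ok s de
 assume *: "placed P (pc s) (code M (pc s) c)" "csize c <= C" "repr w s S"
 and fin: "!!s' S'. repr w s' S' ==> pc s' = pc s + length (code M (pc s) c) ==> frame c S S' ==> Q' S' ==>
 fin_at P ok s' de S'"
 show "fin_at P ok s de S"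
 by (rule spD[OF assms(1) *]) (use fin assms(2) repr_word_state in blast)
qed

lemma sp_Skip: "Q S ==> sp Skip S Q"
 by (auto simp: sp_def frame_refl)

lemma sp_Seq:
 assumes "sp c S (%S'. sp d S' Q)"
 shows "sp (c ;; d) S Q"
 unfolding sp_def
proof (intro allI impI)
 fix P ok p s de
 let ?p = "p + length (code M p c)"
 assume pl: "placed P p (code M p (c ;; d))" and cs: "csize (c ;; d) <= C" and r: "repr w s S" "pc s = p"
 and fin: "\<forall>s' S'. repr w s' S' --> pc s' = p + length (code M p (c ;; d)) --> frame (c ;; d) S S' -->
 Q S' --> fin_at P ok s' de S'"
 show "fin_at P ok s de S"
 proof (rule assms[unfolded sp_def[of c], rule_format, OF _ _ r])
 fix s1 S1 assume 1: "repr w s1 S1" "pc s1 = ?p" "frame c S S1" "sp d S1 Q"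
 show "fin_at P ok s1 de S1"
 proof (rule 1(4)[unfolded sp_def[of d], rule_format, OF _ _ 1(1,2)])
 fix s2 S2 assume 2: "repr w s2 S2" "pc s2 = ?p + length (code M ?p d)" "frame d S1 S2" "Q S2"
 have "frame (c ;; d) S S2" by (rule frame_trans[OF 1(3) 2(3)]) auto
 thus "fin_at P ok s2 de S2"
 using fin 2 by (simp add: )
 qed (insert pl cs, auto simp: placed_append)
 qed (insert pl cs, auto simp: placed_append)
qed

text \<open>Every basic step costs one time unit, which covers \<open>C\<close> machine steps.\<close>

abbreviation tick :: "cst => cst" where "tick S == S(|clk := clk S - 1|)"

lemma fin_tick:
 assumes "fin w P ok s (real C * (c - 1) + de + real k) b (ep * (c - 1))" "k <= C"
 shows "fin w P ok s (real C * c + de) b (ep * c)"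
 by (rule fin_mono[OF assms(1)]) (insert assms(2) eps, auto simp: algebra_simps)

lemma sp_Asg:
 assumes "Q ((upd S x (ev w S e)))" (is "Q ?S")
 shows "sp (Asg x e) S Q"
 unfolding sp_def
proof (intro allI impI)
 fix P ok p s de
 assume pl: "placed P p (code M p (Asg x e))" and cs: "csize (Asg x e) <= C"
 and r: "repr w s S" "pc s = p"
 and fin: "\<forall>s' S'. repr w s' S' --> pc s' = p + length (code M p (Asg x e)) -->
 frame (Asg x e) S S' --> Q S' --> fin_at P ok s' de S'"
 have pl': "placed P p (ecode 0 e)" "p + esize e < length P"
 "P ! (p + esize e) = Binop (var_reg x) Or (tmp_reg 0) (tmp_reg 0)"
 using pl by (auto simp: placed_append placed_Cons)
 have "fin w P ok s (real C * (clk S - 1) + de + 1 + real (esize e)) (bad S) (ep * (clk S - 1))"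
 proof (rule fin_ecode[where V = "vl S" and A = "ar S"])
 fix s1
 assume s1: "pc s1 = pc s + esize e" "mem s1 = mem s" "reg s1 (tmp_reg 0) = ev w S e"
 "!!r. (!!j. 0 <= j ==> r ~= tmp_reg j) ==> reg s1 r = reg s r" "words w s1"
 let ?s = "set_reg (var_reg x) (ev w S e) s1"
 have "ev w S e < 2 ^ w" using s1(3,5) by (metis words_def)
 hence "fin w P ok ?s (real C * (clk S - 1) + de) (bad S) (ep * (clk S - 1))"
 using r s1 fin[rule_format, of ?s ?S] assms s1 r by (auto simp: repr_def set_reg_def words_def set_reg_def frame_def)
thus "fin w P ok s1 (real C * (clk S - 1) + de + 1) (bad S) (ep * (clk S - 1))"
 using s1 pl' r by (auto intro!: fin_det simp: )
 qed (insert pl' r, auto simp: repr_def)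
 thus "fin_at P ok s de S"
 using cs by (intro fin_tick[where k = "1 + esize e"]) (auto simp: add.assoc)
qed

lemma sp_Write:
 assumes "Q (S(|ar := (ar S)(a := (ar S a)(ev w S i := ev w S e)), clk := clk S - 1|))"
 (is "Q ?S")
 shows "sp (Write a i e) S Q"
 unfolding sp_def
proof (intro allI impI)
 fix P ok p s de
 assume pl: "placed P p (code M p (Write a i e))" and cs: "csize (Write a i e) <= C"
 and r: "repr w s S" "pc s = p"
 and fin: "\<forall>s' S'. repr w s' S' --> pc s' = p + length (code M p (Write a i e)) -->
 frame (Write a i e) S S' --> Q S' --> fin_at P ok s' de S'"
 have pl': "placed P p (ecode 0 i)" "placed P (p + esize i) (ecode 1 e)" "p + esize i + esize e < length P"
 "P ! (p + esize i + esize e) = Store (arr a) (tmp_reg 0) (tmp_reg 1)"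
 using pl by (auto simp: placed_append placed_Cons)
 have "fin w P ok s (real C * (clk S - 1) + de + 1 + real (esize e) + real (esize i)) (bad S) (ep * (clk S - 1))"
 proof (rule fin_ecode[where V = "vl S" and A = "ar S"])
 fix s1
 assume s1: "pc s1 = pc s + esize i" "mem s1 = mem s" "reg s1 (tmp_reg 0) = ev w S i"
 "!!r. (!!j. 0 <= j ==> r ~= tmp_reg j) ==> reg s1 r = reg s r" "words w s1"
 show "fin w P ok s1 (real C * (clk S - 1) + de + 1 + real (esize e)) (bad S) (ep * (clk S - 1))"
 proof (rule fin_ecode[where V = "vl S" and A = "ar S" and k = 1])
 fix s2
 assume s2: "pc s2 = pc s1 + esize e" "mem s2 = mem s1" "reg s2 (tmp_reg 1) = ev w S e"
 "!!r. (!!j. 1 <= j ==> r ~= tmp_reg j) ==> reg s2 r = reg s1 r" "words w s2"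
 have 0: "reg s2 (tmp_reg 0) = ev w S i" using s2(4)[of "tmp_reg 0"] s1 by auto
 let ?s = "s2(|pc := Suc (pc s2), mem := (mem s2)(arr a := (mem s2 (arr a))(reg s2 (tmp_reg 0) := reg s2 (tmp_reg 1)))|)"
 have "ev w S e < 2 ^ w" using s2(3,5) by (metis words_def)
 moreover have "\<forall>a i. ar S a i < 2 ^ w" using repr_word_state[OF r(1)] by (simp add: wstate_def)
 ultimately have "fin w P ok ?s (real C * (clk S - 1) + de) (bad S) (ep * (clk S - 1))"
 using r s1(2) s2(2,3,5) 0 fin[rule_format, of ?s ?S] assms s1 s2 r by (auto simp: repr_def words_def frame_def)
thus "fin w P ok s2 (real C * (clk S - 1) + de + 1) (bad S) (ep * (clk S - 1))"
 using s1 s2 pl' r by (auto intro!: fin_det)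
 qed (insert s1 pl' r, auto simp: repr_def)
 qed (insert pl' r, auto simp: repr_def)
 thus "fin_at P ok s de S"
 using cs by (intro fin_tick[where k = "1 + esize e + esize i"]) (auto simp: add.assoc)
qed

lemma sp_Asg_eq:
 assumes "ev w S e = v" "Q ((upd S x v))"
 shows "sp (Asg x e) S Q"
 using assms by (intro sp_Asg) simp

lemma sp_Write_eq:
 assumes "ev w S i = x" "ev w S e = v"
 and "Q (S(|ar := (ar S)(a := (ar S a)(x := v)), clk := clk S - 1|))"
 shows "sp (Write a i e) S Q"
 using assms by (intro sp_Write) simp

lemma sp_Cond:
 assumes "ev w S e ~= 0 ==> sp c (tick S) Q" "ev w S e = 0 ==> sp d (tick S) Q"
 shows "sp (Cond e c d) S Q"
proof (rule spI)
 fix P ok and s :: state and de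
 let ?p = "pc s"
 let ?c = "code M (?p + esize e + 1) c"
 let ?pd = "?p + esize e + 1 + length ?c + 1"
 let ?d = "code M ?pd d"
 assume pl: "placed P ?p (code M ?p (Cond e c d))" and cs: "csize (Cond e c d) <= C" and r: "repr w s S"
 and fin: "!!s' S'. repr w s' S' ==> pc s' = ?p + length (code M ?p (Cond e c d)) ==>
 frame (Cond e c d) S S' ==> Q S' ==> fin_at P ok s' de S'"
 have pl': "placed P ?p (ecode 0 e)" "?p + esize e < length P"
 "P ! (?p + esize e) = JumpIfZero (tmp_reg 0) ?pd" "placed P (?p + esize e + 1) ?c"
 "?p + esize e + 1 + length ?c < length P"
 "P ! (?p + esize e + 1 + length ?c) = Jump (?pd + length ?d)" "placed P ?pd ?d"
 using pl by (auto simp: placed_append placed_Cons Let_def )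
 have "fin w P ok s (real C * (clk S - 1) + de + 2 + real (esize e)) (bad S) (ep * (clk S - 1))"
 proof (rule fin_ecode[where V = "vl S" and A = "ar S"])
 fix s1
 assume s1: "pc s1 = pc s + esize e" "mem s1 = mem s" "reg s1 (tmp_reg 0) = ev w S e"
 "!!r. (!!j. 0 <= j ==> r ~= tmp_reg j) ==> reg s1 r = reg s r" "words w s1"
 have r1: "repr w (s1(|pc := l|)) (tick S)" for l using r s1 by (auto simp: repr_def words_def)
 have "fin w P ok s1 (real C * (clk S - 1) + (de + 1) + 1) (bad S) (ep * (clk S - 1))"
 proof (cases "ev w S e = 0")
 case False
 let ?s = "s1(|pc := ?p + esize e + 1|)"
 have "fin w P ok ?s (real C * clk (tick S) + (de + 1)) (bad (tick S)) (ep * clk (tick S))"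
 proof (rule spD[OF assms(1)[OF False] _ _ r1])
 fix s' S' assume s': "repr w s' S'" "pc s' = pc ?s + length (code M (pc ?s) c)" "frame c (tick S) S'" "Q S'"
 have "fin w P ok (s'(|pc := ?pd + length ?d|)) (real C * clk S' + de) (bad S') (ep * clk S')"
 by (rule fin) (insert s', auto simp: repr_def words_def Let_def frame_def)
 moreover have pc': "pc s' = ?p + esize e + 1 + length ?c" using s' by simp
 ultimately show "fin w P ok s' (real C * clk S' + (de + 1)) (bad S') (ep * clk S')"
 using fin_det[of s' P w "s'(|pc := ?pd + length ?d|)" ok "real C * clk S' + de"] pl'(5,6) by (simp add: add.assoc)
 qed (use pl' cs in auto)
 thus ?thesis using False pl'(2,3) s1 by (intro fin_det[where s' = ?s]) auto
 next
 case True
 let ?s = "s1(|pc := ?pd|)"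
 have "fin w P ok ?s (real C * clk (tick S) + de) (bad (tick S)) (ep * clk (tick S))"
 proof (rule spD[OF assms(2)[OF True] _ _ r1])
 fix s' S' assume s': "repr w s' S'" "pc s' = pc ?s + length (code M (pc ?s) d)" "frame d (tick S) S'" "Q S'"
 show "fin_at P ok s' de S'"
 by (rule fin) (insert s', auto simp: Let_def frame_def)
 qed (use pl' cs in auto)
 hence "fin w P ok ?s (real C * clk (tick S) + (de + 1)) (bad (tick S)) (ep * clk (tick S))"
 by (rule fin_mono) auto
 thus ?thesis using True pl'(2,3) s1 by (intro fin_det[where s' = ?s]) auto
 qed
 thus "fin w P ok s1 (real C * (clk S - 1) + de + 2) (bad S) (ep * (clk S - 1))" by (simp add: add.assoc)
 qed (insert pl' r, auto simp: repr_def)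
 thus "fin_at P ok s de S"
 using cs by (intro fin_tick[where k = "2 + esize e"]) (auto simp: add.assoc)
qed

text \<open>The measure \<open>m\<close> only ensures termination; bounds on the running time are
  put into the invariant as statements about the clock.\<close>

lemma sp_While:
 fixes m :: "cst => nat"
 assumes inv: "Inv S"
 and exit: "!!S'. wstate w S' ==> frame (While e c) S S' ==> Inv S' ==> ev w S' e = 0 ==> Q (tick S')"
 and body: "!!S'. wstate w S' ==> frame (While e c) S S' ==> Inv S' ==> ev w S' e ~= 0 ==>
 sp c (tick S') (%S''. Inv S'' & m S'' < m S')"
 shows "sp (While e c) S Q"
proof (rule spI)
 fix P ok and s :: state and de
 let ?p = "pc s"
 let ?c = "code M (?p + esize e + 1) c"
 let ?q = "?p + esize e + 1 + length ?c + 1"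
 assume pl: "placed P ?p (code M ?p (While e c))" and cs: "csize (While e c) <= C" and r: "repr w s S"
 and fin: "!!s' S'. repr w s' S' ==> pc s' = ?p + length (code M ?p (While e c)) ==>
 frame (While e c) S S' ==> Q S' ==> fin_at P ok s' de S'"
 have pl': "placed P ?p (ecode 0 e)" "?p + esize e < length P"
 "P ! (?p + esize e) = JumpIfZero (tmp_reg 0) ?q" "placed P (?p + esize e + 1) ?c"
 "?p + esize e + 1 + length ?c < length P"
 "P ! (?p + esize e + 1 + length ?c) = Jump ?p"
 using pl by (auto simp: placed_append placed_Cons Let_def )
 have "fin_at P ok s' de S'"
 if "repr w s' S'" "pc s' = ?p" "frame (While e c) S S'" "Inv S'" for s' :: state and S'
 using that
 proof (induction "m S'" arbitrary: s' S' rule: less_induct)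
 case less
 note r = less.prems(1) and p = less.prems(2) and fr = less.prems(3)
 have wS: "wstate w S'" using repr_word_state[OF r] .
 have "fin w P ok s' (real C * (clk S' - 1) + de + 2 + real (esize e)) (bad S') (ep * (clk S' - 1))"
 proof (rule fin_ecode[where V = "vl S'" and A = "ar S'"])
 fix s1
 assume s1: "pc s1 = pc s' + esize e" "mem s1 = mem s'" "reg s1 (tmp_reg 0) = ev w S' e"
 "!!r. (!!j. 0 <= j ==> r ~= tmp_reg j) ==> reg s1 r = reg s' r" "words w s1"
 have r1: "repr w (s1(|pc := l|)) (tick S')" for l using r s1 by (auto simp: repr_def words_def)
 have "fin w P ok s1 (real C * (clk S' - 1) + (de + 1) + 1) (bad S') (ep * (clk S' - 1))"
 proof (cases "ev w S' e = 0")
 case False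
 let ?s = "s1(|pc := ?p + esize e + 1|)"
 have "fin w P ok ?s (real C * clk (tick S') + (de + 1)) (bad (tick S')) (ep * clk (tick S'))"
 proof (rule spD[OF body[OF wS fr less.prems(4) False] _ _ r1])
 fix s2 S2 assume s2: "repr w s2 S2" "pc s2 = pc ?s + length (code M (pc ?s) c)" "frame c (tick S') S2"
 "Inv S2 & m S2 < m S'"
 have "frame (While e c) S S2"
 by (rule frame_trans[OF fr, of ]) (insert s2(3), auto simp: frame_def)
 hence "fin w P ok (s2(|pc := ?p|)) (real C * clk S2 + de) (bad S2) (ep * clk S2)"
 using s2 by (intro less.hyps) (auto simp: repr_def words_def)
 moreover have "pc s2 = ?p + esize e + 1 + length ?c" using s2 by simp
 ultimately show "fin w P ok s2 (real C * clk S2 + (de + 1)) (bad S2) (ep * clk S2)"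
 using fin_det[of s2 P w "s2(|pc := ?p|)" ok "real C * clk S2 + de"] pl'(5,6) by (simp add: add.assoc)
 qed (use pl' cs in auto)
 thus ?thesis using False pl'(2,3) s1 p by (intro fin_det[where s' = ?s]) auto
 next
 case True
 let ?s = "s1(|pc := ?q|)"
 have "fin w P ok ?s (real C * clk (tick S') + de) (bad (tick S')) (ep * clk (tick S'))"
 proof (rule fin[OF r1])
 show "Q (tick S')" by (rule exit[OF wS fr less.prems(4) True])
 show "frame (While e c) S (tick S')" using fr by (auto simp: frame_def)
 qed (simp add: Let_def)
 hence "fin w P ok ?s (real C * clk (tick S') + (de + 1)) (bad (tick S')) (ep * clk (tick S'))"
 by (rule fin_mono) auto
 thus ?thesis using True pl'(2,3) s1 p by (intro fin_det[where s' = ?s]) auto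
 qed
 thus "fin w P ok s1 (real C * (clk S' - 1) + de + 2) (bad S') (ep * (clk S' - 1))" by (simp add: add.assoc)
 qed (insert pl' r p, auto simp: repr_def)
 thus ?case
 using cs by (intro fin_tick[where k = "2 + esize e"]) (auto simp: add.assoc)
 qed
 from this[OF r refl frame_refl inv] show "fin_at P ok s de S" .
qed

lemma less_word_1: "(i::nat) < n ==> n < 2 ^ w ==> (1::nat) < 2 ^ w"
 by (rule le_less_trans[of 1 ]) auto

lemma sp_For:
 assumes x: "x ~= y" "x ~: wvars c" "y ~: wvars c" and n: "vl S y = n"
 and init: "I 0 ((upd S x 0))"
 and body: "!!i S'. wstate w S' ==> frame (For x y c) S S' ==> i < n ==> vl S' x = i ==> I i S' ==>
 sp c (tick S') (%S''. I (Suc i) ((upd S'' x (Suc i))))"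
 and exit: "!!S'. wstate w S' ==> frame (For x y c) S S' ==> vl S' x = n ==> I n S' ==> Q (tick S')"
 shows "sp (For x y c) S Q"
proof -
 let ?b = "c ;; Asg x (Op Add (Var x) (Lit 1))"
 let ?e = "Op Less (Var x) (Var y)"
 let ?S = "(upd S x 0)"
 have fr: "frame (For x y c) S S'" if "frame (While ?e ?b) ?S S'" for S'
 using that by (auto simp: frame_def w_For)
 have "sp (While ?e ?b) ?S Q"
 proof (rule sp_While[where Inv = "%S'. vl S' x <= n & I (vl S' x) S'" and m = "%S'. n - vl S' x"])
 show "vl ?S x <= n & I (vl ?S x) ?S" using init by simp
 next
 fix S' assume S': "wstate w S'" "frame (While ?e ?b) ?S S'" "vl S' x <= n & I (vl S' x) S'"
 have y: "vl S' y = n" using S'(2) x n by (auto simp: frame_def)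
 have n': "n < 2 ^ w" using y S'(1) by (metis wstate_def)
 { assume "ev w S' ?e = 0"
 thus "Q (tick S')" using y S'(3) less_word_1[OF _ n', of "vl S' x"] S' fr by (intro exit) auto
}
 { assume "ev w S' ?e ~= 0"
 hence lt: "vl S' x < n" using y by (auto simp: of_bool_def split: if_splits)
 show "sp ?b (tick S') (%S''. (vl S'' x <= n & I (vl S'' x) S'') & n - vl S'' x < n - vl S' x)"
 proof (rule sp_Seq, rule sp_weak[OF body[OF S'(1) fr[OF S'(2)] lt refl]])
 show "I (vl S' x) S'" using S' by simp
 next
 fix S'' assume S'': "wstate w S''" "frame c (tick S') S''"
 "I (Suc (vl S' x)) ((upd S'' x (Suc (vl S' x))))"
 have "vl S'' x = vl S' x" using S''(2) x by (auto simp: frame_def)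
 thus "sp (Asg x (Op Add (Var x) (Lit 1))) S''
 (%S''. (vl S'' x <= n & I (vl S'' x) S'') & n - vl S'' x < n - vl S' x)"
 using lt n' mod_less[OF less_word_1[]] S''(3) lt by (intro sp_Asg) auto
qed }
 qed
 thus ?thesis unfolding For_def by (intro sp_Seq sp_Asg) simp
qed

text \<open>The 2 in each round pays for the test and the increment; the other 2 pays for the
  initial assignment and the last test.\<close>

lemma sp_For_sum:
 assumes x: "x ~= y" "x ~: wvars c" "y ~: wvars c" and n: "vl S y = n"
 and init: "I 0 ((vl S)(x := 0)) (ar S) (bad S)"
 and body: "!!i S'. wstate w S' ==> frame (For x y c) S S' ==> i < n ==> vl S' x = i ==> vl S' y = n ==>
 (I i)@@@S' ==>
 sp c S' (%S''. I (Suc i) ((vl S'')(x := Suc i)) (ar S'') (bad S'') & clk S' - t i <= clk S'')"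
 and exit: "!!S'. wstate w S' ==> frame (For x y c) S S' ==> vl S' x = n ==> vl S' y = n ==>
 (I n)@@@S' ==> clk S - (2 + (\<Sum>i<n. t i + 2)) <= clk S' ==> Q S'"
 shows "sp (For x y c) S Q"
proof (rule sp_For[where n = n and I = "%i S'. (I i)@@@S' & clk S - (1 + (\<Sum>j<i. t j + 2)) <= clk S'"])
 have y: "vl S' y = n" if "frame (For x y c) S S'" for S' :: cst
 using that x n by (auto simp: frame_def w_For)
 have ws: "wstate w (tick S')" if "wstate w S'" for S' :: cst using that by (simp add: wstate_def)
 have fr: "frame (For x y c) S (tick S')" if "frame (For x y c) S S'" for S' :: cst
 using that by (simp add: frame_def)
 {
 fix i and S' :: cst
 assume S': "wstate w S'" "frame (For x y c) S S'" "i < n" "vl S' x = i"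
 "(I i)@@@S' & clk S - (1 + (\<Sum>j<i. t j + 2)) <= clk S'"
 have "sp c (tick S') (%S''. I (Suc i) ((vl S'')(x := Suc i)) (ar S'') (bad S'') & clk (tick S') - t i <= clk S'')"
 using S' y[] by (intro body ws fr) auto
 thus "sp c (tick S') (%S''. I (Suc i) (vl ((upd S'' x (Suc i))))
 (ar ((upd S'' x (Suc i)))) (bad ((upd S'' x (Suc i)))) &
 clk S - (1 + (\<Sum>j<Suc i. t j + 2)) <= clk ((upd S'' x (Suc i))))"
 by (rule sp_weak) (insert S'(5), auto simp: algebra_simps)
 }
 {
 fix S' :: cst
 assume S': "wstate w S'" "frame (For x y c) S S'" "vl S' x = n"
 "(I n)@@@S' & clk S - (1 + (\<Sum>j<n. t j + 2)) <= clk S'"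
 show "Q (tick S')" using S' y[] by (intro exit ws fr) auto
 }
qed (use x n init in auto)

lemma sp_For_time:
 assumes "x ~= y" "x ~: wvars c" "y ~: wvars c" "vl S y = n" "I 0 ((vl S)(x := 0)) (ar S) (bad S)"
 and "!!i S'. wstate w S' ==> frame (For x y c) S S' ==> i < n ==> vl S' x = i ==> vl S' y = n ==>
 (I i)@@@S' ==>
 sp c S' (%S''. I (Suc i) ((vl S'')(x := Suc i)) (ar S'') (bad S'') & clk S' - t <= clk S'')"
 and "!!S'. wstate w S' ==> frame (For x y c) S S' ==> vl S' x = n ==> vl S' y = n ==>
 (I n)@@@S' ==> clk S - (2 + real n * (t + 2)) <= clk S' ==> Q S'"
 shows "sp (For x y c) S Q"
 by (rule sp_For_sum[where t = "%_. t", OF assms(1-6)]) (use assms(7) in auto)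

text \<open>The program can be called again and again because \<open>initial\<close> tolerates
  arbitrary words in all storage except the input. The price is at least 1, hence it covers the
  error \<open>ep\<close>; a wrong product is recorded in the flag \<open>bad\<close> and the run
  goes on.\<close>

lemma sp_MatMul:
 assumes inst: "(N, X, Y) : matmul_instances" and xs: "xs : matmul_enc (N, X, Y)"
 and input: "!!i. i < length xs ==> ar S 2 i = xs ! i"
 and Q: "!!S'. vl S' = vl S ==> (!!a. a ~: {2, 3} ==> ar S' a = ar S a) ==> (bad S ==> bad S') ==>
 clk S' = clk S - mu * real (dim_row X * dim_col X + dim_col X * dim_col Y + dim_row X * dim_col Y) ==>
 (~bad S' ==> \<forall>i < length (row_major (X * Y)). ar S' 3 i = row_major (X * Y) ! i) ==> Q S'"
 shows "sp MatMul S Q"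
proof (rule spI)
 fix P ok and s :: state and de
 let ?p = "pc s" and ?l = "length M"
 let ?t = "(|pc = 0, reg = (%r. reg s (sub_reg r)), mem = (%a. mem s (sub_arr a))|)"
 let ?c = "mu * real (dim_row X * dim_col X + dim_col X * dim_col Y + dim_row X * dim_col Y)"
 let ?good = "%t'. matmul_ok (N, X, Y) (result t')"
 assume pl: "placed P ?p (code M ?p MatMul)" and r: "repr w s S"
 and fin: "!!s' S'. repr w s' S' ==> pc s' = ?p + length (code M ?p MatMul) ==>
 frame MatMul S S' ==> Q S' ==> fin_at P ok s' de S'"
 have dims: "1 <= dim_row X" "1 <= dim_col X" "1 <= dim_col Y" using inst by (auto simp: matmul_instances_def)
 have "1 <= real (dim_row X * dim_col X)" using dims by (metis mult_le_mono nat_mult_1 of_nat_1 of_nat_le_iff)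
 hence c: "1 <= ?c" using mult_mono[of 1 mu 1] mu by (simp add: add_increasing2)
have "words w ?t" using r by (auto simp: repr_def words_def)
 moreover have "mem ?t 0 i = xs ! i" if "i < length xs" for i
 using input[OF that] r by (simp add: sub_arr_0 repr_def)
 ultimately have init: "initial w xs ?t" by (auto simp: initial_def words_def)
 obtain k where k: "real k <= ?c" "!!t'. t' : set_pmf (run w M k ?t) ==> halted M t'"
 "1 - ep <= measure_pmf.prob (run w M k ?t) {t'. ?good t'}"
 using mul[OF inst xs init] by auto
 have [simp]: "sub_arr ((a - 3) div 2) = a" if "odd a" "3 <= a" for a
 using that by (auto simp: sub_arr_def elim!: )
 have [simp]: "sub_reg (a div 3) = a" if "a mod 3 = 2" for a
 using that mult_div_mod_eq[of 3 a] by (simp add: sub_reg_def)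
 have s: "embed ?p ?l s ?t = s"
 by (cases ) (auto simp: embed_def fun_eq_iff)
 have "fin w P ok (embed ?p ?l s ?t) (real C * (clk S - ?c) + de + real k) (bad S)
 (ep * (clk S - ?c) + 1 - measure_pmf.prob (run w M k ?t) {t'. ?good t'})"
 proof (rule fin_relocate[OF _ k(2)])
 show "placed P ?p (map (relocate ?p ?l) M)" using pl by simp
 fix t' assume t': "t' : set_pmf (run w M k ?t)"
 let ?s = "embed ?p ?l s t'"
 let ?S = "S(|ar := (%a. mem ?s (arr a)), bad := bad S | ~?good t', clk := clk S - ?c|)"
 have wt: "words w t'" using words_run[OF \<open>words w ?t\<close> t'] .
 have 1: "mem ?s (arr a) = ar S a" if "a ~: {2, 3}" for a
 using that split r by (fastforce simp: arr_def embed_def repr_def)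
have 2: "mem ?s (arr 3) = mem t' (Suc 0)" by (simp add: embed_def arr_def)
 have rs: "repr w ?s ?S"
 using r wt by (auto simp: repr_def words_def embed_def var_reg_def)
 have "fin_at P ok ?s de ?S"
 proof (rule fin[OF rs])
 show "pc ?s = ?p + length (code M ?p MatMul)" using k(2)[OF t'] by (simp add: embed_def halted_def)
 show "frame MatMul S ?S" using c 1 by (auto simp: frame_def)
 show "Q ?S"
 proof (rule Q)
 assume "~bad ?S"
 hence res: "map (mem t' (Suc 0)) [0..<reg t' 0] = row_major (X * Y)"
 by (simp add: matmul_ok_def result_def)
 show "\<forall>i < length (row_major (X * Y)). ar ?S 3 i = row_major (X * Y) ! i"
 unfolding res[symmetric] by (simp add: 2)
 qed (use 1 in auto)
 qed
 thus "fin w P ok ?s (real C * (clk S - ?c) + de) (bad S | ~?good t') (ep * (clk S - ?c))" by simp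
 qed
 thus "fin_at P ok s de S"
 unfolding s
 proof (rule fin_mono)
 show "real C * (clk S - ?c) + de + real k <= real C * clk S + de" using k(1) C mult_mono[of 1 "real C" ?c ?c] by (simp add: algebra_simps)
have "ep <= ep * ?c" using c eps by simp
 thus "ep * (clk S - ?c) + 1 - measure_pmf.prob (run w M k ?t) {t'. ?good t'} <= ep * clk S"
 using k(3) by (simp add: algebra_simps)
 qed
qed

lemma card_lists_Suc:
 assumes "finite W"
 shows "card {xs. length xs = Suc k & set xs <= W & B xs} =
 (\<Sum>x\<in>W. card {xs. length xs = k & set xs <= W & B (x # xs)})"
proof -
 have fin: "finite {xs. length xs = k & set xs <= W & B (x # xs)}" for x
 by (rule finite_subset[OF _ finite_lists_length_eq[OF assms, of k]]) auto
 have "{xs. length xs = Suc k & set xs <= W & B xs} =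
 (\<Union>x\<in>W. (#) x ` {xs. length xs = k & set xs <= W & B (x # xs)})"
 by (auto simp: length_Suc_conv )
 moreover have "card (\<Union>x\<in>W. (#) x ` {xs. length xs = k & set xs <= W & B (x # xs)}) =
 (\<Sum>x\<in>W. card ((#) x ` {xs. length xs = k & set xs <= W & B (x # xs)}))"
 using assms fin by (intro card_UN_disjoint) auto
 ultimately show ?thesis by (simp add: card_image)
qed

text \<open>The words drawn are bad with probability at most \<open>ep\<close>.\<close>

lemma sp_Draw:
 assumes n: "vl S x = n"
 and B: "real (card {xs. length xs = n & set xs <= {..<2 ^ w} & B xs}) <= ep * (2 ^ w) ^ n"
 and Q: "!!xs. length xs = n ==> set xs <= {..<2 ^ w} ==>
 Q (S(|ar := (ar S)(a := (%i. if i < n then xs ! i else ar S a i)), bad := bad S | B xs,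
 clk := clk S - real (n + 1)|))"
 shows "sp (Draw a x) S Q"
proof (rule spI)
 fix P ok and s :: state and de
 let ?p = "pc s" and ?W = "{..<2 ^ w} :: nat set"
 let ?clk = "clk S - real (n + 1)"
 assume pl: "placed P ?p (code M ?p (Draw a x))" and r: "repr w s S"
 and fin: "!!s' S'. repr w s' S' ==> pc s' = ?p + length (code M ?p (Draw a x)) ==>
 frame (Draw a x) S S' ==> Q S' ==> fin_at P ok s' de S'"
 have pl': "?p + j < length P" "P ! (?p + j) = code M ?p (Draw a x) ! j" if "j < 8" for j
 using placed_nth[OF pl, of ] that by auto
 have n': "n < 2 ^ w" using repr_word_state[OF r] n by (auto simp: wstate_def)
 \<comment> \<open>The conditional probability of a bad list once the prefix \<open>ys\<close> has
   been drawn. By \<open>f_Suc\<close> it equals the mean over the next word, as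
   \<open>fin_avg\<close> requires at the \<open>Random\<close> instruction.\<close>
 define f where "f ys = real (card {zs. length zs = n - length ys & set zs <= ?W & B (ys @ zs)}) /
 (2 ^ w) ^ (n - length ys)" for ys
 have f_Suc: "f ys = (\<Sum>y\<in>?W. f (ys @ [y])) / 2 ^ w" if "length ys < n" for ys
 proof -
 define k where "k = n - Suc (length ys)"
 have k: "n - length ys = Suc k" using that by (simp add: k_def)
 hence "n - Suc (length ys) = k" by simp
 thus ?thesis
 by (simp add: f_def k card_lists_Suc sum_divide_distrib mult.commute)
 qed
 let ?st = "%j R m. (|pc = ?p + j, reg = R, mem = m|) :: state"
 have det: "fin w P ok (?st j R m) (tu + 1) (bad S) e"
 if "fin w P ok (?st j' R' m') tu (bad S) e" "j < 8"
 "exec w (code M ?p (Draw a x) ! j) (?st j R m) = return_pmf (?st j' R' m')"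
 for j R m j' R' m' tu e
 using pl'[OF that(2)] that(1,3) by (intro fin_det[where s' = "?st j' R' m'"]) (simp_all del: )
 have main: "fin w P ok (?st 1 R m) (real C * ?clk + de + 7 * real (n - length ys) + 2) (bad S) (ep * ?clk + f ys)"
 if "length ys <= n" "set ys <= ?W" "R (tmp_reg 0) = length ys"
 "!!y. R (var_reg y) = vl S y" "words w (?st 1 R m)"
 "!!a' i. m (arr a') i = (if a' = a & i < length ys then ys ! i else ar S a' i)"
 for R m ys
 using that
 proof (induction "n - length ys" arbitrary: ys R m)
 case 0
 hence len: "length ys = n" by simp
 let ?R = "R(tmp_reg 1 := 0)"
 let ?S = "S(|ar := (ar S)(a := (%i. if i < n then ys ! i else ar S a i)), bad := bad S | B ys, clk := ?clk|)"
 have "fin w P ok (?st 8 ?R m) (real C * clk ?S + de) (bad ?S) (ep * clk ?S)"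
 by (rule fin) (insert 0 Q[OF len 0(3)], auto simp: repr_def words_def frame_def)
 hence "fin w P ok (?st 8 ?R m) (real C * ?clk + de) (bad S) (ep * ?clk + 1 - of_bool (~B ys))"
 by (intro fin_branch) simp
 moreover have f: "f ys = 1 - of_bool (~B ys)"
 proof -
 have "{zs. length zs = n - length ys & set zs <= ?W & B (ys @ zs)} = (if B ys then {[]} else {})"
 by (auto simp: len)
 thus ?thesis by (simp add: f_def len)
 qed
 ultimately have "fin w P ok (?st 8 ?R m) (real C * ?clk + de) (bad S) (ep * ?clk + f ys)"
 by (simp only: add_diff_eq)
 hence "fin w P ok (?st 2 ?R m) (real C * ?clk + de + 1) (bad S) (ep * ?clk + f ys)"
 by (rule det) (auto simp: )
 hence "fin w P ok (?st 1 R m) (real C * ?clk + de + 1 + 1) (bad S) (ep * ?clk + f ys)"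
 by (rule det) (insert 0 n, auto simp: set_reg_def fun_eq_iff)
 thus ?case by (simp add: len add.assoc)
 next
 case (Suc k)
 hence lt: "length ys < n" by simp
 have w: "0 < w" using less_word_1[OF lt n'] by (cases ) auto
 let ?R = "R(tmp_reg 1 := 1)"
 let ?c = "real C * ?clk + de + 7 * real (n - Suc (length ys)) + 2"
 have "fin w P ok (?st 4 (?R(tmp_reg 2 := y)) m) (?c + 4) (bad S) (ep * ?clk + f (ys @ [y]))"
 if y: "y : ?W" for y
 proof -
 let ?m = "m(arr a := (m (arr a))(length ys := y))"
 let ?R2 = "?R(tmp_reg 2 := y)" let ?R6 = "?R2(tmp_reg 0 := Suc (length ys))"
 have "fin w P ok (?st 1 ?R6 ?m) (real C * ?clk + de + 7 * real (n - length (ys @ [y])) + 2) (bad S) (ep * ?clk + f (ys @ [y]))"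
 proof (rule Suc.hyps(1))
 show "words w (?st 1 ?R6 ?m)" using Suc.prems(5) lt n' y by (auto simp: words_def)
 next
 show "?m (arr a') i = (if a' = a & i < length (ys @ [y]) then (ys @ [y]) ! i else ar S a' i)" for a' i
 by (auto simp: Suc.prems(6) nth_append)
 qed (use Suc.hyps(2) Suc.prems(1-4) y in auto)
 hence "fin w P ok (?st 1 ?R6 ?m) ?c (bad S) (ep * ?clk + f (ys @ [y]))"
 by simp
 hence "fin w P ok (?st 7 ?R6 ?m) (?c + 1) (bad S) (ep * ?clk + f (ys @ [y]))"
 by (rule det) (auto simp: )
 hence "fin w P ok (?st 6 ?R2 ?m) (?c + 1 + 1) (bad S) (ep * ?clk + f (ys @ [y]))"
 by (rule det) (insert Suc.prems(3) lt n', auto simp: set_reg_def fun_eq_iff)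
 hence "fin w P ok (?st 5 ?R2 ?m) (?c + 1 + 1 + 1) (bad S) (ep * ?clk + f (ys @ [y]))"
 by (rule det) (insert w, auto simp: set_reg_def fun_eq_iff)
 hence "fin w P ok (?st 4 ?R2 m) (?c + 1 + 1 + 1 + 1) (bad S) (ep * ?clk + f (ys @ [y]))"
 by (rule det) (insert Suc.prems(3), auto simp: set_reg_def fun_eq_iff)
 thus ?thesis by (simp add: )
 qed
 hence "fin w P ok (?st 3 ?R m) (?c + 4 + 1) (bad S) (ep * ?clk + f ys)"
 proof (intro fin_avg[where g = "%y. ?st 4 (?R(tmp_reg 2 := y)) m" and D = "pmf_of_set ?W"
 and f = "%y. ep * ?clk + f (ys @ [y])"])
 have ne: "?W ~= {}" by (auto simp: lessThan_empty_iff)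
 have "measure_pmf.expectation (pmf_of_set ?W) (%y. ep * ?clk + f (ys @ [y])) =
 (\<Sum>y\<in>?W. ep * ?clk + f (ys @ [y])) / 2 ^ w"
 using ne by (subst integral_pmf_of_set) auto
 also have "... = ep * ?clk + f ys"
 by (simp add: f_Suc[OF lt] sum.distrib add_divide_distrib)
 finally show "measure_pmf.expectation (pmf_of_set ?W) (%y. ep * ?clk + f (ys @ [y])) <= ep * ?clk + f ys"
 by simp
 show "exec w (P ! pc (?st 3 ?R m)) (?st 3 ?R m) = map_pmf (%y. ?st 4 (?R(tmp_reg 2 := y)) m) (pmf_of_set ?W)"
 using pl'[of 3] by (auto simp: set_reg_def intro!: map_pmf_cong)
 qed (insert pl'[of 3], auto simp: lessThan_empty_iff)
 hence "fin w P ok (?st 2 ?R m) (?c + 4 + 1 + 1) (bad S) (ep * ?clk + f ys)"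
 by (rule det) (auto simp: )
 hence "fin w P ok (?st 1 R m) (?c + 4 + 1 + 1 + 1) (bad S) (ep * ?clk + f ys)"
 by (rule det) (insert Suc.prems(3,4) lt n w, auto simp: set_reg_def fun_eq_iff)
 moreover have "?c + 4 + 1 + 1 + 1 = real C * ?clk + de + 7 * real (n - length ys) + 2"
 using lt by (simp add: )
 ultimately show ?case by metis
 qed
 let ?R = "(reg s)(tmp_reg 0 := 0)"
 have "fin w P ok (?st 1 ?R (mem s)) (real C * ?clk + de + 7 * real (n - length ([] :: nat list)) + 2) (bad S) (ep * ?clk + f [])"
 by (rule main) (insert r, auto simp: repr_def words_def)
 hence "fin w P ok (?st 0 (reg s) (mem s)) (real C * ?clk + de + 7 * real (n - length ([] :: nat list)) + 2 + 1) (bad S) (ep * ?clk + f [])"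
 by (rule det) (auto simp: set_reg_def )
 moreover have "?st 0 (reg s) (mem s) = s" by simp
 ultimately have "fin w P ok s (real C * ?clk + de + 7 * real (n - length ([] :: nat list)) + 2 + 1) (bad S) (ep * ?clk + f [])"
 by metis
 thus "fin_at P ok s de S"
 proof (rule fin_mono)
 \<comment> \<open>Seven instructions per word, two for the last test and one for the first
   constant: the origin of the requirement \<open>10 <= C\<close>.\<close>
 have "7 * real n + 3 <= 10 * real (n + 1)" by simp
 also have "... <= real C * real (n + 1)" using C by (intro mult_right_mono) auto
 finally show "real C * ?clk + de + 7 * real (n - length ([] :: nat list)) + 2 + 1 <= real C * clk S + de"
 by (simp add: algebra_simps)
 have "f [] <= ep" using B by (simp add: f_def divide_le_eq)
 also have "ep <= ep * real (n + 1)" using eps by simp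
 finally show "ep * ?clk + f [] <= ep * clk S" by (simp add: algebra_simps)
 qed qed

end

context ram
begin

text \<open>Each summand of the machine cost of one search is at most a multiple of
  \<open>E\<close>, the quantity \<open>swork\<close> charged to the budget. The overheads
  \<open>mu\<close> and \<rho> go into the factor that is later named \<open>ka0\<close>.\<close>

lemma search_cost:
 fixes h v r :: nat and \<rho> T :: real
 assumes "1 <= h" "1 <= v" "1 <= \<rho>"
 and T: "T <= 2 + 16 * (real r + 1) * (22 + 5 * real v + (mu + 32) * real (h * h)) + ((6 + 2 * mu) * real h + 4) * real v"
 defines "E == real (h * v) + (real r + 1) * (real (h * h) + real v)"
 shows "24 + 3 * real v + ((6 + 2 * mu) * real (h * v) + mu * real (h * h) + 4 * real h + 4 * real v) +
 (4 * real h + 6 * real (h * h)) + \<rho> + \<rho> * (T + 2) <= (\<rho> + 1) * (20 * mu + 2000) * E"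
proof -
 have hv: "real h <= real (h * h)" "real v <= real (h * v)" "1 <= real (h * h)" "1 <= real v"
 using assms(1,2) mult_le_mono[OF assms(1) le_refl[of h]] mult_le_mono[OF assms(1) le_refl[of v]]
 by (simp_all only: )
 have "1 * (real (h * h) + real v) <= (real r + 1) * (real (h * h) + real v)" by (intro mult_right_mono) auto
 hence E: "real (h * h) + real v <= E - real (h * v)" by (simp add: E_def)
 have E1: "real (h * h) <= E" "real v <= E" "real (h * v) <= E" "real h <= E" "1 <= E" using E hv by linarith+
 have mE: "mu * real (h * h) <= mu * E" "mu * real (h * v) <= mu * E" using E1 mu by (auto intro: )
 have mE1: "E <= mu * E" using mult_right_mono[OF mu, of ] E1 by simp
 have "22 + 5 * y + (mu + 32) * x <= (mu + 54) * (x + y)" if "1 <= x" "1 <= y" for x y :: real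
 proof -
 have "0 <= mu * y" using mu that by simp
 thus ?thesis using that by (simp add: algebra_simps)
 qed
 from this[OF hv(3,4)] have "22 + 5 * real v + (mu + 32) * real (h * h) <= (mu + 54) * (real (h * h) + real v)" .
 hence "(real r + 1) * (22 + 5 * real v + (mu + 32) * real (h * h)) <= (real r + 1) * ((mu + 54) * (real (h * h) + real v))"
 by (intro mult_left_mono) auto
 also have "... = (mu + 54) * ((real r + 1) * (real (h * h) + real v))" by simp
 also have "... <= (mu + 54) * E" using mu by (intro mult_left_mono) (auto simp: E_def)
 finally have 1: "(real r + 1) * (22 + 5 * real v + (mu + 32) * real (h * h)) <= mu * E + 54 * E" by (simp add: algebra_simps)
 have T': "T + 2 <= 18 * (mu * E) + 878 * E" using T 1 E1 mE by (simp add: algebra_simps)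
have 2: "24 + 3 * real v + ((6 + 2 * mu) * real (h * v) + mu * real (h * h) + 4 * real h + 4 * real v) +
 (4 * real h + 6 * real (h * h)) <= 3 * (mu * E) + 60 * E"
 using E1 mE by (simp add: algebra_simps)
 have "\<rho> * (T + 2) <= \<rho> * (18 * (mu * E) + 878 * E)" using T' assms(3) by (intro mult_left_mono) auto
 also have "... = 18 * (\<rho> * (mu * E)) + 878 * (\<rho> * E)" by (simp only: distrib_left )
 finally have 3: "\<rho> * (T + 2) <= 18 * (\<rho> * (mu * E)) + 878 * (\<rho> * E)" .
 have 4: "\<rho> <= \<rho> * E" using E1 assms(3) by simp
 have 5: "0 <= \<rho> * (mu * E)" "0 <= \<rho> * E" "0 <= mu * E" "0 <= E" using mE1 E1 assms(3) by auto
 note add_mono[OF add_mono[OF 2 4] 3]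
 also have "3 * (mu * E) + 60 * E + \<rho> * E + (18 * (\<rho> * (mu * E)) + 878 * (\<rho> * E)) <=
 20 * (\<rho> * (mu * E)) + 2000 * (\<rho> * E) + (20 * (mu * E) + 2000 * E)" using 5 by linarith
 also have "... = (\<rho> + 1) * (20 * mu + 2000) * E" by (simp add: algebra_simps)
 finally show ?thesis .
qed

end

subsection \<open>Multiplicative hashing\<close>

text \<open>Multiply-shift hashing with a division by an arbitrary \<open>q\<close> in place of the
  shift; the multiplier \<open>a\<close> is any word, even or odd.\<close>

definition hash :: "nat => nat => nat => nat => nat" where
 "hash w q a x = (a * x mod 2 ^ w) div q"

lemma card_multiples_window:
 fixes d :: nat and l :: int
 assumes "0 < d" and S: "!!a. a : S ==> l < int (a * d) & int (a * d) < l + 2 * int q"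
 shows "card S <= 2 * q div d + 1"
proof (cases "S = {}")
 case False
 define a0 where "a0 = (LEAST a. a : S)"
 have a0: "a0 : S" using False unfolding a0_def by (metis LeastI ex_in_conv)
 have "S <= {a0..a0 + 2 * q div d}"
 proof
 fix a assume a: "a : S"
 have le: "a0 <= a" unfolding a0_def by (rule Least_le[of "%a. a : S", OF a])
 have "int ((a - a0) * d) < 2 * int q" using S[OF a] S[OF a0] le by (simp add: left_diff_distrib)
hence "(a - a0) * d <= 2 * q" by linarith
 hence "a - a0 <= 2 * q div d" using assms(1) by (simp add: less_eq_div_iff_mult_less_eq)
 thus "a : {a0..a0 + 2 * q div d}" using le by auto
 qed
 hence "card S <= card {a0..a0 + 2 * q div d}" by (intro card_mono) auto
 thus ?thesis by simp
qed simp

text \<open>If \<open>x\<close> and \<open>y\<close> collide, the residues of \<open>a * x\<close>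
  and \<open>a * y\<close> differ by less than \<open>q\<close>, so \<open>a * (y - x)\<close> lies
  within \<open>q\<close> of some multiple of \<open>2 ^ w\<close>. There are
  \<open>y - x + 1\<close> such windows, and each contains at most
  \<open>2 * q div (y - x) + 1\<close> multiples of \<open>y - x\<close>.\<close>

lemma card_collisions_less:
 assumes xy: "x < y" and q: "0 < q"
 shows "card {a. a < 2 ^ w & hash w q a x = hash w q a y} <= 4 * q + (y - x) + 1"
proof -
 let ?W = "2 ^ w :: nat"
 define d where "d = y - x"
 have d: "0 < d" using xy by (simp add: d_def)
 define T where "T j = {a. a < ?W & int j * int ?W - int q < int (a * d) & int (a * d) < int j * int ?W + int q}" for j
 have "{a. a < ?W & hash w q a x = hash w q a y} <= (\<Union>j\<in>{..d}. T j)"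
 proof
 fix a assume "a : {a. a < ?W & hash w q a x = hash w q a y}"
 hence a: "a < ?W" "(a * x mod ?W) div q = (a * y mod ?W) div q" by (auto simp: hash_def)
 define u v where "u = a * x mod ?W" and "v = a * y mod ?W"
 have "u div q = v div q" using a(2) by (simp add: u_def v_def)
 hence "u = v div q * q + u mod q" "v = v div q * q + v mod q" by (metis div_mult_mod_eq)+
 hence uv: "u < v + q" "v < u + q"
 using mod_less_divisor[OF q, of u] mod_less_divisor[OF q, of v] by linarith+
 have "a * x <= a * y" using xy by simp
 hence le: "a * x div ?W <= a * y div ?W" by (rule div_le_mono)
 define j where "j = a * y div ?W - a * x div ?W"
 have "int (a * y) - int (a * x) = (int (a * y div ?W) - int (a * x div ?W)) * int ?W + (int v - int u)"
 proof -
 have "int (a * y) = int (a * y div ?W) * int ?W + int v"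
 unfolding v_def by (metis div_mult_mod_eq of_nat_add of_nat_mult)
 moreover have "int (a * x) = int (a * x div ?W) * int ?W + int u"
 unfolding u_def by (metis div_mult_mod_eq of_nat_add of_nat_mult)
 ultimately show ?thesis by (simp add: algebra_simps)
 qed
 moreover have "int (a * y) - int (a * x) = int (a * d)"
 using xy by (simp add: d_def right_diff_distrib)
 moreover have "int (a * y div ?W) - int (a * x div ?W) = int j" using le by (simp add: j_def )
 ultimately have eq: "int (a * d) = int j * int ?W + (int v - int u)" by simp
 have in_T: "int j * int ?W - int q < int (a * d)" "int (a * d) < int j * int ?W + int q"
 using uv unfolding eq by linarith+
 \<comment> \<open>This bounds the index of the window: \<open>a < 2 ^ w\<close> leaves only
   \<open>j <= d\<close>.\<close>
 have "u < ?W" by (simp add: u_def)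
 hence "int j * int ?W < int (a * d) + int ?W" unfolding eq by linarith
 also have "... <= int (?W * d) + int ?W" using a(1) by (simp del: of_nat_mult add: )
 also have "... = int ((d + 1) * ?W)" by (simp add: )
 finally have "j * ?W < (d + 1) * ?W" by (metis of_nat_less_iff of_nat_mult)
 thus "a : (\<Union>j\<in>{..d}. T j)" using in_T a(1) unfolding mult_less_cancel2 by (auto simp: T_def)
qed
 hence "card {a. a < ?W & hash w q a x = hash w q a y} <= card (\<Union>j\<in>{..d}. T j)"
 by (intro card_mono) (auto simp: T_def)
 also have "... <= (\<Sum>j\<in>{..d}. card (T j))" by (intro card_UN_le) simp
 also have "... <= (\<Sum>j\<in>{..d}. 2 * q div d + 1)"
 by (intro sum_mono card_multiples_window[OF d, where l = "int j * int ?W - int q" for j]) (auto simp: T_def)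
 also have "... = (d + 1) * (2 * q div d) + (d + 1)" by simp
 also have "(d + 1) * (2 * q div d) <= 2 * (d * (2 * q div d))" using d by (cases ) auto
 also have "... <= 2 * (2 * q)" by (intro mult_le_mono2) simp
 finally show ?thesis by (simp add: d_def)
qed

lemma card_collisions:
 assumes "x ~= y" "x <= U" "y <= U" "0 < q"
 shows "card {a. a < 2 ^ w & hash w q a x = hash w q a y} <= 4 * q + U + 1"
proof (cases "x < y")
 case True
 show ?thesis using card_collisions_less[OF True assms(4), of w] assms(3) by linarith
next
 case False
 moreover have "{a. a < 2 ^ w & hash w q a x = hash w q a y} = {a. a < 2 ^ w & hash w q a y = hash w q a x}" by auto
 ultimately show ?thesis using card_collisions_less[of y x q w] assms by simp
qed

text \<open>Union bound over the at most \<open>r\<close> competitors of \<open>x\<close>. With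
  about \<open>16 * (r + 1)\<close> buckets the main term of the collision bound takes one half of
  the right-hand side; the hypothesis on \<open>U\<close> lets the additive term take the other
  half.\<close>

lemma card_not_isolated:
 assumes S: "S <= {..U}" "card S <= r" and x: "x : S"
 and q: "q = (2 ^ w - 1) div (16 * (r + 1)) + 1" and U: "4 * (r * (U + 5)) <= 2 ^ w"
 shows "2 * card {a. a < 2 ^ w & (\<exists>y\<in>S. y ~= x & hash w q a y = hash w q a x)} <= 2 ^ w"
proof -
 have "{a. a < 2 ^ w & (\<exists>y\<in>S. y ~= x & hash w q a y = hash w q a x)} =
 (\<Union>y\<in>S - {x}. {a. a < 2 ^ w & hash w q a y = hash w q a x})" by auto
 moreover have fin: "finite S" using S(1) finite_subset by blast
 ultimately have "card {a. a < 2 ^ w & (\<exists>y\<in>S. y ~= x & hash w q a y = hash w q a x)} <=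
 (\<Sum>y\<in>S - {x}. card {a. a < 2 ^ w & hash w q a y = hash w q a x})"
 by (simp add: card_UN_le)
 also have "... <= (\<Sum>y\<in>S - {x}. 4 * q + U + 1)"
 using S x q by (intro sum_mono card_collisions) auto
 also have "... = card (S - {x}) * (4 * q + U + 1)" by simp
 also have "... <= r * (4 * q + U + 1)"
 using S(2) by (intro mult_le_mono1 order_trans[OF card_Diff1_le])
 finally have 1: "2 * card {a. a < 2 ^ w & (\<exists>y\<in>S. y ~= x & hash w q a y = hash w q a x)} <= 2 * (r * (4 * q + U + 1))"
 by simp
 define z where "z = (2 ^ w - 1) div (16 * (r + 1))"
 have "16 * ((r + 1) * z) <= 2 ^ w - 1" unfolding z_def
 by (metis mult.assoc mult.commute div_times_less_eq_dividend)
 hence "16 * (r * z) <= 2 ^ w" by (simp add: )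
 moreover have "r * (4 * q + U + 1) = 4 * (r * z) + r * (U + 5)" by (auto simp: q z_def add_mult_distrib2)
ultimately show ?thesis using U 1 by linarith
qed

text \<open>The number \<open>2 ^ w\<close> is not a word, so the program starts from
  \<open>2 ^ w - 1\<close>, obtained as 0 - 1; adding 1 to the quotient makes \<open>g\<close>
  buckets suffice.\<close>

lemma hash_less:
 assumes "0 < g" "q = (2 ^ w - 1) div g + 1"
 shows "hash w q a x < g"
proof -
 define y where "y = a * x mod 2 ^ w"
 have "y < 2 ^ w" by (simp add: y_def)
 hence "y <= 2 ^ w - 1" by simp
 also have "... = (2 ^ w - 1) div g * g + (2 ^ w - 1) mod g" by (rule div_mult_mod_eq[symmetric])
 also have "... < (2 ^ w - 1) div g * g + g"
 by (rule add_strict_left_mono[OF mod_less_divisor[OF assms(1)]])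
 also have "... = g * q" unfolding assms(2) by (simp only: add_mult_distrib2 mult.commute )
 finally have "y < g * q" .
 thus ?thesis unfolding hash_def y_def[] by (simp add: less_mult_imp_div_less)
qed

text \<open>For a fixed \<open>t\<close> the \<open>R\<close> independent words are all bad with
  probability at most \<open>1 / 2 ^ R\<close>; then a union bound over \<open>T\<close>.\<close>

lemma card_lists_all_bad:
 fixes B :: "'t => nat => bool"
 assumes "finite T" and B: "!!t. t : T ==> 2 * card {a. a < W & B t a} <= W"
 shows "real (card {xs. length xs = R & set xs <= {..<W} & (\<exists>t\<in>T. \<forall>a\<in>set xs. B t a)}) <=
 real (card T) * (real W ^ R / 2 ^ R)"
proof -
 have "{xs. length xs = R & set xs <= {..<W} & (\<exists>t\<in>T. \<forall>a\<in>set xs. B t a)} =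
 (\<Union>t\<in>T. {xs. set xs <= {a. a < W & B t a} & length xs = R})" by auto
 hence "card {xs. length xs = R & set xs <= {..<W} & (\<exists>t\<in>T. \<forall>a\<in>set xs. B t a)} <=
 (\<Sum>t\<in>T. card {xs. set xs <= {a. a < W & B t a} & length xs = R})"
 using assms(1) by (simp add: card_UN_le)
 also have "... = (\<Sum>t\<in>T. card {a. a < W & B t a} ^ R)" by (simp add: card_lists_length_eq)
 finally have "real (card {xs. length xs = R & set xs <= {..<W} & (\<exists>t\<in>T. \<forall>a\<in>set xs. B t a)}) <=
 (\<Sum>t\<in>T. real (card {a. a < W & B t a}) ^ R)"
 by (simp flip: of_nat_power of_nat_sum)
 also have "... <= (\<Sum>t\<in>T. (real W / 2) ^ R)"
 proof (intro sum_mono power_mono)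
 fix t assume "t : T"
 thus "real (card {a. a < W & B t a}) <= real W / 2" using B by fastforce
qed simp
 finally show ?thesis by (simp add: power_divide)
qed

declare [[linarith_neq_limit = 4, linarith_split_limit = 4]]

subsection \<open>Variables and arrays\<close>

abbreviation (input) "vN == 1 :: nat"
abbreviation (input) "vM == 2 :: nat"
abbreviation (input) "vT == 3 :: nat"
abbreviation (input) "vTau == 4 :: nat"
abbreviation (input) "vB == 5 :: nat"
abbreviation (input) "vD == 6 :: nat"
abbreviation (input) "vLV == 7 :: nat"
abbreviation (input) "vR == 8 :: nat"
abbreviation (input) "vBud == 9 :: nat"
abbreviation (input) "vWk == 10 :: nat"
abbreviation (input) "vFlag == 11 :: nat"
abbreviation (input) "vJJ == 12 :: nat"
abbreviation (input) "vCnt == 13 :: nat"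
abbreviation (input) "vE1 == 14 :: nat"
abbreviation (input) "vE2 == 15 :: nat"
abbreviation (input) "vE3 == 16 :: nat"
abbreviation (input) "vE4 == 17 :: nat"
abbreviation (input) "vKey == 18 :: nat"
abbreviation (input) "vP == 19 :: nat"

abbreviation (input) "aOut == 1 :: nat"
abbreviation (input) "aX == 2 :: nat"
abbreviation (input) "aY == 3 :: nat"
abbreviation (input) "aEU == 4 :: nat"
abbreviation (input) "aEV == 5 :: nat"
abbreviation (input) "aPos == 6 :: nat"
abbreviation (input) "aDict == 7 :: nat"
abbreviation (input) "aKey == 8 :: nat"
abbreviation (input) "aSort == 9 :: nat"

notation Var ("$_" [100] 100)

abbreviation plus_exp (infixl "[+]" 65) where "d [+] e == Op Add d e"
abbreviation minus_exp (infixl "[-]" 65) where "d [-] e == Op Sub d e"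
abbreviation times_exp (infixl "[*]" 70) where "d [*] e == Op Mul d e"
abbreviation less_exp (infix "[<]" 50) where "d [<] e == Op Less d e"
abbreviation eq_exp (infix "[=]" 50) where "d [=] e == Op Equal d e"
abbreviation and_exp (infixr "[&]" 35) where "d [&] e == Op And d e"
abbreviation or_exp (infixr "[|]" 30) where "d [|] e == Op Or d e"

lemma and_of_bool: "Bit_Operations.and (of_bool p) (of_bool q) = (of_bool (p & q) :: nat)"
 by (cases ; cases ) auto

lemma or_of_bool: "Bit_Operations.or (of_bool p) (of_bool q) = (of_bool (p | q) :: nat)"
 by (cases ; cases ) auto

subsection \<open>Adjacency\<close>

text \<open>The array \<open>aPos\<close> is never cleared, which would cost time n^2. A stale entry
  does no harm because the edge stored at the position read is compared with the pair in question.
  The test against \<open>$vJJ\<close> restricts the graph to a prefix of the edge list.\<close>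

definition adj_exp :: "exp => exp => exp" where
 "adj_exp d e = (let k = Read aPos (d [*] $vN [+] e) in
 k [<] $vJJ [&] Read aEU k [=] d [&] Read aEV k [=] e)"

definition clique_set :: "nat => (nat \<times> nat) set => nat set set" where
 "clique_set n E = {K. K <= {..<n} & card K = 4 & (\<forall>u\<in>K. \<forall>v\<in>K. u ~= v --> (u, v) : E)}"

lemma finite_clique_set: "finite (clique_set n E)"
 by (rule finite_subset[of _ "Pow {..<n}"]) (auto simp: clique_set_def)

lemma clqD:
 assumes "K : clique_set n E"
 shows "K <= {..<n}" "card K = 4" "u : K ==> v : K ==> u ~= v ==> (u, v) : E"
 using assms unfolding clique_set_def by blast+

lemma madd_less: "(x::nat) < a ==> y < b ==> x * b + y < a * b"
 by (metis add.commute mult_Suc mult_le_mono1 less_eq_Suc_le order_less_le_trans nat_add_left_cancel_less)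

text \<open>
 The edges are listed in both orientations, the two orientations of an edge being neighbours. The
 prefixes of even length are the graphs to which the search is applied.
\<close>

locale lister = ram +
 fixes n m tt U rho :: nat and es :: "(nat \<times> nat) list"
 assumes U: "1000 <= U" "n <= U" "2 * m <= U" "tt <= U" "U ^ 20 < 2 ^ w" "U ^ 4 <= N"
 and rho: "real (U ^ 3) <= ep * 2 ^ rho" "1 <= rho"
 and es: "length es = 2 * m" "distinct es" "!!u v. (u, v) : set es ==> u < n & v < n & u ~= v"
 and es_swap: "!!k. k < m ==> es ! (2 * k + 1) = prod.swap (es ! (2 * k))"
begin

abbreviation adj :: "nat => (nat \<times> nat) set" where "adj k == set (take (2 * k) es)"

abbreviation cl :: "nat => nat set set" where "cl k == clique_set n (adj k)"

lemma word_pos [simp]: "0 < w"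
 using U(1,5) by (cases ) (auto simp: )

lemma U_pow_less: "k <= 20 ==> U ^ k < 2 ^ w"
 using power_increasing[of k 20 U] U(1,5) by linarith

lemma small_less [simp]: "(k::nat) <= 1000 ==> k < 2 ^ w"
proof -
 show "(k::nat) <= 1000 ==> k < 2 ^ w" using U_pow_less[of 1] U(1) by simp
qed

lemma of_bool_mod [simp]: "of_bool p mod 2 ^ w = (of_bool p :: nat)"
 by (cases ) auto

text \<open>Absence of overflow is checked by comparing exponents of \<open>U\<close> with 20; a sum
  costs one exponent since \<open>U\<close> is at least 2.\<close>

lemma poly_bounds:
 "x <= U ^ i ==> y <= U ^ j ==> x * y <= U ^ (i + j)"
 "x <= U ^ i ==> y <= U ^ i ==> x + y <= U ^ (Suc i)"
 using U(1) by (auto simp: power_add mult_mono intro: order_trans[OF _ mult_le_mono1[of 2 U "U ^ i"]])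

lemma n_pow_less: "n * n < 2 ^ w" "n * n * n < 2 ^ w" "n * n * n * n < 2 ^ w"
proof -
 have "n ^ i < 2 ^ w" if "i <= 20" for i
 using power_mono[OF U(2), of i] U_pow_less[OF that] by simp
 from this[of 2] this[of 3] this[of 4] show "n * n < 2 ^ w" "n * n * n < 2 ^ w" "n * n * n * n < 2 ^ w"
 by (simp_all add: eval_nat_numeral )
qed

lemma adj_sym: "k <= m ==> (u, v) : adj k ==> (v, u) : adj k"
proof -
 assume k: "k <= m" and "(u, v) : adj k"
 then obtain i where i: "i < 2 * k" "es ! i = (u, v)" by (auto simp: in_set_conv_nth)
 define j where "j = (if even i then i + 1 else i - 1)"
 have "j < 2 * k" using i(1) by (auto simp: j_def elim!: )
 moreover have "es ! j = (v, u)"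
 proof (cases "even i")
 case True
 thus ?thesis using es_swap[of "i div 2"] i k by (auto simp: j_def)
 next
 case False
 then obtain b where "i = Suc (2 * b)" by (auto elim!: oddE)
 thus ?thesis using es_swap[] i k by (cases "es ! (2 * b)") (auto simp: j_def)
 qed
 ultimately show ?thesis using k es(1) by (auto simp: in_set_conv_nth intro!: )
qed

lemma adj_less: "(u, v) : adj k ==> u < n & v < n & u ~= v"
 using es(3)[] in_set_takeD[of "(u, v)" "2 * k" ] by blast

definition glob :: "(nat => nat) => (nat => nat => nat) => bool" where
 "glob V A <-> V vN = n & V vM = m & V vT = tt &
 (\<forall>k < 2 * m. A aEU k = fst (es ! k) & A aEV k = snd (es ! k) &
 A aPos (fst (es ! k) * n + snd (es ! k)) = k)"

lemma glob_cong:
 "V' vN = V vN ==> V' vM = V vM ==> V' vT = V vT ==> A' aEU = A aEU ==> A' aEV = A aEV ==>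
 A' aPos = A aPos ==> glob V' A' <-> glob V A"
 by (simp only: glob_def)

lemma glob_upd [simp]:
 "x ~= vN ==> x ~= vM ==> x ~= vT ==> glob (V(x := v)) A <-> glob V A"
 "a ~= aEU ==> a ~= aEV ==> a ~= aPos ==> glob V (A(a := f)) <-> glob V A"
 by (rule glob_cong; simp)+

lemma eval_adj_exp:
 assumes "glob V A" "V vJJ = 2 * k" "k <= m" "eval w V A d < n" "eval w V A e < n"
 shows "eval w V A (adj_exp d e) = of_bool ((eval w V A d, eval w V A e) : adj k)"
proof -
 let ?x = "eval w V A d" and ?y = "eval w V A e"
 have less: "?x * n + ?y < n * n" by (rule madd_less) fact+
 have "n * n <= U ^ 2" using U(2) by (simp add: power2_eq_square mult_mono)
 hence less': "?x * n + ?y < 2 ^ w" "?x * n < 2 ^ w" using less U_pow_less[of 2] by auto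
 let ?k = "A aPos (?x * n + ?y)"
 have g: "A aEU i = fst (es ! i)" "A aEV i = snd (es ! i)" "A aPos (fst (es ! i) * n + snd (es ! i)) = i"
 if "i < 2 * k" for i
 using assms(1,3) that unfolding glob_def by auto
 have "(?x, ?y) : adj k <-> ?k < 2 * k & A aEU ?k = ?x & A aEV ?k = ?y"
 proof
 assume "(?x, ?y) : adj k"
 then obtain i where i: "i < 2 * k" "es ! i = (?x, ?y)" by (auto simp: in_set_conv_nth)
 show "?k < 2 * k & A aEU ?k = ?x & A aEV ?k = ?y"
 using g(3)[of i] i g(1,2)[] by simp
next
 assume *: "?k < 2 * k & A aEU ?k = ?x & A aEV ?k = ?y"
 hence "es ! ?k = (?x, ?y)" using g[of ?k] by (simp add: prod_eq_iff)
 moreover have "take (2 * k) es ! ?k = es ! ?k" "?k < length (take (2 * k) es)" using * assms(3) es(1) by auto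
 ultimately show "(?x, ?y) : adj k" by (metis nth_mem)
 qed
 moreover have "V vN = n" using assms(1) by (simp add: glob_def)
 ultimately show ?thesis using less' assms(2)
 by (simp add: adj_exp_def Let_def )
qed

end

subsection \<open>Recording a clique\<close>

lemma card_below_less:
 assumes "finite S" "x : S" "x < (z :: nat)"
 shows "card {y : S. y < x} < card {y : S. y < z}"
proof (rule psubset_card_mono)
 have "x : {y : S. y < z}" "x ~: {y : S. y < x}" using assms by auto
 moreover have "{y : S. y < x} <= {y : S. y < z}" using assms(3) by auto
 ultimately show "{y : S. y < x} \<subset> {y : S. y < z}" by blast
qed (use in simp)

text \<open>Sorting by ranks: an element goes to the position given by the number of smaller
  elements. Distinct elements have distinct ranks, so the four writes do not overwrite each
  other.\<close>

lemma sorted_list_of_set_rank: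
 fixes a b c d :: nat and f :: "nat => nat"
 assumes "a ~= b" "a ~= c" "a ~= d" "b ~= c" "b ~= d" "c ~= d"
 defines "g == f(of_bool (b < a) + of_bool (c < a) + of_bool (d < a) := a,
 of_bool (a < b) + of_bool (c < b) + of_bool (d < b) := b,
 of_bool (a < c) + of_bool (b < c) + of_bool (d < c) := c,
 of_bool (a < d) + of_bool (b < d) + of_bool (c < d) := d)"
 shows "sorted_list_of_set {a, b, c, d} = [g 0, g 1, g 2, g 3]"
proof -
 let ?L = "sorted_list_of_set {a, b, c, d}"
 have len4: "\<exists>p q r s. xs = [p, q, r, s]" if "length xs = 4" for xs :: "nat list"
 using that by (auto simp: length_Suc_conv numeral_eq_Suc)
 have "length ?L = 4" using assms(1-6) by simp
 from len4[OF this] obtain p q r s where L: "?L = [p, q, r, s]" by blast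
 have "sorted_wrt (<) ?L" by (rule strict_sorted_list_of_set)
 hence less: "p < q" "q < r" "r < s" "p < r" "p < s" "q < s" unfolding L by auto
 have S: "{a, b, c, d} = {p, q, r, s}" using L set_sorted_list_of_set[of "{a, b, c, d}"] by simp
 have g: "g (of_bool (p < x) + of_bool (q < x) + of_bool (r < x) + of_bool (s < x)) = x" if "x : {a, b, c, d}" for x
 proof -
 have card: "card {y : Y. y < x} = (\<Sum>y\<in>Y. of_bool (y < x))" if "finite Y" for Y and x :: nat
 using that by (simp add: Int_def)
 have sum4: "(\<Sum>y\<in>{a, b, c, d}. h y) = h a + h b + h c + h d"
 if "a ~= b" "a ~= c" "a ~= d" "b ~= c" "b ~= d" "c ~= d" for h :: "nat => nat" and a b c d :: nat
 using that by simp
 have finite4: "finite {a, b, c, d}" for a b c d :: nat by simp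
 have rank: "of_bool (p < x) + of_bool (q < x) + of_bool (r < x) + of_bool (s < x) = card {y : {a, b, c, d}. y < x}" for x
 unfolding S card[OF finite4] by (rule sum4[symmetric]) (use less in auto)
 have rank': "card {y : {a, b, c, d}. y < x} =
 of_bool (a < x) + of_bool (b < x) + of_bool (c < x) + of_bool (d < x)" for x
 unfolding card[OF finite4] by (rule sum4[OF assms(1-6)])
 have inj: "card {y : {a, b, c, d}. y < x} ~= card {y : {a, b, c, d}. y < z}"
 if "x < z" "x : {a, b, c, d}" for x z
 using card_below_less[OF finite4 that(2,1)] by simp
 have inj': "card {y : {a, b, c, d}. y < x} = card {y : {a, b, c, d}. y < z} <-> x = z"
 if "x : {a, b, c, d}" "z : {a, b, c, d}" for x z
 using inj[of x ] inj[of z x] that by (cases x z rule: linorder_cases) auto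
 have g': "g = f(card {y : {a, b, c, d}. y < a} := a, card {y : {a, b, c, d}. y < b} := b,
 card {y : {a, b, c, d}. y < c} := c, card {y : {a, b, c, d}. y < d} := d)"
 unfolding g_def rank' by simp
 define R where "R z = card {y : {a, b, c, d}. y < z}" for z
 have ne: "R a ~= R b" "R a ~= R c" "R a ~= R d" "R b ~= R c" "R b ~= R d" "R c ~= R d"
 unfolding R_def using inj'[] inj'[of b d] inj'[of c d]
 assms(1-6) by (simp_all only: insert_iff simp_thms)
 have "g (R x) = x" using that ne unfolding g' R_def by auto
thus ?thesis unfolding rank R_def .
 qed
 show ?thesis using g[of p] g[of q] g[of r] g[of s] less unfolding S by (simp_all add: eval_nat_numeral)
qed

lemma card_4_distinct:
 "card {a, b, c, d} = 4 ==> a ~= b & a ~= c & a ~= d & b ~= c & b ~= d & c ~= d"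
 by (simp add: card_insert_if split: if_splits)

lemma sorted_list_of_set_eq_4:
 "card K = 4 ==> sorted_list_of_set K =
 [sorted_list_of_set K ! 0, sorted_list_of_set K ! 1, sorted_list_of_set K ! 2, sorted_list_of_set K ! 3]"
 by (rule nth_equalityI) (auto simp: less_Suc_eq numeral_eq_Suc)

text \<open>The sorted clique read as a numeral in base \<open>n\<close>, which serves as an address
  in the dictionary.\<close>

definition ckey :: "nat => nat set => nat" where
 "ckey n K = (let c = sorted_list_of_set K in ((c ! 0 * n + c ! 1) * n + c ! 2) * n + c ! 3)"

lemma mult_add_eq: "(y::nat) < b ==> y' < b ==> x * b + y = x' * b + y' ==> x = x' & y = y'"
 by (metis div_mult_self3 mod_mult_self3 div_less add_0_right mod_less less_nat_zero_code)

lemma clique_key_inj: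
 assumes "K <= {..<n}" "card K = 4" "K' <= {..<n}" "card K' = 4" "ckey n K = ckey n K'"
 shows "K = K'"
proof -
 have fin: "finite K" "finite K'" using assms by (auto intro: finite_subset)
 let ?c = "sorted_list_of_set K" and ?d = "sorted_list_of_set K'"
 have less: "?c ! i < n" "?d ! i < n" if "i < 4" for i
 using nth_mem[of i ?c] nth_mem[of i ?d] that assms fin by auto
 have "?c ! 0 = ?d ! 0 & ?c ! 1 = ?d ! 1 & ?c ! 2 = ?d ! 2 & ?c ! 3 = ?d ! 3"
 using assms(5) less[of 1] less[of 2] less[of 3] unfolding ckey_def Let_def
 by (auto dest!: mult_add_eq[rotated 2])
 thus ?thesis using sorted_list_of_set_eq_4[OF assms(2)] sorted_list_of_set_eq_4[OF assms(4)] fin by (metis set_sorted_list_of_set)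
qed

definition sort4 :: com where
 "sort4 =
 Write aSort (($vE2 [<] $vE1) [+] ($vE3 [<] $vE1) [+] ($vE4 [<] $vE1)) ($vE1) ;;
 Write aSort (($vE1 [<] $vE2) [+] ($vE3 [<] $vE2) [+] ($vE4 [<] $vE2)) ($vE2) ;;
 Write aSort (($vE1 [<] $vE3) [+] ($vE2 [<] $vE3) [+] ($vE4 [<] $vE3)) ($vE3) ;;
 Write aSort (($vE1 [<] $vE4) [+] ($vE2 [<] $vE4) [+] ($vE3 [<] $vE4)) ($vE4)"

definition record_clique :: com where
 "record_clique =
 Write aDict ($vKey) ($vCnt) ;;
 Write aKey ($vCnt) ($vKey) ;;
 Write aOut (Lit 4 [*] $vCnt) (Read aSort (Lit 0)) ;;
 Write aOut (Lit 4 [*] $vCnt [+] Lit 1) (Read aSort (Lit 1)) ;;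
 Write aOut (Lit 4 [*] $vCnt [+] Lit 2) (Read aSort (Lit 2)) ;;
 Write aOut (Lit 4 [*] $vCnt [+] Lit 3) (Read aSort (Lit 3)) ;;
 Asg vCnt ($vCnt [+] Lit 1)"

text \<open>The dictionary is not initialised either: \<open>aDict\<close> proposes a position in
  the output and \<open>aKey\<close> confirms that this position holds the clique. The flag is
  raised when a new clique meets a full output.\<close>

definition emit :: com where
 "emit =
 Cond (adj_exp ($vE1) ($vE2) [&] adj_exp ($vE1) ($vE3) [&] adj_exp ($vE1) ($vE4) [&]
 adj_exp ($vE2) ($vE3) [&] adj_exp ($vE2) ($vE4) [&] adj_exp ($vE3) ($vE4))
 (sort4 ;;
 Asg vKey (((Read aSort (Lit 0) [*] $vN [+] Read aSort (Lit 1)) [*] $vN [+] Read aSort (Lit 2)) [*] $vN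
 [+] Read aSort (Lit 3)) ;;
 Asg vP (Read aDict ($vKey)) ;;
 Cond ($vP [<] $vCnt [&] Read aKey ($vP) [=] $vKey) Skip
 (Cond ($vCnt [<] $vT) record_clique (Asg vFlag (Lit 1))))
 Skip"

lemma written_emit:
 "wvars emit = {vFlag, vCnt, vKey, vP}" "warrs emit = {aOut, aDict, aKey, aSort}"
 by (auto simp: emit_def sort4_def record_clique_def)

context lister
begin

text \<open>The cliques found so far, each stored as a sorted list.\<close>

definition found :: "(nat => nat) => (nat => nat => nat) => nat => nat set set => bool" where
 "found V A k F <-> V vCnt <= tt & F <= cl k & (\<exists>Ks. length Ks = V vCnt & distinct Ks & set Ks = F &
 (\<forall>p < V vCnt. A aKey p = ckey n (Ks ! p) & A aDict (ckey n (Ks ! p)) = p &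
 (\<forall>i<4. A aOut (4 * p + i) = sorted_list_of_set (Ks ! p) ! i)))"

lemma found_cong:
 "V' vCnt = V vCnt ==> A' aOut = A aOut ==> A' aKey = A aKey ==> A' aDict = A aDict ==>
 found V' A' k F <-> found V A k F"
 by (simp only: found_def)

lemma found_upd [simp]:
 "x ~= vCnt ==> found (V(x := v)) A k F <-> found V A k F"
 "a ~= aOut ==> a ~= aKey ==> a ~= aDict ==> found V (A(a := f)) k F <-> found V A k F"
 by (rule found_cong; simp)+

lemma found_card: "found V A k F ==> card F = V vCnt"
 by (auto simp: found_def distinct_card)

lemma clique_key_eq: "K : cl k ==> K' : cl k' ==> ckey n K = ckey n K' ==> K = K'"
 by (rule clique_key_inj[]) (simp_all add: clique_set_def)

lemma sp_sort4:
 assumes "a ~= b" "a ~= c" "a ~= d" "b ~= c" "b ~= d" "c ~= d"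
 and "vl S vE1 = a" "vl S vE2 = b" "vl S vE3 = c" "vl S vE4 = d"
 and Q: "!!S'. vl S' = vl S ==> (!!x. x ~= aSort ==> ar S' x = ar S x) ==>
 (!!i. i < 4 ==> ar S' aSort i = sorted_list_of_set {a, b, c, d} ! i) ==>
 bad S' = bad S ==> clk S' = clk S - 4 ==> Q S'"
 shows "sp sort4 S Q"
proof -
 have rank: "(of_bool p + of_bool q + of_bool r) mod 2 ^ w = (of_bool p + of_bool q + of_bool r :: nat)"
 "(of_bool p + of_bool q) mod 2 ^ w = (of_bool p + of_bool q :: nat)" for p q r
 by (auto intro!: )
 define g where "g = (ar S aSort)
 (of_bool (b < a) + of_bool (c < a) + of_bool (d < a) := a, of_bool (a < b) + of_bool (c < b) + of_bool (d < b) := b,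
 of_bool (a < c) + of_bool (b < c) + of_bool (d < c) := c, of_bool (a < d) + of_bool (b < d) + of_bool (c < d) := d)"
 have L: "sorted_list_of_set {a, b, c, d} = [g 0, g 1, g 2, g 3]"
 unfolding g_def by (rule sorted_list_of_set_rank[OF assms(1-6)])
 have "g i = [g 0, g 1, g 2, g 3] ! i" if "i < 4" for i
 using that by (auto simp: less_Suc_eq numeral_eq_Suc)
 hence Q': "Q (S(|ar := (ar S)(aSort := g), clk := clk S - 4|))"
 unfolding L[symmetric] by (intro Q) auto
 show ?thesis unfolding sort4_def
 by (intro sp_Seq sp_Write)
 (insert Q', simp add: assms(7-10) rank g_def split del: split_of_bool)
qed

lemma sp_record_clique:
 assumes found: "found@@S k F" and cnt: "vl S vCnt < tt"
 and K: "K : cl k" "K ~: F" and key: "vl S vKey = ckey n K"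
 and sort: "!!i. i < 4 ==> ar S aSort i = sorted_list_of_set K ! i"
 and Q: "!!S'. found@@S' k (insert K F) ==> bad S' = bad S ==> clk S' = clk S - 7 ==>
 vl S' vFlag = vl S vFlag ==> Q S'"
 shows "sp record_clique S Q"
proof -
 have "tt * 4 <= U * U" using U(1,4) by (intro mult_le_mono) auto
 hence less: "4 * tt < 2 ^ w" using U_pow_less[of 2] by (simp add: power2_eq_square)
 obtain Ks where Ks: "length Ks = vl S vCnt" "distinct Ks" "set Ks = F"
 and A: "!!p. p < vl S vCnt ==> ar S aKey p = ckey n (Ks ! p)"
 "!!p. p < vl S vCnt ==> ar S aDict (ckey n (Ks ! p)) = p"
 "!!p i. p < vl S vCnt ==> i < 4 ==> ar S aOut (4 * p + i) = sorted_list_of_set (Ks ! p) ! i"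
 and F: "F <= cl k"
 using found by (auto simp: found_def)
 have ne: "ckey n (Ks ! p) ~= ckey n K" if "p < vl S vCnt" for p
 proof -
 have "Ks ! p : F" using that Ks by auto
 thus ?thesis using K F clique_key_inj[of "Ks ! p" n K] by (auto simp: clique_set_def)
 qed
 let ?c = "vl S vCnt"
 have F': "found ((vl S)(vCnt := ?c + 1)) ((ar S)(aDict := (ar S aDict)(ckey n K := ?c), aKey := (ar S aKey)(?c := ckey n K),
 aOut := (ar S aOut)(4 * ?c := sorted_list_of_set K ! 0, 4 * ?c + 1 := sorted_list_of_set K ! 1,
 4 * ?c + 2 := sorted_list_of_set K ! 2, 4 * ?c + 3 := sorted_list_of_set K ! 3))) k (insert K F)" (is "found ?V ?A k _")
 unfolding found_def
 proof (intro conjI exI[of _ "Ks @ [K]"] allI impI)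
 fix p i assume p: "p < ?V vCnt" and i: "i < (4::nat)"
 show "?A aOut (4 * p + i) = sorted_list_of_set ((Ks @ [K]) ! p) ! i"
 proof (cases "p < ?c")
 case True
 show ?thesis using i True A(3)[OF True i] Ks(1) by (simp add: nth_append)
next
 case False
 hence "p = ?c" using p by simp
 moreover have "i = 0 | i = 1 | i = 2 | i = 3" using i by auto
 ultimately show ?thesis using Ks(1) by (auto simp: nth_append)
 qed
 next
 fix p assume p: "p < ?V vCnt"
 show "?A aKey p = ckey n ((Ks @ [K]) ! p)"
 using p A(1)[of p] Ks(1) by (cases "p = ?c") (simp_all add: nth_append)
 show "?A aDict (ckey n ((Ks @ [K]) ! p)) = p"
 using p A(2)[] Ks(1) ne[of ] by (cases "p = ?c") (simp_all add: nth_append)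
 next
 show "distinct (Ks @ [K])" "set (Ks @ [K]) = insert K F" using Ks(2,3) K(2) by simp_all
 show "insert K F <= cl k" using F K(1) by simp
 qed (use cnt Ks(1) in simp_all)
 have e: "4 * ?c + 3 < 2 ^ w" "4 * ?c + 2 < 2 ^ w" "4 * ?c + 1 < 2 ^ w" "4 * ?c < 2 ^ w" "?c + 1 < 2 ^ w"
 using cnt less by simp_all
 note sort' = sort[of 0, simplified] sort[of 1, simplified] sort[of 2, simplified] sort[of 3, simplified]
 show ?thesis unfolding record_clique_def
 apply (rule sp_Seq, rule sp_Write, simp add: key sort' )+
 apply (rule sp_Asg)
 by (rule Q) (insert F' e[], simp_all add: eval_nat_numeral)
qed

end

context lister
begin

text \<open>In the second outcome, \<open>tt\<close> cliques are on record and a further one has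
  just been seen, hence \<open>tt < card (cl k)\<close>.\<close>

lemma sp_emit:
 assumes glob: "glob@@S" and found: "found@@S k F" and jj: "vl S vJJ = 2 * k" "k <= m"
 and e: "vl S vE1 = a" "vl S vE2 = b" "vl S vE3 = c" "vl S vE4 = d" "a < n" "b < n" "c < n" "d < n"
 and Q: "!!S' F'. found@@S' k F' ==> F <= F' ==> bad S' = bad S ==> clk S - 16 <= clk S' ==>
 vl S' vFlag = vl S vFlag & ({a, b, c, d} : cl k --> {a, b, c, d} : F') \<or>
 vl S' vFlag = 1 & vl S' vCnt = tt & tt < card (cl k) ==> Q S'"
 shows "sp emit S Q"
proof -
 define K where "K = {a, b, c, d}"
 let ?t = "adj_exp ($vE1) ($vE2) [&] adj_exp ($vE1) ($vE3) [&] adj_exp ($vE1) ($vE4) [&]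
 adj_exp ($vE2) ($vE3) [&] adj_exp ($vE2) ($vE4) [&] adj_exp ($vE3) ($vE4)"
 have adj: "ev w S (adj_exp ($x) ($y)) = of_bool ((vl S x, vl S y) : adj k)"
 if "vl S x < n" "vl S y < n" for x y
 using eval_adj_exp[OF glob jj, of "$x" "$y"] that by simp
 have t: "ev w S ?t = of_bool ((a, b) : adj k & (a, c) : adj k & (a, d) : adj k &
 (b, c) : adj k & (b, d) : adj k & (c, d) : adj k)"
 using e by (simp add: adj )
 have "ev w S ?t ~= 0 <-> K : cl k"
 proof
 assume "ev w S ?t ~= 0"
 hence *: "(a, b) : adj k" "(a, c) : adj k" "(a, d) : adj k" "(b, c) : adj k" "(b, d) : adj k" "(c, d) : adj k"
 unfolding t by (auto simp: split: )
 show "K : cl k" using *[THEN adj_less] *[THEN adj_sym[OF jj(2)]] * e by (simp add: clique_set_def K_def)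
next
 assume K: "K : cl k"
 have "card K = 4" using K by (rule clqD(2))
 from card_4_distinct[OF this[unfolded K_def]] show "ev w S ?t ~= 0" using clqD(3)[OF K] unfolding t by (simp add: K_def)
qed
 note t = this
 note Q = Q[folded K_def]
 show ?thesis unfolding emit_def
 proof (rule sp_Cond)
 assume "ev w S ?t = 0"
 thus "sp Skip (tick S) Q" using t found by - (rule sp_Skip, rule Q[where F' = F], simp_all)
next
 assume "ev w S ?t ~= 0"
 hence K: "K : cl k" using t by simp
 hence "card K = 4" by (rule clqD(2))
 from card_4_distinct[OF this[unfolded K_def]] have ne: "a ~= b" "a ~= c" "a ~= d" "b ~= c" "b ~= d" "c ~= d" by simp_all
 let ?l = "sorted_list_of_set K"
 have "finite K" unfolding K_def by simp
 hence l: "?l ! i < n" if "i < 4" for i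
 using nth_mem[of i ?l] that clqD(1)[OF K] \<open>card K = 4\<close> by auto
 let ?x = "?l ! 0 * n + ?l ! 1"
 have 1: "?x < n * n" "?x * n + ?l ! 2 < n * n * n" "(?x * n + ?l ! 2) * n + ?l ! 3 < n * n * n * n"
 using l by (auto intro!: madd_less)
 note 2 = less_trans[OF 1(1) n_pow_less(1)] less_trans[OF 1(2) n_pow_less(2)] less_trans[OF 1(3) n_pow_less(3)]
 have n: "vl S vN = n" "vl S vT = tt" using glob by (auto simp: glob_def)
 show "sp (sort4 ;; Asg vKey (((Read aSort (Lit 0) [*] $vN [+] Read aSort (Lit 1)) [*] $vN [+] Read aSort (Lit 2)) [*] $vN
 [+] Read aSort (Lit 3)) ;;
 Asg vP (Read aDict ($vKey)) ;;
 Cond ($vP [<] $vCnt [&] Read aKey ($vP) [=] $vKey) Skip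
 (Cond ($vCnt [<] $vT) record_clique (Asg vFlag (Lit 1)))) (tick S) Q"
 proof (rule sp_Seq, rule sp_sort4[OF ne, folded K_def])
 fix S1 :: cst
 assume S1: "vl S1 = vl (tick S)" "!!x. x ~= aSort ==> ar S1 x = ar (tick S) x"
 "!!i. i < 4 ==> ar S1 aSort i = ?l ! i" "bad S1 = bad (tick S)" "clk S1 = clk (tick S) - 4"
 let ?V = "(vl S)(vKey := ckey n K, vP := ar S aDict (ckey n K))"
 let ?S = "S1(|vl := ?V, clk := clk S - 7|)"
 have found1: "found ?V (ar S1) k F" using found found_cong[of "vl S" "vl S" "ar S1" "ar S"] S1(2) by simp
 obtain Ks where Ks: "length Ks = vl S vCnt" "set Ks = F"
 and A: "!!p. p < vl S vCnt ==> ar S aKey p = ckey n (Ks ! p)"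
 "!!p. p < vl S vCnt ==> ar S aDict (ckey n (Ks ! p)) = p"
 and F: "F <= cl k" "vl S vCnt <= tt"
 using found by (auto simp: found_def)
 let ?p = "ar S aDict (ckey n K)"
 have mem: "?p < vl S vCnt & ar S aKey ?p = ckey n K <-> K : F"
 proof
 assume *: "?p < vl S vCnt & ar S aKey ?p = ckey n K"
 hence "Ks ! ?p : F" using Ks nth_mem[of ?p Ks] by simp
 moreover have "ckey n (Ks ! ?p) = ckey n K" using * A(1)[of ?p] by simp
 ultimately show "K : F" using F(1) K clique_key_eq \<open>Ks ! ?p : F\<close> by fastforce
next
 assume "K : F"
 then obtain p where "p < vl S vCnt" "Ks ! p = K" using Ks by (metis in_set_conv_nth)
 thus "?p < vl S vCnt & ar S aKey ?p = ckey n K" using A[of p] by simp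
 qed
 have rest: "sp (Cond ($vP [<] $vCnt [&] Read aKey ($vP) [=] $vKey) Skip
 (Cond ($vCnt [<] $vT) record_clique (Asg vFlag (Lit 1)))) ?S Q"
 proof (rule sp_Cond)
 assume "ev w ?S ($vP [<] $vCnt [&] Read aKey ($vP) [=] $vKey) ~= 0"
 hence "K : F" using mem S1(2) by (simp add: and_of_bool)
 thus "sp Skip (tick ?S) Q" using found1 S1(4) by - (rule sp_Skip, rule Q[where F' = F], simp_all)
 next
 assume "ev w ?S ($vP [<] $vCnt [&] Read aKey ($vP) [=] $vKey) = 0"
 hence KF: "K ~: F" using mem S1(2) by (simp add: and_of_bool)
 show "sp (Cond ($vCnt [<] $vT) record_clique (Asg vFlag (Lit 1))) (tick ?S) Q"
 proof (rule sp_Cond)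
 assume "eval w (vl (tick ?S)) (ar (tick ?S)) ($vCnt [<] $vT) ~= 0"
 hence "vl S vCnt < tt" using n by simp
 thus "sp record_clique (tick (tick ?S)) Q"
 proof (intro sp_record_clique[OF _ _ K KF])
 fix S' :: cst assume S': "found@@S' k (insert K F)" "bad S' = bad (tick (tick ?S))"
 "clk S' = clk (tick (tick ?S)) - 7" "vl S' vFlag = vl (tick (tick ?S)) vFlag"
 show "Q S'" by (rule Q[OF S'(1)]) (use S'(2-4) S1(4) in auto)
 qed (simp_all add: found1 S1(3) )
 next
 assume "eval w (vl (tick ?S)) (ar (tick ?S)) ($vCnt [<] $vT) = 0"
 hence cnt: "vl S vCnt = tt" using n F by simp
 have "card (insert K F) <= card (cl k)" using F K by (intro card_mono finite_clique_set) auto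
 moreover have "finite F" using Ks(2) by auto
 ultimately have "tt < card (cl k)" using cnt found_card[OF found] KF by simp
 moreover have "found (?V(vFlag := 1)) (ar S1) k F" using found1 by simp
 ultimately show "sp (Asg vFlag (Lit 1)) (tick (tick ?S)) Q"
 using cnt S1(4) by - (rule sp_Asg, rule Q[where F' = F], simp_all)
 qed
 qed
 have key: "ckey n K = (?x * n + ?l ! 2) * n + ?l ! 3" by (simp add: ckey_def Let_def)
 show "sp (Asg vKey (((Read aSort (Lit 0) [*] $vN [+] Read aSort (Lit 1)) [*] $vN [+] Read aSort (Lit 2)) [*] $vN
 [+] Read aSort (Lit 3)) ;;
 Asg vP (Read aDict ($vKey)) ;;
 Cond ($vP [<] $vCnt [&] Read aKey ($vP) [=] $vKey) Skip
 (Cond ($vCnt [<] $vT) record_clique (Asg vFlag (Lit 1)))) S1 Q"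
 proof (rule sp_Seq, rule sp_Asg)
 have vN: "vl S1 vN = n" using S1(1) n(1) by simp
 have l: "ar S1 aSort 0 = ?l ! 0" "ar S1 aSort 1 = ?l ! 1" "ar S1 aSort 2 = ?l ! 2" "ar S1 aSort 3 = ?l ! 3"
 by (rule S1(3), simp)+
 have lit: "eval w V A (Lit 0) = 0" "eval w V A (Lit 1) = 1" "eval w V A (Lit 2) = 2" "eval w V A (Lit 3) = 3" for V A
 by simp_all
 have "ev w S1 (((Read aSort (Lit 0) [*] $vN [+] Read aSort (Lit 1)) [*] $vN [+] Read aSort (Lit 2)) [*] $vN
 [+] Read aSort (Lit 3)) = ((?x * n + ?l ! 2) * n + ?l ! 3) mod 2 ^ w"
 unfolding eval.simps(2-4) lit binop_val.simps vN l
 by (simp only: mod_add_left_eq mod_mult_left_eq)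
 also have "... = ckey n K" unfolding key by (rule mod_less[OF 2(3)])
 finally have ev: "ev w S1 (((Read aSort (Lit 0) [*] $vN [+] Read aSort (Lit 1)) [*] $vN [+] Read aSort (Lit 2)) [*] $vN
 [+] Read aSort (Lit 3)) = ckey n K" .
 show "sp (Asg vP (Read aDict ($vKey)) ;;
 Cond ($vP [<] $vCnt [&] Read aKey ($vP) [=] $vKey) Skip
 (Cond ($vCnt [<] $vT) record_clique (Asg vFlag (Lit 1))))
 (S1(|vl := (vl S1)(vKey := ev w S1 (((Read aSort (Lit 0) [*] $vN [+] Read aSort (Lit 1)) [*] $vN
 [+] Read aSort (Lit 2)) [*] $vN [+] Read aSort (Lit 3))), clk := clk S1 - 1|)) Q"
 unfolding ev by (rule sp_Seq, rule sp_Asg) (use rest S1(1,2,4,5) in simp)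
 qed
 qed (simp_all add: e)
 qed
qed

end

subsection \<open>Counting and encoding witnesses by matrix multiplication\<close>

abbreviation (input) "vRN == 20 :: nat"
abbreviation (input) "vWN == 21 :: nat"
abbreviation (input) "vRR == 22 :: nat"
abbreviation (input) "vNG == 23 :: nat"
abbreviation (input) "vMode == 24 :: nat"
abbreviation (input) "vGG == 25 :: nat"
abbreviation (input) "vQQ == 26 :: nat"
abbreviation (input) "vRep == 27 :: nat"
abbreviation (input) "vG == 28 :: nat"
abbreviation (input) "vI == 29 :: nat"
abbreviation (input) "vK == 30 :: nat"
abbreviation (input) "vS == 31 :: nat"
abbreviation (input) "vI2 == 32 :: nat"
abbreviation (input) "aRW == 10 :: nat"
abbreviation (input) "aWC == 11 :: nat"
abbreviation (input) "aWD == 12 :: nat"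
abbreviation (input) "aWI == 13 :: nat"
abbreviation (input) "aHM == 14 :: nat"

definition stores :: "(nat => nat) => nat list => bool" where
 "stores f xs <-> (\<forall>i < length xs. f i = xs ! i)"

lemma length_concat_grid: "length (concat (map (%i. map (f i) [0..<c]) [0..<r])) = r * c"
 by (induction r) auto

lemma nth_concat_grid:
 "i < r ==> j < c ==> concat (map (%i. map (f i) [0..<c]) [0..<r]) ! (i * c + j) = f i j"
proof (induction r)
 case (Suc r)
 show ?case
 proof (cases "i < r")
 case True
 hence "i * c + j < r * c" using Suc.prems(2) by (rule madd_less)
 thus ?thesis using Suc True by (simp add: nth_append length_concat_grid)
 next
 case False
 hence "i = r" using Suc.prems(1) by simp
 thus ?thesis using Suc.prems by (simp add: nth_append length_concat_grid)
 qed
qed simp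

lemma length_row_major: "length (row_major X) = dim_row X * dim_col X"
 unfolding row_major_def by (rule length_concat_grid)

lemma nth_row_major: "i < dim_row X ==> j < dim_col X ==> row_major X ! (i * dim_col X + j) = X $$ (i, j)"
 unfolding row_major_def by (rule nth_concat_grid)

definition wit_exp :: exp where
 "wit_exp = (adj_exp (Read aRW ($vI)) (Read aWC (Read aWI ($vK))) [&]
 adj_exp (Read aRW ($vI)) (Read aWD (Read aWI ($vK))))"

text \<open>The entry for two rows sums \<open>1 + d * l\<close> over the common witnesses
  \<open>l\<close> of the current group. Mode \<open>d = 0\<close> counts them; in mode
  \<open>d = 1\<close> an only common witness can be read off as the entry minus 1, the added 1
  distinguishing witness 0 from none.\<close>

definition product :: com where
 "product =
 Write aX (Lit 0) ($vRN) ;; Write aX (Lit 1) ($vNG) ;; Write aX (Lit 2) ($vRN) ;;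
 For vI vRN (For vK vNG
 (Write aX (Lit 3 [+] ($vI [*] $vNG [+] $vK)) wit_exp)) ;;
 For vK vNG (For vI vRN
 (Write aX (Lit 3 [+] $vRN [*] $vNG [+] ($vK [*] $vRN [+] $vI))
 ((Lit 1 [+] $vMode [*] Read aWI ($vK)) [*] wit_exp))) ;;
 MatMul"

lemma written_product: "wvars product = {vI, vK}" "warrs product = {aX, aY}"
 by (auto simp: product_def w_For)

context lister
begin

definition witness :: "nat => nat => nat \<times> nat => bool" where
 "witness k a e <-> (a, fst e) : adj k & (a, snd e) : adj k"

definition search :: "(nat => nat) => (nat => nat => nat) => nat list => (nat \<times> nat) list => bool" where
 "search V A rs es' <-> V vRN = length rs & V vWN = length es' &
 stores (A aRW) rs & stores (A aWC) (map fst es') & stores (A aWD) (map snd es') &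
 set rs <= {..<n} & set es' <= {..<n} \<times> {..<n} & length rs <= U & length es' <= U"

lemma search_cong:
 "V' vRN = V vRN ==> V' vWN = V vWN ==> A' aRW = A aRW ==> A' aWC = A aWC ==> A' aWD = A aWD ==>
 search V' A' rs ws <-> search V A rs ws"
 by (simp only: search_def)

lemma search_upd [simp]:
 "x ~= vRN ==> x ~= vWN ==> search (V(x := v)) A rs ws <-> search V A rs ws"
 "a ~= aRW ==> a ~= aWC ==> a ~= aWD ==> search V (A(a := f)) rs ws <-> search V A rs ws"
 by (rule search_cong; simp)+

lemma eval_witness_exp:
 assumes "glob V A" "V vJJ = 2 * k" "k <= m" "search V A rs ws" "stores (A aWI) ix"
 and "V vI = i" "i < length rs" "V vK = j" "j < length ix" "ix ! j < length ws"
 shows "eval w V A wit_exp = of_bool (witness k (rs ! i) (ws ! (ix ! j)))"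
proof -
 have ev: "eval w V A (Read aRW ($vI)) = rs ! i" "eval w V A (Read aWC (Read aWI ($vK))) = fst (ws ! (ix ! j))"
 "eval w V A (Read aWD (Read aWI ($vK))) = snd (ws ! (ix ! j))"
 using assms by (auto simp: search_def stores_def)
 have less: "rs ! i < n" "fst (ws ! (ix ! j)) < n" "snd (ws ! (ix ! j)) < n"
 using assms(4) nth_mem[OF assms(7)] nth_mem[OF assms(10)] by (auto simp: search_def)
 show ?thesis unfolding wit_exp_def     using less by (simp add: eval_adj_exp[OF assms(1-3)] ev witness_def del: eval.simps(4))
qed

lemma sp_product:
 assumes glob: "glob@@S" and jj: "vl S vJJ = 2 * k" "k <= m"
 and search: "search@@S rs ws" and ix: "stores (ar S aWI) ix" "vl S vNG = length ix"
 and len: "rs ~= []" "ix ~= []" "set ix <= {..<length ws}" "length ix <= U"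
 and mode: "vl S vMode = d" "d <= 1"
 and Q: "!!S'. (bad S ==> bad S') ==>
 clk S - ((6 + 2 * mu) * real (length rs * length ix) + mu * real (length rs * length rs) +
 4 * real (length rs) + 4 * real (length ix) + 7) <= clk S' ==>
 (!!i j. ~bad S' ==> i < length rs ==> j < length rs ==> ar S' aY (i * length rs + j) =
 (\<Sum>l\<leftarrow>ix. of_bool (witness k (rs ! i) (ws ! l) & witness k (rs ! j) (ws ! l)) * (1 + d * l))) ==> Q S'"
 shows "sp product S Q"
proof -
 let ?h = "length rs" and ?g = "length ix"
 let ?wi = "%i l. witness k (rs ! i) (ws ! l)"
 define X where "X = mat ?h ?g (%(i, j). of_bool (?wi i (ix ! j)) :: nat)"
 define Y where "Y = mat ?g ?h (%(j, i). (1 + d * ix ! j) * of_bool (?wi i (ix ! j)))"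
 define L where "L = [?h, ?g, ?h] @ row_major X @ row_major Y"
 have hU: "?h <= U" and wU: "length ws <= U" using search by (auto simp: search_def)
 have ixU: "ix ! j < length ws" if "j < ?g" for j using nth_mem[OF that] len(3) by auto
 have lenL: "length L = 3 + ?h * ?g + ?g * ?h"
 by (simp add: L_def length_row_major X_def Y_def)
 have LX: "L ! (3 + (i * ?g + j)) = of_bool (?wi i (ix ! j))" if "i < ?h" "j < ?g" for i j
 proof -
 have "i * ?g + j < ?h * ?g" using that by (rule madd_less)
 hence "L ! (3 + (i * ?g + j)) = row_major X ! (i * ?g + j)"
 by (simp add: L_def nth_append length_row_major X_def )
 also have "... = X $$ (i, j)" using nth_row_major[of i X ] that by (simp add: X_def)
 finally show ?thesis using that by (simp add: X_def)
 qed
 have LY: "L ! (3 + ?h * ?g + (j * ?h + i)) = (1 + d * ix ! j) * of_bool (?wi i (ix ! j))" if "i < ?h" "j < ?g" for i j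
 proof -
 have "L ! (3 + ?h * ?g + (j * ?h + i)) = row_major Y ! (j * ?h + i)"
 by (simp add: L_def nth_append length_row_major X_def )
 also have "... = Y $$ (j, i)" using nth_row_major[of j Y ] that by (simp add: Y_def)
 finally show ?thesis using that by (simp add: Y_def)
 qed
 have gh: "i * ?g + j < ?h * ?g" "j * ?h + i < ?h * ?g" if "i < ?h" "j < ?g" for i j
 using madd_less[OF that] madd_less[OF that(2,1)] by (simp_all add: mult.commute)
 have "?h * ?g <= U * U" using hU len(4) by (rule mult_le_mono)
 moreover have "3 + 2 * (U * U) <= U ^ 3"
 proof -
 have "3 + 2 * (U * U) <= 3 * (U * U)" using mult_le_mono[OF U(1) U(1)] by simp
 also have "... <= U * (U * U)" using U(1) by (intro mult_le_mono1) simp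
 finally show ?thesis by (simp add: eval_nat_numeral)
 qed
 moreover have "U ^ 3 < 2 ^ w" using U_pow_less by simp
 ultimately have W: "3 + ?h * ?g + ?h * ?g < 2 ^ w" by linarith
 have less1: "3 + (i * ?g + j) < 2 ^ w" "i * ?g + j < 2 ^ w" "i * ?g < 2 ^ w"
 and less2: "3 + ?h * ?g + (j * ?h + i) < 2 ^ w" "j * ?h + i < 2 ^ w" "j * ?h < 2 ^ w" "3 + ?h * ?g < 2 ^ w" "?h * ?g < 2 ^ w"
 if "i < ?h" "j < ?g" for i j
 using gh[OF that] W by linarith+
 have weight: "1 + d * ix ! j <= U + 1" "1 + d * ix ! j < 2 ^ w" "d * ix ! j < 2 ^ w" if "j < ?g" for j
 proof -
 have "d * ix ! j <= 1 * ix ! j" using mode(2) by (rule mult_le_mono1)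
 thus "1 + d * ix ! j <= U + 1" using ixU[OF that] wU by linarith
 moreover have "U + 1 < 2 ^ w"
 using \<open>3 + 2 * (U * U) <= U ^ 3\<close> \<open>U ^ 3 < 2 ^ w\<close> mult_le_mono1[of 1 U U] by linarith
 ultimately show "1 + d * ix ! j < 2 ^ w" "d * ix ! j < 2 ^ w" by linarith+
 qed
 define ctx where "ctx V A <-> glob V A & V vJJ = 2 * k & search V A rs ws & stores (A aWI) ix &
 V vNG = ?g & V vMode = d & V vRN = ?h" for V A
 have ctx: "ctx@@S" using assms by (simp add: ctx_def search_def)
 have ctx_cong: "ctx V' A'" if "ctx V A" "!!x. x ~: {vI, vK} ==> V' x = V x" "!!a. a ~: {aX, aY} ==> A' a = A a" for V A V' A'
 using that(1) unfolding ctx_def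
 by (subst glob_cong[], simp_all add: that(2,3), subst search_cong[of V' V A' A], simp_all add: that(2,3))
 have ev: "eval w V A wit_exp = of_bool (?wi i (ix ! j))" if "ctx V A" "V vI = i" "V vK = j" "i < ?h" "j < ?g" for V A i j
 using that ixU[] jj(2) unfolding ctx_def by (intro eval_witness_exp) auto
 have clk: "clk S - (7 + 4 * real ?h + 4 * real ?g + 6 * real (?h * ?g)) = clk S - 3 - (2 + real ?h * (2 + real ?g * 3 + 2)) - (2 + real ?g * (2 + real ?h * 3 + 2))"
 by (simp add: algebra_simps)
 show ?thesis unfolding product_def
 apply (rule sp_Seq, rule sp_Write, simp)
 apply (rule sp_Seq, rule sp_Write, simp)
 apply (rule sp_Seq, rule sp_Write, simp)
 apply (rule sp_Seq)
 proof -
 let ?S = "S(|ar := (ar S)(aX := (ar S aX)(0 := vl S vRN, Suc 0 := vl S vNG, 2 := vl S vRN)), clk := clk S - 3|)"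
 let ?inv = "%p (V::nat=>nat) (A::nat=>nat=>nat) b. (\<forall>q<p. A aX q = L ! q) & b = bad S"
 let ?Q3 = "%S2. ctx@@S2 & (?inv (3 + ?h * ?g + ?g * ?h))@@@S2 &
 clk S - (7 + 4 * real ?h + 4 * real ?g + 6 * real (?h * ?g)) <= clk S2"
 have ctx0: "ctx@@?S" by (rule ctx_cong[OF ctx]) auto
 have final: "sp MatMul S2 Q" if S2: "?Q3 S2" for S2 :: cst
 proof (rule sp_MatMul)
 have "?h <= N" "?g <= N" "U + 1 <= N"
 proof -
 have "U + 1 <= U ^ 4" proof -
 have "U + 1 <= 3 + 2 * (U * U)" using mult_le_mono1[of 1 U U] by linarith
 also note \<open>3 + 2 * (U * U) <= U ^ 3\<close>
 also have "U ^ 3 <= U ^ 4" using U(1) by (intro power_increasing) auto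
 finally show ?thesis .
 qed
 thus "U + 1 <= N" using U(6) by simp
 thus "?h <= N" "?g <= N" using hU len(4) by auto
 qed
 moreover have "(1 + d * ix ! j) * of_bool b <= N" if "j < ?g" for j b
 using weight(1)[OF that] \<open>U + 1 <= N\<close> by (cases ) simp_all
 ultimately show "(N, X, Y) : matmul_instances"
 using len(1,2) U(1) by (auto simp: matmul_instances_def X_def Y_def Suc_le_eq)
 show "L : matmul_enc (N, X, Y)" by (simp add: matmul_enc_def L_def X_def Y_def)
 show "ar S2 2 i = L ! i" if "i < length L" for i using S2 that lenL by simp
 fix S' :: cst
 assume S': "vl S' = vl S2" "!!a. a ~: {2, 3} ==> ar S' a = ar S2 a" "bad S2 ==> bad S'"
 "clk S' = clk S2 - mu * real (dim_row X * dim_col X + dim_col X * dim_col Y + dim_row X * dim_col Y)"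
 "~bad S' ==> \<forall>i<length (row_major (X * Y)). ar S' 3 i = row_major (X * Y) ! i"
 show "Q S'"
 proof (rule Q)
 show "bad S ==> bad S'" using S2 S'(3) by simp
 show "clk S - ((6 + 2 * mu) * real (?h * ?g) + mu * real (?h * ?h) + 4 * real ?h + 4 * real ?g + 7) <= clk S'"
 using S2 S'(4) by (simp add: X_def Y_def algebra_simps)
 fix i j assume ij: "~bad S'" "i < ?h" "j < ?h"
 have "i * ?h + j < ?h * ?h" using ij(2,3) by (rule madd_less)
 hence "ar S' aY (i * ?h + j) = row_major (X * Y) ! (i * ?h + j)"
 using S'(5)[OF ij(1)] by (simp add: length_row_major X_def Y_def)
 also have "... = (X * Y) $$ (i, j)"
 using nth_row_major[of i "X * Y" ] ij by (simp add: X_def Y_def)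
 also have "... = (\<Sum>l<?g. of_bool (?wi i (ix ! l)) * ((1 + d * ix ! l) * of_bool (?wi j (ix ! l))))"
 using ij by (simp add: X_def Y_def scalar_prod_def atLeast0LessThan)
 also have "... = (\<Sum>l<?g. of_bool (?wi i (ix ! l) & ?wi j (ix ! l)) * (1 + d * ix ! l))"
 by (intro sum.cong) auto
 also have "... = (\<Sum>l\<leftarrow>ix. of_bool (?wi i l & ?wi j l) * (1 + d * l))"
 by (simp add: sum_list_sum_nth atLeast0LessThan)
 finally show "ar S' aY (i * ?h + j) = (\<Sum>l\<leftarrow>ix. of_bool (?wi i l & ?wi j l) * (1 + d * l))" .
 qed
 qed
 have second: "sp (For vK vNG (For vI vRN (Write aX (Lit 3 [+] $vRN [*] $vNG [+] ($vK [*] $vRN [+] $vI))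
 ((Lit 1 [+] $vMode [*] Read aWI ($vK)) [*] wit_exp)))) S1 ?Q3"
 if S1: "ctx@@S1" "(?inv (3 + ?h * ?g))@@@S1"
 "clk S - 3 - (2 + real ?h * (2 + real ?g * 3 + 2)) <= clk S1" for S1 :: cst
 proof (rule sp_For_time[where n = ?g and I = "%j. ?inv (3 + ?h * ?g + j * ?h)" and t = "2 + real ?h * 3"])
 show "vl S1 vNG = ?g" using S1(1) by (simp add: ctx_def)
 fix j and S' :: cst
 let ?c = "For vI vRN (Write aX (Lit 3 [+] $vRN [*] $vNG [+] ($vK [*] $vRN [+] $vI))
 ((Lit 1 [+] $vMode [*] Read aWI ($vK)) [*] wit_exp))"
 assume S': "frame (For vK vNG ?c) S1 S'" "j < ?g" "vl S' vK = j" "(?inv (3 + ?h * ?g + j * ?h))@@@S'"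
 have c': "ctx@@S'"
 by (rule ctx_cong[OF S1(1)]) (insert S'(1), auto simp: frame_def w_For)
 show "sp ?c S' (%S''. ?inv (3 + ?h * ?g + Suc j * ?h) ((vl S'')(vK := Suc j)) (ar S'') (bad S'') & clk S' - (2 + real ?h * 3) <= clk S'')"
 proof (rule sp_For_time[where n = ?h and I = "%i. ?inv (3 + ?h * ?g + (j * ?h + i))" and t = 1])
 show "vl S' vRN = ?h" using c' by (simp add: ctx_def)
 fix i and S2 :: cst
 assume S2: "frame ?c S' S2" "i < ?h" "vl S2 vI = i" "(?inv (3 + ?h * ?g + (j * ?h + i)))@@@S2"
 have c2: "ctx@@S2"
 by (rule ctx_cong[OF c']) (insert S2(1), auto simp: frame_def w_For)
 have vK: "vl S2 vK = j" using S2(1) S'(3) by (auto simp: frame_def w_For)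
 have e: "ev w S2 wit_exp = of_bool (?wi i (ix ! j))"
 by (rule ev[OF c2 S2(3) vK S2(2) S'(2)])
 have pos: "ev w S2 (Lit 3 [+] $vRN [*] $vNG [+] ($vK [*] $vRN [+] $vI)) = 3 + ?h * ?g + (j * ?h + i)"
 using c2 vK S2(3) less2[OF S2(2) S'(2)] by (simp add: ctx_def)
 have val: "ev w S2 ((Lit 1 [+] $vMode [*] Read aWI ($vK)) [*] wit_exp) = (1 + d * ix ! j) * of_bool (?wi i (ix ! j))"
 using c2 vK S'(2) weight(2,3)[] unfolding eval.simps(3) e by (simp add: ctx_def stores_def)
 show "sp (Write aX (Lit 3 [+] $vRN [*] $vNG [+] ($vK [*] $vRN [+] $vI)) ((Lit 1 [+] $vMode [*] Read aWI ($vK)) [*] wit_exp)) S2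
 (%S''. ?inv (3 + ?h * ?g + (j * ?h + Suc i)) ((vl S'')(vI := Suc i)) (ar S'') (bad S'') & clk S2 - 1 <= clk S'')"
 by (rule sp_Write_eq[OF pos val]) (insert S2(4), simp add: less_Suc_eq LY[OF S2(2) S'(2)])
 qed (insert S'(4), auto simp: add_ac)
 next
 fix S' :: cst
 let ?c = "For vI vRN (Write aX (Lit 3 [+] $vRN [*] $vNG [+] ($vK [*] $vRN [+] $vI))
 ((Lit 1 [+] $vMode [*] Read aWI ($vK)) [*] wit_exp))"
 assume S': "frame (For vK vNG ?c) S1 S'" "(?inv (3 + ?h * ?g + ?g * ?h))@@@S'"
 "clk S1 - (2 + real ?g * (2 + real ?h * 3 + 2)) <= clk S'"
 have "ctx@@S'"
 by (rule ctx_cong[OF S1(1)]) (insert S'(1), auto simp: frame_def w_For)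
 thus "?Q3 S'" using S' S1(3) unfolding clk by simp
 qed (insert S1(2), auto simp: w_For)
 show "sp (For vI vRN (For vK vNG (Write aX (Lit 3 [+] ($vI [*] $vNG [+] $vK)) wit_exp))) ?S
 (%S'. sp (For vK vNG (For vI vRN (Write aX (Lit 3 [+] $vRN [*] $vNG [+] ($vK [*] $vRN [+] $vI))
 ((Lit (Suc 0) [+] $vMode [*] Read aWI ($vK)) [*] wit_exp))) ;; MatMul) S' Q)"
 proof (rule sp_For_time[where n = ?h and I = "%i. ?inv (3 + i * ?g)" and t = "2 + real ?g * 3"])
 show "vl ?S vRN = ?h" using ctx0 by (simp add: ctx_def)
 show "?inv (3 + 0 * ?g) ((vl ?S)(vI := 0)) (ar ?S) (bad ?S)"
 using ctx by (auto simp: ctx_def L_def less_Suc_eq numeral_eq_Suc)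
 fix i and S' :: cst
 let ?c = "For vK vNG (Write aX (Lit 3 [+] ($vI [*] $vNG [+] $vK)) wit_exp)"
 assume S': "frame (For vI vRN ?c) ?S S'" "i < ?h" "vl S' vI = i" "(?inv (3 + i * ?g))@@@S'"
 have c': "ctx@@S'"
 by (rule ctx_cong[OF ctx0]) (insert S'(1), auto simp: frame_def w_For)
 show "sp ?c S' (%S''. ?inv (3 + Suc i * ?g) ((vl S'')(vI := Suc i)) (ar S'') (bad S'') & clk S' - (2 + real ?g * 3) <= clk S'')"
 proof (rule sp_For_time[where n = ?g and I = "%j. ?inv (3 + (i * ?g + j))" and t = 1])
 show "vl S' vNG = ?g" using c' by (simp add: ctx_def)
 fix j and S2 :: cst
 assume S2: "frame ?c S' S2" "j < ?g" "vl S2 vK = j" "(?inv (3 + (i * ?g + j)))@@@S2"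
 have c2: "ctx@@S2"
 by (rule ctx_cong[OF c']) (insert S2(1), auto simp: frame_def w_For)
 have vI: "vl S2 vI = i" using S2(1) S'(3) by (auto simp: frame_def w_For)
 have e: "ev w S2 wit_exp = of_bool (?wi i (ix ! j))"
 by (rule ev[OF c2 vI S2(3) S'(2) S2(2)])
 have pos: "ev w S2 (Lit 3 [+] ($vI [*] $vNG [+] $vK)) = 3 + (i * ?g + j)"
 using c2 vI S2(3) less1[OF S'(2) S2(2)] by (simp add: ctx_def)
 show "sp (Write aX (Lit 3 [+] ($vI [*] $vNG [+] $vK)) wit_exp) S2
 (%S''. ?inv (3 + (i * ?g + Suc j)) ((vl S'')(vK := Suc j)) (ar S'') (bad S'') & clk S2 - 1 <= clk S'')"
 by (rule sp_Write_eq[OF pos e]) (insert S2(4), simp add: less_Suc_eq LX[OF S'(2) S2(2)])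
 qed (insert S'(4), auto simp: add_ac)
 next
 fix S1 :: cst
 let ?c = "For vK vNG (Write aX (Lit 3 [+] ($vI [*] $vNG [+] $vK)) wit_exp)"
 assume S1: "frame (For vI vRN ?c) ?S S1" "(?inv (3 + ?h * ?g))@@@S1"
 "clk ?S - (2 + real ?h * (2 + real ?g * 3 + 2)) <= clk S1"
 have c1: "ctx@@S1"
 by (rule ctx_cong[OF ctx0]) (insert S1(1), auto simp: frame_def w_For)
 show "sp (For vK vNG (For vI vRN (Write aX (Lit 3 [+] $vRN [*] $vNG [+] ($vK [*] $vRN [+] $vI))
 ((Lit (Suc 0) [+] $vMode [*] Read aWI ($vK)) [*] wit_exp))) ;; MatMul) S1 Q"
 by (rule sp_Seq, rule sp_weak[OF second[OF c1 S1(2), unfolded One_nat_def]])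
 (use S1(3) final in auto)
 qed (auto simp: w_For)
 qed
qed

end

section \<open>Listing heavy pairs, forming hash groups and reading off witnesses\<close>

definition scan :: "nat => nat => nat => com" where
 "scan ba bb bc =
 Asg bc (Lit 0) ;;
 For vI vRN (For vI2 vRN
 (Cond (($vRR [<] Read aY ($vI [*] $vRN [+] $vI2)) [&] adj_exp (Read aRW ($vI)) (Read aRW ($vI2)))
 (Write ba ($bc) (Read aRW ($vI)) ;; Write bb ($bc) (Read aRW ($vI2)) ;; Asg bc ($bc [+] Lit 1))
 Skip))"

definition gather :: com where
 "gather =
 Asg vNG (Lit 0) ;;
 For vK vWN
 (Cond (Op Div (Read aHM ($vRep) [*] $vK) ($vQQ) [=] $vG)
 (Write aWI ($vNG) ($vK) ;; Asg vNG ($vNG [+] Lit 1)) Skip)"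

text \<open>An entry may also be a sum over several witnesses, or garbage after a failed
  multiplication. This is harmless: indices out of range are skipped and \<open>emit\<close> tests
  all six adjacencies.\<close>

definition report :: com where
 "report =
 For vI vRN (For vI2 vRN
 (Asg vS (Read aY ($vI [*] $vRN [+] $vI2)) ;;
 Cond ((Lit 0 [<] $vS) [&] ($vS [<] ($vWN [+] Lit 1)))
 (Asg vE1 (Read aRW ($vI)) ;; Asg vE2 (Read aRW ($vI2)) ;;
 Asg vE3 (Read aWC ($vS [-] Lit 1)) ;; Asg vE4 (Read aWD ($vS [-] Lit 1)) ;; emit)
 Skip))"

lemma written_scan: "wvars (scan ba bb bc) = {bc, vI, vI2}" "warrs (scan ba bb bc) = {ba, bb}"
 by (auto simp: scan_def w_For)

lemma written_gather: "wvars gather = {vNG, vK}" "warrs gather = {aWI}"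
 by (auto simp: gather_def w_For)

lemma written_report:
 "wvars report = {vI, vI2, vS, vE1, vE2, vE3, vE4, vFlag, vCnt, vKey, vP}"
 "warrs report = {aOut, aDict, aKey, aSort}"
 by (auto simp: report_def w_For written_emit)

definition pairs_at :: "(nat => nat) => (nat => nat => nat) => nat => nat => nat => (nat \<times> nat) list => bool" where
 "pairs_at V A ba bb bc ps <-> V bc = length ps & stores (A ba) (map fst ps) & stores (A bb) (map snd ps)"

lemma stores_append: "stores (f(length xs := x)) (xs @ [x])" if "stores f xs"
 using that by (auto simp: stores_def nth_append)

lemma pairs_at_snoc:
 assumes "pairs_at V A ba bb bc ps" "ba ~= bb"
 shows "pairs_at (V(bc := length ps + 1)) (A(ba := (A ba)(length ps := a), bb := (A bb)(length ps := b))) ba bb bc (ps @ [(a, b)])"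
 using assms stores_append[of "A ba" "map fst ps" ] stores_append[of "A bb" "map snd ps" ] by (simp add: pairs_at_def)

lemma pairs_at_cong:
 "V' bc = V bc ==> A' ba = A ba ==> A' bb = A bb ==> pairs_at V' A' ba bb bc ps <-> pairs_at V A ba bb bc ps"
 by (simp only: pairs_at_def)

lemma pairs_at_upd [simp]:
 "x ~= bc ==> pairs_at (V(x := v)) A ba bb bc ps <-> pairs_at V A ba bb bc ps"
 "a ~= ba ==> a ~= bb ==> pairs_at V (A(a := f)) ba bb bc ps <-> pairs_at V A ba bb bc ps"
 by (rule pairs_at_cong; simp)+

context lister
begin

definition flagged :: "(nat => nat) => nat => bool" where
 "flagged V k <-> V vFlag = 1 & V vCnt = tt & tt < card (cl k)"

text \<open>\<open>R\<close> collects the sets that the finished part of a search is responsible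
  for. It may contain sets that are not cliques, whence the intersection with
  \<open>cl k\<close>.\<close>

definition progress :: "(nat => nat) => (nat => nat => nat) => nat => nat => nat set set => bool" where
 "progress V A k f R <-> (\<exists>F. found V A k F & (V vFlag = f & R Int cl k <= F | flagged V k))"

lemma progress_cong:
 "V' vCnt = V vCnt ==> V' vFlag = V vFlag ==> A' aOut = A aOut ==> A' aKey = A aKey ==> A' aDict = A aDict ==>
 progress V' A' k f R <-> progress V A k f R"
 by (simp only: progress_def flagged_def found_cong[of V' ])

lemma progress_upd [simp]:
 "x ~= vCnt ==> x ~= vFlag ==> progress (V(x := v)) A k f R <-> progress V A k f R"
 "a ~= aOut ==> a ~= aKey ==> a ~= aDict ==> progress V (A(a := g)) k f R <-> progress V A k f R"
 by (rule progress_cong; simp)+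

lemma progress_mono: "progress V A k f R ==> R' <= R ==> progress V A k f R'"
 unfolding progress_def by blast

lemma sp_emit_progress:
 assumes glob: "glob@@S" and prog: "progress@@S k f R" and jj: "vl S vJJ = 2 * k" "k <= m"
 and e: "vl S vE1 = a" "vl S vE2 = b" "vl S vE3 = c" "vl S vE4 = d" "a < n" "b < n" "c < n" "d < n"
 shows "sp emit S (%S'. progress@@S' k f (insert {a, b, c, d} R) & bad S' = bad S & clk S - 16 <= clk S')"
proof -
 obtain F where F: "found@@S k F" "vl S vFlag = f & R Int cl k <= F | flagged (vl S) k"
 using prog by (auto simp: progress_def)
 show ?thesis
 proof (rule sp_emit[OF glob F(1) jj e])
 fix S' :: cst and F'
 assume S': "found@@S' k F'" "F <= F'" "bad S' = bad S" "clk S - 16 <= clk S'"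
 "vl S' vFlag = vl S vFlag & ({a, b, c, d} : cl k --> {a, b, c, d} : F') \<or>
 vl S' vFlag = 1 & vl S' vCnt = tt & tt < card (cl k)"
 have "finite F'" using S'(1) finite_clique_set by (auto simp: found_def intro: finite_subset)
 hence "card F <= card F'" using S'(2) by (rule card_mono)
 hence cnt: "vl S vCnt <= vl S' vCnt" using found_card[OF F(1)] found_card[OF S'(1)] by simp
 have le: "vl S' vCnt <= tt" using S'(1) by (simp add: found_def)
 show "progress@@S' k f (insert {a, b, c, d} R) & bad S' = bad S & clk S - 16 <= clk S'"
 using S' cnt le F S' unfolding progress_def by (auto simp: flagged_def)
qed
qed

text \<open>The slack of 17 makes room for the literal constants of the program, such as those in
  the number \<open>16 * (r + 1)\<close> of buckets.\<close>

lemma UU_less: "x <= U ==> y <= U ==> x * y + U + 17 < 2 ^ w"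
proof -
 have "U * U + U + 17 <= U ^ 3"
 proof -
 have "U + 17 <= 2 * U" using U(1) by simp
 also have "... <= U * U" using U(1) by simp
 finally have "U * U + U + 17 <= 2 * (U * U)" by simp
 also have "... <= U * (U * U)" using U(1) by (intro mult_le_mono1) simp
 finally show ?thesis by (simp add: eval_nat_numeral)
 qed
 moreover have "U ^ 3 < 2 ^ w" using U_pow_less by simp
 moreover assume "x <= U" "y <= U"
 hence "x * y <= U * U" by (rule mult_le_mono)
 ultimately show ?thesis by linarith
qed

lemma search_D:
 assumes "search V A rs ws"
 shows "V vRN = length rs" "V vWN = length ws" "i < length rs ==> A aRW i = rs ! i" "i < length rs ==> rs ! i < n"
 "l < length ws ==> A aWC l = fst (ws ! l)" "l < length ws ==> A aWD l = snd (ws ! l)"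
 "l < length ws ==> fst (ws ! l) < n" "l < length ws ==> snd (ws ! l) < n" "length rs <= U" "length ws <= U"
proof -
 show "i < length rs ==> rs ! i < n" "l < length ws ==> fst (ws ! l) < n" "l < length ws ==> snd (ws ! l) < n"
 using assms nth_mem[] by (auto simp: search_def subset_eq mem_Times_iff)
qed (insert assms, auto simp: search_def stores_def)

lemma sp_gather:
 assumes ws: "vl S vWN = nw" "nw <= U" and q: "vl S vQQ = q" and g: "vl S vG = g" and a: "ar S aHM (vl S vRep) = a"
 and Q: "!!S'. stores (ar S' aWI) (filter (%l. hash w q a l = g) [0..<nw]) ==>
 vl S' vNG = length (filter (%l. hash w q a l = g) [0..<nw]) ==> bad S' = bad S ==>
 clk S - (3 + 5 * real nw) <= clk S' ==> Q S'"
 shows "sp gather S Q"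
 unfolding gather_def
proof (rule sp_Seq, rule sp_Asg_eq)
 let ?ix = "%i. filter (%l. hash w q a l = g) [0..<i]"
 let ?c = "Cond (Op Div (Read aHM ($vRep) [*] $vK) ($vQQ) [=] $vG)
 (Write aWI ($vNG) ($vK) ;; Asg vNG ($vNG [+] Lit 1)) Skip"
 let ?S = "(upd S vNG 0)"
 show "ev w S (Lit 0) = 0" by simp
 show "sp (For vK vWN ?c) ?S Q"
 proof (rule sp_For_time[where n = nw and t = 3 and I = "%i V A b. stores (A aWI) (?ix i) & V vNG = length (?ix i) & b = bad S"])
 fix i and S1 :: cst
 assume S1: "frame (For vK vWN ?c) ?S S1" "i < nw" "vl S1 vK = i"
 "stores (ar S1 aWI) (?ix i) & vl S1 vNG = length (?ix i) & bad S1 = bad S"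
 have same: "ar S1 aHM (vl S1 vRep) = a" "vl S1 vQQ = q" "vl S1 vG = g"
 using S1(1) q g a by (auto simp: frame_def w_For)
 have ev: "ev w S1 (Op Div (Read aHM ($vRep) [*] $vK) ($vQQ) [=] $vG) = of_bool (hash w q a i = g)"
 using same S1(3) by (simp add: hash_def)
 have "length (?ix i) <= i" using length_filter_le[of _ "[0..<i]"] by simp
 hence less: "length (?ix i) + 1 < 2 ^ w" using S1(2) ws(2) U_pow_less[of 1] by simp
show "sp ?c S1 (%S''. (stores (ar S'' aWI) (?ix (Suc i)) & ((vl S'')(vK := Suc i)) vNG = length (?ix (Suc i)) & bad S'' = bad S)
 & clk S1 - 3 <= clk S'')"
 proof (rule sp_Cond)
 assume "ev w S1 (Op Div (Read aHM ($vRep) [*] $vK) ($vQQ) [=] $vG) ~= 0"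
 hence h: "hash w q a i = g" unfolding ev by simp
 show "sp (Write aWI ($vNG) ($vK) ;; Asg vNG ($vNG [+] Lit 1)) (tick S1)
 (%S''. (stores (ar S'' aWI) (?ix (Suc i)) & ((vl S'')(vK := Suc i)) vNG = length (?ix (Suc i)) & bad S'' = bad S)
 & clk S1 - 3 <= clk S'')"
 by (rule sp_Seq, rule sp_Write_eq[where x = "length (?ix i)" and v = i], simp add: S1, simp add: S1,
 rule sp_Asg_eq[where v = "length (?ix i) + 1"])
 (use S1 h less stores_append[of "ar S1 aWI" "?ix i" ] in simp_all)
 next
 assume "ev w S1 (Op Div (Read aHM ($vRep) [*] $vK) ($vQQ) [=] $vG) = 0"
 hence h: "hash w q a i ~= g" unfolding ev by simp
 show "sp Skip (tick S1)
 (%S''. (stores (ar S'' aWI) (?ix (Suc i)) & ((vl S'')(vK := Suc i)) vNG = length (?ix (Suc i)) & bad S'' = bad S)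
 & clk S1 - 3 <= clk S'')"
 by (rule sp_Skip) (use S1(4) h in simp)
 qed
 next
 fix S' :: cst
 assume "stores (ar S' aWI) (?ix nw) & vl S' vNG = length (?ix nw) & bad S' = bad S"
 "clk ?S - (2 + real nw * (3 + 2)) <= clk S'"
 thus "Q S'" by (intro Q) auto
 qed (insert ws, auto simp: stores_def)
qed

end

context lister
begin

lemma sp_scan:
 assumes glob: "glob@@S" and jj: "vl S vJJ = 2 * k" "k <= m"
 and search: "search@@S rs ws" and r: "vl S vRR = r"
 and reg: "19 < ba" "19 < bb" "ba ~= bb" "39 < bc"
 defines "h == length rs"
 assumes Q: "!!S'. pairs_at@@S' ba bb bc
 (map (%q. (rs ! (q div h), rs ! (q mod h)))
 (filter (%q. (rs ! (q div h), rs ! (q mod h)) : adj k & r < ar S aY q) [0..<h * h])) ==>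
 bad S' = bad S ==> clk S - (3 + 4 * real h + 6 * real (h * h)) <= clk S' ==> Q S'"
 shows "sp (scan ba bb bc) S Q"
 unfolding scan_def
proof (rule sp_Seq, rule sp_Asg_eq)
 let ?P = "%q. (rs ! (q div h), rs ! (q mod h)) : adj k & r < ar S aY q"
 let ?f = "%q. (rs ! (q div h), rs ! (q mod h))"
 let ?sel = "%p. map ?f (filter ?P [0..<p])"
 let ?e = "($vRR [<] Read aY ($vI [*] $vRN [+] $vI2)) [&] adj_exp (Read aRW ($vI)) (Read aRW ($vI2))"
 let ?b = "Write ba ($bc) (Read aRW ($vI)) ;; Write bb ($bc) (Read aRW ($vI2)) ;; Asg bc ($bc [+] Lit 1)"
 let ?c = "Cond ?e ?b Skip"
 let ?S = "(upd S bc 0)"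
 let ?inv = "%p V A (b::bool). pairs_at V A ba bb bc (?sel p) & b = bad S"
 have hU: "h <= U" using search_D(9)[OF search] by (simp add: h_def)
 have neq: "bc ~= vI" "bc ~= vI2" "bc ~= vRN" "bc ~= vRR" "ba ~= aY" "bb ~= aY" using reg by auto
 have same: "glob@@S1" "vl S1 vJJ = 2 * k" "search@@S1 rs ws" "vl S1 vRR = r" "ar S1 aY = ar S aY"
 if "!!x. x ~: {bc, vI, vI2} ==> vl S1 x = vl S x" "!!a. a ~: {ba, bb} ==> ar S1 a = ar S a" for S1 :: cst
 proof -
 show "glob@@S1" using glob by (subst glob_cong[of _ "vl S" _ "ar S"]) (insert reg, auto simp: that)
 show "search@@S1 rs ws" using search by (subst search_cong[of _ "vl S" _ "ar S"]) (insert reg, auto simp: that)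
 show "vl S1 vJJ = 2 * k" "vl S1 vRR = r" "ar S1 aY = ar S aY" using jj r reg that by auto
 qed
 show "ev w S (Lit 0) = 0" by simp
 show "sp (For vI vRN (For vI2 vRN ?c)) ?S Q"
 proof (rule sp_For_time[where n = h and t = "2 + real h * 6" and I = "%i. ?inv (i * h)"])
 show "vl ?S vRN = h" using search_D(1)[OF search] neq by (simp add: h_def)
 fix i and S1 :: cst
 assume S1: "frame (For vI vRN (For vI2 vRN ?c)) ?S S1" "i < h" "vl S1 vI = i" "(?inv (i * h))@@@S1"
 have fr1: "x ~: {bc, vI, vI2} ==> vl S1 x = vl S x" "a ~: {ba, bb} ==> ar S1 a = ar S a" for x a
 using S1(1) by (auto simp: frame_def w_For)
 note same1 = same[OF fr1, simplified]
 show "sp (For vI2 vRN ?c) S1 (%S''. ?inv (Suc i * h) ((vl S'')(vI := Suc i)) (ar S'') (bad S'') & clk S1 - (2 + real h * 6) <= clk S'')"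
 proof (rule sp_For_time[where n = h and t = 4 and I = "%j. ?inv (i * h + j)"])
 show "vl S1 vRN = h" using search_D(1)[OF same1(3)] by (simp add: h_def)
 fix j and S2 :: cst
 assume S2: "frame (For vI2 vRN ?c) S1 S2" "j < h" "vl S2 vI2 = j" "(?inv (i * h + j))@@@S2"
 have fr2: "x ~: {bc, vI, vI2} ==> vl S2 x = vl S x" "a ~: {ba, bb} ==> ar S2 a = ar S a" for x a
 using S2(1) fr1 by (auto simp: frame_def w_For)
 note same2 = same[OF fr2, simplified]
 have vI: "vl S2 vI = i" using S2(1) S1(3) neq by (auto simp: frame_def w_For)
 let ?p = "i * h + j"
 have p: "?p div h = i" "?p mod h = j" "?p < h * h" using S2(2) S1(2) by (auto intro: madd_less)
 have pU: "?p < 2 ^ w" "i * h < 2 ^ w" using UU_less[OF hU hU] p(3) by linarith+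
 note D = search_D[OF same2(3)]
 have i: "ar S2 aRW i = rs ! i" "ar S2 aRW j = rs ! j" "rs ! i < n" "rs ! j < n"
 using D(3,4) S1(2) S2(2) by (simp_all add: h_def)
 have idx: "ev w S2 ($vI [*] $vRN [+] $vI2) = ?p" using vI S2(3) D(1) pU by (simp add: h_def)
 have adj: "ev w S2 (adj_exp (Read aRW ($vI)) (Read aRW ($vI2))) = of_bool ((rs ! i, rs ! j) : adj k)"
 using eval_adj_exp[OF same2(1,2) jj(2), of "Read aRW ($vI)" "Read aRW ($vI2)"] vI S2(3) i by simp
 have ev: "ev w S2 ?e = of_bool (?P ?p)"
 unfolding eval.simps(3)[of _ _ _ And] adj eval.simps(3)[of _ _ _ Less] eval.simps(4)[of _ _ _ ] idx
 using same2(4,5) p by (auto simp: )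
 have "length (?sel ?p) <= ?p" using length_filter_le[of ?P "[0..<?p]"] by simp
 hence less: "length (?sel ?p) + 1 < 2 ^ w" using UU_less[OF hU hU] p(3) by linarith
 have bc: "vl S2 bc = length (?sel ?p)" using S2(4) by (simp add: pairs_at_def)
 show "sp ?c S2 (%S''. ?inv (i * h + Suc j) ((vl S'')(vI2 := Suc j)) (ar S'') (bad S'') & clk S2 - 4 <= clk S'')"
 proof (rule sp_Cond)
 assume "ev w S2 ?e ~= 0"
 hence h: "?P ?p" unfolding ev by simp
 hence sel: "?sel (i * h + Suc j) = ?sel ?p @ [(rs ! i, rs ! j)]" using p by simp
 show "sp ?b (tick S2) (%S''. ?inv (i * h + Suc j) ((vl S'')(vI2 := Suc j)) (ar S'') (bad S'') & clk S2 - 4 <= clk S'')"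
 unfolding sel
 apply (rule sp_Seq, rule sp_Write_eq[where x = "length (?sel ?p)" and v = "rs ! i"])
 apply (simp add: bc)
 apply (simp add: vI i)
 apply (rule sp_Seq, rule sp_Write_eq[where x = "length (?sel ?p)" and v = "rs ! j"])
 apply (simp add: bc)
 apply (insert reg, simp add: S2(3) i)
 apply (rule sp_Asg_eq[where v = "length (?sel ?p) + 1"])
 subgoal using less by (simp add: bc)
 subgoal using pairs_at_snoc[OF conjunct1[OF S2(4)] , of "rs ! i" "rs ! j"] conjunct2[OF S2(4)] neq(1,2) reg(3)
 by (simp only: cst.simps fun_upd_apply if_True if_False pairs_at_upd simp_thms) simp
 done
 next
 assume "ev w S2 ?e = 0"
 hence h: "~?P ?p" unfolding ev by simp
 hence sel: "?sel (i * h + Suc j) = ?sel ?p" by simp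
 show "sp Skip (tick S2) (%S''. ?inv (i * h + Suc j) ((vl S'')(vI2 := Suc j)) (ar S'') (bad S'') & clk S2 - 4 <= clk S'')"
 unfolding sel by (rule sp_Skip) (insert S2(4) neq, simp del: upt_Suc)
 qed
 qed (insert S1(4) neq, simp_all add: add.commute del: upt_Suc)
 next
 fix S' :: cst
 assume "(?inv (h * h))@@@S'" "clk ?S - (2 + real h * (2 + real h * 6 + 2)) <= clk S'"
 thus "Q S'" by (intro Q) (auto simp: algebra_simps)
 qed (insert neq, simp_all add: w_For pairs_at_def stores_def)
qed

end

context lister
begin

definition reported :: "nat list => (nat \<times> nat) list => nat => nat => nat => nat set set" where
 "reported rs ws i j s = (if 0 < s & s <= length ws then {{rs ! i, rs ! j, fst (ws ! (s - 1)), snd (ws ! (s - 1))}} else {})"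

lemma sp_report:
 assumes glob: "glob@@S" and jj: "vl S vJJ = 2 * k" "k <= m"
 and search: "search@@S rs ws" and prog: "progress@@S k f R"
 defines "h == length rs"
 assumes Q: "!!S'. progress@@S' k f (R Un (\<Union>p<h * h. reported rs ws (p div h) (p mod h) (ar S aY p))) ==>
 bad S' = bad S ==> clk S - (2 + 4 * real h + 24 * real (h * h)) <= clk S' ==> Q S'"
 shows "sp report S Q"
 unfolding report_def
proof -
 let ?D = "%p. \<Union>q<p. reported rs ws (q div h) (q mod h) (ar S aY q)"
 let ?e = "(Lit 0 [<] $vS) [&] ($vS [<] ($vWN [+] Lit 1))"
 let ?b = "Asg vE1 (Read aRW ($vI)) ;; Asg vE2 (Read aRW ($vI2)) ;;
 Asg vE3 (Read aWC ($vS [-] Lit 1)) ;; Asg vE4 (Read aWD ($vS [-] Lit 1)) ;; emit"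
 let ?c = "Asg vS (Read aY ($vI [*] $vRN [+] $vI2)) ;; Cond ?e ?b Skip"
 let ?inv = "%p V A (b::bool). progress V A k f (R Un ?D p) & b = bad S"
 let ?W = "{vI, vI2, vS, vE1, vE2, vE3, vE4, vFlag, vCnt, vKey, vP}" let ?A = "{aOut, aDict, aKey, aSort}"
 have hU: "h <= U" using search_D(9)[OF search] by (simp add: h_def)
 have same: "glob@@S1" "vl S1 vJJ = 2 * k" "search@@S1 rs ws" "ar S1 aY = ar S aY"
 if "!!x. x ~: ?W ==> vl S1 x = vl S x" "!!a. a ~: ?A ==> ar S1 a = ar S a" for S1 :: cst
 proof -
 show "glob@@S1" using glob by (subst glob_cong[of _ "vl S" _ "ar S"]) (auto simp: that)
 show "search@@S1 rs ws" using search by (subst search_cong[of _ "vl S" _ "ar S"]) (auto simp: that)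
 show "vl S1 vJJ = 2 * k" "ar S1 aY = ar S aY" using jj that by auto
 qed
 show "sp (For vI vRN (For vI2 vRN ?c)) S Q"
 proof (rule sp_For_time[where n = h and t = "2 + real h * 24" and I = "%i. ?inv (i * h)"])
 show "vl S vRN = h" using search_D(1)[OF search] by (simp add: h_def)
 fix i and S1 :: cst
 assume S1: "frame (For vI vRN (For vI2 vRN ?c)) S S1" "i < h" "vl S1 vI = i" "(?inv (i * h))@@@S1"
 have fr1: "x ~: ?W ==> vl S1 x = vl S x" "a ~: ?A ==> ar S1 a = ar S a" for x a
 using S1(1) by (auto simp: frame_def w_For written_emit)
 note same1 = same[OF fr1, simplified]
 show "sp (For vI2 vRN ?c) S1 (%S''. ?inv (Suc i * h) ((vl S'')(vI := Suc i)) (ar S'') (bad S'') & clk S1 - (2 + real h * 24) <= clk S'')"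
 proof (rule sp_For_time[where n = h and t = 22 and I = "%j. ?inv (i * h + j)"])
 show "vl S1 vRN = h" using search_D(1)[OF same1(3)] by (simp add: h_def)
 fix j and S2 :: cst
 assume S2: "frame (For vI2 vRN ?c) S1 S2" "j < h" "vl S2 vI2 = j" "(?inv (i * h + j))@@@S2"
 have fr2: "x ~: ?W ==> vl S2 x = vl S x" "a ~: ?A ==> ar S2 a = ar S a" for x a
 using S2(1) fr1 by (auto simp: frame_def w_For written_emit)
 note same2 = same[OF fr2, simplified]
 have vI: "vl S2 vI = i" using S2(1) S1(3) by (auto simp: frame_def w_For written_emit)
 let ?p = "i * h + j"
 let ?s = "ar S aY ?p"
 have p: "?p div h = i" "?p mod h = j" "?p < h * h" using S2(2) S1(2) by (auto intro: madd_less)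
 have pU: "?p < 2 ^ w" "i * h < 2 ^ w" using UU_less[OF hU hU] p(3) by linarith+
 note D = search_D[OF same2(3)]
 have i: "ar S2 aRW i = rs ! i" "ar S2 aRW j = rs ! j" "rs ! i < n" "rs ! j < n"
 using D(3,4) S1(2) S2(2) by (simp_all add: h_def)
 have idx: "ev w S2 ($vI [*] $vRN [+] $vI2) = ?p" using vI S2(3) D(1) pU by (simp add: h_def)
 have s: "ev w S2 (Read aY ($vI [*] $vRN [+] $vI2)) = ?s"
 unfolding eval.simps(4) idx same2(4) ..
 let ?S3 = "(upd S2 vS ?s)"
 have WN: "length ws + 1 < 2 ^ w" using D(10) UU_less[OF hU hU] by linarith
 have ev: "ev w ?S3 ?e = of_bool (0 < ?s & ?s <= length ws)"
 using WN D(2) by (auto simp: )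
 have prog3: "progress@@S2 k f (R Un ?D ?p)" using S2(4) by simp
 have D_Suc: "?D (i * h + Suc j) = ?D ?p Un reported rs ws i j ?s" using p by (simp add: lessThan_Suc Un_commute)
 show "sp ?c S2 (%S''. ?inv (i * h + Suc j) ((vl S'')(vI2 := Suc j)) (ar S'') (bad S'') & clk S2 - 22 <= clk S'')"
 proof (rule sp_Seq, rule sp_Asg_eq[OF s], rule sp_Cond)
 assume "ev w ?S3 ?e ~= 0"
 hence h: "0 < ?s" "?s <= length ws" unfolding ev by auto
 let ?K = "{rs ! i, rs ! j, fst (ws ! (?s - 1)), snd (ws ! (?s - 1))}"
 have rep: "R Un ?D (i * h + Suc j) = insert ?K (R Un ?D ?p)" unfolding D_Suc using h by (simp add: reported_def)
 have l: "?s - 1 < length ws" using h by simp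
 have sub: "(2 ^ w + ?s - 1) mod 2 ^ w = ?s - 1"
 proof -
 have "2 ^ w + ?s - 1 = 2 ^ w + (?s - 1)" using h(1) by linarith
 moreover have "?s - 1 < 2 ^ w" using l WN by linarith
 ultimately show ?thesis by (simp only: mod_add_self1 mod_less)
 qed
 let ?V = "(vl S2)(vS := ?s, vE1 := rs ! i, vE2 := rs ! j, vE3 := fst (ws ! (?s - 1)), vE4 := snd (ws ! (?s - 1)))"
 have "sp emit (S2(|vl := ?V, clk := clk S2 - 6|)) (%S'. progress@@S' k f (insert ?K (R Un ?D ?p)) &
 bad S' = bad (S2(|vl := ?V, clk := clk S2 - 6|)) & clk (S2(|vl := ?V, clk := clk S2 - 6|)) - 16 <= clk S')"
 by (rule sp_emit_progress) (use same2(1,2) jj(2) prog3 i D(7,8)[OF l] in simp_all)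
 hence em: "sp emit (S2(|vl := ?V, clk := clk S2 - 6|))
 (%S''. ?inv (i * h + Suc j) ((vl S'')(vI2 := Suc j)) (ar S'') (bad S'') & clk S2 - 22 <= clk S'')"
 unfolding rep by (rule sp_weak) (use S2(4) in simp)
 show "sp ?b (tick ?S3) (%S''. ?inv (i * h + Suc j) ((vl S'')(vI2 := Suc j)) (ar S'') (bad S'') & clk S2 - 22 <= clk S'')"
 apply (rule sp_Seq, rule sp_Asg_eq[where v = "rs ! i"], simp add: vI i)
 apply (rule sp_Seq, rule sp_Asg_eq[where v = "rs ! j"], simp add: S2(3) i)
 apply (rule sp_Seq, rule sp_Asg_eq[where v = "fst (ws ! (?s - 1))"])
 subgoal using sub D(5)[OF l] by (simp del: add: )
 apply (rule sp_Seq, rule sp_Asg_eq[where v = "snd (ws ! (?s - 1))"])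
 subgoal using sub D(6)[OF l] by simp
 using em by simp
 next
 assume "ev w ?S3 ?e = 0"
 hence h: "~(0 < ?s & ?s <= length ws)" unfolding ev by simp
 have "reported rs ws i j ?s = {}" unfolding reported_def using h by (rule if_not_P)
 hence rep: "R Un ?D (i * h + Suc j) = R Un ?D ?p" unfolding D_Suc by simp
 show "sp Skip (tick ?S3) (%S''. ?inv (i * h + Suc j) ((vl S'')(vI2 := Suc j)) (ar S'') (bad S'') & clk S2 - 22 <= clk S'')"
 unfolding rep by (rule sp_Skip) (use S2(4) in simp)
 qed
 qed (insert S1(4), simp_all add: add.commute written_emit)
 next
 fix S' :: cst
 assume "(?inv (h * h))@@@S'" "clk S - (2 + real h * (2 + real h * 24 + 2)) <= clk S'"
 thus "Q S'" by (intro Q) (auto simp: algebra_simps)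
 qed (insert prog, simp_all add: w_For written_emit)
qed

end

section \<open>The search for witnesses of pairs of rows\<close>

definition hash_round :: com where
 "hash_round = gather ;; Cond ($vNG) (product ;; report) Skip"

text \<open>Multiplication instances have positive dimensions, so empty lists of rows or witnesses
  are handled apart. The heavy pairs are copied out first because the hashing rounds overwrite the
  counts.\<close>

definition search_all :: "nat => nat => nat => com" where
 "search_all ba bb bc =
 Cond (($vRN [=] Lit 0) [|] ($vWN [=] Lit 0)) (Asg bc (Lit 0))
 (Asg vNG ($vWN) ;; For vK vWN (Write aWI ($vK) ($vK)) ;; Asg vMode (Lit 0) ;; product ;; scan ba bb bc ;;
 Asg vMode (Lit 1) ;; Asg vGG (Lit 16 [*] ($vRR [+] Lit 1)) ;;
 Asg vQQ (Op Div (Lit 0 [-] Lit 1) ($vGG) [+] Lit 1) ;;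
 Draw aHM vR ;;
 For vRep vR (For vG vGG hash_round))"

lemma w_hash_round:
 "wvars hash_round = {vNG, vK, vI, vI2, vS, vE1, vE2, vE3, vE4, vFlag, vCnt, vKey, vP}"
 "warrs hash_round = {aWI, aX, aY, aOut, aDict, aKey, aSort}"
 by (auto simp: hash_round_def written_gather written_product written_report)

lemma w_search_all:
 "wvars (search_all ba bb bc) =
 {bc, vMode, vGG, vQQ, vRep, vG, vNG, vK, vI, vI2, vS, vE1, vE2, vE3, vE4, vFlag, vCnt, vKey, vP}"
 "warrs (search_all ba bb bc) = {ba, bb, aHM, aWI, aX, aY, aOut, aDict, aKey, aSort}"
 by (auto simp: search_all_def w_hash_round written_product written_scan w_For)

lemma grid_div_mod: "j < (h :: nat) ==> (i * h + j) div h = i" "j < h ==> (i * h + j) mod h = j"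
 by auto

text \<open>The groups of one hash function are disjoint. Hence the factors of all their products
  together are no larger than those of a single product with all witnesses.\<close>

lemma sum_length_filter_le: "(\<Sum>g<(G :: nat). length (filter (%l. f l = g) xs)) <= length xs"
proof (induction xs)
 case (Cons x xs)
 have "(\<Sum>g<G. length (filter (%l. f l = g) (x # xs))) =
 (\<Sum>g<G. of_bool (g = f x)) + (\<Sum>g<G. length (filter (%l. f l = g) xs))"
 unfolding sum.distrib[symmetric] by (intro sum.cong) (auto simp: )
 moreover have "card ({..<G} Int {g. g = f x}) <= card {f x}" by (rule card_mono) auto
 ultimately show ?case using Cons.IH by simp
qed simp

context lister
begin

definition common :: "nat => nat list => (nat \<times> nat) list => nat => nat => nat set" where
 "common k rs ws i j = {l. l < length ws & witness k (rs ! i) (ws ! l) & witness k (rs ! j) (ws ! l)}"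

text \<open>What \<open>report\<close> hands to \<open>emit\<close> after a correct weighted product
  for the bucket \<open>g\<close> of the multiplier \<open>a\<close>.\<close>

definition grp_rep :: "nat => nat list => (nat \<times> nat) list => nat => nat => nat => nat set set" where
 "grp_rep k rs ws q a g = (\<Union>p<length rs * length rs.
 reported rs ws (p div length rs) (p mod length rs)
 (\<Sum>l\<leftarrow>filter (%l. hash w q a l = g) [0..<length ws].
 of_bool (l : common k rs ws (p div length rs) (p mod length rs)) * (1 + l)))"

lemma sp_hash_round:
 assumes glob: "glob@@S" and jj: "vl S vJJ = 2 * k" "k <= m"
 and search: "search@@S rs ws" and prog: "progress@@S k f R"
 and q: "vl S vQQ = q" and g: "vl S vG = g" and a: "ar S aHM (vl S vRep) = a" and mode: "vl S vMode = 1"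
 and ne: "rs ~= []"
 shows "sp hash_round S (%S'. (bad S --> bad S') &
 progress@@S' k f (R Un (if bad S' then {} else grp_rep k rs ws q a g)) &
 clk S - (20 + 5 * real (length ws) + (mu + 32) * real (length rs * length rs) +
 ((6 + 2 * mu) * real (length rs) + 4) * real (length (filter (%l. hash w q a l = g) [0..<length ws]))) <= clk S')"
 (is "sp _ S ?Q")
 unfolding hash_round_def
proof (rule sp_Seq, rule sp_weak[OF sp_gather[OF _ _ q g a]])
 let ?h = "length rs" and ?nw = "length ws"
 let ?ix = "filter (%l. hash w q a l = g) [0..<length ws]"
 let ?P = "%S'. stores (ar S' aWI) ?ix & vl S' vNG = length ?ix & bad S' = bad S & clk S - (3 + 5 * real ?nw) <= clk S'"
 show "vl S vWN = ?nw" "?nw <= U" using search_D[OF search] by auto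
 show "stores (ar S' aWI) ?ix ==> vl S' vNG = length ?ix ==> bad S' = bad S ==> clk S - (3 + 5 * real ?nw) <= clk S' ==> ?P S'"
 for S' :: cst by blast
 fix S1 :: cst
 assume fr: "frame gather S S1" and S1: "?P S1"
 have V1: "x ~: {vNG, vK} ==> vl S1 x = vl S x" "a ~= aWI ==> ar S1 a = ar S a" for x a
 using fr by (auto simp: frame_def written_gather)
 have glob1: "glob@@S1" using glob by (subst glob_cong[of _ "vl S" _ "ar S"]) (auto simp: V1)
 have search1: "search@@S1 rs ws" using search by (subst search_cong[of _ "vl S" _ "ar S"]) (auto simp: V1)
 have prog1: "progress@@S1 k f R" using prog by (subst progress_cong[of _ "vl S" _ "ar S"]) (auto simp: V1)
 have jj1: "vl S1 vJJ = 2 * k" using jj by (simp add: V1)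
 have h1: "real ?h <= real (?h * ?h)" by (cases rs) simp_all
 have mu0: "0 <= mu" using mu by simp
 show "sp (Cond ($vNG) (product ;; report) Skip) S1 ?Q"
 proof (rule sp_Cond)
 assume "ev w S1 ($vNG) = 0"
 hence ix: "?ix = []" using S1 by simp
 have "grp_rep k rs ws q a g = {}" unfolding grp_rep_def ix by (simp add: reported_def)
 moreover have "0 <= (mu + 32) * real (?h * ?h)" using mu0 by simp
 ultimately show "sp Skip (tick S1) ?Q" using S1 prog1 by (intro sp_Skip) (simp add: ix)
 next
 assume "ev w S1 ($vNG) ~= 0"
 hence ix: "?ix ~= []" using S1 by auto
 let ?S = "tick S1"
 have ixU: "length ?ix <= U" using order_trans[OF length_filter_le[of _ "[0..<length ws]"]] search_D(10)[OF search] by simp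
 show "sp (product ;; report) ?S ?Q"
 proof (rule sp_Seq, rule sp_weak)
 let ?R = "%S'. (bad S1 --> bad S') &
 clk ?S - ((6 + 2 * mu) * real (?h * length ?ix) + mu * real (?h * ?h) + 4 * real ?h + 4 * real (length ?ix) + 7) <= clk S' &
 (\<forall>i j. ~bad S' --> i < ?h --> j < ?h --> ar S' aY (i * ?h + j) =
 (\<Sum>l\<leftarrow>?ix. of_bool (witness k (rs ! i) (ws ! l) & witness k (rs ! j) (ws ! l)) * (1 + 1 * l)))"
 show "sp product ?S ?R"
 by (rule sp_product[where S = ?S and k = k and rs = rs and ws = ws and ix = ?ix and d = 1])
 (insert glob1 jj1 jj(2) search1 S1 ix ne ixU mode, auto simp: V1)
 fix S2 :: cst
 assume fr2: "frame product ?S S2" and S2: "?R S2"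
 have V2: "x ~: {vI, vK} ==> vl S2 x = vl S1 x" "a ~: {aX, aY} ==> ar S2 a = ar S1 a" for x a
 using fr2 by (auto simp: frame_def written_product)
 have glob2: "glob@@S2" using glob1 by (subst glob_cong[of _ "vl S1" _ "ar S1"]) (auto simp: V2)
 have search2: "search@@S2 rs ws" using search1 by (subst search_cong[of _ "vl S1" _ "ar S1"]) (auto simp: V2)
 have prog2: "progress@@S2 k f R" using prog1 by (subst progress_cong[of _ "vl S1" _ "ar S1"]) (auto simp: V2)
 have jj2: "vl S2 vJJ = 2 * k" using jj1 by (simp add: V2)
 have Y: "ar S2 aY p = (\<Sum>l\<leftarrow>?ix. of_bool (l : common k rs ws (p div ?h) (p mod ?h)) * (1 + l))"
 if "~bad S2" "p < ?h * ?h" for p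
 proof -
 have p: "p div ?h < ?h" "p mod ?h < ?h" "(p div ?h) * ?h + p mod ?h = p"
 using that(2) ne by (auto simp: less_mult_imp_div_less)
 have "ar S2 aY p = (\<Sum>l\<leftarrow>?ix. of_bool (witness k (rs ! (p div ?h)) (ws ! l) & witness k (rs ! (p mod ?h)) (ws ! l)) * (1 + 1 * l))"
 using conjunct2[OF conjunct2[OF S2], rule_format, OF that(1) p(1,2)] unfolding p(3) .
 also have "... = (\<Sum>l\<leftarrow>?ix. of_bool (l : common k rs ws (p div ?h) (p mod ?h)) * (1 + l))"
 by (intro arg_cong[where f = sum_list] ) (auto simp: common_def)
 finally show ?thesis .
 qed
 show "sp report S2 ?Q"
 proof (rule sp_report[OF glob2 jj2 jj(2) search2 prog2])
 fix S' :: cst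
 assume S': "progress@@S' k f (R Un (\<Union>p<?h * ?h. reported rs ws (p div ?h) (p mod ?h) (ar S2 aY p)))"
 "bad S' = bad S2" "clk S2 - (2 + 4 * real ?h + 24 * real (?h * ?h)) <= clk S'"
 have "R Un (if bad S' then {} else grp_rep k rs ws q a g) \<subseteq>
 R Un (\<Union>p<?h * ?h. reported rs ws (p div ?h) (p mod ?h) (ar S2 aY p))"
 using Y S'(2) unfolding grp_rep_def by auto
 with S'(1) have "progress@@S' k f (R Un (if bad S' then {} else grp_rep k rs ws q a g))"
 by (rule progress_mono)
 moreover have "clk S - (20 + 5 * real ?nw + (mu + 32) * real (?h * ?h) + ((6 + 2 * mu) * real ?h + 4) * real (length ?ix)) <= clk S'"
 using S'(3) conjunct1[OF conjunct2[OF S2]] conjunct2[OF conjunct2[OF conjunct2[OF S1]]] h1           by (simp add: algebra_simps)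
 ultimately show "?Q S'" using S'(2) S2 S1 by auto
 qed
 qed
 qed
qed

lemma isolated_sum:
 assumes "distinct xs" "l : set xs" "l : S" "!!l'. l' : set xs ==> l' : S ==> l' = l"
 shows "(\<Sum>l\<leftarrow>xs. of_bool (l : S) * (1 + l)) = 1 + (l :: nat)"
proof -
 have "(\<Sum>l\<leftarrow>xs. of_bool (l : S) * (1 + l)) = (\<Sum>x\<in>set xs. of_bool (x : S) * (1 + x))"
 using assms(1) by (simp add: sum_list_distinct_conv_sum_set)
 also have "... = (\<Sum>x\<in>set xs. if x = l then 1 + l else 0)"
 proof (intro sum.cong refl)
 fix x assume "x : set xs"
 hence "x : S <-> x = l" using assms(3,4) by blast
 thus "of_bool (x : S) * (1 + x) = (if x = l then 1 + l else 0)" by simp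
 qed
 also have "... = 1 + l" using assms(2) by simp
 finally show ?thesis .
qed

text \<open>In the bucket of \<open>l\<close> no other common witness of the two rows is present, so
  the weighted sum has the single non-zero term \<open>1 + l\<close>.\<close>

lemma group_reported_isolated:
 assumes "i < length rs" "j < length rs" "l : common k rs ws i j"
 and iso: "!!l'. l' : common k rs ws i j ==> l' ~= l ==> hash w q a l' ~= hash w q a l"
 shows "{rs ! i, rs ! j, fst (ws ! l), snd (ws ! l)} : grp_rep k rs ws q a (hash w q a l)"
proof -
 let ?h = "length rs"
 let ?p = "i * ?h + j"
 have p: "?p < ?h * ?h" "?p div ?h = i" "?p mod ?h = j"
 using assms(1,2) by (auto intro: madd_less simp : grid_div_mod)
 have l: "l < length ws" using assms(3) by (simp add: common_def)
 have "(\<Sum>l'\<leftarrow>filter (%l'. hash w q a l' = hash w q a l) [0..<length ws]. of_bool (l' : common k rs ws i j) * (1 + l')) = 1 + l"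
 proof (rule isolated_sum)
 fix l' assume "l' : set (filter (%l'. hash w q a l' = hash w q a l) [0..<length ws])" "l' : common k rs ws i j"
 thus "l' = l" using iso[] by (metis (mono_tags, lifting) mem_Collect_eq set_filter)
 qed (use assms(3) l in simp_all)
 thus ?thesis unfolding grp_rep_def using p l by (intro UN_I[of ?p]) (auto simp: reported_def)
qed

end

context lister
begin

text \<open>The rows \<open>i\<close> and \<open>j\<close> need not be adjacent, nor even distinct;
  the members that fail to be cliques are dropped in \<open>progress\<close>.\<close>

definition light :: "nat => nat list => (nat \<times> nat) list => nat => nat set set" where
 "light k rs ws r = {{rs ! i, rs ! j, fst (ws ! l), snd (ws ! l)} | i j l. i < length rs & j < length rs &
 l : common k rs ws i j & card (common k rs ws i j) <= r}"

definition heavy_pairs :: "nat => nat list => (nat \<times> nat) list => nat => (nat \<times> nat) set" where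
 "heavy_pairs k rs ws r = {(rs ! i, rs ! j) | i j. i < length rs & j < length rs & (rs ! i, rs ! j) : adj k &
 r < card (common k rs ws i j)}"

definition bad_draw :: "nat => nat list => (nat \<times> nat) list => nat => nat => nat list => bool" where
 "bad_draw k rs ws r q xs <-> (\<exists>t\<in>{(i, j, l). i < length rs & j < length rs & l : common k rs ws i j & card (common k rs ws i j) <= r}.
 \<forall>a\<in>set xs. case t of (i, j, l) => \<exists>y\<in>common k rs ws i j. y ~= l & hash w q a y = hash w q a l)"

text \<open>There are at most \<open>U ^ 3\<close> triples of two rows and a witness. Each
  multiplier fails to isolate a given witness with probability at most one half, so a triple is
  missed by all \<open>rho\<close> of them with probability at most
  \<open>1 / 2 ^ rho\<close>.\<close>

lemma card_bad_draw:
 assumes r: "r <= U" and len: "length rs <= U" "length ws <= U" and q: "q = (2 ^ w - 1) div (16 * (r + 1)) + 1"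
 shows "real (card {xs. length xs = rho & set xs <= {..<2 ^ w} & bad_draw k rs ws r q xs}) <= ep * (2 ^ w) ^ rho"
proof -
 let ?T = "{(i, j, l). i < length rs & j < length rs & l : common k rs ws i j & card (common k rs ws i j) <= r}"
 have sub: "?T <= {..<length rs} \<times> {..<length rs} \<times> {..<length ws}" by (auto simp: common_def)
 hence fin: "finite ?T" by (rule finite_subset) auto
 have "card ?T <= card ({..<length rs} \<times> {..<length rs} \<times> {..<length ws})" by (rule card_mono[OF _ sub]) auto
 also have "... = length rs * (length rs * length ws)" by simp
 also have "... <= U * (U * U)" using len by (intro mult_le_mono)
 also have "... = U ^ 3" by (simp add: eval_nat_numeral)
 finally have T: "card ?T <= U ^ 3" .
 have "4 * (r * (U + 5)) <= 2 ^ w"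
 proof -
 have "4 * (r * (U + 5)) <= 4 * (U * (2 * U))" using r U(1) by (intro mult_le_mono) auto
 also have "... = 8 * (U * U)" by simp
 also have "... <= U * (U * U)" using U(1) by (intro mult_le_mono1) simp
 also have "... = U ^ 3" by (simp add: eval_nat_numeral)
 also have "... < 2 ^ w" by (rule U_pow_less) simp
 finally show ?thesis by simp
 qed
 note iso = card_not_isolated[OF _ _ _ q this]
 have "2 * card {a. a < 2 ^ w & (case t of (i, j, l) => \<exists>y\<in>common k rs ws i j. y ~= l & hash w q a y = hash w q a l)} <= 2 ^ w"
 if t: "t : ?T" for t
 proof -
 obtain i j l where t': "t = (i, j, l)" by (metis prod_cases3)
 have "common k rs ws i j <= {..U}" using len by (auto simp: common_def)
 thus ?thesis using t iso[of "common k rs ws i j" ] by (simp add: t')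
 qed
 from card_lists_all_bad[OF fin this, where R = rho]
 have "real (card {xs. length xs = rho & set xs <= {..<2 ^ w} & bad_draw k rs ws r q xs}) <=
 real (card ?T) * (real (2 ^ w) ^ rho / 2 ^ rho)"
 by (simp only: bad_draw_def)
 also have "... <= real (U ^ 3) * (real (2 ^ w) ^ rho / 2 ^ rho)"
 using T by (intro mult_right_mono) (auto del: )
 also have "... <= (ep * 2 ^ rho) * (real (2 ^ w) ^ rho / 2 ^ rho)"
 using rho by (intro mult_right_mono) auto
 finally show ?thesis by simp
qed

lemma light_reported:
 assumes "~bad_draw k rs ws r q xs" "q = (2 ^ w - 1) div (16 * (r + 1)) + 1"
 shows "light k rs ws r <= (\<Union>i<length xs. \<Union>g<16 * (r + 1). grp_rep k rs ws q (xs ! i) g)"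
proof
 fix K assume "K : light k rs ws r"
 then obtain i j l where K: "K = {rs ! i, rs ! j, fst (ws ! l), snd (ws ! l)}" and ijl: "i < length rs" "j < length rs"
 "l : common k rs ws i j" "card (common k rs ws i j) <= r"
 by (auto simp: light_def)
 then obtain a where a: "a : set xs" "!!y. y : common k rs ws i j ==> y ~= l ==> hash w q a y ~= hash w q a l"
 using assms(1) by (fastforce simp: bad_draw_def)
 obtain e where e: "e < length xs" "xs ! e = a" using a(1) by (metis in_set_conv_nth)
 have "K : grp_rep k rs ws q a (hash w q a l)"
 unfolding K using ijl(1-3) a(2) by (rule group_reported_isolated)
 moreover have "hash w q a l < 16 * (r + 1)" by (rule hash_less) (use assms(2) in simp_all)
 ultimately show "K : (\<Union>i<length xs. \<Union>g<16 * (r + 1). grp_rep k rs ws q (xs ! i) g)" using e by blast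
qed

lemma sp_rounds:
 assumes glob: "glob@@S" and jj: "vl S vJJ = 2 * k" "k <= m"
 and search: "search@@S rs ws" and prog: "progress@@S k f R"
 and v: "vl S vQQ = q" "vl S vGG = G" "vl S vMode = 1" "vl S vR = length xs"
 and xs: "!!i. i < length xs ==> ar S aHM i = xs ! i" and ne: "rs ~= []"
 defines "h == length rs"
 defines "T == 2 + real G * (22 + 5 * real (length ws) + (mu + 32) * real (h * h)) + ((6 + 2 * mu) * real h + 4) * real (length ws)"
 shows "sp (For vRep vR (For vG vGG hash_round)) S (%S'.
 progress@@S' k f (R Un (if bad S' then {} else \<Union>i<length xs. \<Union>g<G. grp_rep k rs ws q (xs ! i) g)) &
 clk S - (2 + real (length xs) * (T + 2)) <= clk S')"
proof -
 let ?D = "%i. \<Union>j<i. \<Union>g<G. grp_rep k rs ws q (xs ! j) g"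
 let ?inv = "%X V A b. progress V A k f (R Un (if b then {} else X))"
 let ?W = "{vRep, vG, vNG, vK, vI, vI2, vS, vE1, vE2, vE3, vE4, vFlag, vCnt, vKey, vP}"
 let ?A = "{aWI, aX, aY, aOut, aDict, aKey, aSort}"
 let ?c = "For vG vGG hash_round"
 let ?len = "%a g. length (filter (%l. hash w q a l = g) [0..<length ws])"
 let ?t = "%a g. 20 + 5 * real (length ws) + (mu + 32) * real (h * h) + ((6 + 2 * mu) * real h + 4) * real (?len a g)"
 have same: "glob@@S1" "vl S1 vJJ = 2 * k" "search@@S1 rs ws" "vl S1 vQQ = q" "vl S1 vGG = G"
 "vl S1 vMode = 1" "ar S1 aHM = ar S aHM"
 if "!!x. x ~: ?W ==> vl S1 x = vl S x" "!!a. a ~: ?A ==> ar S1 a = ar S a" for S1 :: cst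
 proof -
 show "glob@@S1" using glob by (subst glob_cong[of _ "vl S" _ "ar S"]) (auto simp: that)
 show "search@@S1 rs ws" using search by (subst search_cong[of _ "vl S" _ "ar S"]) (auto simp: that)
 qed (use jj v that in auto)
 have T: "2 + (\<Sum>g<G. ?t a g + 2) <= T" for a
 proof -
 have "(\<Sum>g<G. ?t a g + 2) = real G * (22 + 5 * real (length ws) + (mu + 32) * real (h * h)) +
 ((6 + 2 * mu) * real h + 4) * real (\<Sum>g<G. ?len a g)"
 by (simp add: sum.distrib sum_distrib_left algebra_simps)
 moreover have "((6 + 2 * mu) * real h + 4) * real (\<Sum>g<G. ?len a g) <= ((6 + 2 * mu) * real h + 4) * real (length ws)"
 using sum_length_filter_le[of "hash w q a" "[0..<length ws]" ] mu by (intro mult_left_mono) (simp_all del: of_nat_sum)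
 ultimately show ?thesis unfolding T_def by linarith
 qed
 show ?thesis
 proof (rule sp_For_time[where n = "length xs" and t = T and I = "%i. ?inv (?D i)"])
 fix i and S1 :: cst
 assume S1: "frame (For vRep vR ?c) S S1" "i < length xs" "vl S1 vRep = i" "(?inv (?D i))@@@S1"
 have fr1: "x ~: ?W ==> vl S1 x = vl S x" "a ~: ?A ==> ar S1 a = ar S a" for x a
 using S1(1) by (auto simp: frame_def w_For w_hash_round)
 note same1 = same[OF fr1, simplified]
 show "sp ?c S1 (%S''. ?inv (?D (Suc i)) ((vl S'')(vRep := Suc i)) (ar S'') (bad S'') & clk S1 - T <= clk S'')"
 proof (rule sp_For_sum[where n = G and t = "?t (xs ! i)" and
 I = "%g. ?inv (?D i Un (\<Union>g'<g. grp_rep k rs ws q (xs ! i) g'))"])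
 fix g and S2 :: cst
 let ?X = "%g. ?D i Un (\<Union>g'<g. grp_rep k rs ws q (xs ! i) g')"
 assume S2: "frame ?c S1 S2" "g < G" "vl S2 vG = g" "(?inv (?X g))@@@S2"
 have fr2: "x ~: ?W ==> vl S2 x = vl S x" "a ~: ?A ==> ar S2 a = ar S a" for x a
 using S2(1) fr1 by (auto simp: frame_def w_For w_hash_round)
 note same2 = same[OF fr2, simplified]
 have rep: "vl S2 vRep = i" using S2(1) S1(3) by (auto simp: frame_def w_For w_hash_round)
 have a: "ar S2 aHM (vl S2 vRep) = xs ! i" using rep same2(7) xs[OF S1(2)] by simp
 have mode: "vl S2 vMode = 1" using same2(6) by simp
 show "sp hash_round S2 (%S''. ?inv (?X (Suc g)) ((vl S'')(vG := Suc g)) (ar S'') (bad S'') & clk S2 - ?t (xs ! i) g <= clk S'')"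
 proof (rule sp_weak[OF sp_hash_round[OF same2(1,2) jj(2) same2(3) S2(4) same2(4) S2(3) a mode ne]])
 fix S' :: cst
 assume S': "(bad S2 --> bad S') & progress@@S' k f (R Un (if bad S2 then {} else ?X g) \<union>
 (if bad S' then {} else grp_rep k rs ws q (xs ! i) g)) &
 clk S2 - (20 + 5 * real (length ws) + (mu + 32) * real (length rs * length rs) +
 ((6 + 2 * mu) * real (length rs) + 4) * real (?len (xs ! i) g)) <= clk S'"
 have "(?inv (?X (Suc g)))@@@S'"
 using S' by (elim conjE) (erule progress_mono, auto simp: lessThan_Suc)
 thus "?inv (?X (Suc g)) ((vl S')(vG := Suc g)) (ar S') (bad S') & clk S2 - ?t (xs ! i) g <= clk S'"
 using S' by (simp add: h_def)
 qed
 next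
 fix S' :: cst
 assume "(?inv (?D i Un (\<Union>g'<G. grp_rep k rs ws q (xs ! i) g')))@@@S'"
 "clk S1 - (2 + (\<Sum>g<G. ?t (xs ! i) g + 2)) <= clk S'"
 thus "?inv (?D (Suc i)) ((vl S')(vRep := Suc i)) (ar S') (bad S') & clk S1 - T <= clk S'"
 using T[of "xs ! i"] by (auto simp: lessThan_Suc Un_commute)
 qed (insert same1(5) S1(4), auto simp: w_hash_round split: if_splits)
 qed (insert v prog, simp_all add: w_For w_hash_round)
qed

end

context lister
begin

lemma rho_pos: "1 <= real rho"
 using rho(2) by simp

text \<open>The cost of a search up to polylogarithmic factors, for \<open>h\<close> rows,
  \<open>v\<close> witnesses and the threshold \<open>r\<close>. The matrix factors have
  \<open>h * v\<close> entries altogether, and each of the order of \<open>r + 1\<close> groups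
  needs \<open>h * h\<close> entries of the product and a pass over the \<open>v\<close>
  witnesses.\<close>

definition swork :: "nat => nat => nat => nat" where
 "swork h v r = h * v + (r + 1) * (h * h + v)"

definition ka0 :: real where
 "ka0 = (real rho + 1) * (20 * mu + 2000)"

lemma kappa0_ge: "2000 <= ka0"
 using mu mult_mono[of 1 "real rho + 1" 2000 "20 * mu + 2000"] by (simp add: ka0_def)

lemma set_heavy_list:
 assumes Y: "!!p. p < length rs * length rs ==> Y p = card (common k rs ws (p div length rs) (p mod length rs))"
 defines "h == length rs"
 shows "set (map (%q. (rs ! (q div h), rs ! (q mod h)))
 (filter (%q. (rs ! (q div h), rs ! (q mod h)) : adj k & r < Y q) [0..<h * h])) = heavy_pairs k rs ws r" (is "?L = _")
proof (intro equalityI subsetI)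
 fix e assume "e : ?L"
 then obtain q where q: "q < h * h" "e = (rs ! (q div h), rs ! (q mod h))" "(rs ! (q div h), rs ! (q mod h)) : adj k" "r < Y q"
 by auto
 have "0 < h" using q(1) by (cases ) auto
 hence "q div h < h" "q mod h < h" using q(1) by (auto simp: less_mult_imp_div_less)
 moreover have "r < card (common k rs ws (q div h) (q mod h))" using q(1,4) Y[] unfolding h_def[] by simp
 ultimately show "e : heavy_pairs k rs ws r" using q(2,3) unfolding heavy_pairs_def h_def[] by blast
next
 fix e assume "e : heavy_pairs k rs ws r"
 then obtain i j where ij: "i < h" "j < h" "e = (rs ! i, rs ! j)" "(rs ! i, rs ! j) : adj k" "r < card (common k rs ws i j)"
 unfolding heavy_pairs_def h_def by blast
 have p: "i * h + j < h * h" "(i * h + j) div h = i" "(i * h + j) mod h = j"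
 using ij(1,2) by (rule madd_less, simp_all only: grid_div_mod)
 hence "r < Y (i * h + j)" using ij(5) Y[of "i * h + j"] unfolding h_def[] by simp
 thus "e : ?L" using p ij(3,4) by (auto intro!: image_eqI[where x = "i * h + j"])
qed

lemma heavy_list_sub:
 fixes rs :: "nat list" and E :: "(nat \<times> nat) set" and P :: "nat => bool"
 defines "h == length rs"
 defines "L == map (%q. (rs ! (q div h), rs ! (q mod h))) (filter (%q. (rs ! (q div h), rs ! (q mod h)) : E & P q) [0..<h * h])"
 shows "set L <= (set rs \<times> set rs) Int E" "distinct rs ==> distinct L"
proof -
 have *: "q div h < h" "q mod h < h" if "q < h * h" for q
 proof -
 have "0 < h" using that by (cases ) auto
 thus "q div h < h" "q mod h < h" using that by (auto simp: less_mult_imp_div_less)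
 qed
 thus "set L <= (set rs \<times> set rs) Int E" by (auto simp: L_def h_def)
 assume dist: "distinct rs"
 have "inj_on (%q. (rs ! (q div h), rs ! (q mod h))) {..<h * h}"
 proof (rule inj_onI)
 fix q q' assume q: "q : {..<h * h}" "q' : {..<h * h}" "(rs ! (q div h), rs ! (q mod h)) = (rs ! (q' div h), rs ! (q' mod h))"
 hence "q div h = q' div h" "q mod h = q' mod h"
 using *[] *[] nth_eq_iff_index_eq[OF dist] by (auto simp: h_def)
 thus "q = q'" by (metis div_mult_mod_eq)
 qed
 thus "distinct L" unfolding L_def by (auto simp: distinct_map intro: inj_on_subset)
qed

text \<open>The first properties of \<open>hl\<close> hold even after a failure, since the rest of
  the program must then still run on well-formed data within its time bound. Only completeness
  depends on \<open>bad\<close>.\<close>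

lemma sp_search_cliques:
 assumes glob: "glob@@S" and jj: "vl S vJJ = 2 * k" "k <= m"
 and search: "search@@S rs ws" and prog: "progress@@S k f R"
 and r: "vl S vRR = r" "r <= U" and R: "vl S vR = rho"
 and reg: "19 < ba" "19 < bb" "ba ~= bb" "39 < bc"
 shows "sp (search_all ba bb bc) S (%S'.
 (\<exists>hl. pairs_at@@S' ba bb bc hl & (distinct rs --> distinct hl) & set hl <= (set rs \<times> set rs) Int adj k &
 (~bad S' --> set hl = heavy_pairs k rs ws r)) &
 progress@@S' k f (R Un (if bad S' then {} else light k rs ws r)) &
 clk S - ka0 * (1 + real (swork (length rs) (length ws) r)) <= clk S')" (is "sp _ S ?Q")
 unfolding search_all_def
proof (rule sp_Cond)
 let ?h = "length rs" and ?nw = "length ws"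
 note D = search_D[OF search]
 have k0: "0 <= ka0 * real (swork ?h ?nw r)" using kappa0_ge by simp
 have cond: "ev w S (($vRN [=] Lit 0) [|] ($vWN [=] Lit 0)) = of_bool (rs = [] | ws = [])"
 using D(1,2) by (simp add: )
 { assume "ev w S (($vRN [=] Lit 0) [|] ($vWN [=] Lit 0)) ~= 0"
 hence e: "heavy_pairs k rs ws r = {}" "light k rs ws r = {}"
 unfolding cond by (auto simp: heavy_pairs_def light_def common_def)
show "sp (Asg bc (Lit 0)) (tick S) ?Q"
 by (rule sp_Asg_eq[where v = 0])
 (use prog reg in \<open>auto simp: e pairs_at_def stores_def ring_distribs simp del: of_nat_add of_nat_mult intro!: exI[of _ "[]"] dest: order_trans\<close>, use k0 kappa0_ge in linarith) }
 assume "ev w S (($vRN [=] Lit 0) [|] ($vWN [=] Lit 0)) = 0"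
 hence ne: "rs ~= []" "ws ~= []" unfolding cond by auto
 let ?W = "{bc, vMode, vGG, vQQ, vRep, vG, vNG, vK, vI, vI2}" and ?A = "{ba, bb, aHM, aWI, aX, aY}"
 have same: "glob@@S1" "vl S1 vJJ = 2 * k" "search@@S1 rs ws" "progress@@S1 k f R"
 "vl S1 vRR = r" "vl S1 vR = rho"
 if "!!x. x ~: ?W ==> vl S1 x = vl S x" "!!a. a ~: ?A ==> ar S1 a = ar S a" for S1 :: cst
 proof -
 show "glob@@S1" using glob by (subst glob_cong[of _ "vl S" _ "ar S"]) (insert reg, auto simp: that)
 show "search@@S1 rs ws" using search by (subst search_cong[of _ "vl S" _ "ar S"]) (insert reg, auto simp: that)
 show "progress@@S1 k f R" using prog by (subst progress_cong[of _ "vl S" _ "ar S"]) (insert reg, auto simp: that)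
 qed (use jj r R reg that in auto)
 have neq: "bc ~: {vMode, vGG, vQQ, vRep, vG, vNG, vK, vI, vI2, vRR, vR, vWN, vRN, vJJ}" "ba ~: {aHM, aWI, aX, aY}" "bb ~: {aHM, aWI, aX, aY}"
 using reg by auto
 let ?S1 = "tick S(|vl := (vl (tick S))(vNG := ?nw), clk := clk (tick S) - 1|)"
 show "sp (Asg vNG ($vWN) ;; For vK vWN (Write aWI ($vK) ($vK)) ;; Asg vMode (Lit 0) ;; product ;; scan ba bb bc ;;
 Asg vMode (Lit 1) ;; Asg vGG (Lit 16 [*] ($vRR [+] Lit 1)) ;;
 Asg vQQ (Op Div (Lit 0 [-] Lit 1) ($vGG) [+] Lit 1) ;;
 Draw aHM vR ;;
 For vRep vR (For vG vGG hash_round)) (tick S) ?Q"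
 proof (rule sp_Seq, rule sp_Asg_eq[where v = ?nw], simp add: D(2), rule sp_Seq,
 rule sp_For_time[where n = ?nw and t = 1 and I = "%i V A b. stores (A aWI) [0..<i] & b = bad S"])
 show "vl ?S1 vWN = ?nw" using D(2) by simp
 fix i and S2 :: cst
 assume "vl S2 vK = i" "stores (ar S2 aWI) [0..<i] & bad S2 = bad S"
 thus "sp (Write aWI ($vK) ($vK)) S2 (%S''. (stores (ar S'' aWI) [0..<Suc i] & bad S'' = bad S) & clk S2 - 1 <= clk S'')"
 using stores_append[of "ar S2 aWI" "[0..<i]" ] by (intro sp_Write_eq[where x = i and v = i]) auto
 next
 fix S2 :: cst
 assume fr2: "frame (For vK vWN (Write aWI ($vK) ($vK))) ?S1 S2" and S2: "stores (ar S2 aWI) [0..<?nw] & bad S2 = bad S"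
 "clk ?S1 - (2 + real ?nw * (1 + 2)) <= clk S2"
 have V2: "x ~: ?W ==> vl S2 x = vl S x" "a ~: ?A ==> ar S2 a = ar S a" for x a
 using fr2 by (auto simp: frame_def w_For)
 have NG2: "vl S2 vNG = ?nw" using fr2 by (auto simp: frame_def w_For)
 let ?S3 = "(upd S2 vMode 0)"
 have V3: "x ~: ?W ==> vl ?S3 x = vl S x" "a ~: ?A ==> ar ?S3 a = ar S a" for x a using V2 by auto
 note same3 = same[of ?S3, OF V3]
 let ?R4 = "%S'. (bad S2 --> bad S') &
 clk ?S3 - ((6 + 2 * mu) * real (?h * length [0..<?nw]) + mu * real (?h * ?h) + 4 * real ?h + 4 * real (length [0..<?nw]) + 7) <= clk S' &
 (\<forall>i j. ~bad S' --> i < ?h --> j < ?h --> ar S' aY (i * ?h + j) =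
 (\<Sum>l\<leftarrow>[0..<?nw]. of_bool (witness k (rs ! i) (ws ! l) & witness k (rs ! j) (ws ! l)) * (1 + 0 * l)))"
 show "sp (Asg vMode (Lit 0) ;; product ;; scan ba bb bc ;;
 Asg vMode (Lit 1) ;; Asg vGG (Lit 16 [*] ($vRR [+] Lit 1)) ;;
 Asg vQQ (Op Div (Lit 0 [-] Lit 1) ($vGG) [+] Lit 1) ;;
 Draw aHM vR ;; For vRep vR (For vG vGG hash_round)) S2 ?Q"
 proof (rule sp_Seq, rule sp_Asg_eq[where v = 0], simp, rule sp_Seq, rule sp_weak)
 show "sp product ?S3 ?R4"
 by (rule sp_product[where S = ?S3 and k = k and rs = rs and ws = ws and ix = "[0..<?nw]" and d = 0])
 (use same3(1-3) jj(2) S2 ne NG2 D(10) in auto)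
 fix S4 :: cst
 assume fr4: "frame product ?S3 S4" and S4: "?R4 S4"
 have V4: "x ~: ?W ==> vl S4 x = vl S x" "a ~: ?A ==> ar S4 a = ar S a" for x a
 using fr4 V3 by (auto simp: frame_def written_product)
 note same4 = same[of S4, OF V4]
 have Y: "ar S4 aY p = card (common k rs ws (p div ?h) (p mod ?h))" if "~bad S4" "p < ?h * ?h" for p
 proof -
 have p: "p div ?h < ?h" "p mod ?h < ?h" "(p div ?h) * ?h + p mod ?h = p"
 using that(2) ne by (auto simp: less_mult_imp_div_less)
 have "ar S4 aY p = (\<Sum>l\<leftarrow>[0..<?nw]. of_bool (witness k (rs ! (p div ?h)) (ws ! l) & witness k (rs ! (p mod ?h)) (ws ! l)) * (1 + 0 * l))"
 using conjunct2[OF conjunct2[OF S4], rule_format, OF that(1) p(1,2)] unfolding p(3) .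
 also have "... = (\<Sum>l<?nw. of_bool (witness k (rs ! (p div ?h)) (ws ! l) & witness k (rs ! (p mod ?h)) (ws ! l)))"
 by (simp add: sum_list_distinct_conv_sum_set atLeast0LessThan)
 also have "... = card (common k rs ws (p div ?h) (p mod ?h))"
 by (subst sum_of_bool_eq) (auto simp: common_def intro!: arg_cong[where f = card])
 finally show ?thesis .
 qed
 show "sp (scan ba bb bc ;; Asg vMode (Lit 1) ;; Asg vGG (Lit 16 [*] ($vRR [+] Lit 1)) ;;
 Asg vQQ (Op Div (Lit 0 [-] Lit 1) ($vGG) [+] Lit 1) ;; Draw aHM vR ;; For vRep vR (For vG vGG hash_round)) S4 ?Q"
 proof (rule sp_Seq, rule sp_weak)
 define hl where "hl = map (%q. (rs ! (q div ?h), rs ! (q mod ?h)))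
 (filter (%q. (rs ! (q div ?h), rs ! (q mod ?h)) : adj k & r < ar S4 aY q) [0..<?h * ?h])"
 let ?R5 = "%S'. pairs_at@@S' ba bb bc hl & bad S' = bad S4 & clk S4 - (3 + 4 * real ?h + 6 * real (?h * ?h)) <= clk S'"
 have hl1: "set hl <= (set rs \<times> set rs) Int adj k" "distinct rs ==> distinct hl"
 unfolding hl_def by (rule heavy_list_sub)+
 have hl2: "set hl = heavy_pairs k rs ws r" if "~bad S4"
 unfolding hl_def by (rule set_heavy_list) (use Y[OF that] in simp)
 show "sp (scan ba bb bc) S4 ?R5"
 unfolding hl_def by (rule sp_scan[OF same4(1,2) jj(2) same4(3,5) reg]) (assumption | intro conjI)+
 fix S5 :: cst
 assume fr5: "frame (scan ba bb bc) S4 S5" and S5: "?R5 S5"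
 have V5: "x ~: ?W ==> vl S5 x = vl S x" "a ~: ?A ==> ar S5 a = ar S a" for x a
 using fr5 V4 by (auto simp: frame_def written_scan)
 let ?G = "16 * (r + 1)" let ?q = "(2 ^ w - 1) div ?G + 1"
 have G: "?G < 2 ^ w" "r + 1 < 2 ^ w" using UU_less[of 16 r] U(1) r(2) by simp_all
 have q: "?q < 2 ^ w"
 proof -
 have "(2 ^ w - 1) div ?G <= (2 ^ w - 1) div (2 :: nat)" by (intro div_le_mono2) auto
 moreover have "(2 ^ w - 1) div (2 :: nat) + 1 < 2 ^ w" using small_less[of 3] by linarith
 ultimately show ?thesis by linarith
 qed
 let ?V = "(vl S5)(vMode := 1, vGG := ?G, vQQ := ?q)"
 let ?S6 = "S5(|vl := ?V, clk := clk S5 - 3|)"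
 have V6: "x ~: ?W ==> ?V x = vl S x" for x using V5 by auto
 have bound: "card {xs. length xs = rho & set xs <= {..<2 ^ w} & bad_draw k rs ws r ?q xs} <= ep * (2 ^ w) ^ rho"
 by (rule card_bad_draw[OF r(2) D(9,10) refl])
 have last: "sp (Draw aHM vR ;; For vRep vR (For vG vGG hash_round)) ?S6 ?Q"
 proof (rule sp_Seq, rule sp_Draw[where n = rho and B = "bad_draw k rs ws r ?q"])
 show "vl ?S6 vR = rho" using R V6[] reg by auto
 show "card {xs. length xs = rho & set xs <= {..<2 ^ w} & bad_draw k rs ws r ?q xs} <= ep * (2 ^ w) ^ rho" by (rule bound)
 fix xs :: "nat list" assume xs: "length xs = rho"
 let ?S7 = "?S6(|ar := (ar ?S6)(aHM := (%i. if i < rho then xs ! i else ar ?S6 aHM i)),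
 bad := bad ?S6 | bad_draw k rs ws r ?q xs, clk := clk ?S6 - real (rho + 1)|)"
 have V7: "x ~: ?W ==> vl ?S7 x = vl S x" "a ~: ?A ==> ar ?S7 a = ar S a" for x a using V5 by auto
 note same7 = same[of ?S7, OF V7]
 let ?T = "2 + real ?G * (22 + 5 * real ?nw + (mu + 32) * real (?h * ?h)) + ((6 + 2 * mu) * real ?h + 4) * real ?nw"
 show "sp (For vRep vR (For vG vGG hash_round)) ?S7 ?Q"
 proof (rule sp_weak[OF sp_rounds[OF same7(1,2) jj(2) same7(3,4), where q = ?q and G = ?G and xs = xs]])
 fix S' :: cst
 assume fr': "frame (For vRep vR (For vG vGG hash_round)) ?S7 S'"
 and S': "progress@@S' k f (R Un (if bad S' then {} else \<Union>i<length xs. \<Union>g<?G. grp_rep k rs ws ?q (xs ! i) g)) &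
 clk ?S7 - (2 + real (length xs) * (?T + 2)) <= clk S'"
 have bad: "~bad_draw k rs ws r ?q xs & ~bad S4" if "~bad S'" using fr' S5 that by (auto simp: frame_def)
 have "pairs_at@@S' ba bb bc hl"
 using S5 by (subst pairs_at_cong[of _ bc "vl S5" _ ba "ar S5"]) (insert fr' reg, auto simp: frame_def w_For w_hash_round)
 moreover have "progress@@S' k f (R Un (if bad S' then {} else light k rs ws r))"
 proof (rule progress_mono[OF conjunct1[OF S']])
 show "R Un (if bad S' then {} else light k rs ws r) \<subseteq>
 R Un (if bad S' then {} else \<Union>i<length xs. \<Union>g<?G. grp_rep k rs ws ?q (xs ! i) g)"
 using light_reported[OF _ , of k rs ws ] bad by (cases "bad S'") auto
 qed
 moreover have "clk S - ka0 * (1 + real (swork ?h ?nw r)) <= clk S'"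
 proof -
 have E: "real (swork ?h ?nw r) = real (?h * ?nw) + (real r + 1) * (real (?h * ?h) + real ?nw)"
 by (simp add: swork_def algebra_simps)
 have "?T <= 2 + 16 * (real r + 1) * (22 + 5 * real ?nw + (mu + 32) * real (?h * ?h)) + ((6 + 2 * mu) * real ?h + 4) * real ?nw"
 by (simp add: add.commute)
 note cost = search_cost[OF _ _ rho_pos this, folded E]
 have ge1: "1 <= ?h" "1 <= ?nw" using ne by (simp_all add: Suc_le_eq)
 have "ka0 * real (swork ?h ?nw r) <= ka0 * (1 + real (swork ?h ?nw r))" using kappa0_ge by simp
 moreover have "clk S' \<ge> clk S - (24 + 3 * real ?nw + ((6 + 2 * mu) * real (?h * ?nw) + mu * real (?h * ?h) + 4 * real ?h + 4 * real ?nw) +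
 (4 * real ?h + 6 * real (?h * ?h)) + real rho + real rho * (?T + 2))"
 using conjunct2 S' xs S5 conjunct1 S4 length_upt diff_zero S2 by (auto)
moreover note cost[OF ge1, folded ka0_def]
 ultimately show ?thesis by argo
 qed
 ultimately show "?Q S'" using hl1 hl2 bad by blast
 qed (use ne neq xs R V6[] in auto)
 qed
 show "sp (Asg vMode (Lit 1) ;; Asg vGG (Lit 16 [*] ($vRR [+] Lit 1)) ;;
 Asg vQQ (Op Div (Lit 0 [-] Lit 1) ($vGG) [+] Lit 1) ;; Draw aHM vR ;; For vRep vR (For vG vGG hash_round)) S5 ?Q"
 apply (rule sp_Seq, rule sp_Asg_eq[where v = 1], simp)
 apply (rule sp_Seq, rule sp_Asg_eq[where v = "?G"])
 subgoal using V5(1)[] r(1) neq G by simp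
 apply (rule sp_Seq, rule sp_Asg_eq[where v = "?q"])
 subgoal using q by simp
 using last by simp
 qed
 qed
 qed (auto simp: stores_def)
qed

end

section \<open>Adjacency lists built from an edge list\<close>

abbreviation (input) "aBA g == 20 + 10 * g :: nat"
abbreviation (input) "aBB g == 21 + 10 * g :: nat"
abbreviation (input) "aDeg g == 22 + 10 * g :: nat"
abbreviation (input) "aNb g == 23 + 10 * g :: nat"
abbreviation (input) "aVl g == 24 + 10 * g :: nat"
abbreviation (input) "vBc g == 40 + 10 * g :: nat"
abbreviation (input) "vVc g == 41 + 10 * g :: nat"
abbreviation (input) "vLevel g == 42 + 10 * g :: nat"
abbreviation (input) "vPos g == 43 + 10 * g :: nat"
abbreviation (input) "vVert g == 44 + 10 * g :: nat"
abbreviation (input) "vDg g == 45 + 10 * g :: nat"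
abbreviation (input) "vIx g == 46 + 10 * g :: nat"
abbreviation (input) "vJx g == 47 + 10 * g :: nat"
abbreviation (input) "vNbI g == 48 + 10 * g :: nat"
abbreviation (input) "vNbJ g == 49 + 10 * g :: nat"

text \<open>\<open>remdups\<close> keeps last occurrences; with the two reversals the vertices come
  in the order of their first occurrence, in which \<open>build\<close> appends them.\<close>

definition firsts :: "(nat \<times> nat) list => nat list" where
 "firsts hl = rev (remdups (rev (map fst hl)))"

definition nbs :: "(nat \<times> nat) list => nat => nat list" where
 "nbs hl a = map snd (filter (%e. fst e = a) hl)"

lemma firsts_simps [simp]:
 "firsts [] = []"
 "firsts (hl @ [e]) = (if fst e : fst ` set hl then firsts hl else firsts hl @ [fst e])"
 by (auto simp: firsts_def)

lemma set_firsts [simp]: "set (firsts hl) = fst ` set hl" "distinct (firsts hl)"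
 by (auto simp: firsts_def)

lemma length_firsts: "length (firsts hl) <= length hl"
 using length_remdups_leq[of "rev (map fst hl)"] by (simp add: firsts_def)

lemma nbs_simps [simp]: "nbs [] a = []" "nbs (hl @ [e]) a = (if fst e = a then nbs hl a @ [snd e] else nbs hl a)"
 by (auto simp: nbs_def)

lemma set_nbs: "set (nbs hl a) = {b. (a, b) : set hl}"
 by (force simp: nbs_def)

lemma distinct_nbs: "distinct hl ==> distinct (nbs hl a)"
 by (auto simp: nbs_def distinct_map inj_on_def intro: )

lemma nbs_eq_Nil: "nbs hl a = [] <-> a ~: fst ` set hl"
 by (force simp: nbs_def filter_empty_conv)

text \<open>Degrees are reset only at vertices occurring in the list. The time is therefore linear
  in the number of edges and independent of \<open>n\<close>.\<close>

definition build :: "nat => com" where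
 "build g =
 For (vIx g) (vBc g) (Write (aDeg g) (Read (aBA g) ($(vIx g))) (Lit 0)) ;;
 Asg (vVc g) (Lit 0) ;;
 For (vIx g) (vBc g)
 (Asg (vVert g) (Read (aBA g) ($(vIx g))) ;;
 Asg (vDg g) (Read (aDeg g) ($(vVert g))) ;;
 Cond ($(vDg g)) Skip (Write (aVl g) ($(vVc g)) ($(vVert g)) ;; Asg (vVc g) ($(vVc g) [+] Lit 1)) ;;
 Write (aNb g) ($(vVert g) [*] $vN [+] $(vDg g)) (Read (aBB g) ($(vIx g))) ;;
 Write (aDeg g) ($(vVert g)) ($(vDg g) [+] Lit 1))"

lemma written_build: "wvars (build g) = {vIx g, vVc g, vVert g, vDg g}" "warrs (build g) = {aDeg g, aNb g, aVl g}"
 by (auto simp: build_def w_For)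

context lister
begin

definition built :: "nat => (nat => nat) => (nat => nat => nat) => (nat \<times> nat) list => bool" where
 "built g V A hl <-> V (vVc g) = length (firsts hl) & stores (A (aVl g)) (firsts hl) &
 (\<forall>a. A (aDeg g) a = length (nbs hl a) | a ~: fst ` set hl) &
 (\<forall>a i. i < length (nbs hl a) --> A (aNb g) (a * n + i) = nbs hl a ! i)"

lemma built_cong:
 "V' (vVc g) = V (vVc g) ==> A' (aVl g) = A (aVl g) ==> A' (aDeg g) = A (aDeg g) ==> A' (aNb g) = A (aNb g) ==>
 built g V' A' hl <-> built g V A hl"
 by (simp only: built_def)

lemma length_nbs:
 assumes "distinct hl" "set hl <= adj k"
 shows "length (nbs hl a) <= n" "b : set (nbs hl a) ==> b < n"
proof -
 have *: "set (nbs hl a) <= {..<n}" using assms(2) adj_less by (auto simp: set_nbs)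
 show "length (nbs hl a) <= n" using card_mono[OF _ *] distinct_card[OF distinct_nbs[OF assms(1), of ]] by simp
 show "b : set (nbs hl a) ==> b < n" using * by auto
qed

lemma length_sub_adj: "distinct hl ==> set hl <= adj k ==> length hl <= 2 * m"
proof -
 assume "distinct hl" "set hl <= adj k"
 hence "length hl <= card (set es)" using card_mono[of "set es" "set hl"] set_take_subset[of "2 * k" es]
 by (simp add: distinct_card)
 thus "length hl <= 2 * m" using es(1) card_length[of es] by simp
qed

definition building :: "nat => (nat \<times> nat) list => nat => (nat => nat) => (nat => nat => nat) => bool" where
 "building g hl i V A <-> V (vVc g) = length (firsts (take i hl)) & stores (A (aVl g)) (firsts (take i hl)) &
 (\<forall>a\<in>fst ` set hl. A (aDeg g) a = length (nbs (take i hl) a)) &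
 (\<forall>a i'. i' < length (nbs (take i hl) a) --> A (aNb g) (a * n + i') = nbs (take i hl) a ! i')"

lemma building_step:
 assumes b: "building g hl i V A" and i: "i < length hl" and hl: "distinct hl" "set hl <= adj k"
 defines "a == fst (hl ! i)"
 defines "d == A (aDeg g) a"
 shows "building g hl (Suc i)
 (if d = 0 then V(vVc g := V (vVc g) + 1) else V)
 ((if d = 0 then A(aVl g := (A (aVl g))(V (vVc g) := a)) else A)(aNb g := (A (aNb g))(a * n + d := snd (hl ! i)), aDeg g := (A (aDeg g))(a := d + 1)))"
 (is "building g hl (Suc i) ?V ?A") and "d < n" "a < n"
proof -
 let ?t = "take i hl"
 have t: "take (Suc i) hl = ?t @ [hl ! i]" using i by (rule take_Suc_conv_app_nth)
 have mem: "hl ! i : set hl" using i by simp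
 hence d: "d = length (nbs ?t a)" using b by (auto simp: a_def building_def d_def)
have "length (nbs (take (Suc i) hl) a) <= n"
 using hl set_take_subset[of "Suc i" hl] by (intro length_nbs(1)[of _ ]) auto
 thus dn: "d < n" by (simp add: t d a_def)
 have "(a, snd (hl ! i)) : adj k" using mem hl(2) by (auto simp: a_def)
 thus an: "a < n" using adj_less by blast
 have d0: "d = 0 <-> a ~: fst ` set ?t" using d nbs_eq_Nil[of ?t ] by simp
 have 1: "V (vVc g) = length (firsts ?t)" "stores (A (aVl g)) (firsts ?t)"
 "!!c. c : fst ` set hl ==> A (aDeg g) c = length (nbs ?t c)"
 "!!c i'. i' < length (nbs ?t c) ==> A (aNb g) (c * n + i') = nbs ?t c ! i'"
 using b unfolding building_def by blast+
 have lt: "length (nbs ?t c) <= n" for c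
 using hl set_take_subset[of i hl] by (intro length_nbs(1)[of _ ]) auto
 have "?A (aNb g) (c * n + i') = nbs (take (Suc i) hl) c ! i'" if i': "i' < length (nbs (take (Suc i) hl) c)" for c i'
 proof (cases "c = a & i' = d")
 case True
 thus ?thesis by (simp add: t a_def[] d)
 next
 case False
 have "c * n + i' ~= a * n + d"
 proof
 assume "c * n + i' = a * n + d"
 moreover have "i' < n" using i' lt[of c] False by (auto simp: t a_def[] d split: if_splits)
 ultimately show False using False dn mult_add_eq[of i' n d ] by auto
 qed
 thus ?thesis using 1(4)[] i' by (auto simp: t a_def[] d nth_append split: )
 qed
 moreover have "stores (?A (aVl g)) (firsts (take (Suc i) hl))" "?V (vVc g) = length (firsts (take (Suc i) hl))"
 using 1(1,2) d0 stores_append[OF 1(2), of ] by (auto simp: t a_def[])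
 moreover have "\<forall>c\<in>fst ` set hl. ?A (aDeg g) c = length (nbs (take (Suc i) hl) c)"
 using 1(3) by (auto simp: t a_def[] d)
 ultimately show "building g hl (Suc i) ?V ?A" unfolding building_def by blast
qed

lemma building_cong:
 "V' (vVc g) = V (vVc g) ==> A' (aVl g) = A (aVl g) ==> A' (aDeg g) = A (aDeg g) ==> A' (aNb g) = A (aNb g) ==>
 building g hl i V' A' <-> building g hl i V A"
 by (simp only: building_def)

lemma sp_build:
 assumes N: "vl S vN = n" and ps: "pairs_at@@S (aBA g) (aBB g) (vBc g) hl" and hl: "distinct hl" "set hl <= adj k"
 shows "sp (build g) S (%S'. (built g)@@S' hl & bad S' = bad S & clk S - (5 + 13 * real (length hl)) <= clk S')" (is "sp _ S ?Q")
 unfolding build_def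
proof (rule sp_Seq, rule sp_For_time[where n = "length hl" and t = 1 and
 I = "%i V A b. b = bad S & (\<forall>j<i. A (aDeg g) (fst (hl ! j)) = 0)"])
 have BC: "vl S (vBc g) = length hl" and BA: "i < length hl ==> ar S (aBA g) i = fst (hl ! i)"
 and BB: "i < length hl ==> ar S (aBB g) i = snd (hl ! i)" for i
 using ps by (auto simp: pairs_at_def stores_def)
 let ?c1 = "For (vIx g) (vBc g) (Write (aDeg g) (Read (aBA g) ($(vIx g))) (Lit 0))"
 show "vl S (vBc g) = length hl" by (rule BC)
 {
 fix i and S1 :: cst
 assume fr: "frame ?c1 S S1" and i: "i < length hl" "vl S1 (vIx g) = i"
 and I: "bad S1 = bad S & (\<forall>j<i. ar S1 (aDeg g) (fst (hl ! j)) = 0)"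
 have BA1: "ar S1 (aBA g) i = fst (hl ! i)" using fr BA i(1) by (simp add: frame_def w_For)
 show "sp (Write (aDeg g) (Read (aBA g) ($(vIx g))) (Lit 0)) S1
 (%S''. (bad S'' = bad S & (\<forall>j<Suc i. ar S'' (aDeg g) (fst (hl ! j)) = 0)) & clk S1 - 1 <= clk S'')"
 by (rule sp_Write_eq[where x = "fst (hl ! i)" and v = 0]) (insert i BA1 I, auto simp: less_Suc_eq)
 }
 fix S1 :: cst
 assume fr1: "frame ?c1 S S1" and I1: "bad S1 = bad S & (\<forall>j<length hl. ar S1 (aDeg g) (fst (hl ! j)) = 0)"
 and clk1: "clk S - (2 + real (length hl) * (1 + 2)) <= clk S1"
 let ?S2 = "(upd S1 (vVc g) 0)"
 let ?b = "Asg (vVert g) (Read (aBA g) ($(vIx g))) ;;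
 Asg (vDg g) (Read (aDeg g) ($(vVert g))) ;;
 Cond ($(vDg g)) Skip (Write (aVl g) ($(vVc g)) ($(vVert g)) ;; Asg (vVc g) ($(vVc g) [+] Lit 1)) ;;
 Write (aNb g) ($(vVert g) [*] $vN [+] $(vDg g)) (Read (aBB g) ($(vIx g))) ;;
 Write (aDeg g) ($(vVert g)) ($(vDg g) [+] Lit 1)"
 have same: "vl S3 (vBc g) = length hl" "i < length hl ==> ar S3 (aBA g) i = fst (hl ! i)"
 "i < length hl ==> ar S3 (aBB g) i = snd (hl ! i)" "vl S3 vN = n"
 if "frame (For (vIx g) (vBc g) ?b) ?S2 S3" for S3 :: cst and i
 using that fr1 BA[] BB[] BC N by (auto simp: frame_def w_For)
 show "sp (Asg (vVc g) (Lit 0) ;; For (vIx g) (vBc g) ?b) S1 ?Q"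
 proof (rule sp_Seq, rule sp_Asg_eq[where v = 0], simp, rule sp_For_time[where n = "length hl" and t = 8 and
 I = "%i V A b. b = bad S & building g hl i V A"])
 show "vl ?S2 (vBc g) = length hl" using fr1 BC by (simp add: frame_def w_For)
 show "bad ?S2 = bad S & building g hl 0 ((vl ?S2)(vIx g := 0)) (ar ?S2)"
 using I1 by (fastforce simp: building_def stores_def in_set_conv_nth)
 {
 fix i and S3 :: cst
 assume fr3: "frame (For (vIx g) (vBc g) ?b) ?S2 S3" and i: "i < length hl" "vl S3 (vIx g) = i" and
 I3: "bad S3 = bad S & (building g hl i)@@S3"
 note same3 = same[OF fr3]
 let ?a = "fst (hl ! i)" let ?d = "ar S3 (aDeg g) ?a"
 note step = building_step[OF conjunct2[OF I3] i(1) hl]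
 have an: "?a * n + ?d < n * n" using step(2,3) by (rule madd_less[rotated])
 have vc: "vl S3 (vVc g) = length (firsts (take i hl))" using I3 by (simp add: building_def)
 have vcU: "vl S3 (vVc g) + 1 < 2 ^ w"
 using length_firsts[of "take i hl"] length_sub_adj[OF hl] U(3) UU_less[of 0 0] vc by simp
let ?Q3 = "%S''. (bad S'' = bad S & building g hl (Suc i) ((vl S'')(vIx g := Suc i)) (ar S'')) & clk S3 - 8 <= clk S''"
 let ?V3 = "(vl S3)(vVert g := ?a, vDg g := ?d)"
 have fin: "sp (Write (aNb g) ($(vVert g) [*] $vN [+] $(vDg g)) (Read (aBB g) ($(vIx g))) ;;
 Write (aDeg g) ($(vVert g)) ($(vDg g) [+] Lit 1)) S5 ?Q3"
 if S5: "vl S5 = (if ?d = 0 then ?V3(vVc g := vl S3 (vVc g) + 1) else ?V3)"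
 "ar S5 = (if ?d = 0 then (ar S3)(aVl g := (ar S3 (aVl g))(vl S3 (vVc g) := ?a)) else ar S3)"
 "bad S5 = bad S" "clk S3 - 6 <= clk S5" for S5 :: cst
 proof (rule sp_Seq, rule sp_Write_eq[where x = "?a * n + ?d" and v = "snd (hl ! i)"])
 show "ev w S5 ($(vVert g) [*] $vN [+] $(vDg g)) = ?a * n + ?d"
 using an n_pow_less(1) same3(4) unfolding S5 by auto
 show "ev w S5 (Read (aBB g) ($(vIx g))) = snd (hl ! i)" using same3(3)[OF i(1)] i(2) unfolding S5 by auto
 show "sp (Write (aDeg g) ($(vVert g)) ($(vDg g) [+] Lit 1))
 (S5(|ar := (ar S5)(aNb g := (ar S5 (aNb g))(?a * n + ?d := snd (hl ! i))), clk := clk S5 - 1|)) ?Q3"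
 proof (rule sp_Write_eq[where x = "?a" and v = "?d + 1"])
 show "eval w (vl (S5(|ar := (ar S5)(aNb g := (ar S5 (aNb g))(?a * n + ?d := snd (hl ! i))), clk := clk S5 - 1|)))
 (ar (S5(|ar := (ar S5)(aNb g := (ar S5 (aNb g))(?a * n + ?d := snd (hl ! i))), clk := clk S5 - 1|))) ($(vDg g) [+] Lit 1) = ?d + 1"
 using step(2) U(2) UU_less[of 0 0] by (simp add: S5)
 let ?S6 = "S5(|ar := (ar S5)(aNb g := (ar S5 (aNb g))(?a * n + ?d := snd (hl ! i))), clk := clk S5 - 1|)"
 let ?S7 = "?S6(|ar := (ar ?S6)(aDeg g := (ar ?S6 (aDeg g))(?a := ?d + 1)), clk := clk ?S6 - 1|)"
 have "building g hl (Suc i) ((vl ?S7)(vIx g := Suc i)) (ar ?S7)"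
 by (rule iffD1[OF building_cong step(1)]) (simp_all add: S5(1,2))
 thus "?Q3 ?S7" using S5(3,4) by simp
 qed (use S5 in simp_all)
 qed
 show "sp ?b S3 ?Q3"
 proof (rule sp_Seq, rule sp_Asg_eq[where v = ?a])
 show "ev w S3 (Read (aBA g) ($(vIx g))) = ?a" using same3(2)[OF i(1)] i(2) by simp
 show "sp (Asg (vDg g) (Read (aDeg g) ($(vVert g))) ;;
 Cond ($(vDg g)) Skip (Write (aVl g) ($(vVc g)) ($(vVert g)) ;; Asg (vVc g) ($(vVc g) [+] Lit 1)) ;;
 Write (aNb g) ($(vVert g) [*] $vN [+] $(vDg g)) (Read (aBB g) ($(vIx g))) ;;
 Write (aDeg g) ($(vVert g)) ($(vDg g) [+] Lit 1)) ((upd S3 (vVert g) ?a)) ?Q3"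
 apply (rule sp_Seq, rule sp_Asg_eq[where v = ?d], simp, rule sp_Seq, rule sp_Cond)
 subgoal by (rule sp_Skip, rule fin) (use I3 in simp_all)
 subgoal
 apply (rule sp_Seq, rule sp_Write_eq[where x = "vl S3 (vVc g)" and v = ?a], simp, simp)
 apply (rule sp_Asg_eq[where v = "vl S3 (vVc g) + 1"])
 subgoal using vcU by simp
 by (rule fin) (use I3 in simp_all)
 done
 qed
 }
 fix S3 :: cst
 assume "bad S3 = bad S & (building g hl (length hl))@@S3" "clk ?S2 - (2 + real (length hl) * (8 + 2)) <= clk S3"
 thus "?Q S3" using clk1 by (auto simp: building_def built_def)
 qed (simp_all add: )
qed (simp_all)

end

section \<open>Charging work to a budget\<close>

text \<open>The charge precedes the work, so the amount charged never exceeds the budget, whatever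
  the random choices were.\<close>

definition charged :: "exp => com => com" where
 "charged e c = Cond ($vFlag) Skip
 (Cond ($vBud [<] ($vWk [+] e)) (Asg vFlag (Lit 1)) (Asg vWk ($vWk [+] e)) ;; Cond ($vFlag) Skip c)"

definition nb_pairs :: "nat => com => com" where
 "nb_pairs g c =
 Asg (vDg g) (Read (aDeg g) ($(vVert g))) ;;
 For (vIx g) (vDg g)
 (Asg (vNbI g) (Read (aNb g) ($(vVert g) [*] $vN [+] $(vIx g))) ;;
 For (vJx g) (vDg g)
 (Asg (vNbJ g) (Read (aNb g) ($(vVert g) [*] $vN [+] $(vJx g))) ;; c))"

lemma written_charged: "wvars (charged e c) = insert vFlag (insert vWk (wvars c))" "warrs (charged e c) = warrs c"
 by (auto simp: charged_def)

lemma written_nb_pairs: "wvars (nb_pairs g c) = {vDg g, vIx g, vNbI g, vJx g, vNbJ g} Un wvars c" "warrs (nb_pairs g c) = warrs c"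
 by (auto simp: nb_pairs_def w_For)

text \<open>\<open>B\<close> is the time aimed at, \<open>D\<close> separates low from high degrees,
  and \<open>LV\<close> levels suffice to halve \<open>2 * m\<close> down to 0. The assumptions
  \<open>balance\<close> are the inequalities between m, t, D and B on which all work bounds
  rest.\<close>

locale budget = lister +
 fixes tu B D LV Bud :: nat
 assumes tau: "tt <= tu" "1 <= tu" "24 * tu <= U" and BD: "1 <= B" "B <= U" "1 <= D" "D <= U"
 and LV: "2 * m < 2 ^ (LV - 1)" "1 <= LV" "LV <= U" and Bud: "Bud <= U ^ 6" "15000 * (LV * LV * B) <= Bud"
 and balance: "1 <= m" "m <= B" "tu <= B" "m * m <= D * B" "tu * m <= D * D * B" "m * D <= 2 * B"
 "D * D * m * tu * tu <= 4 * B * B * B"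
begin

definition env :: "(nat => nat) => (nat => nat => nat) => nat => bool" where
 "env V A k <-> glob V A & V vTau = tu & V vB = B & V vD = D & V vLV = LV & V vR = rho & V vBud = Bud & V vJJ = 2 * k & k <= m"

lemma env_D: "env V A k ==> glob V A" "env V A k ==> V vJJ = 2 * k" "env V A k ==> k <= m" "env V A k ==> V vN = n"
 "env V A k ==> V vLV = LV" "env V A k ==> V vBud = Bud" "env V A k ==> V vR = rho" "env V A k ==> V vTau = tu"
 "env V A k ==> V vB = B" "env V A k ==> V vD = D" "env V A k ==> V vM = m"
 by (auto simp: env_def glob_def)

text \<open>
 Here W is the work charged so far if all random choices are good; then the flag is raised only if there are too
 many cliques or W exceeds the budget.
\<close>

definition status :: "(nat => nat) => (nat => nat => nat) => bool => nat => nat => nat set set => bool" where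
 "status V A b k W R <-> (\<exists>F. found V A k F & V vWk <= Bud &
 (V vFlag ~= 0 --> b | tt < card (cl k) | Bud < W) & (V vFlag = 0 & ~b --> V vWk = W & R Int cl k <= F))"

lemma status_cong:
 "V' vCnt = V vCnt ==> V' vFlag = V vFlag ==> V' vWk = V vWk ==> A' aOut = A aOut ==> A' aKey = A aKey ==> A' aDict = A aDict ==>
 status V' A' b k W R <-> status V A b k W R"
 by (simp only: status_def found_cong[of V' ])

lemma status_upd [simp]:
 "x ~= vCnt ==> x ~= vFlag ==> x ~= vWk ==> status (V(x := v)) A b k W R <-> status V A b k W R"
 "a ~= aOut ==> a ~= aKey ==> a ~= aDict ==> status V (A(a := g)) b k W R <-> status V A b k W R"
 by (rule status_cong; simp)+

text \<open>With the flag raised, nothing is claimed about \<open>R\<close>, and \<open>W\<close>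
  occurs only as an amount exceeding the budget. So later work may be skipped.\<close>

lemma status_flag: "status V A b k W R ==> V vFlag ~= 0 ==> W <= W' ==> status V A b k W' R'"
 unfolding status_def by (meson order_less_le_trans)

lemma status_progress:
 assumes "status V A b k W R" "V vFlag = 0"
 shows "progress V A k 0 (if b then {} else R)"
 using assms unfolding status_def progress_def by (cases ) auto

lemma progress_status:
 assumes st: "status V A b k W R" and V: "V vFlag = 0" and b: "b ==> b'"
 and prog: "progress V' A' k 0 R'" and wk: "V' vWk = V vWk" and R': "~b' ==> R'' <= R'"
 shows "status V' A' b' k W R''"
proof -
 have 1: "V vWk <= Bud" "~b ==> V vWk = W" using st V unfolding status_def by blast+
 obtain F where F: "found V' A' k F" "V' vFlag = 0 & R' Int cl k <= F | flagged V' k"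
 using prog unfolding progress_def by blast
 from F(2) show ?thesis
 proof
 assume "V' vFlag = 0 & R' Int cl k <= F"
 moreover have "~b' ==> R'' Int cl k <= F" using calculation R' by blast
 ultimately show ?thesis using F(1) 1 b wk unfolding status_def by (intro exI[of _ ]) auto
 next
 assume "flagged V' k"
 thus ?thesis using F(1) 1 wk unfolding status_def flagged_def by (intro exI[of _ ]) auto
 qed
qed

text \<open>A search costs \<open>ka0 * (1 + swork)\<close>. The factor 2 leaves room for the
  additive term and for the passes that are linear in the edge list.\<close>

definition ka :: real where "ka = 2 * ka0"

lemma kappa_ge: "4000 <= ka"
 using kappa0_ge by (simp add: ka_def)

text \<open>Amortisation: a charge of \<open>x\<close> raises the potential by
  \<open>ka * x\<close>, and the work done afterwards consumes it. As the total charge is at most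
  the budget, a nearly constant potential bounds the time spent.\<close>

definition pot :: "cst => real" where "pot S = clk S + ka * real (vl S vWk)"

lemma pot_tick [simp]: "pot (tick S) = pot S - 1"
 by (simp add: pot_def)

lemma pot_upd [simp]: "x ~= vWk ==> pot (S(|vl := (vl S)(x := v), clk := c|)) = pot S + c - clk S"
 "pot (S(|ar := A, clk := c|)) = pot S + c - clk S"
 by (simp_all add: pot_def)

lemma sp_For_pot:
 assumes x: "x ~= y" "x ~: wvars c" "y ~: wvars c" "x ~= vWk" and n: "vl S y = l"
 and init: "I 0 ((vl S)(x := 0)) (ar S) (bad S)"
 and body: "!!i S'. wstate w S' ==> frame (For x y c) S S' ==> i < l ==> vl S' x = i ==> vl S' y = l ==>
 (I i)@@@S' ==>
 sp c S' (%S''. I (Suc i) ((vl S'')(x := Suc i)) (ar S'') (bad S'') & pot S' - t <= pot S'')"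
 and exit: "!!S'. wstate w S' ==> frame (For x y c) S S' ==> vl S' x = l ==> vl S' y = l ==>
 (I l)@@@S' ==> pot S - (2 + real l * (t + 2)) <= pot S' ==> Q S'"
 shows "sp (For x y c) S Q"
proof (rule sp_For[OF x(1-3) n, where I = "%i S'. (I i)@@@S' & pot S - (1 + real i * (t + 2)) <= pot S'"])
 have y: "vl S' y = l" if "frame (For x y c) S S'" for S' :: cst
 using that x n by (auto simp: frame_def w_For)
 have ws: "wstate w (tick S')" if "wstate w S'" for S' :: cst using that by (simp add: wstate_def)
 have fr: "frame (For x y c) S (tick S')" if "frame (For x y c) S S'" for S' :: cst
 using that by (simp add: frame_def)
 show "I 0 (vl ((upd S x 0))) (ar ((upd S x 0))) (bad ((upd S x 0))) &
 pot S - (1 + real 0 * (t + 2)) <= pot ((upd S x 0))"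
 using init x(4) by simp
 {
 fix i and S' :: cst
 assume S': "wstate w S'" "frame (For x y c) S S'" "i < l" "vl S' x = i" "(I i)@@@S' & pot S - (1 + real i * (t + 2)) <= pot S'"
 show "sp c (tick S') (%S''. I (Suc i) (vl ((upd S'' x (Suc i)))) (ar ((upd S'' x (Suc i)))) (bad ((upd S'' x (Suc i)))) &
 pot S - (1 + real (Suc i) * (t + 2)) <= pot ((upd S'' x (Suc i))))"
 by (rule sp_weak[OF body[where i = i]])
 (insert S' x(4) y ws fr, auto simp: algebra_simps)
 }
 fix S' :: cst
 assume S': "wstate w S'" "frame (For x y c) S S'" "vl S' x = l" "(I l)@@@S' & pot S - (1 + real l * (t + 2)) <= pot S'"
 show "Q (tick S')" by (rule exit) (use S' ws fr y in simp_all)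
qed

text \<open>\<open>x\<close> is the actual charge and \<open>y\<close> the charge of an ideal run;
  they have to agree only as long as nothing has failed.\<close>

lemma sp_charged:
 assumes st: "status@@@S k W R" and env: "env@@S k"
 and e: "!!S' :: cst. (!!x. x ~= vFlag ==> vl S' x = vl S x) ==> ar S' = ar S ==> ev w S' e = x" "x <= U ^ 6" "~bad S ==> x = y"
 and skip: "!!S'. vl S' vFlag ~= 0 ==> (!!x. x ~= vFlag ==> vl S' x = vl S x) ==> ar S' = ar S ==> bad S' = bad S ==>
 (!!W' R'. W + y <= W' ==> status@@@S' k W' R') ==> pot S - 5 <= pot S' ==> Q S'"
 and run: "!!S'. vl S' vFlag = 0 ==> (!!x. x ~= vWk ==> vl S' x = vl S x) ==> ar S' = ar S ==> bad S' = bad S ==>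
 status@@@S' k (W + y) R ==> pot S + ka * real x - 5 <= pot S' ==> sp c S' Q"
 shows "sp (charged e c) S Q"
 unfolding charged_def
proof (rule sp_Cond)
 assume f: "ev w S ($vFlag) ~= 0"
 show "sp Skip (tick S) Q"
 by (rule sp_Skip, rule skip) (insert f st, auto intro: status_flag)
next
 assume f: "ev w S ($vFlag) = 0"
 obtain F where F: "found@@S k F" "vl S vWk <= Bud" "~bad S ==> vl S vWk = W & R Int cl k <= F"
 using st f unfolding status_def by auto
 have "U ^ 6 + U ^ 6 <= U ^ Suc 6" by (rule poly_bounds(2)) auto
 hence less: "vl S vWk + x < 2 ^ w" using F(2) Bud(1) e(2) U_pow_less[of 7] by simp
 have ev: "ev w S e = x" by (rule e(1)) auto
 show "sp (Cond ($vBud [<] ($vWk [+] e)) (Asg vFlag (Lit 1)) (Asg vWk ($vWk [+] e)) ;; Cond ($vFlag) Skip c) (tick S) Q"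
 proof (rule sp_Seq, rule sp_Cond)
 assume "eval w (vl (tick S)) (ar (tick S)) ($vBud [<] ($vWk [+] e)) ~= 0"
 hence B: "Bud < vl S vWk + x" using ev less env_D(6)[OF env] by auto
 let ?S1 = "tick (tick S)(|vl := (vl (tick (tick S)))(vFlag := 1), clk := clk (tick (tick S)) - 1|)"
 have st': "status@@@?S1 k W' R'" if "W + y <= W'" for W' R'
 using F(1) F(2,3) B e(3) that unfolding status_def by (intro exI[of _ ]) auto
show "sp (Asg vFlag (Lit 1)) (tick (tick S)) (%S'. sp (Cond ($vFlag) Skip c) S' Q)"
 proof (rule sp_Asg_eq[where v = 1], simp, rule sp_Cond)
 show "sp Skip (tick ?S1) Q"
 by (rule sp_Skip, rule skip) (use st' in simp_all)
 qed simp
 next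
 assume "eval w (vl (tick S)) (ar (tick S)) ($vBud [<] ($vWk [+] e)) = 0"
 hence B: "vl S vWk + x <= Bud" using ev less env_D(6)[OF env] by auto
 let ?S1 = "tick (tick S)(|vl := (vl (tick (tick S)))(vWk := vl S vWk + x), clk := clk (tick (tick S)) - 1|)"
 have st': "status@@@?S1 k (W + y) R"
 using F(1) F(2,3) B e(3) f unfolding status_def by (intro exI[of _ ]) auto
show "sp (Asg vWk ($vWk [+] e)) (tick (tick S)) (%S'. sp (Cond ($vFlag) Skip c) S' Q)"
 proof (rule sp_Asg_eq[where v = "vl S vWk + x"], use ev less in simp, rule sp_Cond)
 show "sp c (tick ?S1) Q"
 by (rule run) (insert st' f, simp_all add: pot_def distrib_left)
 qed (use f in simp)
 qed
qed

lemma sp_nb_pairs: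
 assumes built: "(built g)@@S hl" and N: "vl S vN = n" and hl: "distinct hl" "set hl <= adj k" and v: "vl S (vVert g) = v" "v : fst ` set hl"
 and c: "wvars c Int {vN, vVert g, vDg g, vIx g, vNbI g, vJx g} = {}" "warrs c Int {aDeg g, aNb g} = {}"
 and I: "!!q V A b x u. x : {vDg g, vIx g, vNbI g, vJx g, vNbJ g} ==> I q V A b ==> I q (V(x := u)) A b"
 and init: "(I 0)@@@S"
 defines "d == length (nbs hl v)"
 assumes body: "!!S' q. q < d * d ==> vl S' (vNbI g) = nbs hl v ! (q div d) ==> vl S' (vNbJ g) = nbs hl v ! (q mod d) ==>
 (!!x. x ~: {vDg g, vIx g, vNbI g, vJx g, vNbJ g} Un wvars c ==> vl S' x = vl S x) ==>
 (!!a. a ~: warrs c ==> ar S' a = ar S a) ==> (I q)@@@S' ==>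
 sp c S' (%S''. (I (Suc q))@@@S'' & clk S' - t <= clk S'')"
 and exit: "!!S'. (I (d * d))@@@S' ==> clk S - (3 + 5 * real d + (t + 3) * real (d * d)) <= clk S' ==> Q S'"
 shows "sp (nb_pairs g c) S Q"
 unfolding nb_pairs_def
proof (rule sp_Seq, rule sp_Asg_eq[where v = d])
 let ?X = "{vDg g, vIx g, vNbI g, vJx g, vNbJ g} Un wvars c"
 have B: "ar S (aDeg g) v = d" "i < d ==> ar S (aNb g) (v * n + i) = nbs hl v ! i" for i
 using built v(2) unfolding built_def d_def by blast+
 show "ev w S (Read (aDeg g) ($(vVert g))) = d" using B v(1) by simp
 have dn: "d <= n" using length_nbs(1)[OF hl] by (simp add: d_def)
 have vn: "v < n" using v(2) hl(2) adj_less by fastforce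
 have ix: "v * n + i < 2 ^ w" "v * n < 2 ^ w" if "i < d" for i
 using madd_less[OF vn, of i n] that dn n_pow_less(1) by linarith+
 let ?b2 = "Asg (vNbJ g) (Read (aNb g) ($(vVert g) [*] $vN [+] $(vJx g))) ;; c"
 let ?b1 = "Asg (vNbI g) (Read (aNb g) ($(vVert g) [*] $vN [+] $(vIx g))) ;; For (vJx g) (vDg g) ?b2"
 let ?S0 = "(upd S (vDg g) d)"
 show "sp (For (vIx g) (vDg g) ?b1) ?S0 Q"
 proof (rule sp_For_time[where n = d and t = "3 + real d * (t + 1 + 2)" and I = "%i. I (i * d)"])
 show "I (0 * d) ((vl ?S0)(vIx g := 0)) (ar ?S0) (bad ?S0)" using init by (auto intro!: I)
 fix i and S1 :: cst
 assume fr1: "frame (For (vIx g) (vDg g) ?b1) ?S0 S1" and i: "i < d" "vl S1 (vIx g) = i" "vl S1 (vDg g) = d"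
 and I1: "(I (i * d))@@@S1"
 have V1: "x ~: ?X ==> vl S1 x = vl S x" "a ~: warrs c ==> ar S1 a = ar S a" for x a
 using fr1 by (auto simp: frame_def w_For)
 have fx1: "vl S1 (vVert g) = v" "vl S1 vN = n" "ar S1 (aNb g) = ar S (aNb g)" using V1 c v(1) N by auto
 let ?ni = "nbs hl v ! i"
 let ?S2 = "(upd S1 (vNbI g) ?ni)"
 show "sp ?b1 S1 (%S''. I (Suc i * d) ((vl S'')(vIx g := Suc i)) (ar S'') (bad S'') & clk S1 - (3 + real d * (t + 1 + 2)) <= clk S'')"
 proof (rule sp_Seq, rule sp_Asg_eq[where v = "?ni"])
 show "ev w S1 (Read (aNb g) ($(vVert g) [*] $vN [+] $(vIx g))) = ?ni"
 using B(2)[OF i(1)] ix[OF i(1)] i(2) by (simp add: fx1[unfolded One_nat_def])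
 show "sp (For (vJx g) (vDg g) ?b2) ?S2 (%S''. I (Suc i * d) ((vl S'')(vIx g := Suc i)) (ar S'') (bad S'') & clk S1 - (3 + real d * (t + 1 + 2)) <= clk S'')"
 proof (rule sp_For_time[where n = d and t = "t + 1" and I = "%j. I (i * d + j)"])
 show "I (i * d + 0) ((vl ?S2)(vJx g := 0)) (ar ?S2) (bad ?S2)" using I1 by (auto intro!: I)
 fix j and S3 :: cst
 assume fr3: "frame (For (vJx g) (vDg g) ?b2) ?S2 S3" and j: "j < d" "vl S3 (vJx g) = j"
 and I3: "(I (i * d + j))@@@S3"
 have V3: "x ~: ?X ==> vl S3 x = vl S x" "a ~: warrs c ==> ar S3 a = ar S a" for x a
 using fr3 V1 by (auto simp: frame_def w_For)
 have fx3: "vl S3 (vVert g) = v" "vl S3 vN = n" "ar S3 (aNb g) = ar S (aNb g)" using V3 c v(1) N by auto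
 have ni: "vl S3 (vNbI g) = ?ni" using fr3 c by (auto simp: frame_def w_For)
 let ?nj = "nbs hl v ! j"
 let ?S4 = "(upd S3 (vNbJ g) ?nj)"
 have q: "(i * d + j) div d = i" "(i * d + j) mod d = j" "i * d + j < d * d"
 using i(1) j(1) by (auto intro: madd_less)
 show "sp ?b2 S3 (%S''. I (i * d + Suc j) ((vl S'')(vJx g := Suc j)) (ar S'') (bad S'') & clk S3 - (t + 1) <= clk S'')"
 proof (rule sp_Seq, rule sp_Asg_eq[where v = "?nj"])
 show "ev w S3 (Read (aNb g) ($(vVert g) [*] $vN [+] $(vJx g))) = ?nj"
 using B(2)[OF j(1)] ix[OF j(1)] j(2) by (simp add: fx3[unfolded One_nat_def])
 show "sp c ?S4 (%S''. I (i * d + Suc j) ((vl S'')(vJx g := Suc j)) (ar S'') (bad S'') & clk S3 - (t + 1) <= clk S'')"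
 by (rule sp_weak, rule body[where q = "i * d + j"])
 (insert q ni V3 I3, auto intro!: I)
 qed
 next
 fix S3 :: cst
 assume "(I (i * d + d))@@@S3" "clk ?S2 - (2 + real d * (t + 1 + 2)) <= clk S3"
 thus "I (Suc i * d) ((vl S3)(vIx g := Suc i)) (ar S3) (bad S3) & clk S1 - (3 + real d * (t + 1 + 2)) <= clk S3"
 by (auto simp: add.commute intro!: I)
 qed (insert c i(3), auto simp: w_For)
 qed
 next
 fix S1 :: cst
 assume "(I (d * d))@@@S1" "clk ?S0 - (2 + real d * (3 + real d * (t + 1 + 2) + 2)) <= clk S1"
 thus "Q S1" by (intro exit) (auto simp: algebra_simps)
 qed (insert c, auto simp: w_For)
qed

end

section \<open>The level loop, common to the whole graph and to single neighbourhoods\<close>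

abbreviation (input) "vBase == 34 :: nat"

definition low_pass :: "nat => exp => com => com" where
 "low_pass g tex act = For (vPos g) (vVc g)
 (Asg (vVert g) (Read (aVl g) ($(vPos g))) ;;
 Cond (tex [<] Read (aDeg g) ($(vVert g))) Skip act)"

definition row_pass :: "nat => exp => com" where
 "row_pass g tex = Asg vRN (Lit 0) ;;
 For (vPos g) (vVc g)
 (Asg (vVert g) (Read (aVl g) ($(vPos g))) ;;
 Cond (tex [<] Read (aDeg g) ($(vVert g)))
 (Write aRW ($vRN) ($(vVert g)) ;; Asg vRN ($vRN [+] Lit 1)) Skip)"

definition search_work_exp :: exp where
 "search_work_exp = $vRN [*] $vWN [+] ($vRR [+] Lit 1) [*] ($vRN [*] $vRN [+] $vWN)"

text \<open>Used with \<open>g = 2\<close> for the whole graph and with \<open>g = 1\<close> inside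
  the neighbourhood of a vertex of low degree; \<open>act\<close> treats a low vertex and
  \<open>fill\<close> lists the witness edges.\<close>

definition level :: "nat => exp => exp => com => com => com" where
 "level g tex rex act fill =
 charged ($(vBc g) [+] Lit 1)
 (build g ;; low_pass g tex act ;; row_pass g tex ;; fill ;; Asg vRR rex ;;
 charged search_work_exp (search_all (aBA g) (aBB g) (vBc g)))"

text \<open>If there are at most \<open>tt\<close> cliques, no edge survives the last level of a run
  without failures. Surviving edges therefore raise the flag.\<close>

definition solve :: "nat => exp => exp => com => com => com" where
 "solve g tex rex act fill =
 For (vLevel g) vLV (Cond ($vFlag) Skip (level g tex rex act fill)) ;;
 Cond ($(vBc g)) (Asg vFlag (Lit 1)) Skip"

definition dg :: "(nat \<times> nat) set => nat => nat" where
 "dg E a = card {b. (a, b) : E}"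

definition lverts :: "(nat \<times> nat) set => nat => nat set" where
 "lverts E h = {a : fst ` E. dg E a <= h}"

definition hverts :: "(nat \<times> nat) set => nat => nat set" where
 "hverts E h = {a : fst ` E. h < dg E a}"

lemma length_nbs_dg: "distinct hl ==> length (nbs hl a) = dg (set hl) a"
 using distinct_card[OF distinct_nbs, of ] by (simp add: dg_def set_nbs)

lemma written_pass:
 "wvars (low_pass g tex act) = {vPos g, vVert g} Un wvars act" "warrs (low_pass g tex act) = warrs act"
 "wvars (row_pass g tex) = {vPos g, vVert g, vRN}" "warrs (row_pass g tex) = {aRW}"
 by (auto simp: low_pass_def row_pass_def w_For)

context lister
begin

text \<open>The counterpart of \<open>heavy_pairs\<close> for sets in place of lists, so that the
  combinatorial analysis does not depend on the order of edges.\<close>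

definition heavy :: "nat => nat set => (nat \<times> nat) set => nat => (nat \<times> nat) set" where
 "heavy k X W r = {e : X \<times> X Int adj k. r < card {f : W. witness k (fst e) f & witness k (snd e) f}}"

definition lights :: "nat => nat set => (nat \<times> nat) set => nat => nat set set" where
 "lights k X W r = {{a, b, c, d} | a b c d. a : X & b : X & (c, d) : W & witness k a (c, d) & witness k b (c, d) &
 card {f : W. witness k a f & witness k b f} <= r}"

lemma card_common: "distinct ws ==> card (common k rs ws i j) = card {f : set ws. witness k (rs ! i) f & witness k (rs ! j) f}"
proof -
 assume d: "distinct ws"
 have "{f : set ws. witness k (rs ! i) f & witness k (rs ! j) f} = (!) ws ` common k rs ws i j"
 by (force simp: common_def in_set_conv_nth)
 moreover have "inj_on ((!) ws) (common k rs ws i j)"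
 using d by (auto simp: inj_on_def common_def nth_eq_iff_index_eq)
 ultimately show ?thesis by (simp add: card_image)
qed

lemma heavy_pairs_heavy: "distinct ws ==> heavy_pairs k rs ws r = heavy k (set rs) (set ws) r"
proof (intro equalityI subsetI)
 assume d: "distinct ws"
 fix e assume "e : heavy_pairs k rs ws r"
 thus "e : heavy k (set rs) (set ws) r" by (auto simp: heavy_pairs_def heavy_def card_common[OF d])
next
 assume d: "distinct ws"
 fix e assume e: "e : heavy k (set rs) (set ws) r"
 then obtain i j where "i < length rs" "j < length rs" "e = (rs ! i, rs ! j)"
 by (auto simp: heavy_def in_set_conv_nth)
 thus "e : heavy_pairs k rs ws r" using e unfolding heavy_pairs_def heavy_def by (auto simp: card_common[OF d])
qed

lemma light_lights: "distinct ws ==> lights k (set rs) (set ws) r <= light k rs ws r"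
proof
 assume d: "distinct ws"
 fix K assume "K : lights k (set rs) (set ws) r"
 then obtain a b c e where K: "K = {a, b, c, e}" "a : set rs" "b : set rs" "(c, e) : set ws" "witness k a (c, e)" "witness k b (c, e)"
 "card {f : set ws. witness k a f & witness k b f} <= r"
 unfolding lights_def by blast
 then obtain i j l where "i < length rs" "rs ! i = a" "j < length rs" "rs ! j = b" "l < length ws" "ws ! l = (c, e)"
 by (metis in_set_conv_nth)
 hence "K = {rs ! i, rs ! j, fst (ws ! l), snd (ws ! l)} & i < length rs & j < length rs &
 l : common k rs ws i j & card (common k rs ws i j) <= r"
 using K by (simp add: card_common[OF d]) (simp add: common_def)
 thus "K : light k rs ws r" unfolding light_def by blast
qed

lemma built_same:
 "built g V A hl ==> V' (vVc g) = V (vVc g) ==> A' (aVl g) = A (aVl g) ==> A' (aDeg g) = A (aDeg g) ==> A' (aNb g) = A (aNb g) ==>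
 built g V' A' hl"
 by (rule iffD2[OF built_cong])

lemma built_D:
 assumes "built g V A hl" "distinct hl"
 shows "V (vVc g) = length (firsts hl)" "i < length (firsts hl) ==> A (aVl g) i = firsts hl ! i"
 "a : fst ` set hl ==> A (aDeg g) a = dg (set hl) a"
 using assms(1) unfolding built_def stores_def length_nbs_dg[OF assms(2)] by blast+

lemma sp_row_pass:
 assumes built: "(built g)@@S hl" and hl: "distinct hl" "set hl <= adj k"
 and tex: "!!S' :: cst. (!!x. x ~: {vPos g, vVert g, vRN} ==> vl S' x = vl S x) ==> (!!a. a ~= aRW ==> ar S' a = ar S a) ==>
 ev w S' tex = h"
 and Q: "!!S' rs. stores (ar S' aRW) rs ==> vl S' vRN = length rs ==> distinct rs ==> set rs = hverts (set hl) h ==>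
 length rs <= length hl ==> bad S' = bad S ==> clk S - (3 + 6 * real (length hl)) <= clk S' ==> Q S'"
 shows "sp (row_pass g tex) S Q"
 unfolding row_pass_def
proof (rule sp_Seq, rule sp_Asg_eq[where v = 0], simp)
 note D = built_D[OF built hl(1)]
 let ?vs = "firsts hl" let ?f = "%i. filter (%a. h < dg (set hl) a) (take i ?vs)"
 let ?b = "Asg (vVert g) (Read (aVl g) ($(vPos g))) ;;
 Cond (tex [<] Read (aDeg g) ($(vVert g)))
 (Write aRW ($vRN) ($(vVert g)) ;; Asg vRN ($vRN [+] Lit 1)) Skip"
 let ?S0 = "(upd S vRN 0)"
 show "sp (For (vPos g) (vVc g) ?b) ?S0 Q"
 proof (rule sp_For_time[where n = "length ?vs" and t = 4 and I = "%i V A b. V vRN = length (?f i) & stores (A aRW) (?f i) & b = bad S"])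
 fix i and S1 :: cst
 assume fr: "frame (For (vPos g) (vVc g) ?b) ?S0 S1" and i: "i < length ?vs" "vl S1 (vPos g) = i"
 and I: "vl S1 vRN = length (?f i) & stores (ar S1 aRW) (?f i) & bad S1 = bad S"
 have V1: "x ~: {vPos g, vVert g, vRN} ==> vl S1 x = vl S x" "a ~= aRW ==> ar S1 a = ar S a" for x a
 using fr by (auto simp: frame_def w_For)
 let ?a = "?vs ! i"
 let ?S2 = "(upd S1 (vVert g) ?a)"
 have a: "?a : fst ` set hl" using i(1) nth_mem[of i ?vs] by simp
 have t: "take (Suc i) ?vs = take i ?vs @ [?a]" using i(1) by (rule take_Suc_conv_app_nth)
 have "ev w ?S2 tex = h" by (rule tex) (use V1 in auto)
 hence cond: "ev w ?S2 (tex [<] Read (aDeg g) ($(vVert g))) = of_bool (h < dg (set hl) ?a)"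
 using V1(2) D(3)[OF a] by simp
 have "length (?f i) <= length ?vs" by (rule le_trans[OF length_filter_le]) simp
 hence small: "length (?f i) + 1 < 2 ^ w" using length_firsts[of hl] length_sub_adj[OF hl] U(3) UU_less[of 0 0] by simp
 show "sp ?b S1 (%S''. (((vl S'')(vPos g := Suc i)) vRN = length (?f (Suc i)) & stores (ar S'' aRW) (?f (Suc i)) & bad S'' = bad S) & clk S1 - 4 <= clk S'')"
 proof (rule sp_Seq, rule sp_Asg_eq[where v = ?a], simp add: V1 i D(2), rule sp_Cond)
 assume "ev w ?S2 (tex [<] Read (aDeg g) ($(vVert g))) ~= 0"
 thus "sp (Write aRW ($vRN) ($(vVert g)) ;; Asg vRN ($vRN [+] Lit 1)) (tick ?S2)
 (%S''. (((vl S'')(vPos g := Suc i)) vRN = length (?f (Suc i)) & stores (ar S'' aRW) (?f (Suc i)) & bad S'' = bad S) & clk S1 - 4 <= clk S'')"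
 using I stores_append[of "ar S1 aRW" "?f i" ?a] small unfolding cond by (intro sp_Seq sp_Write_eq[where x = "length (?f i)" and v = ?a] sp_Asg_eq[where v = "length (?f i) + 1"]) (simp_all add: t)
next
 assume "ev w ?S2 (tex [<] Read (aDeg g) ($(vVert g))) = 0"
 thus "sp Skip (tick ?S2)
 (%S''. (((vl S'')(vPos g := Suc i)) vRN = length (?f (Suc i)) & stores (ar S'' aRW) (?f (Suc i)) & bad S'' = bad S) & clk S1 - 4 <= clk S'')"
 using I unfolding cond by (intro sp_Skip) (simp add: t)
qed
 next
 fix S1 :: cst
 assume I: "vl S1 vRN = length (?f (length ?vs)) & stores (ar S1 aRW) (?f (length ?vs)) & bad S1 = bad S"
 "clk ?S0 - (2 + real (length ?vs) * (4 + 2)) <= clk S1"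
 show "Q S1"
 proof (rule Q[where rs = "?f (length ?vs)"])
 show "distinct (?f (length ?vs))" "set (?f (length ?vs)) = hverts (set hl) h"
 by (auto simp: hverts_def)
 show "length (?f (length ?vs)) <= length hl"
 using le_trans[OF length_filter_le length_firsts] by simp
 show "clk S - (3 + 6 * real (length hl)) <= clk S1" using I(2) length_firsts[of hl] by simp
 qed (use I in auto)
 qed (insert D, auto simp: stores_def)
qed

end

lemma (in budget) env_same:
 assumes "env V A k" "!!x. x <= 9 | x = 12 ==> V' x = V x" "!!a. a : {4, 5, 6} ==> A' a = A a"
 shows "env V' A' k"
 using assms(1) unfolding env_def glob_def by (simp add: assms(2,3))

text \<open>The interface shared by both uses of the level loop. \<open>th l\<close> and
  \<open>r l\<close> are the degree and witness thresholds of level \<open>l\<close>. The witness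
  edges \<open>wsel X E\<close> will be all of \<open>E\<close> for the graph and
  \<open>{v} \<times> X\<close> for the neighbourhood of \<open>v\<close>. \<open>wact\<close> and
  \<open>ract\<close> are the ideal work for one low vertex and the sets it is responsible
  for.\<close>

locale solver = budget +
 fixes k g v :: nat and tex rex :: exp and act fill :: com and th r :: "nat => nat"
 and wsel :: "nat set => (nat \<times> nat) set => (nat \<times> nat) set"
 and wact :: "(nat \<times> nat) set => nat => nat" and ract :: "(nat \<times> nat) set => nat => nat set set"
 assumes act_written: "x : wvars act ==> 9 < x & x ~= vJJ & x ~: {vBc g, vVc g, vLevel g, vPos g, vVert g} & (g = 1 --> x ~= vBase)"
 "a : warrs act ==> a ~: {aEU, aEV, aPos, aBA g, aBB g, aDeg g, aNb g, aVl g}"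
 and fill_written: "wvars fill <= {vWN, vI}" "warrs fill <= {aWC, aWD}"
 and tex: "env V A k ==> V (vLevel g) = l ==> l < LV ==> eval w V A tex = th l"
 and rex: "env V A k ==> V (vLevel g) = l ==> l < LV ==> eval w V A rex = r l" "l < LV ==> r l <= U"
 and act: "env@@S k ==> (g = 1 --> vl S vBase = v) ==> (built g)@@S hl ==> distinct hl ==> set hl <= adj k ==>
 vl S (vVert g) = a ==> a : fst ` set hl ==> status@@@S k W R ==>
 sp act S (%S'. status@@@S' k (W + wact (set hl) a) (R Un ract (set hl) a) & pot S - 50 <= pot S')"
 and fill: "env@@S k ==> (g = 1 --> vl S vBase = v) ==> stores (ar S aRW) rs ==> vl S vRN = length rs ==>
 distinct rs ==> set rs <= {..<n} ==> length rs <= length hl ==>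
 pairs_at@@S (aBA g) (aBB g) (vBc g) hl ==> distinct hl ==> set hl <= adj k ==>
 sp fill S (%S'. (\<exists>ws. search@@S' rs ws & distinct ws & set ws = wsel (set rs) (set hl)) & bad S' = bad S &
 clk S - (10 + 10 * real (length hl)) <= clk S')"
begin

definition next_edges :: "(nat \<times> nat) set => nat => (nat \<times> nat) set" where
 "next_edges E l = heavy k (hverts E (th l)) (wsel (hverts E (th l)) E) (r l)"

definition lwork :: "(nat \<times> nat) set => nat => nat" where
 "lwork E l = card E + 1 + (\<Sum>a\<in>lverts E (th l). wact E a) +
 swork (card (hverts E (th l))) (card (wsel (hverts E (th l)) E)) (r l)"

definition lrep :: "(nat \<times> nat) set => nat => nat set set" where
 "lrep E l = (\<Union>a\<in>lverts E (th l). ract E a) Un lights k (hverts E (th l)) (wsel (hverts E (th l)) E) (r l)"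

text \<open>The edge sets of a run without failures. They do not mention the program, so work and
  completeness can be analysed by pure counting.\<close>

primrec edge_seq :: "(nat \<times> nat) set => nat => (nat \<times> nat) set" where
 "edge_seq E 0 = E"
| "edge_seq E (Suc l) = next_edges (edge_seq E l) l"

lemma sp_low_pass:
 assumes env: "env@@S k" and base: "g = 1 --> vl S vBase = v" and built: "(built g)@@S hl"
 and hl: "distinct hl" "set hl <= adj k" and l: "vl S (vLevel g) = l" "l < LV"
 and st: "status@@@S k W R"
 shows "sp (low_pass g tex act) S (%S'. status@@@S' k
 (W + (\<Sum>a\<in>lverts (set hl) (th l). wact (set hl) a)) (R Un (\<Union>a\<in>lverts (set hl) (th l). ract (set hl) a)) &
 pot S - (2 + 54 * real (length hl)) <= pot S')" (is "sp _ S ?Q")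
 unfolding low_pass_def
proof -
 note D = built_D[OF built hl(1)]
 let ?vs = "firsts hl" let ?h = "th l"
 let ?L = "%i. {a : set (take i ?vs). dg (set hl) a <= ?h}"
 let ?I = "%i V A b. status V A b k (W + (\<Sum>a\<in>?L i. wact (set hl) a)) (R Un (\<Union>a\<in>?L i. ract (set hl) a))"
 let ?b = "Asg (vVert g) (Read (aVl g) ($(vPos g))) ;; Cond (tex [<] Read (aDeg g) ($(vVert g))) Skip act"
 show "sp (For (vPos g) (vVc g) ?b) S ?Q"
 proof (rule sp_For_pot[where l = "length ?vs" and t = 52 and I = ?I])
 show "vPos g ~: wvars ?b" "vVc g ~: wvars ?b" using act_written(1)[of "vPos g"] act_written(1)[of "vVc g"] by auto
 show "vl S (vVc g) = length ?vs" by (rule D)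
 show "?I 0 ((vl S)(vPos g := 0)) (ar S) (bad S)" using st by simp
 fix i and S1 :: cst
 assume fr: "frame (For (vPos g) (vVc g) ?b) S S1" and i: "i < length ?vs" "vl S1 (vPos g) = i"
 and I: "(?I i)@@@S1"
 have V1: "x ~: {vPos g, vVert g} Un wvars act ==> vl S1 x = vl S x" "a ~: warrs act ==> ar S1 a = ar S a" for x a
 using fr by (auto simp: frame_def w_For)
 let ?a = "?vs ! i"
 let ?S2 = "(upd S1 (vVert g) ?a)"
 have V2: "x ~: {vPos g, vVert g} Un wvars act ==> vl ?S2 x = vl S x" "a ~: warrs act ==> ar ?S2 a = ar S a" for x a
 using V1 by auto
 have arr: "ar S1 (aVl g) = ar S (aVl g)" "ar S1 (aDeg g) = ar S (aDeg g)"
 using V1(2) act_written(2)[of "aVl g"] act_written(2)[of "aDeg g"] by auto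
 have a: "?a : fst ` set hl" using i(1) nth_mem[of i ?vs] by simp
 have t: "take (Suc i) ?vs = take i ?vs @ [?a]" using i(1) by (rule take_Suc_conv_app_nth)
 have anew: "?a ~: set (take i ?vs)" using i(1) by (auto simp: in_set_conv_nth nth_eq_iff_index_eq)
 have env2: "env@@?S2 k"
 by (rule env_same[OF env]; rule V2) (use act_written in fastforce)+
 have base2: "g = 1 --> vl ?S2 vBase = v" using base V2(1)[of vBase] act_written(1)[] by auto
 have l2: "vl ?S2 (vLevel g) = l" using l(1) V2(1)[of "vLevel g"] act_written(1)[of "vLevel g"] by auto
 have built2: "(built g)@@?S2 hl"
 by (rule built_same[OF built]; rule V2) (use act_written in fastforce)+
 have cond: "ev w ?S2 (tex [<] Read (aDeg g) ($(vVert g))) = of_bool (?h < dg (set hl) ?a)"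
 by (simp only: eval.simps tex[OF env2 l2 l(2)]) (simp add: arr D(3)[OF a])
 show "sp ?b S1 (%S''. ?I (Suc i) ((vl S'')(vPos g := Suc i)) (ar S'') (bad S'') & pot S1 - 52 <= pot S'')"
 proof (rule sp_Seq, rule sp_Asg_eq[where v = ?a], simp add: arr i D(2), rule sp_Cond)
 assume "ev w ?S2 (tex [<] Read (aDeg g) ($(vVert g))) ~= 0"
 hence "?L (Suc i) = ?L i" unfolding cond by (auto simp: t)
 thus "sp Skip (tick ?S2) (%S''. ?I (Suc i) ((vl S'')(vPos g := Suc i)) (ar S'') (bad S'') & pot S1 - 52 <= pot S'')"
 using I by (intro sp_Skip) simp
 next
 assume "ev w ?S2 (tex [<] Read (aDeg g) ($(vVert g))) = 0"
 hence L: "?L (Suc i) = insert ?a (?L i)" unfolding cond by (auto simp: t)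
 have sum: "(\<Sum>a\<in>insert ?a (?L i). wact (set hl) a) = (\<Sum>a\<in>?L i. wact (set hl) a) + wact (set hl) ?a"
 using anew by simp
 have "status (vl (tick ?S2)) (ar (tick ?S2)) (bad (tick ?S2)) k (W + (\<Sum>a\<in>?L i. wact (set hl) a)) (R Un (\<Union>a\<in>?L i. ract (set hl) a))"
 using I by simp
 from act[OF _ _ _ hl _ a this] show "sp act (tick ?S2) (%S''. ?I (Suc i) ((vl S'')(vPos g := Suc i)) (ar S'') (bad S'') & pot S1 - 52 <= pot S'')"
 by (rule sp_weak) (insert env2 base2 built2, simp_all add: sum L Un_ac add_ac)
 qed
 next
 fix S1 :: cst
 assume I: "(?I (length ?vs))@@@S1" "pot S - (2 + real (length ?vs) * (52 + 2)) <= pot S1"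
 show "?Q S1" using I length_firsts[of hl] by (auto simp: lverts_def)
qed simp_all
qed

end

context solver
begin

lemma written_level:
 "wvars (level g tex rex act fill) <= {vFlag, vWk, vIx g, vVc g, vVert g, vDg g, vPos g, vRN, vRR, vWN, vI} Un wvars act \<union>
 wvars (search_all (aBA g) (aBB g) (vBc g))"
 "warrs (level g tex rex act fill) <= {aDeg g, aNb g, aVl g, aRW, aWC, aWD} Un warrs act \<union>
 warrs (search_all (aBA g) (aBB g) (vBc g))"
 using fill_written by (auto simp: level_def written_charged written_build written_pass)

lemma high_verts_adj: "E <= adj k ==> hverts E h <= {..<n}"
 using adj_less by (fastforce simp: hverts_def)

lemma eval_search_work:
 assumes "search V A rs ws" "V vRR = q" "q <= U"
 shows "eval w V A search_work_exp = swork (length rs) (length ws) q" "swork (length rs) (length ws) q <= U ^ 6"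
proof -
 note D = search_D[OF assms(1)]
 let ?h = "length rs" and ?v = "length ws"
 have h: "?h <= U ^ 1" "?v <= U ^ 1" "q <= U ^ 1" "1 <= U ^ 1" using D assms(3) U(1) by simp_all
 note b = poly_bounds
 have hh: "?h * ?h <= U ^ 2" using b(1)[OF h(1,1)] by (simp add: power2_eq_square)
 have hv: "?h * ?v <= U ^ 2" using b(1)[OF h(1,2)] by (simp add: power2_eq_square)
 have v2: "?v <= U ^ 2" using U(1) order_trans[OF h(2) power_increasing[of 1 2 ]] by simp
 have s: "?h * ?h + ?v <= U ^ 3" using b(2)[OF hh v2] by simp
 have r1: "q + 1 <= U ^ 2" using b(2)[OF h(3,4)] by (simp add: numeral_2_eq_2)
 have p: "(q + 1) * (?h * ?h + ?v) <= U ^ 5" using b(1)[OF r1 s] by simp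
 show t: "swork ?h ?v q <= U ^ 6" using order_trans[OF hv ] U(1) b(2)[OF _ p] by (simp add: swork_def)
have less: "x < 2 ^ w" if "x <= U ^ 6" for x using that U_pow_less[of 6] by simp
 have up: "U ^ i <= U ^ 6" if "i <= 6" for i using that U(1) by (intro power_increasing) auto
 have w: "?h * ?v < 2 ^ w" "?h * ?h < 2 ^ w" "?h * ?h + ?v < 2 ^ w" "q + 1 < 2 ^ w" "(q + 1) * (?h * ?h + ?v) < 2 ^ w"
 "?h * ?v + (q + 1) * (?h * ?h + ?v) < 2 ^ w"
 using r1 t up[of 2] by (auto intro!: less simp: swork_def)
 show "eval w V A search_work_exp = swork ?h ?v q"
 by (simp only: search_work_exp_def eval.simps binop_val.simps D(1,2) assms(2) mod_less[OF w(1)] mod_less[OF w(2)] mod_less[OF w(3)]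
 mod_less[OF w(4)] mod_less[OF w(5)] mod_less[OF w(6)] mod_less[OF small_less[of 1]] swork_def)
qed

lemma sp_level:
 assumes env: "env@@S k" and base: "g = 1 --> vl S vBase = v" and l: "vl S (vLevel g) = l" "l < LV"
 and ps: "pairs_at@@S (aBA g) (aBB g) (vBc g) hl" and hl: "distinct hl" "set hl <= adj k"
 and st: "status@@@S k W R"
 defines "E == set hl"
 shows "sp (level g tex rex act fill) S (%S'.
 (\<exists>hl'. pairs_at@@S' (aBA g) (aBB g) (vBc g) hl' & distinct hl' & set hl' <= adj k &
 (~bad S' & vl S' vFlag = 0 --> set hl' = next_edges E l)) &
 status@@@S' k (W + lwork E l) (R Un lrep E l) & pot S - 20 <= pot S')" (is "sp _ S ?Q")
 unfolding level_def
proof -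
 let ?h = "length hl" and ?X = "hverts E (th l)" let ?Ws = "wsel ?X E"
 let ?low = "\<Sum>a\<in>lverts E (th l). wact E a"
 let ?sw = "swork (card ?X) (card ?Ws) (r l)"
 let ?R1 = "R Un (\<Union>a\<in>lverts E (th l). ract E a)"
 have h: "?h = card E" using hl(1) by (simp add: E_def distinct_card)
 have hU: "?h <= U" using length_sub_adj[OF hl] U(3) by simp
 have h6: "?h + 1 <= U ^ 6"
 proof -
 have "U + 1 <= U ^ 2" using poly_bounds(2)[of 1 1] U(1) by (simp add: numeral_2_eq_2)
 also have "... <= U ^ 6" using U(1) by (intro power_increasing) auto
 finally show ?thesis using hU by simp
 qed
 have work: "lwork E l = ?h + 1 + ?low + ?sw" by (simp add: lwork_def h)
 let ?search = "charged search_work_exp (search_all (aBA g) (aBB g) (vBc g))"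
 show "sp (charged ($(vBc g) [+] Lit 1) (build g ;; low_pass g tex act ;; row_pass g tex ;; fill ;; Asg vRR rex ;; ?search)) S ?Q"
 proof (rule sp_charged[OF st env, where x = "?h + 1" and y = "?h + 1"])
 show "ev w S' ($(vBc g) [+] Lit 1) = ?h + 1" if "!!x. x ~= vFlag ==> vl S' x = vl S x" for S' :: cst
 using ps that[of "vBc g"] UU_less[of 0 0] hU by (simp add: pairs_at_def)
 show "?h + 1 <= U ^ 6" by (rule h6)
 next
 fix S1 :: cst
 assume S1: "vl S1 vFlag ~= 0" "!!x. x ~= vFlag ==> vl S1 x = vl S x" "ar S1 = ar S" "bad S1 = bad S"
 "!!W' R'. W + (?h + 1) <= W' ==> status@@@S1 k W' R'" "pot S - 5 <= pot S1"
 have "pairs_at@@S1 (aBA g) (aBB g) (vBc g) hl" using ps by (rule iffD2[OF pairs_at_cong, rotated 3]) (use S1 in auto)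
 thus "?Q S1" using S1 hl work by (intro conjI ) auto
 next
 fix S1 :: cst
 assume S1: "vl S1 vFlag = 0" "!!x. x ~= vWk ==> vl S1 x = vl S x" "ar S1 = ar S" "bad S1 = bad S"
 "status@@@S1 k (W + (?h + 1)) R" "pot S + ka * real (?h + 1) - 5 <= pot S1"
 let ?Y = "{vWk, vIx g, vVc g, vVert g, vDg g}" let ?Z = "{aDeg g, aNb g, aVl g}"
 have env1: "env@@S1 k" by (rule env_same[OF env]) (use S1 in auto)
 have ps1: "pairs_at@@S1 (aBA g) (aBB g) (vBc g) hl" using ps by (rule iffD2[OF pairs_at_cong, rotated 3]) (use S1 in auto)
 show "sp (build g ;; low_pass g tex act ;; row_pass g tex ;; fill ;; Asg vRR rex ;; ?search) S1 ?Q"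
 proof (rule sp_Seq, rule sp_weak[OF sp_build[OF env_D(4)[OF env1] ps1 hl]])
 fix S2 :: cst
 assume fr2: "frame (build g) S1 S2" and S2: "(built g)@@S2 hl & bad S2 = bad S1 & clk S1 - (5 + 13 * real ?h) <= clk S2"
 have V2: "x ~: ?Y ==> vl S2 x = vl S x" "a ~: ?Z ==> ar S2 a = ar S a" for x a
 using fr2 S1 by (auto simp: frame_def written_build)
 have wk2: "vl S2 vWk = vl S1 vWk" "vl S2 vFlag = vl S1 vFlag" "vl S2 vCnt = vl S1 vCnt" using fr2 by (auto simp: frame_def written_build)
 have env2: "env@@S2 k" by (rule env_same[OF env]) (use V2 in auto)
 have st2: "status@@@S2 k (W + (?h + 1)) R"
 using S1(5) S2 wk2 V2 S1(3) by (subst status_cong[of _ "vl S1" _ "ar S1"]) auto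
 have built2: "(built g)@@S2 hl" and base2: "g = 1 --> vl S2 vBase = v" and l2: "vl S2 (vLevel g) = l"
 using S2 base l V2 by auto
 have pot2: "pot S1 - (5 + 13 * real ?h) <= pot S2" using S2 wk2 by (simp add: pot_def)
 show "sp (low_pass g tex act ;; row_pass g tex ;; fill ;; Asg vRR rex ;; ?search) S2 ?Q"
 proof (rule sp_Seq, rule sp_weak[OF sp_low_pass[OF env2 base2 built2 hl l2 l(2) st2, folded E_def]])
 fix S3 :: cst
 assume fr3: "frame (low_pass g tex act) S2 S3" and S3: "status@@@S3 k (W + (?h + 1) + ?low) ?R1 &
 pot S2 - (2 + 54 * real ?h) <= pot S3"
 have act1: "x ~: wvars act" if "x <= 9 | x = vJJ | x : {vBc g, vVc g, vLevel g} | g = 1 & x = vBase" for x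
 using act_written(1)[of x] that by auto
 have V3: "x ~: ?Y Un {vPos g, vVert g} Un wvars act ==> vl S3 x = vl S x" "a ~: ?Z Un warrs act ==> ar S3 a = ar S a" for x a
 using fr3 V2 by (auto simp: frame_def written_pass)
 have arr3: "ar S3 a = ar S2 a" if "a : {aDeg g, aNb g, aVl g}" for a
 using fr3 that act_written(2)[] by (auto simp: frame_def written_pass)
 have vc3: "vl S3 (vVc g) = vl S2 (vVc g)" using fr3 act1[of "vVc g"] by (auto simp: frame_def written_pass)
 have env3: "env@@S3 k" by (rule env_same[OF env]; rule V3) (use act1 act_written(2) in auto)
 have base3: "g = 1 --> vl S3 vBase = v" using base V3(1)[] act1[] by auto
 have l3: "vl S3 (vLevel g) = l" using V3(1)[of "vLevel g"] act1[of "vLevel g"] l by auto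
 have ps3: "pairs_at@@S3 (aBA g) (aBB g) (vBc g) hl"
 using ps by (rule iffD2[OF pairs_at_cong, rotated 3]; intro V3) (use act1[of "vBc g"] act_written(2) in auto)
 have built3: "(built g)@@S3 hl" by (rule built_same[OF built2]) (use arr3 vc3 in auto)
 have tex3: "ev w S' tex = th l"
 if "!!x. x ~: {vPos g, vVert g, vRN} ==> vl S' x = vl S3 x" "!!a. a ~= aRW ==> ar S' a = ar S3 a" for S' :: cst
 by (rule tex[OF env_same[OF env3]]) (use that l3 l in auto)
 show "sp (row_pass g tex ;; fill ;; Asg vRR rex ;; ?search) S3 ?Q"
 proof (rule sp_Seq, rule sp_weak[OF sp_row_pass[OF built3 hl tex3, folded E_def,
 where Q = "%S'. \<exists>rs. stores (ar S' aRW) rs & vl S' vRN = length rs & distinct rs & set rs = ?X & length rs <= ?h &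
 bad S' = bad S3 & clk S3 - (3 + 6 * real ?h) <= clk S'"]])
 fix S4 :: cst
 assume fr4: "frame (row_pass g tex) S3 S4" and "\<exists>rs. stores (ar S4 aRW) rs & vl S4 vRN = length rs & distinct rs & set rs = ?X &
 length rs <= ?h & bad S4 = bad S3 & clk S3 - (3 + 6 * real ?h) <= clk S4"
 then obtain rs where S4: "stores (ar S4 aRW) rs" "vl S4 vRN = length rs" "distinct rs" "set rs = ?X" "length rs <= ?h"
 "bad S4 = bad S3" "clk S3 - (3 + 6 * real ?h) <= clk S4" by blast
 have V4: "x ~: {vPos g, vVert g, vRN} ==> vl S4 x = vl S3 x" "a ~= aRW ==> ar S4 a = ar S3 a" for x a
 using fr4 by (auto simp: frame_def written_pass)
 have env4: "env@@S4 k" by (rule env_same[OF env3]; rule V4) auto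
 have base4: "g = 1 --> vl S4 vBase = v" using base3 V4 by auto
 have ps4: "pairs_at@@S4 (aBA g) (aBB g) (vBc g) hl"
 using ps3 by (rule iffD2[OF pairs_at_cong, rotated 3]; intro V4) auto
 have rsn: "set rs <= {..<n}" using high_verts_adj[] hl(2) S4(4) by (simp add: E_def)
 show "sp (fill ;; Asg vRR rex ;; ?search) S4 ?Q"
 proof (rule sp_Seq, rule sp_weak[OF fill[OF env4 base4 S4(1,2,3) rsn S4(5) ps4 hl, folded E_def]])
 fix S5 :: cst
 assume fr5: "frame fill S4 S5" and "(\<exists>ws. search@@S5 rs ws & distinct ws & set ws = wsel (set rs) E) &
 bad S5 = bad S4 & clk S4 - (10 + 10 * real ?h) <= clk S5"
 then obtain ws where S5: "search@@S5 rs ws" "distinct ws" "set ws = ?Ws" "bad S5 = bad S4" "clk S4 - (10 + 10 * real ?h) <= clk S5"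
 using S4(4) by auto
 have V5: "x ~: {vPos g, vVert g, vRN, vWN, vI} ==> vl S5 x = vl S3 x" "a ~: {aRW, aWC, aWD} ==> ar S5 a = ar S3 a" for x a
 using fr5 V4 fill_written by (auto simp: frame_def)
 have env5: "env@@S5 k" by (rule env_same[OF env3]; rule V5) auto
 have l5: "vl S5 (vLevel g) = l" using V5 l3 by auto
 have len: "length rs = card ?X" "length ws = card ?Ws" using S4(3,4) S5(2,3) distinct_card by metis+
 let ?S6 = "(upd S5 vRR (r l))"
 have V6: "x ~: {vPos g, vVert g, vRN, vWN, vI, vRR} ==> vl ?S6 x = vl S3 x" "a ~: {aRW, aWC, aWD} ==> ar ?S6 a = ar S3 a" for x a
 using V5 by auto
 have env6: "env@@?S6 k" by (rule env_same[OF env3]; rule V6) auto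
 have ps6: "pairs_at@@?S6 (aBA g) (aBB g) (vBc g) hl"
 using ps3 by (rule iffD2[OF pairs_at_cong, rotated 3]; intro V6) auto
 have search6: "search@@?S6 rs ws" using S5(1) by (rule iffD2[OF search_cong, rotated 5]) auto
 have st6: "status@@@?S6 k (W + (?h + 1) + ?low) ?R1"
 using conjunct1[OF S3] S4(6) S5(4) V6 by (subst status_cong[of _ "vl S3" _ "ar S3"]) auto
 have wk6: "vl ?S6 vWk = vl S3 vWk" by (rule V6) auto
 have pot6: "pot S - 33 + ka * real (?h + 1) - 83 * real ?h <= pot ?S6"
 using S1(6) pot2 conjunct2[OF S3] S4(7) S5(5) wk6 by (simp add: pot_def)
 \<comment> \<open>The charge for the edges supplies \<open>2 * ka0\<close>, which covers the
   constant part of the search, and at least 4000 per edge, which covers the linear passes.\<close>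
 have k1: "ka * real (?h + 1) = 2 * ka0 + 2 * (ka0 * real ?h)" by (simp add: ka_def distrib_left)
 have k2: "2000 * real ?h <= ka0 * real ?h" using kappa0_ge by (intro mult_right_mono) auto
 show "sp (Asg vRR rex ;; ?search) S5 ?Q"
 proof (rule sp_Seq, rule sp_Asg_eq[where v = "r l"], rule rex(1)[OF env5 l5 l(2)])
 show "sp ?search ?S6 ?Q"
 proof (rule sp_charged[OF st6 env6, where x = ?sw and y = ?sw])
 show "ev w S' search_work_exp = ?sw" if "!!x. x ~= vFlag ==> vl S' x = vl ?S6 x" "ar S' = ar ?S6" for S' :: cst
 using eval_search_work(1)[of "vl S'" "ar S'" rs ws "r l"] rex(2)[OF l(2)] len []
 iffD2[OF search_cong search6, of "vl S'" "ar S'"] that by simp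
 show "?sw <= U ^ 6" using eval_search_work(2)[OF search6 _ rex(2)[OF l(2)]] len by simp
 next
 fix S7 :: cst
 assume S7: "vl S7 vFlag ~= 0" "!!x. x ~= vFlag ==> vl S7 x = vl ?S6 x" "ar S7 = ar ?S6" "bad S7 = bad ?S6"
 "!!W' R'. W + (?h + 1) + ?low + ?sw <= W' ==> status@@@S7 k W' R'" "pot ?S6 - 5 <= pot S7"
 have "pairs_at@@S7 (aBA g) (aBB g) (vBc g) hl"
 using ps6 by (rule iffD2[OF pairs_at_cong, rotated 3]) (use S7 in auto)
 moreover have "pot S - 20 <= pot S7" using S7(6) pot6 k1 k2 kappa0_ge by linarith
 ultimately show "?Q S7" using S7(1,5) hl work by (intro conjI ) auto
 next
 fix S7 :: cst
 assume S7: "vl S7 vFlag = 0" "!!x. x ~= vWk ==> vl S7 x = vl ?S6 x" "ar S7 = ar ?S6" "bad S7 = bad ?S6"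
 "status@@@S7 k (W + (?h + 1) + ?low + ?sw) ?R1" "pot ?S6 + ka * real ?sw - 5 <= pot S7"
 have env7: "env@@S7 k" by (rule env_same[OF env6]) (use S7 in auto)
 have search7: "search@@S7 rs ws" using search6 by (rule iffD2[OF search_cong, rotated 5]) (use S7 in auto)
 have rr: "vl S7 vRR = r l" using S7(2)[] by simp
 let ?post = "%S'. (\<exists>hl. pairs_at@@S' (aBA g) (aBB g) (vBc g) hl & (distinct rs --> distinct hl) & set hl <= (set rs \<times> set rs) Int adj k &
 (~bad S' --> set hl = heavy_pairs k rs ws (r l))) &
 progress@@S' k 0 ((if bad S7 then {} else ?R1) Un (if bad S' then {} else light k rs ws (r l))) &
 clk S7 - ka0 * (1 + real (swork (length rs) (length ws) (r l))) <= clk S'"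
 have "sp (search_all (aBA g) (aBB g) (vBc g)) S7 ?post"
 by (rule sp_search_cliques[OF env_D(1,2,3)[OF env7] search7 status_progress[OF S7(5,1)] rr rex(2)[OF l(2)] env_D(7)[OF env7]]) auto
 thus "sp (search_all (aBA g) (aBB g) (vBc g)) S7 ?Q"
 proof (rule sp_weak)
 fix S8 :: cst
 assume fr8: "frame (search_all (aBA g) (aBB g) (vBc g)) S7 S8" and S8: "?post S8"
 have wk8: "vl S8 vWk = vl S7 vWk" using fr8 by (simp add: frame_def w_search_all)
 have bad8: "bad S7 ==> bad S8" using fr8 by (simp add: frame_def)
 obtain hl' where hl': "pairs_at@@S8 (aBA g) (aBB g) (vBc g) hl'" "distinct hl'" "set hl' <= adj k"
 "~bad S8 ==> set hl' = heavy_pairs k rs ws (r l)" using S8 S4(3) by blast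
 have "set hl' = next_edges E l" if "~bad S8"
 using hl'(4)[OF that] by (simp add: heavy_pairs_heavy[OF S5(2)] next_edges_def S4(4) S5(3))
 moreover have "status@@@S8 k (W + (?h + 1) + ?low + ?sw) (?R1 Un lights k ?X ?Ws (r l))"
 by (rule progress_status[OF S7(5,1) bad8 conjunct1[OF conjunct2[OF S8]] wk8])
 (use bad8 light_lights[OF S5(2), of k rs "r l"] S4(4) S5(3) in auto)
 moreover have "pot S - 20 <= pot S8"
 proof -
 have "pot S7 - (ka0 + ka0 * real ?sw) <= pot S8" using S8 len wk8 by (simp add: pot_def distrib_left)
moreover have "ka * real ?sw = 2 * (ka0 * real ?sw)" by (simp add: ka_def)
 moreover have "0 <= ka0 * real ?sw" using kappa0_ge by simp
 ultimately show ?thesis using S7(6) pot6 k1 k2 kappa0_ge by linarith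
 qed
 ultimately show "?Q S8" using hl'(1-3) by (auto simp: work lrep_def Un_assoc add.assoc)
 qed
 qed simp
 qed
 qed
 qed ((rule , (intro ; assumption)) | blast)+
 qed
 qed
 qed simp
qed

lemma written_solve:
 "wvars (solve g tex rex act fill) <= insert (vLevel g) (insert vFlag (wvars (level g tex rex act fill)))"
 "warrs (solve g tex rex act fill) = warrs (level g tex rex act fill)"
 by (auto simp: solve_def w_For)

lemma status_raise:
 assumes "status V A b k W R" "V vFlag = 0 ==> b | tt < card (cl k)"
 shows "status (V(vFlag := 1)) A b k W R"
using assms exI by (auto simp: status_def)
lemma sp_solve:
 assumes env: "env@@S k" and base: "g = 1 --> vl S vBase = v"
 and ps: "pairs_at@@S (aBA g) (aBB g) (vBc g) hl" and hl: "distinct hl" "set hl <= adj k"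
 and E: "~bad S ==> vl S vFlag = 0 ==> set hl = E"
 and st: "status@@@S k W R"
 and final: "card (cl k) <= tt ==> edge_seq E LV = {}"
 shows "sp (solve g tex rex act fill) S (%S'. status@@@S' k
 (W + (\<Sum>l<LV. lwork (edge_seq E l) l)) (R Un (\<Union>l<LV. lrep (edge_seq E l) l)) &
 (~bad S' & vl S' vFlag = 0 --> edge_seq E LV = {}) & pot S - (10 + 30 * real LV) <= pot S')" (is "sp _ S ?Q")
 unfolding solve_def
proof (rule sp_Seq)
 let ?l = "level g tex rex act fill" let ?b = "Cond ($vFlag) Skip ?l"
 let ?W = "%l. W + (\<Sum>i<l. lwork (edge_seq E i) i)" and ?R = "%l. R Un (\<Union>i<l. lrep (edge_seq E i) i)"
 let ?I = "%l V A b. (\<exists>hl. pairs_at V A (aBA g) (aBB g) (vBc g) hl & distinct hl & set hl <= adj k &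
 (~b & V vFlag = 0 --> set hl = edge_seq E l)) & status V A b k (?W l) (?R l)"
 have nin: "x ~: wvars ?l" if "x <= 9 | x = vJJ | x = vLevel g | g = 1 & x = vBase" for x
 using written_level(1) that act_written(1)[of x] by (auto simp: w_search_all)
 have nia: "a ~: warrs ?l" if "a : {aEU, aEV, aPos}" for a
 using written_level(2) that act_written(2)[of a] by (auto simp: w_search_all)
 show "sp (For (vLevel g) vLV ?b) S (%S'. sp (Cond ($(vBc g)) (Asg vFlag (Lit 1)) Skip) S' ?Q)"
 proof (rule sp_For_pot[where l = LV and t = 21 and I = ?I])
 show "vLevel g ~: wvars ?b" "vLV ~: wvars ?b" using nin[] by auto
 show "vl S vLV = LV" by (rule env_D(5)[OF env])
 show "?I 0 ((vl S)(vLevel g := 0)) (ar S) (bad S)" using ps hl E st by (intro conjI ) auto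
 fix l and S1 :: cst
 assume fr1: "frame (For (vLevel g) vLV ?b) S S1" and l: "l < LV" "vl S1 (vLevel g) = l" and I: "(?I l)@@@S1"
 have V1: "x ~: insert (vLevel g) (wvars ?l) ==> vl S1 x = vl S x" "a ~: warrs ?l ==> ar S1 a = ar S a" for x a
 using fr1 by (auto simp: frame_def w_For)
 have env1: "env@@S1 k" by (rule env_same[OF env]; rule V1) (use nin nia in auto)
 have base1: "g = 1 --> vl S1 vBase = v" using base V1(1)[] nin[] by auto
 obtain hl1 where hl1: "pairs_at@@S1 (aBA g) (aBB g) (vBc g) hl1" "distinct hl1" "set hl1 <= adj k"
 "~bad S1 ==> vl S1 vFlag = 0 ==> set hl1 = edge_seq E l" using I by blast
 show "sp ?b S1 (%S''. ?I (Suc l) ((vl S'')(vLevel g := Suc l)) (ar S'') (bad S'') & pot S1 - 21 <= pot S'')"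
 proof (rule sp_Cond)
 assume f: "ev w S1 ($vFlag) ~= 0"
 have "status@@@S1 k (?W (Suc l)) (?R (Suc l))"
 by (rule status_flag[OF conjunct2[OF I]]) (use f in auto)
 thus "sp Skip (tick S1) (%S''. ?I (Suc l) ((vl S'')(vLevel g := Suc l)) (ar S'') (bad S'') & pot S1 - 21 <= pot S'')"
 using hl1 f by (intro sp_Skip ) auto
 next
 assume f: "ev w S1 ($vFlag) = 0"
 have "sp ?l (tick S1) (%S'.
 (\<exists>hl'. pairs_at@@S' (aBA g) (aBB g) (vBc g) hl' & distinct hl' & set hl' <= adj k &
 (~bad S' & vl S' vFlag = 0 --> set hl' = next_edges (set hl1) l)) &
 status@@@S' k (?W l + lwork (set hl1) l) (?R l Un lrep (set hl1) l) & pot (tick S1) - 20 <= pot S')"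
 by (rule sp_level) (use env1 base1 l hl1 I in simp_all)
 thus "sp ?l (tick S1) (%S''. ?I (Suc l) ((vl S'')(vLevel g := Suc l)) (ar S'') (bad S'') & pot S1 - 21 <= pot S'')"
 proof (rule sp_weak)
 fix S2 :: cst
 assume fr2: "frame ?l (tick S1) S2" and S2: "(\<exists>hl'. pairs_at@@S2 (aBA g) (aBB g) (vBc g) hl' & distinct hl' & set hl' <= adj k &
 (~bad S2 & vl S2 vFlag = 0 --> set hl' = next_edges (set hl1) l)) &
 status@@@S2 k (?W l + lwork (set hl1) l) (?R l Un lrep (set hl1) l) & pot (tick S1) - 20 <= pot S2"
 have eq: "set hl1 = edge_seq E l" if "~bad S2" using fr2 that f hl1(4) by (auto simp: frame_def)
 have "status@@@S2 k (?W (Suc l)) (?R (Suc l))"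
 proof (cases "bad S2")
 case True
 thus ?thesis using S2 unfolding status_def by auto
 next
 case False
 thus ?thesis using S2 eq by (simp add: lessThan_Suc Un_ac add_ac)
 qed
 thus "?I (Suc l) ((vl S2)(vLevel g := Suc l)) (ar S2) (bad S2) & pot S1 - 21 <= pot S2"
 using S2 eq by auto
 qed
 qed
 next
 fix S1 :: cst
 assume I: "(?I LV)@@@S1" and pot1: "pot S - (2 + real LV * (21 + 2)) <= pot S1"
 obtain hl1 where hl1: "pairs_at@@S1 (aBA g) (aBB g) (vBc g) hl1"
 "~bad S1 ==> vl S1 vFlag = 0 ==> set hl1 = edge_seq E LV" using I by blast
 have bc: "vl S1 (vBc g) = 0 <-> hl1 = []" using hl1(1) by (simp add: pairs_at_def)
 show "sp (Cond ($(vBc g)) (Asg vFlag (Lit 1)) Skip) S1 ?Q"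
 proof (rule sp_Cond)
 assume "ev w S1 ($(vBc g)) ~= 0"
 hence ne: "set hl1 ~= {}" using bc by simp
 have "status ((vl S1)(vFlag := 1)) (ar S1) (bad S1) k (?W LV) (?R LV)"
 by (rule status_raise[OF conjunct2[OF I]]) (insert ne hl1(2) final, auto simp: not_le[symmetric])
 thus "sp (Asg vFlag (Lit 1)) (tick S1) ?Q"
 using pot1 by (intro sp_Asg_eq[where v = 1]) auto
 next
 assume "ev w S1 ($(vBc g)) = 0"
 thus "sp Skip (tick S1) ?Q" using bc I hl1(2) pot1 by (intro sp_Skip) auto
qed
 qed simp_all
qed

end

section \<open>The search inside the neighbourhood of one vertex\<close>

definition halved_exp :: "exp => exp" where
 "halved_exp e = Op Shr (Lit 2 [*] $vM) e"

definition rate_exp1 :: "exp => exp" where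
 "rate_exp1 e = Op Div ($vB) ((halved_exp e [+] Lit 1) [*] $vD)"

text \<open>At level 0 the subtraction wraps around; the leading factor discards the
  outcome.\<close>

definition thr_exp1 :: exp where
 "thr_exp1 = (Lit 0 [<] $(vLevel 1)) [*] Op Div (Lit 24 [*] $vTau)
 ((rate_exp1 ($(vLevel 1) [-] Lit 1) [+] Lit 1) [*] (halved_exp ($(vLevel 1)) [+] Lit 1))"

definition deg_sq_exp :: "nat => exp" where
 "deg_sq_exp g = Read (aDeg g) ($(vVert g)) [*] Read (aDeg g) ($(vVert g))"

definition act_1 :: com where
 "act_1 = charged (deg_sq_exp 1) (nb_pairs 1
 (Asg vE1 ($vBase) ;; Asg vE2 ($(vVert 1)) ;; Asg vE3 ($(vNbI 1)) ;; Asg vE4 ($(vNbJ 1)) ;; emit))"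

definition fill1 :: com where
 "fill1 = Asg vWN ($vRN) ;; For vI vRN (Write aWC ($vI) ($vBase) ;; Write aWD ($vI) (Read aRW ($vI)))"

lemma written_act1: "wvars act_1 = {vFlag, vWk, vDg 1, vIx 1, vNbI 1, vJx 1, vNbJ 1, vE1, vE2, vE3, vE4, vCnt, vKey, vP}"
 "warrs act_1 = {aOut, aDict, aKey, aSort}"
 by (auto simp: act_1_def written_charged written_nb_pairs written_emit)

lemma written_fill1: "wvars fill1 = {vWN, vI}" "warrs fill1 = {aWC, aWD}"
 by (auto simp: fill1_def w_For)

context budget
begin

text \<open>The bound aimed at for level \<open>l\<close>: on the number of edges in the outer
  search, and on the number of rows of all neighbourhoods together in the inner one.\<close>

definition halved :: "nat => nat" where "halved l = 2 * m div 2 ^ l"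

text \<open>The largest threshold \<open>r\<close> with
  \<open>r * ((halved l + 1) * D) <= B\<close>. Each neighbourhood has at most \<open>D\<close> rows
  and all together have at most \<open>halved l\<close>, so the dominant terms
  \<open>r * h * h\<close> of their searches add up to at most \<open>B\<close>.\<close>

definition rate1 :: "nat => nat" where "rate1 l = B div ((halved l + 1) * D)"

text \<open>If there are few cliques, all neighbourhoods together enter level \<open>l\<close> with
  at most \<open>24 * tu div (rate1 (l - 1) + 1)\<close> edges. This degree threshold leaves at most
  \<open>halved l\<close> high vertices among them. At level 0 every vertex counts as high.\<close>

definition thr1 :: "nat => nat" where
 "thr1 l = (if l = 0 then 0 else 24 * tu div ((rate1 (l - 1) + 1) * (halved l + 1)))"

lemma halved_le: "halved l <= 2 * m"
 by (simp add: halved_def)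

lemma rate1_le: "rate1 l <= B"
 by (simp add: rate1_def)

lemma mult_less: "x <= 2 * U ==> y <= 2 * U ==> x * y < 2 ^ w" "x <= 2 * U ==> x < 2 ^ w"
proof -
 have "4 * (U * U) <= U * (U * U)" using U(1) by (intro mult_le_mono1) simp
 also have "... = U ^ 3" by (simp add: power3_eq_cube)
 also have "... < 2 ^ w" by (rule U_pow_less) simp
 finally have 4: "4 * (U * U) < 2 ^ w" .
 show *: "x * y < 2 ^ w" if "x <= 2 * U" "y <= 2 * U" for x y
 using mult_le_mono[OF that] 4 by linarith
 show "x < 2 ^ w" if "x <= 2 * U"
 using *[OF that, of 1] U(1) by simp
qed

lemma eval_halved: "V vM = m ==> eval w V A e = l ==> eval w V A (halved_exp e) = halved l"
 using mult_less(2)[of "2 * m"] U(3) by (simp add: halved_exp_def halved_def)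

lemma eval_rate1: "env V A k ==> eval w V A e = l ==> eval w V A (rate_exp1 e) = rate1 l"
proof -
 assume env: "env V A k" and e: "eval w V A e = l"
 have 1: "halved l + 1 <= 2 * U" using halved_le[of l] U(1,3) by simp
 have D: "D <= 2 * U" using BD by simp
 show "eval w V A (rate_exp1 e) = rate1 l"
 using env_D(9-11)[OF env]
 by (simp only: rate_exp1_def eval.simps binop_val.simps eval_halved[OF _ e] mod_less[OF small_less[of 1]]
 mod_less[OF mult_less(2)[OF 1]] mod_less[OF mult_less(1)[OF 1 D]] rate1_def)
qed

lemma eval_thr1: "env V A k ==> V (vLevel 1) = l ==> l < LV ==> eval w V A thr_exp1 = thr1 l"
proof -
 assume env: "env V A k" and l: "V (vLevel 1) = l" "l < LV"
 define p where "p = eval w V A ($(vLevel 1) [-] Lit 1)"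
 define y where "y = 24 * tu div ((rate1 p + 1) * (halved l + 1))"
 have 1: "halved l + 1 <= 2 * U" using halved_le[of l] U(1,3) by simp
 have 2: "rate1 p + 1 <= 2 * U" using rate1_le[of p] BD by simp
 have 3: "24 * tu <= 2 * U" using tau by simp
 have ev: "eval w V A ($(vLevel 1)) = l" using l by simp
 have y: "eval w V A (Op Div (Lit 24 [*] $vTau) ((rate_exp1 ($(vLevel 1) [-] Lit 1) [+] Lit 1) [*] (halved_exp ($(vLevel 1)) [+] Lit 1))) = y"
 using mult_less(2)[OF 1] mult_less(2)[OF 2] mult_less(2)[OF 3] mult_less(1)[OF 2 1]
 eval_rate1[OF env p_def[symmetric]] eval_halved[OF env_D(11)[OF env] ev] env_D(8)[OF env]
 by (simp add: y_def)
 have "y <= 24 * tu" by (simp add: y_def)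
 hence yw: "y < 2 ^ w" using mult_less(2)[OF 3] by linarith
 have pos: "eval w V A (Lit 0 [<] $(vLevel 1)) = of_bool (0 < l)" using l(1) by simp
 have "eval w V A thr_exp1 = of_bool (0 < l) * y mod 2 ^ w"
 unfolding thr_exp1_def by (subst eval.simps(3)) (simp only: pos y binop_val.simps)
 moreover have "p = l - 1" if "0 < l"
 proof -
 show ?thesis using l(2) LV(3) mult_less(2)[of "l - 1"] l(1) that by (cases l) (simp_all add: p_def)
qed
 ultimately show "eval w V A thr_exp1 = thr1 l" using yw by (cases "l = 0") (simp_all add: thr1_def y_def)
qed

lemma eval_deg_sq:
 assumes "built g V A hl" "distinct hl" "set hl <= adj k" "V (vVert g) = a" "a : fst ` set hl"
 shows "eval w V A (deg_sq_exp g) = dg (set hl) a * dg (set hl) a" "dg (set hl) a <= n" "1 <= dg (set hl) a"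
proof -
 show n: "dg (set hl) a <= n" using length_nbs(1)[OF assms(2,3)] by (simp add: length_nbs_dg[OF assms(2)])
 have "nbs hl a ~= []" using assms(5) by (simp add: nbs_eq_Nil)
 thus "1 <= dg (set hl) a" using length_nbs_dg[OF assms(2), of a] by (cases "nbs hl a") auto
 show "eval w V A (deg_sq_exp g) = dg (set hl) a * dg (set hl) a"
 using built_D(3)[OF assms(1,2,5)] assms(4) mult_less(1)[of "dg (set hl) a" "dg (set hl) a"] n U(2)
 by (simp add: deg_sq_exp_def)
qed

lemma sp_act1:
 assumes env: "env@@S k" and v: "vl S vBase = v" "v < n" and built: "(built 1)@@S hl" and hl: "distinct hl" "set hl <= adj k"
 and a: "vl S (vVert 1) = a" "a : fst ` set hl" and st: "status@@@S k W R"
 shows "sp act_1 S (%S'. status@@@S' k (W + dg (set hl) a * dg (set hl) a)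
 (R Un {{v, a, b, c} | b c. (a, b) : set hl & (a, c) : set hl}) & pot S - 50 <= pot S')" (is "sp _ S ?Q")
 unfolding act_1_def
proof -
 let ?d = "dg (set hl) a" let ?c = "Asg vE1 ($vBase) ;; Asg vE2 ($(vVert 1)) ;; Asg vE3 ($(vNbI 1)) ;; Asg vE4 ($(vNbJ 1)) ;; emit"
 note d = eval_deg_sq[OF built hl a]
 have an: "a < n" using a(2) hl(2) adj_less by fastforce
 have lend: "length (nbs hl a) = ?d" by (rule length_nbs_dg[OF hl(1)])
 show "sp (charged (deg_sq_exp 1) (nb_pairs 1 ?c)) S ?Q"
 proof (rule sp_charged[OF st env, where x = "?d * ?d" and y = "?d * ?d"])
 fix S1 :: cst
 assume "!!x. x ~= vFlag ==> vl S1 x = vl S x" "ar S1 = ar S"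
 thus "ev w S1 (deg_sq_exp 1) = ?d * ?d" using d(1) by (simp add: deg_sq_exp_def)
 next
 have "?d * ?d <= U ^ 2" using d(2) U(2) by (simp add: power2_eq_square mult_le_mono)
 also have "... <= U ^ 6" using U(1) by (intro power_increasing) auto
 finally show "?d * ?d <= U ^ 6" .
 next
 fix S1 :: cst
 assume "!!W' R'. W + ?d * ?d <= W' ==> status@@@S1 k W' R'" "pot S - 5 <= pot S1"
 thus "?Q S1" by simp
 next
 fix S1 :: cst
 assume S1: "vl S1 vFlag = 0" "!!x. x ~= vWk ==> vl S1 x = vl S x" "ar S1 = ar S" "bad S1 = bad S"
 "status@@@S1 k (W + ?d * ?d) R" "pot S + ka * real (?d * ?d) - 5 <= pot S1"
 let ?ns = "nbs hl a"
 let ?R = "%q. (if bad S1 then {} else R) Un (\<Union>q'<q. {{v, a, ?ns ! (q' div ?d), ?ns ! (q' mod ?d)}})"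
 let ?I = "%q V A b. progress V A k 0 (?R q) & b = bad S1"
 have built1: "(built 1)@@S1 hl" by (rule built_same[OF built]) (use S1 in auto)
 have env1: "env@@S1 k" by (rule env_same[OF env]) (use S1 in auto)
 have "sp (nb_pairs 1 ?c) S1 (%S'. (?I (?d * ?d))@@@S' & clk S1 - (3 + 5 * real ?d + (20 + 3) * real (?d * ?d)) <= clk S')"
 proof (rule sp_nb_pairs[OF built1 env_D(4)[OF env1] hl, where v = a and I = ?I and t = 20, unfolded lend])
 show "vl S1 (vVert 1) = a" using a S1 by auto
 show "(?I 0)@@@S1" using status_progress[OF S1(5,1)] by simp
 fix S2 :: cst and q
 assume q: "q < ?d * ?d" and ni: "vl S2 (vNbI 1) = ?ns ! (q div ?d)" and nj: "vl S2 (vNbJ 1) = ?ns ! (q mod ?d)"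
 and V2: "!!x. x ~: {vDg 1, vIx 1, vNbI 1, vJx 1, vNbJ 1} Un wvars ?c ==> vl S2 x = vl S1 x"
 "!!a. a ~: warrs ?c ==> ar S2 a = ar S1 a" and I: "(?I q)@@@S2"
 have "0 < ?d" using q by (cases ?d) auto
 hence qd: "q div ?d < length ?ns" "q mod ?d < length ?ns" using q lend by (simp_all add: less_mult_imp_div_less)
 have nn: "?ns ! (q div ?d) < n" "?ns ! (q mod ?d) < n"
 using length_nbs(2)[OF hl nth_mem[OF qd(1)]] length_nbs(2)[OF hl nth_mem[OF qd(2)]] .
 have env2: "env@@S2 k" by (rule env_same[OF env1]) (insert V2, auto simp: written_emit)
 have v2: "vl S2 vBase = v" "vl S2 (vVert 1) = a" using V2(1)[] V2(1)[of "vVert 1"] S1(2) v a by (auto simp: written_emit)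
 let ?S3 = "S2(|vl := (vl S2)(vE1 := v, vE2 := a, vE3 := ?ns ! (q div ?d), vE4 := ?ns ! (q mod ?d)), clk := clk S2 - 4|)"
 have "sp emit ?S3 (%S'. progress@@S' k 0 (insert {v, a, ?ns ! (q div ?d), ?ns ! (q mod ?d)} (?R q)) & bad S' = bad ?S3 & clk ?S3 - 16 <= clk S')"
 by (rule sp_emit_progress) (use env_D(1-3)[OF env2] I v an nn in simp_all)
 hence "sp emit ?S3 (%S''. (?I (Suc q))@@@S'' & clk S2 - 20 <= clk S'')"
 by (rule sp_weak) (insert I, auto simp: lessThan_Suc Un_insert_right insert_commute)
 thus "sp ?c S2 (%S''. (?I (Suc q))@@@S'' & clk S2 - 20 <= clk S'')"
 using v2 ni nj
 by (intro sp_Seq sp_Asg_eq[where v = v and x = vE1] sp_Asg_eq[where v = a and x = vE2]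
 sp_Asg_eq[where v = "?ns ! (q div ?d)" and x = vE3] sp_Asg_eq[where v = "?ns ! (q mod ?d)" and x = vE4]) simp_all
 qed (insert a(2), auto simp: written_emit)
 thus "sp (nb_pairs 1 ?c) S1 ?Q"
 proof (rule sp_weak)
 fix S2 :: cst
 assume fr: "frame (nb_pairs 1 ?c) S1 S2" and S2: "(?I (?d * ?d))@@@S2 & clk S1 - (3 + 5 * real ?d + (20 + 3) * real (?d * ?d)) <= clk S2"
 have wk: "vl S2 vWk = vl S1 vWk" using fr by (simp add: frame_def written_nb_pairs written_emit)
 have sub: "R Un {{v, a, b, c} | b c. (a, b) : set hl & (a, c) : set hl} <= ?R (?d * ?d)" if "~bad S1"
 proof -
 have "\<exists>q<?d * ?d. {v, a, b, c} = {v, a, ?ns ! (q div ?d), ?ns ! (q mod ?d)}" if bc: "(a, b) : set hl" "(a, c) : set hl" for b c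
 proof -
 have "b : set ?ns" "c : set ?ns" using bc by (simp_all add: set_nbs)
 then obtain i j where ij: "i < ?d" "?ns ! i = b" "j < ?d" "?ns ! j = c" by (metis in_set_conv_nth lend)
 thus ?thesis by (intro exI[of _ "i * ?d + j"]) (auto intro: madd_less)
 qed
 thus ?thesis using that by auto
 qed
 have "status@@@S2 k (W + ?d * ?d) (R Un {{v, a, b, c} | b c. (a, b) : set hl & (a, c) : set hl})"
 by (rule progress_status[OF S1(5,1) _ conjunct1[OF conjunct1[OF S2]] wk]) (use S2 in simp, rule sub, use S2 in simp)
 moreover have "pot S - 50 <= pot S2"
 proof -
 have "real ?d <= real (?d * ?d)" using d(3) by (simp add: )
 moreover have "4000 * real (?d * ?d) <= ka * real (?d * ?d)" using kappa_ge by (intro mult_right_mono) auto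
 moreover have "pot S1 - (3 + 5 * real ?d + (20 + 3) * real (?d * ?d)) <= pot S2" using S2 wk by (simp add: pot_def)
 moreover have "0 <= real (?d * ?d)" by simp
 ultimately show ?thesis using S1(6) by argo
 qed
 ultimately show "?Q S2" by blast
 qed
 qed simp
qed

lemma sp_fill1:
 assumes v: "vl S vBase = v" "v < n" and rs: "stores (ar S aRW) rs" "vl S vRN = length rs" "set rs <= {..<n}" "distinct rs"
 shows "sp fill1 S (%S'. (\<exists>ws. search@@S' rs ws & distinct ws & set ws = {v} \<times> set rs) & bad S' = bad S &
 clk S - (3 + 4 * real (length rs)) <= clk S')" (is "sp _ S ?Q")
 unfolding fill1_def
proof (rule sp_Seq, rule sp_Asg_eq[where v = "length rs"], simp add: rs)
 let ?b = "Write aWC ($vI) ($vBase) ;; Write aWD ($vI) (Read aRW ($vI))"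
 let ?S0 = "(upd S vWN (length rs))"
 have nU: "length rs <= U" using card_mono[OF _ rs(3)] rs(4) U(2) by (simp add: distinct_card)
 show "sp (For vI vRN ?b) ?S0 ?Q"
 proof (rule sp_For_time[where n = "length rs" and t = 2 and
 I = "%i V A b. b = bad S & (\<forall>j<i. A aWC j = v & A aWD j = rs ! j)"])
 fix i and S1 :: cst
 assume fr: "frame (For vI vRN ?b) ?S0 S1" and i: "i < length rs" "vl S1 vI = i" and I: "bad S1 = bad S & (\<forall>j<i. ar S1 aWC j = v & ar S1 aWD j = rs ! j)"
 have "vl S1 vBase = v" "ar S1 aRW i = rs ! i" using fr v rs i(1) by (auto simp: frame_def w_For stores_def)
 thus "sp ?b S1 (%S''. (bad S'' = bad S & (\<forall>j<Suc i. ar S'' aWC j = v & ar S'' aWD j = rs ! j)) & clk S1 - 2 <= clk S'')"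
 using i I by (intro sp_Seq sp_Write_eq[where x = i and v = v] sp_Write_eq[where x = i and v = "rs ! i"]) (auto simp: )
 next
 fix S1 :: cst
 assume fr: "frame (For vI vRN ?b) ?S0 S1" and I: "bad S1 = bad S & (\<forall>j<length rs. ar S1 aWC j = v & ar S1 aWD j = rs ! j)"
 and clk: "clk ?S0 - (2 + real (length rs) * (2 + 2)) <= clk S1"
 have "search@@S1 rs (map (Pair v) rs)"
 using fr I rs v nU by (auto simp: search_def frame_def w_For stores_def)
 moreover have "distinct (map (Pair v) rs)" "set (map (Pair v) rs) = {v} \<times> set rs" using rs(4) by (auto simp: distinct_map inj_on_def)
 ultimately show "?Q S1" using I clk by auto
 qed (use rs in simp_all)
qed

text \<open>Taking \<open>v mod n\<close> makes the statement true for every number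
  \<open>v\<close>, so that it can serve as an unconditional interpretation; for a vertex it is
  \<open>v\<close> itself.\<close>

lemma solver1: "solver w M C ep mu N n m tt U rho es tu B D LV Bud k 1 (v mod n) thr_exp1 (rate_exp1 ($(vLevel 1))) act_1 fill1 thr1 rate1
 (%X E. {v mod n} \<times> X) (%E a. dg E a * dg E a) (%E a. {{v mod n, a, b, c} | b c. (a, b) : E & (a, c) : E})"
proof (intro solver.intro solver_axioms.intro)
 show "budget w M C ep mu N n m tt U rho es tu B D LV Bud" by (rule budget_axioms)
next
 fix x a :: nat
 show "x : wvars act_1 ==> 9 < x & x ~= vJJ & x ~: {vBc 1, vVc 1, vLevel 1, vPos 1, vVert 1} & (1 = (1::nat) --> x ~= vBase)"
 "a : warrs act_1 ==> a ~: {aEU, aEV, aPos, aBA 1, aBB 1, aDeg 1, aNb 1, aVl 1}"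
 by (auto simp: written_act1)
 show "wvars fill1 <= {vWN, vI}" "warrs fill1 <= {aWC, aWD}" by (auto simp: written_fill1)
next
 fix V A l assume "env V A k" "V (vLevel 1) = l" "l < LV"
 thus "eval w V A thr_exp1 = thr1 l" by (rule eval_thr1)
next
 fix V A l assume *: "env V A k" "V (vLevel 1) = l" "l < LV"
 thus "eval w V A (rate_exp1 ($(vLevel 1))) = rate1 l" by (intro eval_rate1[OF *(1)]) simp
next
 fix l show "rate1 l <= U" using rate1_le[of l] BD by simp
next
 fix S :: cst and hl a W R
 assume *: "env@@S k" "1 = (1::nat) --> vl S vBase = v mod n" "(built 1)@@S hl" "distinct hl" "set hl <= adj k"
 "vl S (vVert 1) = a" "a : fst ` set hl" "status@@@S k W R"
 have "0 < n" using *(5,7) adj_less by fastforce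
 thus "sp act_1 S (%S'. status@@@S' k (W + dg (set hl) a * dg (set hl) a)
 (R Un {{v mod n, a, b, c} | b c. (a, b) : set hl & (a, c) : set hl}) & pot S - 50 <= pot S')"
 using * by (intro sp_act1[where k = k]) auto
next
 fix S :: cst and hl rs
 assume *: "env@@S k" "1 = (1::nat) --> vl S vBase = v mod n" "stores (ar S aRW) rs" "vl S vRN = length rs" "distinct rs"
 "set rs <= {..<n}" "length rs <= length hl"
 have n: "0 < n"
 proof -
 have "es ~= []" using es(1) balance(1) by auto
 thus ?thesis using es(3)[of "fst (hd es)" "snd (hd es)"] by (cases ) auto
 qed
 show "sp fill1 S (%S'. (\<exists>ws. search@@S' rs ws & distinct ws & set ws = {v mod n} \<times> set rs) & bad S' = bad S &
 clk S - (10 + 10 * real (length hl)) <= clk S')"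
 proof (rule sp_weak[OF sp_fill1[OF mp[OF *(2) refl] _ *(3,4,6,5)]])
 show "v mod n < n" using n by simp
 qed (use *(7) in auto)
qed

sublocale s1: solver w M C ep mu N n m tt U rho es tu B D LV Bud k 1 "v mod n" thr_exp1 "rate_exp1 ($(vLevel 1))" act_1 fill1 thr1 rate1
 "%X E. {v mod n} \<times> X" "%E a. dg E a * dg E a" "%E a. {{v mod n, a, b, c} | b c. (a, b) : E & (a, c) : E}" for k v
 by (rule solver1)

end

section \<open>Counting cliques, heavy pairs and degrees\<close>

lemma card_lists_4: "card K = 4 ==> card {xs. length xs = 4 & distinct xs & set xs <= K} = (24 :: nat)"
proof -
 assume K: "card K = 4"
 hence "finite K" by (auto intro: card_ge_0_finite)
 hence "card {xs. length xs = 4 & distinct xs & set xs <= K} = \<Prod>{card K - 4 + 1 .. card K}"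
 by (intro card_lists_distinct_length_eq) (simp_all add: K)
 also have "... = 24" by (simp add: K) code_simp
 finally show ?thesis .
qed

lemma sum_dg: "finite E ==> finite X ==> (\<Sum>a\<in>X. dg E a) = card {e : E. fst e : X}"
proof -
 assume E: "finite E" and X: "finite X"
 have fin: "finite {b. (a, b) : E}" for a
 by (rule finite_subset[of _ "snd ` E"]) (use E in force)+
 have "(\<Sum>a\<in>X. dg E a) = card (SIGMA a:X. {b. (a, b) : E})" using X fin by (simp add: dg_def)
 also have "(SIGMA a:X. {b. (a, b) : E}) = {e : E. fst e : X}" by auto
 finally show ?thesis .
qed

lemma sum_dg_le: "finite E ==> finite X ==> (\<Sum>a\<in>X. dg E a) <= card E"
 by (simp add: sum_dg card_mono)

lemma dg_pos: "finite E ==> a : fst ` E ==> 1 <= dg E a"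
proof -
 assume E: "finite E" "a : fst ` E"
 have "finite {b. (a, b) : E}" by (rule finite_subset[of _ "snd ` E"]) (use E in force)+
 moreover have "{b. (a, b) : E} ~= {}" using E(2) by force
 ultimately show ?thesis by (simp add: dg_def Suc_le_eq card_gt_0_iff)
qed

lemma card_high_verts: "finite E ==> card (hverts E h) * (h + 1) <= card E"
proof -
 assume E: "finite E"
 hence fin: "finite (hverts E h)" by (simp add: hverts_def)
 have "card (hverts E h) * (h + 1) <= (\<Sum>a\<in>hverts E h. dg E a)"
 using sum_bounded_below[of "hverts E h" "h + 1" "dg E"] by (simp add: hverts_def )
 also have "... <= card E" by (rule sum_dg_le[OF E fin])
 finally show ?thesis .
qed

lemma sum_low_verts: "finite E ==> (\<Sum>a\<in>lverts E h. dg E a * dg E a) <= h * card E"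
proof -
 assume E: "finite E"
 have "(\<Sum>a\<in>lverts E h. dg E a * dg E a) <= (\<Sum>a\<in>lverts E h. h * dg E a)"
 by (intro sum_mono ) (simp add: lverts_def)
 also have "... = h * (\<Sum>a\<in>lverts E h. dg E a)" by (simp add: sum_distrib_left)
 also have "... <= h * card E" using E by (intro mult_le_mono2 sum_dg_le) (auto simp: lverts_def)
 finally show ?thesis .
qed

text \<open>Both \<open>T\<close> and \<open>th * (M + 1)\<close> are at most a/q, and q is at least
  B/(M' D), so th T is at most a^2 M'^2 D^2 / (B^2 (M + 1)). One factor M' cancels against M + 1,
  the other is at most 3m, and the hypothesis on D^2 m a^2 finishes. Multiplying by (M + 1) B^2
  avoids division.\<close>

lemma balance_low:
 fixes T q a th M M' D B c m :: nat
 assumes "T * q <= a" "th * (q * (M + 1)) <= a" "B <= q * (M' * D)" "M' <= 2 * (M + 1)" "M' <= 3 * m"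
 "D * D * m * (a * a) <= c * (B * B * B)" "0 < B"
 shows "th * T <= 6 * c * B"
proof -
 have "(th * T) * ((M + 1) * (B * B)) <= (th * T) * ((M + 1) * ((q * (M' * D)) * (q * (M' * D))))"
 by (intro mult_le_mono le_refl assms(3))
 also have "... = (T * q) * (th * (q * (M + 1))) * ((M' * M') * (D * D))" by (simp add: ac_simps)
 also have "... <= a * a * ((2 * (M + 1)) * (3 * m) * (D * D))" by (intro mult_le_mono le_refl assms)
 also have "... = 6 * (M + 1) * (D * D * m * (a * a))" by (simp add: algebra_simps)
 also have "... <= 6 * (M + 1) * (c * (B * B * B))" by (intro mult_le_mono le_refl assms)
 also have "... = (6 * c * B) * ((M + 1) * (B * B))" by (simp only: ac_simps)
 finally show ?thesis using assms(7) by (subst () ) simp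
qed

context lister
begin

lemma finite_sub_adj: "E <= adj k ==> finite E"
 by (rule finite_subset) auto

lemma card_sub_adj: "E <= adj k ==> card E <= 2 * m"
 using card_mono[of "adj k" E] card_length[of "take (2 * k) es"] es(1) by simp

lemma clique_adj:
 assumes k: "k <= m" and "(a, b) : adj k" "(a, c) : adj k" "(a, d) : adj k" "(b, c) : adj k" "(b, d) : adj k" "(c, d) : adj k"
 shows "{a, b, c, d} : cl k" "distinct [a, b, c, d]"
proof -
 have ne: "a ~= b" "a ~= c" "a ~= d" "b ~= c" "b ~= d" "c ~= d" "a < n" "b < n" "c < n" "d < n"
 using adj_less assms by blast+
 moreover have "\<forall>u\<in>{a, b, c, d}. \<forall>v\<in>{a, b, c, d}. u ~= v --> (u, v) : adj k"
 using assms adj_sym[] by auto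
 ultimately show "{a, b, c, d} : cl k" "distinct [a, b, c, d]" by (auto simp: clique_set_def)
qed

text \<open>Ordered cliques. A clique has 4! = 24 orderings, the origin of the 24 in all
  thresholds.\<close>

definition quads :: "nat => nat list set" where
 "quads k = {xs. length xs = 4 & distinct xs & set xs : cl k}"

lemma quads: "finite (quads k)" "card (quads k) <= 24 * card (cl k)"
proof -
 let ?L = "%K. {xs. length xs = 4 & distinct xs & set xs <= (K :: nat set)}"
 have c: "card K = 4" if "K : cl k" for K using clqD(2)[OF that] .
 have fin: "finite (?L K)" if "K : cl k" for K
 using card_lists_4[OF c[OF that]] by (auto intro: card_ge_0_finite)
 have sub: "quads k <= (\<Union>K\<in>cl k. ?L K)" by (auto simp: quads_def)
 have finU: "finite (\<Union>K\<in>cl k. ?L K)" using finite_clique_set fin by blast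
 thus "finite (quads k)" by (rule finite_subset[OF sub])
 have "card (quads k) <= card (\<Union>K\<in>cl k. ?L K)" by (rule card_mono[OF finU sub])
 also have "... <= (\<Sum>K\<in>cl k. card (?L K))" by (rule card_UN_le[OF finite_clique_set])
 also have "... = (\<Sum>K\<in>cl k. 24)" by (intro sum.cong refl card_lists_4 c)
 finally show "card (quads k) <= 24 * card (cl k)" by simp
qed

definition wits :: "nat => (nat \<times> nat) set => nat \<times> nat => (nat \<times> nat) set" where
 "wits k W e = {f : W. witness k (fst e) f & witness k (snd e) f}"

lemma finite_heavy: "finite (heavy k X W r)"
 by (rule finite_sub_adj[of _ ]) (auto simp: heavy_def)

lemma card_heavy: "finite W ==> card (heavy k X W r) * (r + 1) <= card (SIGMA e:heavy k X W r. wits k W e)"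
proof -
 assume W: "finite W"
 have "card (heavy k X W r) * (r + 1) <= (\<Sum>e\<in>heavy k X W r. card (wits k W e))"
 using sum_bounded_below[of "heavy k X W r" "r + 1" "%e. card (wits k W e)"]
 by (simp add: heavy_def wits_def )
 also have "... = card (SIGMA e:heavy k X W r. wits k W e)" using W finite_heavy by (simp add: wits_def)
 finally show ?thesis .
qed

text \<open>A heavy pair followed by one of its witness edges is an ordered clique, and the pair and
  the edge can be recovered from it. Each heavy pair contributes more than \<open>r\<close> of
  them.\<close>

lemma heavy_edges_bound:
 assumes k: "k <= m" and W: "W <= adj k"
 shows "card (heavy k X W r) * (r + 1) <= 24 * card (cl k)"
proof -
 have fin: "finite W" using W by (rule finite_sub_adj)
 let ?T = "SIGMA e:heavy k X W r. wits k W e" let ?f = "%(e, f). [fst e, snd e, fst f, snd f]"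
 have "inj_on ?f ?T" by (rule ) auto
 moreover have "?f ` ?T <= quads k"
 proof
 fix q assume "q : ?f ` ?T"
 then obtain a b c d where q: "q = [a, b, c, d]" "(a, b) : heavy k X W r" "(c, d) : wits k W (a, b)"
 by fastforce
 hence "(a, b) : adj k" "(a, c) : adj k" "(a, d) : adj k" "(b, c) : adj k" "(b, d) : adj k" "(c, d) : adj k"
 using W by (auto simp: heavy_def wits_def witness_def)
 note c = clique_adj[OF k this]
 thus "q : quads k" by (simp add: quads_def q(1))
 qed
 ultimately have "card ?T <= card (quads k)" by (rule card_inj_on_le[OF _ _ quads(1)])
 thus ?thesis using card_heavy[OF fin, of k X r] quads(2)[of k] by linarith
qed

text \<open>The same injection, with the centre \<open>v\<close> as the first vertex of the ordered
  clique. The centre tells the neighbourhoods apart, so a single count of the cliques bounds the sum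
  over all of them.\<close>

lemma heavy_stars_bound:
 assumes k: "k <= m" and Vs: "finite Vs" and X: "!!v. v : Vs ==> X v <= {a. (v, a) : adj k}"
 shows "(\<Sum>v\<in>Vs. card (heavy k (X v) ({v} \<times> X v) r)) * (r + 1) <= 24 * card (cl k)"
proof -
 have fin: "finite ({v} \<times> X v)" if "v : Vs" for v
 proof -
 have "X v <= {..<n}" using X[OF that] adj_less by blast
 thus ?thesis by (simp add: finite_subset)
 qed
 let ?T = "%v. SIGMA e:heavy k (X v) ({v} \<times> X v) r. wits k ({v} \<times> X v) e" let ?S = "SIGMA v:Vs. ?T v"
 let ?f = "%(v, e, f). [v, fst e, snd e, snd f]"
 have S: "\<exists>v a b c. x = (v, (a, b), (v, c)) & v : Vs & (a, b) : heavy k (X v) ({v} \<times> X v) r & (v, c) : wits k ({v} \<times> X v) (a, b)"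
 if "x : ?S" for x
 using that prod.exhaust by (auto simp: wits_def)
have "inj_on ?f ?S"
 proof (rule inj_onI)
 fix x y assume "x : ?S" "y : ?S" and f: "?f x = ?f y"
 obtain v a b c where x: "x = (v, (a, b), (v, c))" using S[OF \<open>x : ?S\<close>] by blast
 obtain v' a' b' c' where y: "y = (v', (a', b'), (v', c'))" using S[OF \<open>y : ?S\<close>] by blast
 show "x = y" using f by (simp add: x y)
 qed
 moreover have "?f ` ?S <= quads k"
 proof
 fix q assume "q : ?f ` ?S"
 then obtain x where x: "x : ?S" "q = ?f x" by blast
 obtain v a b c where x': "x = (v, (a, b), (v, c))" and v: "v : Vs" and
 q: "(a, b) : heavy k (X v) ({v} \<times> X v) r" "(v, c) : wits k ({v} \<times> X v) (a, b)" using S[OF x(1)] by blast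
 have q1: "q = [v, a, b, c]" by (simp add: x(2) x')
 have "(v, a) : adj k" "(v, b) : adj k" "(v, c) : adj k" "(a, b) : adj k" "(a, c) : adj k" "(b, c) : adj k"
 using X[OF v] q by (auto simp: heavy_def wits_def witness_def)
 note c = clique_adj[OF k this]
 thus "q : quads k" by (simp add: quads_def q1)
 qed
 ultimately have le: "card ?S <= card (quads k)" by (rule card_inj_on_le[OF _ _ quads(1)])
 have finT: "finite (?T v)" if "v : Vs" for v using finite_heavy fin[OF that] by (auto simp: wits_def)
 have "(\<Sum>v\<in>Vs. card (heavy k (X v) ({v} \<times> X v) r)) * (r + 1) = (\<Sum>v\<in>Vs. card (heavy k (X v) ({v} \<times> X v) r) * (r + 1))"
 by (rule sum_distrib_right)
 also have "... <= (\<Sum>v\<in>Vs. card (?T v))" by (intro sum_mono card_heavy fin)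
 also have "... = card ?S" using Vs finT by simp
 finally show ?thesis using le quads(2)[of k] by linarith
qed

lemma clique_rest:
 assumes "K : cl k" "a : K" "b : K" "a ~= b"
 obtains c d where "K = {a, b, c, d}" "c ~= d" "c ~: {a, b}" "d ~: {a, b}"
proof -
 have K: "card K = 4" using clqD(2)[OF assms(1)] .
 have "card (K - {a, b}) = 2" using K assms by (simp add: )
 then obtain c d where "K - {a, b} = {c, d}" "c ~= d" by (auto simp: card_2_iff)
 thus thesis using assms by (intro that[]) auto
qed

end

section \<open>Work and completeness of the inner searches\<close>

context budget
begin

definition sub_edges :: "nat => (nat \<times> nat) set => nat => (nat \<times> nat) set" where
 "sub_edges k E v = {(a, b). (v, a) : E & (v, b) : E & (a, b) : adj k}"

definition sseq :: "nat => (nat \<times> nat) set => nat => nat => (nat \<times> nat) set" where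
 "sseq k E v l = s1.edge_seq k v (sub_edges k E v) l"

abbreviation sverts :: "nat => (nat \<times> nat) set => nat => nat => nat set" where
 "sverts k E v l == hverts (sseq k E v l) (thr1 l)"

lemma star_seq_Suc: "v < n ==> sseq k E v (Suc l) = heavy k (sverts k E v l) ({v} \<times> sverts k E v l) (rate1 l)"
 unfolding sseq_def s1.edge_seq.simps s1.next_edges_def by simp

lemma star_level_work: "v < n ==> s1.lwork v F l = card F + 1 + (\<Sum>a\<in>lverts F (thr1 l). dg F a * dg F a) +
 swork (card (hverts F (thr1 l))) (card (hverts F (thr1 l))) (rate1 l)"
 unfolding s1.lwork_def by (simp add: card_cartesian_product_singleton)

lemma star_level_rep: "v < n ==> s1.lrep k v F l = (\<Union>a\<in>lverts F (thr1 l). {{v, a, b, c} | b c. (a, b) : F & (a, c) : F}) \<union>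
 lights k (hverts F (thr1 l)) ({v} \<times> hverts F (thr1 l)) (rate1 l)"
 unfolding s1.lrep_def by simp

lemma heavy_sub: "heavy k X W r <= X \<times> X Int adj k"
 by (auto simp: heavy_def)

lemma star_seq_sub: "v < n ==> sseq k E v l <= {a. (v, a) : E} \<times> {a. (v, a) : E} Int adj k"
proof (induction l)
 case 0
 show ?case unfolding sseq_def s1.edge_seq.simps by (auto simp: sub_edges_def)
next
 case (Suc l)
 have "sverts k E v l <= {a. (v, a) : E}" using Suc by (auto simp: hverts_def)
 thus ?case unfolding star_seq_Suc[OF Suc.prems] using heavy_sub by blast
qed

lemma finite_star_seq: "v < n ==> finite (sseq k E v l)"
 using star_seq_sub finite_sub_adj by blast

lemma star_verts_sub: "v < n ==> sverts k E v l <= {a. (v, a) : E}"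
 using star_seq_sub[of v k E l] by (auto simp: hverts_def)

lemma card_star_verts: "v < n ==> E <= adj k ==> card (sverts k E v l) <= dg E v"
proof -
 assume v: "v < n" and E: "E <= adj k"
 have "finite {a. (v, a) : E}" by (rule finite_subset[of _ "{..<n}"]) (use E adj_less in blast, simp)
 thus ?thesis using card_mono[OF _ star_verts_sub[OF v]] by (simp add: dg_def)
qed

lemma card_star_seq: "v < n ==> E <= adj k ==> card (sseq k E v l) <= dg E v * dg E v"
proof -
 assume v: "v < n" and E: "E <= adj k"
 have fin: "finite {a. (v, a) : E}" by (rule finite_subset[of _ "{..<n}"]) (use E adj_less in blast, simp)
 have "card (sseq k E v l) <= card ({a. (v, a) : E} \<times> {a. (v, a) : E})" using star_seq_sub[OF v] fin by (intro card_mono) auto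
thus ?thesis by (simp add: dg_def card_cartesian_product)
qed

lemma halved_Suc: "halved (Suc l) = halved l div 2" "halved l + 1 <= 2 * (halved (Suc l) + 1)" "halved 0 = 2 * m"
proof -
 show 1: "halved (Suc l) = halved l div 2" by (simp only: halved_def power_Suc2 div_mult2_eq)
 show "halved l + 1 <= 2 * (halved (Suc l) + 1)" unfolding 1 by presburger
qed (simp add: halved_def)

lemma halved_LV: "halved (LV - 1) = 0" "halved LV = 0"
proof -
 show 1: "halved (LV - 1) = 0" using LV(1) by (simp add: halved_def)
 show "halved LV = 0" using halved_Suc(1)[of "LV - 1"] LV(2) 1 by simp
qed

lemma mult_div_le: "(x :: nat) * (a div x) <= a"
 by (simp add: )

lemma less_mult_div: "0 < x ==> a < x * (a div x + 1)" for x :: nat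
 by (metis add.commute dividend_less_times_div add_mult_distrib2 nat_mult_1_right)

context
 fixes k :: nat and E :: "(nat \<times> nat) set" and Vs :: "nat set"
 assumes k: "k <= m" and E: "E <= adj k" and Vs: "Vs <= fst ` E" and few: "card (cl k) <= tt"
begin

lemma Vs_less: "v : Vs ==> v < n"
 using Vs E adj_less by fastforce

lemma finite_Vs: "finite Vs"
 using Vs finite_sub_adj[OF E] finite_surj by blast

lemma sum_dg_Vs: "(\<Sum>v\<in>Vs. dg E v) <= 2 * m"
 using sum_dg_le[OF finite_sub_adj[OF E] finite_Vs] card_sub_adj[OF E] by linarith

lemma cl_tau: "24 * card (cl k) <= 24 * tu"
 using few tau(1) by simp

lemma sum_star_Suc: "(\<Sum>v\<in>Vs. card (sseq k E v (Suc l))) * (rate1 l + 1) <= 24 * tu"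
proof -
 have "(\<Sum>v\<in>Vs. card (sseq k E v (Suc l))) = (\<Sum>v\<in>Vs. card (heavy k (sverts k E v l) ({v} \<times> sverts k E v l) (rate1 l)))"
 by (intro sum.cong refl) (simp only: star_seq_Suc[OF Vs_less])
 moreover have "(\<Sum>v\<in>Vs. card (heavy k (sverts k E v l) ({v} \<times> sverts k E v l) (rate1 l))) * (rate1 l + 1) <= 24 * card (cl k)"
 proof (rule heavy_stars_bound[OF k finite_Vs])
 fix v assume "v : Vs"
 thus "sverts k E v l <= {a. (v, a) : adj k}" using star_verts_sub[OF Vs_less, of ] E by blast
 qed
 ultimately show ?thesis using cl_tau by simp
qed

text \<open>At level 0 the rows of \<open>v\<close> are among its neighbours, and degrees sum to at
  most \<open>2 * m\<close>. Later \<open>sum_star_Suc\<close> bounds the edges left, every row has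
  more than \<open>thr1 l\<close> of them, and \<open>thr1\<close> was defined to give this
  bound.\<close>

lemma sum_star_verts: "(\<Sum>v\<in>Vs. card (sverts k E v l)) <= halved l"
proof (cases l)
 case 0
 have "(\<Sum>v\<in>Vs. card (sverts k E v l)) <= (\<Sum>v\<in>Vs. dg E v)"
 by (intro sum_mono card_star_verts Vs_less E)
 thus ?thesis using sum_dg_Vs by (simp add: 0 halved_Suc)
next
 case (Suc l')
 let ?T = "\<Sum>v\<in>Vs. card (sseq k E v l)" and ?H = "\<Sum>v\<in>Vs. card (sverts k E v l)" let ?q = "rate1 l' + 1"
 have "?H * (thr1 l + 1) <= ?T"
 unfolding sum_distrib_right by (intro sum_mono card_high_verts finite_star_seq Vs_less)
 hence "?H * (thr1 l + 1) * ?q <= ?T * ?q" by (rule mult_le_mono1)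
 also have "... <= 24 * tu" unfolding Suc by (rule sum_star_Suc)
 also have "... < ?q * (halved l + 1) * (thr1 l + 1)"
 using less_mult_div[of "?q * (halved l + 1)" "24 * tu"] by (simp add: thr1_def Suc)
 finally have "?H * ((thr1 l + 1) * ?q) < (halved l + 1) * ((thr1 l + 1) * ?q)" by (simp only: ac_simps)
 thus ?thesis by (subst (asm) mult_less_cancel2) simp
qed

text \<open>In h^2 one factor is at most \<open>D\<close> and the other sums to at most
  \<open>halved l\<close>. The choice of \<open>rate1\<close> turns the main term into
  \<open>2 * B\<close>, and \<open>m * D <= 2 * B\<close> bounds the rest by
  \<open>12 * B\<close>.\<close>

lemma sum_star_verts_sq:
 assumes D: "!!v. v : Vs ==> dg E v <= D"
 shows "(\<Sum>v\<in>Vs. swork (card (sverts k E v l)) (card (sverts k E v l)) (rate1 l)) <= 14 * B"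
proof -
 let ?h = "%v. card (sverts k E v l)" and ?r = "rate1 l"
 have "swork (?h v) (?h v) ?r <= (2 * ?r + 3) * D * ?h v" if "v : Vs" for v
 proof -
 have hD: "?h v <= D" using card_star_verts[OF Vs_less[OF that] E] D[OF that] by (rule le_trans)
 have "swork (?h v) (?h v) ?r <= ?h v * ?h v + (?r + 1) * (2 * (?h v * ?h v))"
 unfolding swork_def by (intro add_mono mult_le_mono le_refl) simp
 also have "... = (2 * ?r + 3) * ?h v * ?h v" by (simp add: algebra_simps)
 also have "... <= (2 * ?r + 3) * D * ?h v" by (intro mult_le_mono le_refl hD)
 finally show ?thesis .
 qed
 hence "(\<Sum>v\<in>Vs. swork (?h v) (?h v) ?r) <= (\<Sum>v\<in>Vs. (2 * ?r + 3) * D * ?h v)" by (rule sum_mono)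
 also have "... = (2 * ?r + 3) * D * (\<Sum>v\<in>Vs. ?h v)" by (simp only: sum_distrib_left)
 also have "... <= (2 * ?r + 3) * D * halved l" by (intro mult_le_mono2 sum_star_verts)
 also have "... <= 2 * (?r * ((halved l + 1) * D)) + 3 * (D * (2 * m))"
 proof -
 have "D * halved l <= D * (2 * m)" using halved_le by (rule mult_le_mono2)
 moreover have "(2 * ?r + 3) * D * halved l = 2 * (?r * (halved l * D)) + 3 * (D * halved l)" by (simp add: algebra_simps)
 moreover have "?r * (halved l * D) <= ?r * ((halved l + 1) * D)" by (intro mult_le_mono le_refl) simp
 ultimately show ?thesis by linarith
 qed
 also have "... <= 2 * B + 12 * B"
 proof -
 have "?r * ((halved l + 1) * D) <= B" unfolding rate1_def by (rule div_times_less_eq_dividend)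
 moreover have "D * (2 * m) = 2 * (m * D)" by simp
 ultimately show ?thesis using balance(6) by linarith
 qed
 finally show ?thesis by simp
qed

lemma sum_star_low: "(\<Sum>v\<in>Vs. \<Sum>a\<in>lverts (sseq k E v l) (thr1 l). dg (sseq k E v l) a * dg (sseq k E v l) a) <= 13824 * B"
proof -
 let ?T = "\<Sum>v\<in>Vs. card (sseq k E v l)"
 have "(\<Sum>v\<in>Vs. \<Sum>a\<in>lverts (sseq k E v l) (thr1 l). dg (sseq k E v l) a * dg (sseq k E v l) a) <=
 (\<Sum>v\<in>Vs. thr1 l * card (sseq k E v l))"
 by (intro sum_mono sum_low_verts finite_star_seq Vs_less)
 also have "... = thr1 l * ?T" by (simp only: sum_distrib_left)
 also have "... <= 13824 * B"
 proof (cases l)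
 case 0
 thus ?thesis by (simp add: thr1_def)
 next
 case (Suc l')
 \<comment> \<open>2304 is 4 * 24^2: the 4 comes from the balance inequality and the square from
   \<open>24 * tu\<close> entering twice.\<close>
 have "thr1 l * ?T <= 6 * 2304 * B"
 proof (rule balance_low)
 show "?T * (rate1 l' + 1) <= 24 * tu" unfolding Suc by (rule sum_star_Suc)
 show "thr1 l * ((rate1 l' + 1) * (halved l + 1)) <= 24 * tu"
 using mult_div_le[of "(rate1 l' + 1) * (halved l + 1)" "24 * tu"] by (simp add: thr1_def Suc mult.commute)
 have "0 < (halved l' + 1) * D" using BD by simp
 from less_mult_div[OF this, of B] show "B <= (rate1 l' + 1) * ((halved l' + 1) * D)" by (simp add: rate1_def mult.commute)
 show "halved l' + 1 <= 2 * (halved l + 1)" unfolding Suc by (rule halved_Suc)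
 show "halved l' + 1 <= 3 * m" using halved_le[of l'] balance(1) by simp
 have "D * D * m * ((24 * tu) * (24 * tu)) = 576 * (D * D * m * tu * tu)" by simp
 also have "... <= 576 * (4 * B * B * B)" by (intro mult_le_mono2 balance)
 finally show "D * D * m * ((24 * tu) * (24 * tu)) <= 2304 * (B * B * B)" by simp
 qed (use BD in simp)
 thus ?thesis by simp
 qed
 finally show ?thesis .
qed

lemma sum_star_card:
 assumes D: "!!v. v : Vs ==> dg E v <= D"
 shows "(\<Sum>v\<in>Vs. card (sseq k E v l)) <= 28 * B"
proof (cases l)
 case 0
 have "(\<Sum>v\<in>Vs. card (sseq k E v l)) <= (\<Sum>v\<in>Vs. D * dg E v)"
 proof (rule sum_mono)
 fix v assume v: "v : Vs"
 have "card (sseq k E v l) <= dg E v * dg E v" by (rule card_star_seq[OF Vs_less[OF v] E])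
 also have "... <= D * dg E v" by (intro mult_le_mono1 D v)
 finally show "card (sseq k E v l) <= D * dg E v" .
 qed
 also have "... = D * (\<Sum>v\<in>Vs. dg E v)" by (simp only: sum_distrib_left)
 also have "... <= D * (2 * m)" by (intro mult_le_mono2 sum_dg_Vs)
 finally show ?thesis using balance(6) by (simp add: mult.commute)
next
 case (Suc l')
 show ?thesis using sum_star_Suc[of l'] balance(3) by (simp add: Suc)
qed

text \<open>13868 = 28 + 2 + 13824 + 14, for the edges, the number of neighbourhoods, the low
  vertices and the searches of one level.\<close>

lemma star_work:
 assumes D: "!!v. v : Vs ==> dg E v <= D"
 shows "(\<Sum>v\<in>Vs. \<Sum>l<LV. s1.lwork v (sseq k E v l) l) <= LV * (13868 * B)"
proof -
 have "card Vs = (\<Sum>v\<in>Vs. 1)" by simp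
 also have "... <= (\<Sum>v\<in>Vs. dg E v)" using Vs finite_sub_adj[OF E] by (intro sum_mono dg_pos) auto
 finally have cV: "card Vs <= 2 * B" using sum_dg_Vs balance(2) by linarith
 have "(\<Sum>v\<in>Vs. s1.lwork v (sseq k E v l) l) <= 13868 * B" for l
 proof -
 have "(\<Sum>v\<in>Vs. s1.lwork v (sseq k E v l) l) = (\<Sum>v\<in>Vs. card (sseq k E v l)) + card Vs +
 (\<Sum>v\<in>Vs. \<Sum>a\<in>lverts (sseq k E v l) (thr1 l). dg (sseq k E v l) a * dg (sseq k E v l) a) +
 (\<Sum>v\<in>Vs. swork (card (sverts k E v l)) (card (sverts k E v l)) (rate1 l))"
 proof -
 have "(\<Sum>v\<in>Vs. s1.lwork v (sseq k E v l) l) = (\<Sum>v\<in>Vs. card (sseq k E v l) + 1 +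
 (\<Sum>a\<in>lverts (sseq k E v l) (thr1 l). dg (sseq k E v l) a * dg (sseq k E v l) a) +
 swork (card (sverts k E v l)) (card (sverts k E v l)) (rate1 l))"
 by (intro sum.cong refl star_level_work Vs_less)
 thus ?thesis by (simp only: sum.distrib) simp
 qed
 thus ?thesis using sum_star_card[OF D, of l] cV sum_star_low[of l] sum_star_verts_sq[OF D, of l] by linarith
 qed
 hence "(\<Sum>l<LV. \<Sum>v\<in>Vs. s1.lwork v (sseq k E v l) l) <= LV * (13868 * B)"
 using sum_bounded_above[of "{..<LV}" "%l. \<Sum>v\<in>Vs. s1.lwork v (sseq k E v l) l" "13868 * B"] by simp
 thus ?thesis by (subst sum.swap)
qed

end

text \<open>The bound on all rows together, applied to the single vertex \<open>v\<close>, leaves no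
  row at level \<open>LV - 1\<close>, where \<open>halved\<close> is 0.\<close>

lemma star_seq_LV:
 assumes "k <= m" "E <= adj k" "v : fst ` E" "card (cl k) <= tt"
 shows "sseq k E v LV = {}"
proof -
 have v: "v < n" using assms(2,3) adj_less by fastforce
 have "(\<Sum>v\<in>{v}. card (sverts k E v (LV - 1))) <= halved (LV - 1)"
 using assms by (intro sum_star_verts) auto
 hence "card (sverts k E v (LV - 1)) = 0" using halved_LV by simp
 moreover have "finite (sverts k E v (LV - 1))" using finite_star_seq[OF v] by (simp add: hverts_def)
 ultimately have "sseq k E v (Suc (LV - 1)) = {}" unfolding star_seq_Suc[OF v] by (simp add: heavy_def)
thus ?thesis using LV(2) by simp
qed

text \<open>As long as \<open>K\<close> has not been reported, all edges inside
  \<open>K - {v}\<close> pass to the next level: a low vertex of \<open>K\<close> would report it,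
  and so would a pair with few witnesses. An empty last level therefore forces a report.\<close>

lemma star_cover:
 assumes k: "k <= m" and K: "K : cl k" and v: "v : K" "K - {v} <= {a. (v, a) : E}" and empty: "sseq k E v LV = {}"
 shows "K : (\<Union>l<LV. s1.lrep k v (sseq k E v l) l)"
proof (rule ccontr)
 assume not: "~?thesis"
 have vn: "v < n" using clqD(1)[OF K] v(1) by auto
 have "\<forall>a\<in>K - {v}. \<forall>b\<in>K - {v}. a ~= b --> (a, b) : sseq k E v l" if "l <= LV" for l
 using that
 proof (induction l)
 case 0
 show ?case using clqD(3)[OF K] v(2) unfolding sseq_def by (auto simp: sub_edges_def)
 next
 case (Suc l)
 let ?F = "sseq k E v l" let ?X = "sverts k E v l"
 have not': "K ~: s1.lrep k v ?F l" using not Suc.prems by auto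
 have IH: "(a, b) : ?F" if "a : K - {v}" "b : K - {v}" "a ~= b" for a b using Suc that by auto
 have high: "a : ?X" if a: "a : K - {v}" for a
 proof (rule ccontr)
 assume no: "a ~: ?X"
 obtain b c where K': "K = {v, a, b, c}" "b ~= c" "b ~: {v, a}" "c ~: {v, a}"
 using clique_rest[OF K v(1), of ] a by blast
 hence e: "(a, b) : ?F" "(a, c) : ?F" using IH a by auto
 hence "a : lverts ?F (thr1 l)" using no by (force simp: lverts_def hverts_def)
 moreover have "K : {{v, a, b, c} | b c. (a, b) : ?F & (a, c) : ?F}" using K'(1) e by blast
 ultimately show False using not' unfolding star_level_rep[OF vn] by blast
qed
 show ?case
 proof (intro ballI impI)
 fix a b assume ab: "a : K - {v}" "b : K - {v}" "a ~= b"
 obtain d c where K': "K = {a, b, d, c}" "d ~= c" "d ~: {a, b}" "c ~: {a, b}" using clique_rest[OF K, of a ] ab by auto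
 then obtain c where c: "c : K - {v}" "K = {a, b, v, c}" "c ~: {a, b}" using v(1) ab by auto
 have adj: "(a, b) : adj k" "(a, v) : adj k" "(a, c) : adj k" "(b, v) : adj k" "(b, c) : adj k"
 using clqD(3)[OF K] ab c by auto
 have wit: "(v, c) : {v} \<times> ?X" "witness k a (v, c)" "witness k b (v, c)" using high[OF c(1)] adj by (auto simp: witness_def)
 have "~card {f : {v} \<times> ?X. witness k a f & witness k b f} <= rate1 l"
 using c high ab wit not' star_level_rep vn by (auto simp: lights_def)
thus "(a, b) : sseq k E v (Suc l)"
 unfolding star_seq_Suc[OF vn] heavy_def using high[OF ab(1)] high[OF ab(2)] adj(1) by auto
 qed
 qed
 from this[of LV] have none: "~(a : K - {v} & b : K - {v} & a ~= b)" for a b using empty by auto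
 have "card K = 4" using clqD(2)[OF K] .
 hence "card (K - {v}) = 3" using v(1) by simp
 then obtain a b c where "K - {v} = {a, b, c}" "a ~= b" by (auto simp: card_3_iff)
 thus False using none[of a b] by simp
qed

end

section \<open>The search in the whole graph\<close>

definition thr_exp2 :: exp where "thr_exp2 = $vD"

definition rate_exp2 :: exp where
 "rate_exp2 = Op Div (Lit 24 [*] $vTau) (halved_exp ($(vLevel 2) [+] Lit 1) [+] Lit 1)"

definition collect :: com where
 "collect = Cond (adj_exp ($(vNbI 2)) ($(vNbJ 2)))
 (Write (aBA 1) ($(vBc 1)) ($(vNbI 2)) ;; Write (aBB 1) ($(vBc 1)) ($(vNbJ 2)) ;; Asg (vBc 1) ($(vBc 1) [+] Lit 1)) Skip"

definition solve1 :: com where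
 "solve1 = solve 1 thr_exp1 (rate_exp1 ($(vLevel 1))) act_1 fill1"

text \<open>The charge \<open>$vLV\<close> pays for the level loop of \<open>solve1\<close>, which
  goes through all its rounds even if hardly any edges are present.\<close>

definition act2 :: com where
 "act2 = charged (deg_sq_exp 2 [+] $vLV)
 (Asg vBase ($(vVert 2)) ;; Asg (vBc 1) (Lit 0) ;; nb_pairs 2 collect ;; solve1)"

definition fill2 :: com where
 "fill2 = Asg vWN ($(vBc 2)) ;;
 For vI (vBc 2) (Write aWC ($vI) (Read (aBA 2) ($vI)) ;; Write aWD ($vI) (Read (aBB 2) ($vI)))"

definition solve2 :: com where
 "solve2 = solve 2 thr_exp2 rate_exp2 act2 fill2"

lemma written_collect: "wvars collect = {vBc 1}" "warrs collect = {aBA 1, aBB 1}"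
 by (auto simp: collect_def)

lemma written_fill2: "wvars fill2 = {vWN, vI}" "warrs fill2 = {aWC, aWD}"
 by (auto simp: fill2_def w_For)

context budget
begin

lemma written_solve1: "wvars solve1 <= {10, 11} Un {13..33} Un {50..59}" "warrs solve1 <= {1, 2, 3} Un {7..19} Un {30..39}"
proof -
 have "wvars solve1 <= insert (vLevel 1) (insert vFlag (wvars (level 1 thr_exp1 (rate_exp1 ($(vLevel 1))) act_1 fill1)))"
 unfolding solve1_def by (rule s1.written_solve)
 also have "... <= insert (vLevel 1) (insert vFlag ({vFlag, vWk, vIx 1, vVc 1, vVert 1, vDg 1, vPos 1, vRN, vRR, vWN, vI} Un wvars act_1 \<union>
 wvars (search_all (aBA 1) (aBB 1) (vBc 1))))"
 by (intro insert_mono s1.written_level(1))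
 also have "... <= {10, 11} Un {13..33} Un {50..59}"
 unfolding written_act1 w_search_all by simp
 finally show "wvars solve1 <= {10, 11} Un {13..33} Un {50..59}" .
 have "warrs solve1 = warrs (level 1 thr_exp1 (rate_exp1 ($(vLevel 1))) act_1 fill1)"
 unfolding solve1_def by (rule s1.written_solve)
 also have "... <= {aDeg 1, aNb 1, aVl 1, aRW, aWC, aWD} Un warrs act_1 Un warrs (search_all (aBA 1) (aBB 1) (vBc 1))"
 by (rule s1.written_level(2))
 also have "... <= {1, 2, 3} Un {7..19} Un {30..39}"
 unfolding written_act1 w_search_all by simp
 finally show "warrs solve1 <= {1, 2, 3} Un {7..19} Un {30..39}" .
qed

lemma written_act2: "wvars act2 <= {10, 11} Un {13..34} Un {50..59} Un {65..69}" "warrs act2 <= {1, 2, 3} Un {7..19} Un {30..39}"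
using written_charged written_nb_pairs written_collect Un_mono order_refl written_solve1 by (auto simp: act2_def)
text \<open>By \<open>heavy_edges_bound\<close>, exceeding this threshold leaves at most
  \<open>halved (l + 1)\<close> edges for the next level if there are at most \<open>tt\<close>
  cliques.\<close>

definition rate2 :: "nat => nat" where "rate2 l = 24 * tu div (halved (l + 1) + 1)"

definition star_total :: "nat => (nat \<times> nat) set => nat => nat" where
 "star_total k E v = dg E v * dg E v + LV + (\<Sum>l<LV. s1.lwork v (sseq k E v l) l)"

definition star_cliques :: "nat => (nat \<times> nat) set => nat => nat set set" where
 "star_cliques k E v = {K : cl k. v : K & K - {v} <= {a. (v, a) : E}}"

lemma status_rep:
 assumes "status V A b k W R" "~b ==> V vFlag = 0 ==> R' Int cl k <= R"
 shows "status V A b k W R'"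
using assms exI by (fastforce simp: status_def)
lemma eval_rate2: "env V A k ==> V (vLevel 2) = l ==> l < LV ==> eval w V A rate_exp2 = rate2 l"
proof -
 assume env: "env V A k" and l: "V (vLevel 2) = l" "l < LV"
 have 1: "halved (l + 1) + 1 <= 2 * U" using halved_le[of "l + 1"] U(1,3) by simp
 have 3: "24 * tu <= 2 * U" using tau by simp
 have ev: "eval w V A ($(vLevel 2) [+] Lit 1) = l + 1" using l(2) LV(3) mult_less(2)[of "l + 1"] l by simp
show "eval w V A rate_exp2 = rate2 l"
 using mult_less(2)[OF 1] mult_less(2)[OF 3] eval_halved[OF env_D(11)[OF env] ev] env_D(8)[OF env]
 by (simp add: rate_exp2_def rate2_def)
qed

lemma sp_collect:
 assumes env: "env@@S k" and ps: "pairs_at@@S (aBA 1) (aBB 1) (vBc 1) xs" and xs: "length xs + 1 < 2 ^ w"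
 and ab: "vl S (vNbI 2) = a" "vl S (vNbJ 2) = b" "a < n" "b < n"
 shows "sp collect S (%S'. pairs_at@@S' (aBA 1) (aBB 1) (vBc 1) (if (a, b) : adj k then xs @ [(a, b)] else xs) & bad S' = bad S & clk S - 4 <= clk S')"
 (is "sp _ S ?Q")
 unfolding collect_def
proof (rule sp_Cond)
 have bc: "vl S (vBc 1) = length xs" using ps by (simp add: pairs_at_def)
 have cond: "ev w S (adj_exp ($(vNbI 2)) ($(vNbJ 2))) = of_bool ((a, b) : adj k)"
 using eval_adj_exp[OF env_D(1,2,3)[OF env], of "$(vNbI 2)" "$(vNbJ 2)"] ab by simp
 {
 assume "ev w S (adj_exp ($(vNbI 2)) ($(vNbJ 2))) ~= 0"
 hence e: "(a, b) : adj k" unfolding cond by simp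
 have "pairs_at ((vl S)(vBc 1 := length xs + 1)) ((ar S)(aBA 1 := (ar S (aBA 1))(length xs := a), aBB 1 := (ar S (aBB 1))(length xs := b)))
 (aBA 1) (aBB 1) (vBc 1) (xs @ [(a, b)])" by (rule pairs_at_snoc[OF ps]) simp
 thus "sp (Write (aBA 1) ($(vBc 1)) ($(vNbI 2)) ;; Write (aBB 1) ($(vBc 1)) ($(vNbJ 2)) ;; Asg (vBc 1) ($(vBc 1) [+] Lit 1)) (tick S) ?Q"
 using bc ab e xs
 by (intro sp_Seq sp_Write_eq[where x = "length xs" and v = a and a = "aBA 1"] sp_Write_eq[where x = "length xs" and v = b and a = "aBB 1"]
 sp_Asg_eq[where v = "length xs + 1"]) simp_all
 next
 assume "ev w S (adj_exp ($(vNbI 2)) ($(vNbJ 2))) = 0"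
 thus "sp Skip (tick S) ?Q" using ps unfolding cond by (intro sp_Skip) simp
}
qed

lemma sp_act2:
 assumes env: "env@@S k" and built: "(built 2)@@S hl" and hl: "distinct hl" "set hl <= adj k"
 and v: "vl S (vVert 2) = v" "v : fst ` set hl" and st: "status@@@S k W R"
 shows "sp act2 S (%S'. status@@@S' k (W + star_total k (set hl) v)
 (R Un star_cliques k (set hl) v) & pot S - 50 <= pot S')" (is "sp _ S ?Q")
 unfolding act2_def
proof -
 let ?d = "dg (set hl) v" let ?x = "?d * ?d + LV"
 note d = eval_deg_sq[OF built hl v]
 have vn: "v < n" using v(2) hl(2) adj_less by fastforce
 let ?ns = "nbs hl v"
 have lend: "length ?ns = ?d" by (rule length_nbs_dg[OF hl(1)])
 have dU: "?d * ?d + U + 17 < 2 ^ w" using UU_less[of ?d ?d] d(2) U(2) by simp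
 let ?b = "Asg vBase ($(vVert 2)) ;; Asg (vBc 1) (Lit 0) ;; nb_pairs 2 collect ;; solve1"
 show "sp (charged (deg_sq_exp 2 [+] $vLV) ?b) S ?Q"
 proof (rule sp_charged[OF st env, where x = ?x and y = ?x])
 fix S1 :: cst
 assume S1: "!!x. x ~= vFlag ==> vl S1 x = vl S x" "ar S1 = ar S"
 have e: "ev w S1 (deg_sq_exp 2) = ?d * ?d" using d(1) S1 by (simp add: deg_sq_exp_def)
 show "ev w S1 (deg_sq_exp 2 [+] $vLV) = ?x"
 using S1(1)[] env_D(5)[OF env] by (simp only: eval.simps(3) e) (use dU LV(3) in simp)
next
 have "?d * ?d <= U ^ 2" using d(2) U(2) by (simp add: power2_eq_square mult_le_mono)
 moreover have "LV <= U ^ 2" using U(1) order_trans[OF LV(3) power_increasing[of 1 2 , simplified]] by simp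
 ultimately have "?x <= U ^ Suc 2" by (rule poly_bounds(2))
 also have "... <= U ^ 6" using U(1) by (intro power_increasing) auto
 finally show "?x <= U ^ 6" .
 next
 fix S1 :: cst
 assume "!!W' R'. W + ?x <= W' ==> status@@@S1 k W' R'" "pot S - 5 <= pot S1"
 thus "?Q S1" by (simp add: star_total_def)
 next
 fix S1 :: cst
 assume S1: "vl S1 vFlag = 0" "!!x. x ~= vWk ==> vl S1 x = vl S x" "ar S1 = ar S" "bad S1 = bad S"
 "status@@@S1 k (W + ?x) R" "pot S + ka * real ?x - 5 <= pot S1"
 let ?S2 = "S1(|vl := (vl S1)(vBase := v, vBc 1 := 0), clk := clk S1 - 2|)"
 have V2: "x ~: {vWk, vBase, vBc 1} ==> vl ?S2 x = vl S x" "ar ?S2 a = ar S a" for x a using S1(2,3) by auto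
 have env2: "env@@?S2 k" by (rule env_same[OF env]; rule V2) auto
 have built2: "(built 2)@@?S2 hl" by (rule built_same[OF built]; rule V2) auto
 have st2: "status@@@?S2 k (W + ?x) R" using S1(5) by simp
 let ?e = "%q. (?ns ! (q div ?d), ?ns ! (q mod ?d))"
 let ?L = "%q. map ?e (filter (%q. ?e q : adj k) [0..<q])"
 let ?I = "%q V A b. pairs_at V A (aBA 1) (aBB 1) (vBc 1) (?L q) & b = bad S1"
 have coll: "sp (nb_pairs 2 collect) ?S2 (%S'. (?I (?d * ?d))@@@S' & clk ?S2 - (3 + 5 * real ?d + (4 + 3) * real (?d * ?d)) <= clk S')"
 proof (rule sp_nb_pairs[OF built2 env_D(4)[OF env2] hl, where v = v and I = ?I and t = 4, unfolded lend])
 show "vl ?S2 (vVert 2) = v" using v(1) V2(1)[of "vVert 2"] by simp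
 show "(?I 0)@@@?S2" by (simp add: pairs_at_def stores_def)
 fix S3 :: cst and q
 assume q: "q < ?d * ?d" and ni: "vl S3 (vNbI 2) = ?ns ! (q div ?d)" and nj: "vl S3 (vNbJ 2) = ?ns ! (q mod ?d)"
 and V3: "!!x. x ~: {vDg 2, vIx 2, vNbI 2, vJx 2, vNbJ 2} Un wvars collect ==> vl S3 x = vl ?S2 x"
 "!!a. a ~: warrs collect ==> ar S3 a = ar ?S2 a" and I: "(?I q)@@@S3"
 have "0 < ?d" using q by (cases ?d) auto
 hence qd: "q div ?d < length ?ns" "q mod ?d < length ?ns" using q lend by (simp_all add: less_mult_imp_div_less)
 have nn: "?ns ! (q div ?d) < n" "?ns ! (q mod ?d) < n"
 using length_nbs(2)[OF hl nth_mem[OF qd(1)]] length_nbs(2)[OF hl nth_mem[OF qd(2)]] .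
 have env3: "env@@S3 k" by (rule env_same[OF env2]; rule V3) (auto simp: written_collect)
 have len: "length (?L q) + 1 < 2 ^ w"
 proof -
 show ?thesis using length_filter_le[of "%q. ?e q : adj k" "[0..<q]"] q dU by simp
qed
 show "sp collect S3 (%S''. (?I (Suc q))@@@S'' & clk S3 - 4 <= clk S'')"
 by (rule sp_weak[OF sp_collect[OF env3 conjunct1[] len ni nj nn]]) (insert I, auto split: if_splits)
 qed (auto simp: written_collect v)
 have solve: "sp solve1 S3 ?Q"
 if fr: "frame (nb_pairs 2 collect) ?S2 S3" and I: "(?I (?d * ?d))@@@S3"
 and clk: "clk ?S2 - (3 + 5 * real ?d + (4 + 3) * real (?d * ?d)) <= clk S3" for S3 :: cst
 proof -
 have V3: "x ~: {vDg 2, vIx 2, vNbI 2, vJx 2, vNbJ 2, vBc 1} ==> vl S3 x = vl ?S2 x" "a ~: {aBA 1, aBB 1} ==> ar S3 a = ar ?S2 a" for x a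
 using fr by (auto simp: frame_def written_nb_pairs written_collect)
 have env3: "env@@S3 k" by (rule env_same[OF env2]; rule V3) auto
 have base3: "1 = (1 :: nat) --> vl S3 vBase = v mod n" using V3(1)[] vn by simp
 have st3: "status@@@S3 k (W + ?x) R"
 proof -
 have b: "bad S3 = bad ?S2" using I by simp
 show ?thesis unfolding b by (rule iffD2[OF status_cong[OF V3(1) V3(1) V3(1) V3(2) V3(2) V3(2)] st2]) simp_all
 qed
 \<comment> \<open>With a trivial predicate on indices, the list of adjacent pairs of neighbours has
   the shape of a list of heavy pairs, so its properties follow from the same lemma.\<close>
 note hs = heavy_list_sub[where rs = ?ns and E = "adj k" and P = "%_. True", unfolded lend simp_thms]
 have dist: "distinct (?L (?d * ?d))" and sub: "set (?L (?d * ?d)) <= adj k" using hs distinct_nbs[OF hl(1)] by auto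
 have L: "set (?L (?d * ?d)) = sub_edges k (set hl) v"
 proof (intro equalityI subsetI)
 fix e assume "e : set (?L (?d * ?d))"
 thus "e : sub_edges k (set hl) v" using hs(1) by (auto simp: sub_edges_def set_nbs)
next
 fix e assume e: "e : sub_edges k (set hl) v"
 then obtain a b where ab: "e = (a, b)" "a : set ?ns" "b : set ?ns" "(a, b) : adj k" by (auto simp: sub_edges_def set_nbs)
 then obtain i j where ij: "i < ?d" "?ns ! i = a" "j < ?d" "?ns ! j = b" by (metis in_set_conv_nth lend)
 have "i * ?d + j < ?d * ?d" by (rule madd_less) (use ij in auto)
 moreover have "?e (i * ?d + j) = e" using ij ab(1) by simp
 ultimately show "e : set (?L (?d * ?d))" using ab(1,4) by (auto intro!: )
 qed
 have final: "card (cl k) <= tt ==> s1.edge_seq k v (sub_edges k (set hl) v) LV = {}"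
 using star_seq_LV[OF env_D(3)[OF env] hl(2) v(2)] unfolding sseq_def .
 have "sp solve1 S3 (%S'. status@@@S' k
 (W + ?x + (\<Sum>l<LV. s1.lwork v (sseq k (set hl) v l) l)) (R Un (\<Union>l<LV. s1.lrep k v (sseq k (set hl) v l) l)) &
 (~bad S' & vl S' vFlag = 0 --> sseq k (set hl) v LV = {}) & pot S3 - (10 + 30 * real LV) <= pot S')"
 unfolding solve1_def sseq_def
 by (rule s1.sp_solve[OF env3 base3 conjunct1[OF I] dist sub L st3 final])
 thus "sp solve1 S3 ?Q"
 proof (rule sp_weak)
 fix S4 :: cst
 assume S4: "status@@@S4 k
 (W + ?x + (\<Sum>l<LV. s1.lwork v (sseq k (set hl) v l) l)) (R Un (\<Union>l<LV. s1.lrep k v (sseq k (set hl) v l) l)) &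
 (~bad S4 & vl S4 vFlag = 0 --> sseq k (set hl) v LV = {}) & pot S3 - (10 + 30 * real LV) <= pot S4"
 have sub: "star_cliques k (set hl) v <= (\<Union>l<LV. s1.lrep k v (sseq k (set hl) v l) l)" if "~bad S4" "vl S4 vFlag = 0"
 using star_cover[OF env_D(3)[OF env], of _ v "set hl"] S4 that unfolding star_cliques_def by blast
 have "status@@@S4 k (W + star_total k (set hl) v) (R Un (\<Union>l<LV. s1.lrep k v (sseq k (set hl) v l) l))"
 using conjunct1[OF S4] by (simp only: star_total_def add.assoc)
 hence "status@@@S4 k (W + star_total k (set hl) v) (R Un star_cliques k (set hl) v)"
 by (rule status_rep) (use sub in blast)
 moreover have "pot S - 50 <= pot S4"
 proof -
 have "real ?d <= real (?d * ?d)" using d(3) by (simp add: )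
 moreover have "4000 * real ?x <= ka * real ?x" using kappa_ge by (intro mult_right_mono) auto
 moreover have "real ?x = real (?d * ?d) + real LV" by (simp only: )
 moreover have "pot S1 - 2 - (3 + 5 * real ?d + (4 + 3) * real (?d * ?d)) <= pot S3" using V3(1)[] clk by (simp add: pot_def)
moreover have "0 <= real (?d * ?d)" "0 <= real LV" by simp_all
 ultimately show ?thesis using S1(6) conjunct2[OF conjunct2[OF S4]] by argo
 qed
 ultimately show "?Q S4" by blast
 qed
 qed
 have "sp (nb_pairs 2 collect ;; solve1) ?S2 ?Q"
 by (rule sp_Seq, rule sp_weak[OF coll]) (use solve in blast)
 moreover have "ev w S1 ($(vVert 2)) = v" using S1(2)[of "vVert 2"] v(1) by simp
 ultimately show "sp ?b S1 ?Q"
 by (intro sp_Seq[of "Asg vBase ($(vVert 2))"] sp_Seq[of "Asg (vBc 1) (Lit 0)"] sp_Asg_eq[where v = v and x = vBase] sp_Asg_eq[where v = 0 and x = "vBc 1"])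
 (assumption | simp)+
 qed simp
qed

lemma sp_fill2:
 assumes ps: "pairs_at@@S (aBA 2) (aBB 2) (vBc 2) hl" and hl: "distinct hl" "set hl <= adj k"
 and rs: "stores (ar S aRW) rs" "vl S vRN = length rs" "set rs <= {..<n}" "distinct rs"
 shows "sp fill2 S (%S'. search@@S' rs hl & bad S' = bad S & clk S - (3 + 4 * real (length hl)) <= clk S')" (is "sp _ S ?Q")
 unfolding fill2_def
proof (rule sp_Seq, rule sp_Asg_eq[where v = "length hl"])
 show "ev w S ($(vBc 2)) = length hl" using ps by (simp add: pairs_at_def)
 let ?b = "Write aWC ($vI) (Read (aBA 2) ($vI)) ;; Write aWD ($vI) (Read (aBB 2) ($vI))"
 let ?S0 = "(upd S vWN (length hl))"
 have nU: "length rs <= U" using card_mono[OF _ rs(3)] rs(4) U(2) by (simp add: distinct_card)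
 have mU: "length hl <= U" using length_sub_adj[OF hl] U(3) by simp
 have sub: "set hl <= {..<n} \<times> {..<n}" using hl(2) adj_less by fastforce
 show "sp (For vI (vBc 2) ?b) ?S0 ?Q"
 proof (rule sp_For_time[where n = "length hl" and t = 2 and
 I = "%i V A b. b = bad S & (\<forall>j<i. A aWC j = fst (hl ! j) & A aWD j = snd (hl ! j))"])
 show "vl ?S0 (vBc 2) = length hl" using ps by (simp add: pairs_at_def)
 fix i and S1 :: cst
 assume fr: "frame (For vI (vBc 2) ?b) ?S0 S1" and i: "i < length hl" "vl S1 vI = i"
 and I: "bad S1 = bad S & (\<forall>j<i. ar S1 aWC j = fst (hl ! j) & ar S1 aWD j = snd (hl ! j))"
 have "ar S1 (aBA 2) i = fst (hl ! i)" "ar S1 (aBB 2) i = snd (hl ! i)"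
 using fr ps i(1) by (auto simp: frame_def w_For stores_def pairs_at_def)
 thus "sp ?b S1 (%S''. (bad S'' = bad S & (\<forall>j<Suc i. ar S'' aWC j = fst (hl ! j) & ar S'' aWD j = snd (hl ! j))) & clk S1 - 2 <= clk S'')"
 using i I by (intro sp_Seq sp_Write_eq[where x = i and v = "fst (hl ! i)" and a = aWC] sp_Write_eq[where x = i and v = "snd (hl ! i)" and a = aWD])
 (auto simp: )
 next
 fix S1 :: cst
 assume fr: "frame (For vI (vBc 2) ?b) ?S0 S1" and I: "bad S1 = bad S & (\<forall>j<length hl. ar S1 aWC j = fst (hl ! j) & ar S1 aWD j = snd (hl ! j))"
 and clk: "clk ?S0 - (2 + real (length hl) * (2 + 2)) <= clk S1"
 show "?Q S1" using fr I rs nU mU sub I clk by (simp add: search_def frame_def w_For stores_def)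
qed simp_all
qed

lemma solver2: "solver w M C ep mu N n m tt U rho es tu B D LV Bud k 2 0 thr_exp2 rate_exp2 act2 fill2 (%_. D) rate2
 (%X E. E) (star_total k) (star_cliques k)"
proof (intro solver.intro solver_axioms.intro)
 show "budget w M C ep mu N n m tt U rho es tu B D LV Bud" by (rule budget_axioms)
next
 fix x a :: nat
 show "x : wvars act2 ==> 9 < x & x ~= vJJ & x ~: {vBc 2, vVc 2, vLevel 2, vPos 2, vVert 2} & (2 = (1::nat) --> x ~= vBase)"
 "a : warrs act2 ==> a ~: {aEU, aEV, aPos, aBA 2, aBB 2, aDeg 2, aNb 2, aVl 2}"
 using written_act2 by auto
 show "wvars fill2 <= {vWN, vI}" "warrs fill2 <= {aWC, aWD}" by (auto simp: written_fill2)
next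
 fix V A and l :: nat assume "env V A k" "V (vLevel 2) = l" "l < LV"
 thus "eval w V A thr_exp2 = D" by (simp add: thr_exp2_def env_D)
next
 fix V A l assume *: "env V A k" "V (vLevel 2) = l" "l < LV"
 thus "eval w V A rate_exp2 = rate2 l" by (rule eval_rate2)
next
 fix l
 have "rate2 l <= 24 * tu" by (simp add: rate2_def)
 thus "rate2 l <= U" using tau by simp
next
 fix S :: cst and hl a W R
 assume *: "env@@S k" "2 = (1::nat) --> vl S vBase = 0" "(built 2)@@S hl" "distinct hl" "set hl <= adj k"
 "vl S (vVert 2) = a" "a : fst ` set hl" "status@@@S k W R"
 show "sp act2 S (%S'. status@@@S' k (W + star_total k (set hl) a)
 (R Un star_cliques k (set hl) a) & pot S - 50 <= pot S')"
 by (rule sp_act2[OF *(1,3-8)])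
next
 fix S :: cst and hl rs
 assume *: "env@@S k" "2 = (1::nat) --> vl S vBase = 0" "stores (ar S aRW) rs" "vl S vRN = length rs" "distinct rs"
 "set rs <= {..<n}" "length rs <= length hl" "pairs_at@@S (aBA 2) (aBB 2) (vBc 2) hl" "distinct hl" "set hl <= adj k"
 show "sp fill2 S (%S'. (\<exists>ws. search@@S' rs ws & distinct ws & set ws = set hl) & bad S' = bad S &
 clk S - (10 + 10 * real (length hl)) <= clk S')"
 by (rule sp_weak[OF sp_fill2[OF *(8-10) *(3,4,6,5)]]) (use * in auto)
qed

sublocale s2: solver w M C ep mu N n m tt U rho es tu B D LV Bud k 2 0 thr_exp2 rate_exp2 act2 fill2 "%_. D" rate2
 "%X E. E" "star_total k" "star_cliques k" for k
 by (rule solver2)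

end

section \<open>Work and completeness of the outer search\<close>

text \<open>High vertices have degree above \<open>D\<close>, so h <= c/D. Then h c <= 4 m^2/D <= 4
  B, r c <= 48 tu, and r h^2 <= r c^2/D^2 <= 96 tu m/D^2 <= 96 B. Together with h^2 <= h c and c <=
  2 m this gives 154 = 4 + 96 + 4 + 48 + 2.\<close>

lemma search_work_bound:
 fixes h c r D B tu m M :: nat
 assumes hD: "h * (D + 1) <= c" and c: "c <= 2 * m" "c <= 2 * M" and r: "r * M <= 24 * tu" and D: "1 <= D"
 and B: "m <= B" "tu <= B" "m * m <= D * B" "tu * m <= D * D * B"
 shows "h * c + (r + 1) * (h * h + c) <= 154 * B"
proof -
 have hc: "h * D <= c" "h <= c" using hD by simp_all
 have "h * c * D <= 4 * B * D"
 proof -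
 have "h * c * D = (h * D) * c" by simp
 have "... <= (2 * m) * (2 * m)" by (rule mult_le_mono[OF order_trans[OF hc(1) c(1)] c(1)])
 also have "... = 4 * (m * m)" by simp
 also have "... <= 4 * (D * B)" by (rule mult_le_mono2[OF B(3)])
 finally show ?thesis by (simp add: )
 qed
 hence 1: "h * c <= 4 * B" using D by simp
 have rc: "r * c <= 48 * tu"
 proof -
 have "r * c <= r * (2 * M)" by (rule mult_le_mono2[OF c(2)])
 also have "... = 2 * (r * M)" by simp
 finally show ?thesis using r by linarith
 qed
 have "r * (h * h) * (D * D) <= 96 * B * (D * D)"
 proof -
 have "r * (h * h) * (D * D) = r * ((h * D) * (h * D))" by simp
 have "... <= r * (c * c)" using hc(1) by (intro mult_le_mono) auto
 also have "... = (r * c) * c" by simp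
 also have "... <= (48 * tu) * (2 * m)" by (rule mult_le_mono[OF rc c(1)])
 also have "... = 96 * (tu * m)" by simp
 also have "... <= 96 * (D * D * B)" by (rule mult_le_mono2[OF B(4)])
 finally show ?thesis by (simp add: )
 qed
 hence 2: "r * (h * h) <= 96 * B" using D by (subst () ) simp
 have 3: "h * h <= h * c" by (rule mult_le_mono2[OF hc(2)])
 have "h * c + (r + 1) * (h * h + c) = h * c + r * (h * h) + h * h + r * c + c" by (simp add: algebra_simps)
 thus ?thesis using 1 2 3 rc c(1) B(1,2) by linarith
qed

context budget
begin

definition edges :: "nat => nat => (nat \<times> nat) set" where
 "edges k l = s2.edge_seq k (adj k) l"

lemma edges_simps: "edges k 0 = adj k" "edges k (Suc l) = heavy k (hverts (edges k l) D) (edges k l) (rate2 l)"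
 by (simp_all add: edges_def s2.next_edges_def)

lemma edges_sub: "edges k l <= adj k"
 by (cases l) (insert heavy_sub, auto simp: edges_simps)

lemma card_edges:
 assumes k: "k <= m" and few: "card (cl k) <= tt"
 shows "card (edges k l) <= halved l"
proof (cases l)
 case 0
 thus ?thesis using card_sub_adj[OF order_refl, of ] by (simp add: edges_simps halved_def)
next
 case (Suc l')
 have "card (edges k l) * (rate2 l' + 1) <= 24 * card (cl k)"
 unfolding Suc edges_simps by (rule heavy_edges_bound[OF k edges_sub])
 also have "... <= 24 * tu" using few tau(1) by simp
 also have "... < (halved l + 1) * (rate2 l' + 1)" using less_mult_div[of "halved l + 1" "24 * tu"] by (simp add: rate2_def Suc)
 finally show ?thesis by (subst (asm) mult_less_cancel2) simp
qed

lemma edges_LV: "k <= m ==> card (cl k) <= tt ==> edges k LV = {}"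
 using card_edges[of k LV] halved_LV(2) finite_sub_adj[OF edges_sub, of ] by simp

text \<open>14031 = 13870 + 161, where 13870 = 13868 + 2 belongs to the inner searches and their
  charges \<open>LV\<close>, and 161 = 2 + 1 + 4 + 154 to the edge list, the constant, the squared
  low degrees and the search.\<close>

lemma level_work2:
 assumes k: "k <= m" and few: "card (cl k) <= tt"
 shows "s2.lwork k (edges k l) l <= LV * (14031 * B)"
proof -
 let ?E = "edges k l" let ?L = "lverts ?E D"
 have finE: "finite ?E" and E: "?E <= adj k" using edges_sub finite_sub_adj by blast+
 have c: "card ?E <= 2 * m" by (rule card_sub_adj[OF E])
 have L: "?L <= fst ` ?E" "finite ?L" "!!v. v : ?L ==> dg ?E v <= D" using finE by (auto simp: lverts_def)
 have "card ?L = (\<Sum>v\<in>?L. 1)" by simp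
 also have "... <= (\<Sum>v\<in>?L. dg ?E v)" using L(1) by (intro sum_mono dg_pos finE) auto
 finally have cL: "card ?L <= 2 * m" using sum_dg_le[OF finE L(2)] c by linarith
 have "(\<Sum>v\<in>?L. star_total k ?E v) = (\<Sum>v\<in>?L. dg ?E v * dg ?E v) + card ?L * LV + (\<Sum>v\<in>?L. \<Sum>l<LV. s1.lwork v (sseq k ?E v l) l)"
 unfolding star_total_def by (simp only: sum.distrib) simp
 also have "... <= 4 * B + (2 * B) * LV + LV * (13868 * B)"
 proof (intro add_mono)
 have "(\<Sum>v\<in>?L. dg ?E v * dg ?E v) <= D * card ?E" by (rule sum_low_verts[OF finE])
 also have "... <= D * (2 * m)" by (rule mult_le_mono2[OF c])
 also have "... = 2 * (m * D)" by simp
 finally show "(\<Sum>v\<in>?L. dg ?E v * dg ?E v) <= 4 * B" using balance(6) by linarith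
 show "card ?L * LV <= (2 * B) * LV" using cL balance(2) by (intro mult_le_mono1) linarith
 show "(\<Sum>v\<in>?L. \<Sum>l<LV. s1.lwork v (sseq k ?E v l) l) <= LV * (13868 * B)"
 by (rule star_work[OF k E L(1) few L(3)])
 qed
 finally have 1: "(\<Sum>v\<in>?L. star_total k ?E v) <= 4 * B + LV * (13870 * B)" by (simp add: algebra_simps)
 have 2: "swork (card (hverts ?E D)) (card ?E) (rate2 l) <= 154 * B"
 unfolding swork_def
 proof (rule search_work_bound[where M = "halved (Suc l) + 1" and tu = tu and D = D and m = m])
 show "card ?E <= 2 * (halved (Suc l) + 1)" using card_edges[OF k few, of l] halved_Suc(2)[of l] by linarith
 show "rate2 l * (halved (Suc l) + 1) <= 24 * tu" unfolding rate2_def Suc_eq_plus1 by (rule div_times_less_eq_dividend)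
 qed (use card_high_verts[OF finE] c BD balance in auto)
 have "s2.lwork k ?E l = card ?E + 1 + (\<Sum>v\<in>?L. star_total k ?E v) + swork (card (hverts ?E D)) (card ?E) (rate2 l)"
 unfolding s2.lwork_def by (rule )
 also have "... <= 161 * B + LV * (13870 * B)" using 1 2 c balance(1,2) by linarith
 also have "... <= LV * (161 * B) + LV * (13870 * B)" using mult_le_mono1[OF LV(2), of "161 * B"] by simp
 finally show ?thesis by (simp add: algebra_simps)
qed

lemma total_work:
 assumes "k <= m" "card (cl k) <= tt"
 shows "(\<Sum>l<LV. s2.lwork k (edges k l) l) <= Bud"
proof -
 have "(\<Sum>l<LV. s2.lwork k (edges k l) l) <= (\<Sum>l<LV. LV * (14031 * B))" by (intro sum_mono level_work2 assms)
 also have "... = 14031 * (LV * LV * B)" by simp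
 finally show ?thesis using Bud(2) by linarith
qed

text \<open>As in \<open>star_cover\<close>: an unreported clique keeps all its edges from level to
  level. A vertex of low degree now reports the clique through the search of its
  neighbourhood.\<close>

lemma clique_cover:
 assumes k: "k <= m" and empty: "edges k LV = {}"
 shows "cl k <= (\<Union>l<LV. s2.lrep k (edges k l) l)"
proof (rule subsetI, rule ccontr)
 fix K assume K: "K : cl k" and not: "K ~: (\<Union>l<LV. s2.lrep k (edges k l) l)"
 have "\<forall>a\<in>K. \<forall>b\<in>K. a ~= b --> (a, b) : edges k l" if "l <= LV" for l
 using that
 proof (induction l)
 case 0
 show ?case using clqD(3)[OF K] by (auto simp: edges_simps)
 next
 case (Suc l)
 let ?F = "edges k l" let ?X = "hverts ?F D"
 have rep: "s2.lrep k ?F l = (\<Union>v\<in>lverts ?F D. star_cliques k ?F v) Un lights k ?X ?F (rate2 l)"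
 unfolding s2.lrep_def by (rule )
 have not': "K ~: s2.lrep k ?F l" using not Suc.prems by auto
 have IH: "(a, b) : ?F" if "a : K" "b : K" "a ~= b" for a b using Suc that by auto
 have high: "a : ?X" if a: "a : K" for a
 proof (rule ccontr)
 assume no: "a ~: ?X"
 have "K ~= {a}" using clqD(2)[OF K] by auto
then obtain b where "b : K" "b ~= a" using a by blast
 hence "a : lverts ?F D" using IH a no by (force simp: lverts_def hverts_def)
moreover have "K : star_cliques k ?F a" using K a IH by (auto simp: star_cliques_def)
 ultimately show False using not' rep by blast
 qed
 show ?case
 proof (intro ballI impI)
 fix a b assume ab: "a : K" "b : K" "a ~= b"
 obtain c d where K': "K = {a, b, c, d}" "c ~= d" "c ~: {a, b}" "d ~: {a, b}" using clique_rest[OF K ab] by blast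
 have adj: "(a, b) : adj k" "(a, c) : adj k" "(a, d) : adj k" "(b, c) : adj k" "(b, d) : adj k"
 using clqD(3)[OF K] K' ab by auto
 have wit: "(c, d) : ?F" "witness k a (c, d)" "witness k b (c, d)" using IH K' adj by (auto simp: witness_def)
 have "~card {f : ?F. witness k a f & witness k b f} <= rate2 l"
 using K' high ab wit not' rep by (auto simp: lights_def)
thus "(a, b) : edges k (Suc l)"
 unfolding edges_simps heavy_def using high[OF ab(1)] high[OF ab(2)] adj(1) by auto
 qed
 qed
 from this[of LV] have none: "~(a : K & b : K & a ~= b)" for a b using empty by auto
 have K4: "card K = 4" using clqD(2)[OF K] .
 then obtain a where a: "a : K" by fastforce
 have "K ~= {a}" using K4 by auto
thus False using a none by blast
qed

text \<open>With at most \<open>tt\<close> cliques the ideal work stays within the budget by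
  \<open>total_work\<close>. Without failures, a raised flag thus certifies more than
  \<open>tt\<close> cliques, and otherwise \<open>clique_cover\<close> makes the list
  complete.\<close>

lemma sp_solve2:
 assumes env: "env@@S k"
 and ps: "pairs_at@@S (aBA 2) (aBB 2) (vBc 2) hl" and hl: "distinct hl" "set hl = adj k"
 and st: "status@@@S k 0 {}"
 shows "sp solve2 S (%S'. (\<exists>F. found@@S' k F & (~bad S' --> (if vl S' vFlag = 0 then F = cl k else tt < card (cl k)))) &
 clk S - (ka * real Bud + 10 + 30 * real LV) <= clk S')" (is "sp _ S ?Q")
proof -
 have sub: "set hl <= adj k" using hl by simp
 have final: "card (cl k) <= tt ==> s2.edge_seq k (adj k) LV = {}" using edges_LV[OF env_D(3)[OF env]] by (simp add: edges_def)
 have "sp solve2 S (%S'. status@@@S' k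
 (0 + (\<Sum>l<LV. s2.lwork k (edges k l) l)) ({} Un (\<Union>l<LV. s2.lrep k (edges k l) l)) &
 (~bad S' & vl S' vFlag = 0 --> edges k LV = {}) & pot S - (10 + 30 * real LV) <= pot S')"
 unfolding solve2_def edges_def by (rule s2.sp_solve[OF env _ ps hl(1) sub hl(2) st final]) simp
 thus ?thesis
 proof (rule sp_weak)
 fix S' :: cst
 assume S': "status@@@S' k
 (0 + (\<Sum>l<LV. s2.lwork k (edges k l) l)) ({} Un (\<Union>l<LV. s2.lrep k (edges k l) l)) &
 (~bad S' & vl S' vFlag = 0 --> edges k LV = {}) & pot S - (10 + 30 * real LV) <= pot S'"
 obtain F where F: "found@@S' k F" "vl S' vWk <= Bud"
 "vl S' vFlag ~= 0 --> bad S' | tt < card (cl k) | Bud < (\<Sum>l<LV. s2.lwork k (edges k l) l)"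
 "vl S' vFlag = 0 & ~bad S' --> (\<Union>l<LV. s2.lrep k (edges k l) l) Int cl k <= F"
 using conjunct1[OF S'] unfolding status_def by auto
 have "F = cl k" if "~bad S'" "vl S' vFlag = 0"
 using F(1) clique_cover[OF env_D(3)[OF env]] that S' F(4) unfolding found_def by blast
moreover have "tt < card (cl k)" if "~bad S'" "vl S' vFlag ~= 0"
 using total_work[OF env_D(3)[OF env]] that F(3) by fastforce
 moreover have "clk S - (ka * real Bud + 10 + 30 * real LV) <= clk S'"
 proof -
 have "ka * real (vl S' vWk) <= ka * real Bud" using F(2) kappa_ge by (intro mult_left_mono) auto
 moreover have "0 <= ka * real (vl S vWk)" using kappa_ge by simp
 ultimately show ?thesis using S' by (auto simp: pot_def)
 qed
 ultimately show "?Q S'" using F(1) by auto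
 qed
qed

end

section \<open>Bit lengths, the doubled edge list and the balance of the thresholds\<close>

fun blen :: "nat => nat" where
 "blen x = (if x = 0 then 0 else Suc (blen (x div 2)))"

declare blen.simps [simp del]

lemma less_blen: "x < 2 ^ blen x"
proof (induction x rule: blen.induct)
 case (1 x)
 show ?case
 proof (cases "x = 0")
 case False
 show ?thesis using 1 False by (subst blen.simps) simp
qed simp
qed

lemma blen_le: "0 < x ==> 2 ^ blen x <= 2 * x"
proof (induction x rule: blen.induct)
 case (1 x)
 show ?case
 proof (cases "x div 2 = 0")
 case True
 thus ?thesis using 1(2) by (simp add: blen.simps)
next
 case False
 thus ?thesis using 1 1(2) by (subst blen.simps) simp
qed
qed

lemma blen_le_self: "blen x <= x"
proof (induction x rule: blen.induct)
 case (1 x)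
 show ?case
 proof (cases "x = 0")
 case False
 show ?thesis using 1 False by (subst blen.simps) simp
qed (simp add: blen.simps)
qed

definition both :: "(nat \<times> nat) list => (nat \<times> nat) list" where
 "both es = concat (map (%(u, v). [(u, v), (v, u)]) es)"

lemma length_both: "length (both es) = 2 * length es"
 by (induction es) (auto simp: both_def)

lemma nth_both: "k < length es ==> both es ! (2 * k) = es ! k" "k < length es ==> both es ! (2 * k + 1) = prod.swap (es ! k)"
proof (induction es arbitrary: k)
 case (Cons e es)
 have b: "both (e # es) = e # prod.swap e # both es" by (cases e) (simp add: both_def)
 { case 1 thus ?case using Cons(1)[of "k - 1"] by (cases k) (simp_all add: b) }
 { case 2 thus ?case using Cons(2)[of "k - 1"] by (cases k) (simp_all add: b) }
qed simp_all

lemma set_both: "set (both es) = set es Un prod.swap ` set es"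
 by (force simp: both_def)

lemma distinct_both:
 "distinct (map (%(u, v). {u, v}) es) ==> (!!u v. (u, v) : set es ==> u ~= v) ==> distinct (both es)"
proof (induction es)
 case (Cons e es)
 obtain u v where e: "e = (u, v)" by (cases e)
 moreover have "both (e # es) = e # prod.swap e # both es" by (simp add: both_def e)
 ultimately show ?case using Cons by (auto simp: e set_both)
qed (simp add: both_def)

text \<open>Integer form of the three lower bounds m^(3/2), m tu^(2/5) and m^(1/2) tu^(3/4) on
  b.\<close>

definition balanced :: "nat => nat => nat => bool" where
 "balanced m tu b <-> m * m * m <= b * b & m * m * m * m * m * tu * tu <= b * b * b * b * b & m * m * tu * tu * tu <= b * b * b * b"

text \<open>The lower bounds m^2/b and (tu m/b)^(1/2) on the degree threshold, exactly those needed
  in \<open>search_work_bound\<close>.\<close>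

definition split_ok :: "nat => nat => nat => nat => bool" where
 "split_ok m tu b d <-> m * m <= d * b & tu * m <= d * d * b"

lemma balanced_sq: "1 <= m ==> tu <= m * m ==> balanced m tu (m * m)"
using mult_le_mono order_refl by (auto simp: balanced_def)
lemma balanced_D:
 assumes b: "balanced m tu B" and m: "1 <= m" and t: "1 <= tu" "tu <= m * m"
 shows "m <= B" "tu <= B" "1 <= B"
proof -
 show mB: "m <= B"
 proof (rule ccontr)
 assume "~m <= B"
 hence "B * B < m * m" by (intro mult_strict_mono) auto
 also have "... <= m * m * m" by simp
 finally show False using b by (simp add: balanced_def)
 qed
 show "tu <= B"
 proof (rule ccontr)
 assume "~tu <= B"
 hence lt: "B < tu" by simp
 have "B * B * B * B < tu * tu * tu * tu" using lt by (intro mult_strict_mono) auto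
 also have "... <= m * m * tu * tu * tu" using mult_le_mono1[OF t(2), of "tu * tu * tu"] by (simp add: )
 finally show False using b by (simp add: balanced_def)
 qed
 show "1 <= B" using mB m by simp
qed

text \<open>Since \<open>D - 1\<close> violates \<open>split_ok\<close>, D is at most about twice
  m^2/B or twice (tu m/B)^(1/2). In the first case the first two conditions of
  \<open>balanced\<close> give the claims, in the second case the first and the third together with
  \<open>tu <= B\<close>. This is where the exponents of the theorem come from.\<close>

lemma split_balance:
 assumes b: "balanced m tu B" and m: "1 <= m" and t: "1 <= tu" "tu <= m * m"
 and least: "D = 1 | (2 <= D & ~split_ok m tu B (D - 1))"
 shows "m * D <= 2 * B" "D * D * m * tu * tu <= 4 * B * B * B"
proof -
 have B: "m * m * m <= B * B" "m * m * m * m * m * tu * tu <= B * B * B * B * B" "m * m * tu * tu * tu <= B * B * B * B"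
 using b by (simp_all add: balanced_def)
 note mB = balanced_D[OF b m t]
 have "m * D <= 2 * B & D * D * m * tu * tu <= 4 * B * B * B"
 using least
 proof
 assume D: "D = 1"
 have "m * tu * tu <= B * B * B" using mB by (intro mult_le_mono)
 thus ?thesis using mB(1) by (simp add: D)
 next
 assume D: "2 <= D & ~split_ok m tu B (D - 1)"
 hence D2: "D <= 2 * (D - 1)" by linarith
 from D consider "(D - 1) * B < m * m" | "(D - 1) * (D - 1) * B < tu * m" by (auto simp: split_ok_def)
 thus ?thesis
 proof cases
 case 1
 have "D * B <= 2 * (D - 1) * B" by (rule mult_le_mono1[OF D2])
 also have "... <= 2 * (m * m)" using 1 by simp
 finally have DB: "D * B <= 2 * (m * m)" .
 have "m * D * B = m * (D * B)" by simp
 have "... <= m * (2 * (m * m))" by (rule mult_le_mono2[OF DB])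
 also have "... = 2 * (m * m * m)" by simp
 also have "... <= 2 * (B * B)" by (rule mult_le_mono2[OF B(1)])
 finally have "m * D <= 2 * B" using mB(3) by (subst () ) simp
moreover have "D * D * m * tu * tu * (B * B) <= 4 * B * B * B * (B * B)"
 proof -
 have "D * D * m * tu * tu * (B * B) = (D * B) * (D * B) * (m * tu * tu)" by (simp add: )
 also have "... <= (2 * (m * m)) * (2 * (m * m)) * (m * tu * tu)" by (intro mult_le_mono DB order_refl)
 also have "... = 4 * (m * m * m * m * m * tu * tu)" by simp
 also have "... <= 4 * (B * B * B * B * B)" by (rule mult_le_mono2[OF B(2)])
 finally show ?thesis by (simp only: )
 qed
 hence "0 < B * B --> D * D * m * tu * tu <= 4 * B * B * B" by (simp only: mult_le_cancel2)
 hence "D * D * m * tu * tu <= 4 * B * B * B" by (rule ) (use mB(3) in simp)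
 ultimately show ?thesis by blast
 next
 case 2
 have DB: "D * D * B <= 4 * (tu * m)"
 proof -
 have "D * D * B <= (2 * (D - 1)) * (2 * (D - 1)) * B" by (intro mult_le_mono D2 order_refl)
 also have "... <= 4 * (tu * m)" using 2 by simp
 finally show ?thesis .
 qed
 have "(m * D) * (m * D) * B <= (2 * B) * (2 * B) * B"
 proof -
 have "(m * D) * (m * D) * B = m * m * (D * D * B)" by (simp add: )
 have "... <= m * m * (4 * (tu * m))" by (rule mult_le_mono2[OF DB])
 also have "... = 4 * tu * (m * m * m)" by simp
 also have "... <= 4 * B * (B * B)" by (intro mult_le_mono mB B order_refl)
 finally show ?thesis by (simp add: ac_simps)
 qed
 hence sq: "(m * D) * (m * D) <= (2 * B) * (2 * B)" using mB(3) by (subst () ) simp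
 have "m * D <= 2 * B"
 proof (rule ccontr)
 assume "~m * D <= 2 * B"
 hence lt: "2 * B < m * D" by simp
 have "(2 * B) * (2 * B) < (m * D) * (m * D)" by (rule mult_strict_mono'[OF lt lt]) auto
 thus False using sq by linarith
 qed
 moreover have "D * D * m * tu * tu * B <= 4 * B * B * B * B"
 proof -
 have "D * D * m * tu * tu * B = (D * D * B) * (m * tu * tu)" by (simp add: )
 also have "... <= 4 * (tu * m) * (m * tu * tu)" by (rule mult_le_mono1[OF DB])
 also have "... = 4 * (m * m * tu * tu * tu)" by simp
 also have "... <= 4 * (B * B * B * B)" by (rule mult_le_mono2[OF B(3)])
 finally show ?thesis by (simp only: )
 qed
 hence "0 < B --> D * D * m * tu * tu <= 4 * B * B * B" by (simp only: mult_le_cancel2)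
 hence "D * D * m * tu * tu <= 4 * B * B * B" by (rule ) (use mB(3) in simp)
 ultimately show ?thesis by blast
 qed
 qed
 thus "m * D <= 2 * B" "D * D * m * tu * tu <= 4 * B * B * B" by blast+
qed

text \<open>\<open>U\<close> bounds all quantities polynomially. The number of hash functions is a
  multiple \<open>cr\<close> of a bit length, as this is a logarithm that the program can compute by
  itself. Suitable values are supplied in \<open>inputI\<close>.\<close>

locale input = ram +
 fixes n t U cr :: nat and es_0 :: "(nat \<times> nat) list"
 assumes es0: "es_0 ~= []" "distinct (map (%(u, v). {u, v}) es_0)" "!!u v. (u, v) : set es_0 ==> u < n & v < n & u ~= v"
 and U: "1000 <= U" "n <= U" "24 * (length es_0 * length es_0 + t + 1) <= U" "U ^ 20 < 2 ^ w" "U ^ 4 <= N"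
 and cr: "1 <= cr" "cr * blen (n + t) <= U" "real (U ^ 3) <= ep * 2 ^ (cr * blen (n + t))"
begin

definition m :: nat where "m = length es_0"
text \<open>A 4-clique is the union of two opposite edges, so there are at most \<open>m * m\<close>
  of them and a larger target may be cut down. The balance of the thresholds relies on this.\<close>

definition tt :: nat where "tt = min t (m * m)"
definition tu :: nat where "tu = max 1 tt"
definition B :: nat where "B = (LEAST b. balanced m tu b)"
definition D :: nat where "D = (LEAST d. 1 <= d & split_ok m tu B d)"
definition LV :: nat where "LV = blen (2 * m) + 1"
definition Bud :: nat where "Bud = 15000 * (LV * LV * B)"
definition rho :: nat where "rho = cr * blen (n + t)"
definition es :: "(nat \<times> nat) list" where "es = both es_0"

lemma m_pos: "1 <= m"
 using es0(1) by (simp add: m_def Suc_le_eq)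

lemma tau: "1 <= tu" "tu <= m * m" "tt <= tu" "tu <= t + 1"
 using m_pos by (auto simp: tu_def tt_def)

lemma balanced_B: "balanced m tu B" "B <= m * m" "b < B ==> ~balanced m tu b"
proof -
 have sq: "balanced m tu (m * m)" by (rule balanced_sq[OF m_pos tau(2)])
 show "balanced m tu B" unfolding B_def by (rule LeastI[of "balanced m tu", OF sq])
 show "B <= m * m" unfolding B_def by (rule Least_le[of "balanced m tu", OF sq])
 show "b < B ==> ~balanced m tu b" unfolding B_def by (rule not_less_Least)
qed

lemma B_bounds: "m <= B" "tu <= B" "1 <= B"
 using balanced_D[OF balanced_B(1) m_pos tau(1,2)] by blast+

lemma split_D: "1 <= D" "split_ok m tu B D" "D <= m * m" "1 <= d ==> d < D ==> ~split_ok m tu B d"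
proof -
 let ?P = "%d. 1 <= d & split_ok m tu B d"
 have 1: "1 <= m * m" using m_pos by simp
 have "m * m * 1 <= m * m * B" by (rule mult_le_mono2[OF B_bounds(3)])
 moreover have "tu * m <= m * m * (m * m) * B"
 proof -
 have "tu * m * 1 <= (m * m) * (m * m) * B" using tau(2) B_bounds(3) by (intro mult_le_mono) auto
 thus ?thesis by simp
 qed
 ultimately have sq: "?P (m * m)" using 1 by (simp add: split_ok_def)
 have "?P D" unfolding D_def by (rule LeastI[of ?P, OF sq])
 thus "1 <= D" "split_ok m tu B D" by blast+
 show "D <= m * m" unfolding D_def by (rule Least_le[of ?P, OF sq])
 show "1 <= d ==> d < D ==> ~split_ok m tu B d" unfolding D_def using not_less_Least[of d ?P] by blast
qed

lemma D_bounds: "m * D <= 2 * B" "D * D * m * tu * tu <= 4 * B * B * B"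
proof -
 have "D = 1 | (2 <= D & ~split_ok m tu B (D - 1))"
 using split_D(1) split_D(4)[of "D - 1"] by (cases "D = 1") auto
 from split_balance[OF balanced_B(1) m_pos tau(1,2) this] show "m * D <= 2 * B" "D * D * m * tu * tu <= 4 * B * B * B" .
qed

lemma mm_U: "m * m <= U" "24 * tu <= U" "2 * m <= U" "2 * m + 1 <= U" "t <= U"
proof -
 have U': "24 * (m * m) + 24 * t + 24 <= U" using U(3) by (simp add: m_def)
 have "m * 1 <= m * m" using m_pos by (intro mult_le_mono2)   thus "m * m <= U" "24 * tu <= U" "2 * m <= U" "2 * m + 1 <= U" "t <= U" using U' tau(4) by linarith+
qed

lemma LV_bounds: "2 * m < 2 ^ (LV - 1)" "1 <= LV" "LV <= U" "2 ^ (LV - 1) <= 4 * m"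
proof -
 show "2 * m < 2 ^ (LV - 1)" using less_blen[of "2 * m"] by (simp add: LV_def)
 show "LV <= U" using blen_le_self[of "2 * m"] mm_U(4) by (simp add: LV_def)
 show "2 ^ (LV - 1) <= 4 * m" using blen_le[of "2 * m"] m_pos by (simp add: LV_def)
qed (simp add: LV_def)

lemma Bud_le: "Bud <= U ^ 6"
proof -
 have "15000 <= U * U" using mult_le_mono[OF U(1) U(1)] by simp
 moreover have "B <= U" using balanced_B(2) mm_U(1) by simp
 ultimately have "15000 * (LV * LV * B) <= (U * U) * (U * U * U)"
 using LV_bounds(3) by (intro mult_le_mono)
 also have "... = U ^ 5" by (simp add: eval_nat_numeral)
 also have "... <= U ^ 6" using U(1) by (intro power_increasing) auto
 finally show ?thesis by (simp add: Bud_def)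
qed

sublocale budget w M C ep mu N n m tt U rho es tu B D LV Bud
proof unfold_locales
 show "1000 <= U" "n <= U" "U ^ 20 < 2 ^ w" "U ^ 4 <= N" by (rule U)+
 show "2 * m <= U" "24 * tu <= U" by (rule mm_U)+
 show "tt <= U" using mm_U(5) by (simp add: tt_def)
 have "1 <= blen (n + t)" using es0(3)[of "fst (hd es_0)" "snd (hd es_0)"] hd_in_set[OF es0(1)] by (subst blen.simps) simp
thus "1 <= rho" using cr(1) by (simp add: rho_def)
 show "real (U ^ 3) <= ep * 2 ^ rho" using cr(3) by (simp add: rho_def)
 show "length es = 2 * m" by (simp add: es_def length_both m_def)
 show "distinct es" unfolding es_def using es0(2,3) by (intro distinct_both) auto
 show "u < n & v < n & u ~= v" if "(u, v) : set es" for u v using that es0(3) by (auto simp: es_def set_both)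
 show "es ! (2 * k + 1) = prod.swap (es ! (2 * k))" if "k < m" for k using that by (simp only: es_def nth_both m_def)
 show "tt <= tu" "1 <= tu" by (rule tau)+
 show "1 <= B" "m <= B" "tu <= B" by (rule B_bounds)+
 show "B <= U" using balanced_B(2) mm_U(1) by simp
 show "1 <= D" by (rule split_D)
 show "D <= U" using split_D(3) mm_U(1) by simp
 show "2 * m < 2 ^ (LV - 1)" "1 <= LV" "LV <= U" by (rule LV_bounds)+
 show "Bud <= U ^ 6" by (rule Bud_le)
 show "15000 * (LV * LV * B) <= Bud" by (simp add: Bud_def)
 show "1 <= m" by (rule m_pos)
 show "m * m <= D * B" "tu * m <= D * D * B" using split_D(2) by (simp_all add: split_ok_def)
 show "m * D <= 2 * B" "D * D * m * tu * tu <= 4 * B * B * B" by (rule D_bounds)+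
qed

end

section \<open>Computing the parameters and reading the input\<close>

fun poly_exp :: "exp => bool" where
 "poly_exp (Lit k) = True"
| "poly_exp (Var x) = True"
| "poly_exp (Op f d e) = ((f = Add | f = Mul) & poly_exp d & poly_exp e)"
| "poly_exp (Read a e) = False"

fun nval :: "(nat => nat) => exp => nat" where
 "nval V (Lit k) = k"
| "nval V (Var x) = V x"
| "nval V (Op f d e) = (if f = Add then nval V d + nval V e else nval V d * nval V e)"
| "nval V (Read a e) = 0"

text \<open>Word addition and multiplication are those of residues, so only the final value has to
  be compared with \<open>2 ^ w\<close>, not the intermediate ones.\<close>

lemma eval_mod: "poly_exp e ==> eval w V A e mod 2 ^ w = nval V e mod 2 ^ w"
proof (induction e)
 case (Op f d e)
 hence d: "eval w V A d mod 2 ^ w = nval V d mod 2 ^ w" and e: "eval w V A e mod 2 ^ w = nval V e mod 2 ^ w" by auto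
 from Op(3) consider "f = Add" | "f = Mul" by auto
 thus ?case using mod_add_cong[OF d e] mod_mult_cong[OF d e] by cases simp_all
qed simp_all

lemma eval_poly: "poly_exp e ==> nval V e < 2 ^ w ==> eval w V A e = nval V e"
proof (cases e)
 case (Op f d e')
 assume p: "poly_exp e" "nval V e < 2 ^ w"
 thus ?thesis using Op eval_mod[OF p(1), of ] p(2) by auto
qed auto

definition bits :: "nat => nat => com" where
 "bits x y = While ($x) (Asg x (Op Div ($x) (Lit 2)) ;; Asg y ($y [+] Lit 1))"

abbreviation (input) "vIn == 81 :: nat"
abbreviation (input) "vTmp == 82 :: nat"
abbreviation (input) "vBits == 83 :: nat"
abbreviation (input) "vEdge == 84 :: nat"

definition unbalanced_exp :: exp where
 "unbalanced_exp = (
 ($vB [*] $vB [<] $vM [*] $vM [*] $vM) [|]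
 ($vB [*] $vB [*] $vB [*] $vB [*] $vB [<] $vM [*] $vM [*] $vM [*] $vM [*] $vM [*] $vTau [*] $vTau) [|]
 ($vB [*] $vB [*] $vB [*] $vB [<] $vM [*] $vM [*] $vTau [*] $vTau [*] $vTau))"

definition unsplit_exp :: exp where
 "unsplit_exp = (($vD [*] $vB [<] $vM [*] $vM) [|] ($vD [*] $vD [*] $vB [<] $vTau [*] $vM))"

definition read_params :: "nat => com" where
 "read_params cr =
 Asg vN (Read 0 (Lit 0)) ;; Asg vM (Read 0 (Lit 1)) ;; Asg vIn (Read 0 (Lit 2)) ;;
 Asg vTmp ($vN [+] $vIn) ;; Asg vBits (Lit 0) ;; bits vTmp vBits ;; Asg vR (Lit cr [*] $vBits) ;;
 Asg vT ($vM [*] $vM) ;; Cond ($vIn [<] $vT) (Asg vT ($vIn)) Skip ;;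
 Asg vTau ($vT) ;; Cond ($vT) Skip (Asg vTau (Lit 1)) ;;
 Asg vTmp (Lit 2 [*] $vM) ;; Asg vLV (Lit 1) ;; bits vTmp vLV"

definition balance_params :: com where
 "balance_params =
 Asg vB (Lit 0) ;; While unbalanced_exp (Asg vB ($vB [+] Lit 1)) ;;
 Asg vD (Lit 1) ;; While unsplit_exp (Asg vD ($vD [+] Lit 1)) ;;
 Asg vBud (Lit 15000 [*] ($vLV [*] $vLV [*] $vB)) ;; Asg vJJ (Lit 0)"

definition put_edge :: "nat => nat => exp => com" where
 "put_edge x y e = Write aEU e ($x) ;; Write aEV e ($y) ;; Write aPos ($x [*] $vN [+] $y) e"

definition read_edge :: com where
 "read_edge =
 Asg vTmp (Read 0 (Lit 3 [+] Lit 2 [*] $vEdge)) ;; Asg vBits (Read 0 (Lit 4 [+] Lit 2 [*] $vEdge)) ;;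
 put_edge vTmp vBits (Lit 2 [*] $vEdge) ;; put_edge vBits vTmp (Lit 2 [*] $vEdge [+] Lit 1)"

definition read_edges :: com where "read_edges = For vEdge vM read_edge"

context ram
begin

lemma sp_bits:
 assumes "vl S x = a" "vl S y = b" "x ~= y" "b + blen a < 2 ^ w" "1 < w"
 and Q: "!!S'. ar S' = ar S ==> (!!z. z ~: {x, y} ==> vl S' z = vl S z) ==> vl S' y = b + blen a ==> bad S' = bad S ==>
 clk S - (1 + 3 * real (blen a)) <= clk S' ==> Q S'"
 shows "sp (bits x y) S Q"
 unfolding bits_def
proof (rule sp_While[where m = "%S'. vl S' x" and Inv = "%S'. ar S' = ar S & (\<forall>z. z ~: {x, y} --> vl S' z = vl S z) & bad S' = bad S &
 vl S' y + blen (vl S' x) = b + blen a & clk S - 3 * (real (blen a) - real (blen (vl S' x))) <= clk S'"])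
 fix S' :: cst
 assume I: "ar S' = ar S & (\<forall>z. z ~: {x, y} --> vl S' z = vl S z) & bad S' = bad S &
 vl S' y + blen (vl S' x) = b + blen a & clk S - 3 * (real (blen a) - real (blen (vl S' x))) <= clk S'"
 {
 assume "ev w S' ($x) = 0"
 hence "blen (vl S' x) = 0" by (simp add: blen.simps)
 thus "Q (tick S')" using I by (intro Q) auto
 next
 assume "ev w S' ($x) ~= 0"
 hence pos: "0 < vl S' x" by simp
 hence bl: "blen (vl S' x) = Suc (blen (vl S' x div 2))" by (subst blen.simps) simp
 have 2: "(2 :: nat) < 2 ^ w" using power_strict_increasing[of 1 w "2 :: nat"] assms(5) by simp
 have y: "vl S' y + 1 < 2 ^ w" using I bl assms(4) by linarith
 show "sp (Asg x (Op Div ($x) (Lit 2)) ;; Asg y ($y [+] Lit 1)) (tick S') (%S''. (ar S'' = ar S & (\<forall>z. z ~: {x, y} --> vl S'' z = vl S z) & bad S'' = bad S &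
 vl S'' y + blen (vl S'' x) = b + blen a & clk S - 3 * (real (blen a) - real (blen (vl S'' x))) <= clk S'') & vl S'' x < vl S' x)"
 proof (rule sp_Seq, rule sp_Asg_eq[where v = "vl S' x div 2"])
 show "eval w (vl (tick S')) (ar (tick S')) (Op Div ($x) (Lit 2)) = vl S' x div 2" using 2 by simp
 have *: "clk S - 3 * (real (blen a) - real (blen (vl S' x div 2))) <= clk S' - 3" using I bl by simp
 show "sp (Asg y ($y [+] Lit 1)) (tick S'(|vl := (vl (tick S'))(x := vl S' x div 2), clk := clk (tick S') - 1|))
 (%S''. (ar S'' = ar S & (\<forall>z. z ~: {x, y} --> vl S'' z = vl S z) & bad S'' = bad S &
 vl S'' y + blen (vl S'' x) = b + blen a & clk S - 3 * (real (blen a) - real (blen (vl S'' x))) <= clk S'') & vl S'' x < vl S' x)"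
 proof (rule sp_Asg_eq[where v = "vl S' y + 1"])
 show "eval w (vl (tick S'(|vl := (vl (tick S'))(x := vl S' x div 2), clk := clk (tick S') - 1|)))
 (ar (tick S'(|vl := (vl (tick S'))(x := vl S' x div 2), clk := clk (tick S') - 1|))) ($y [+] Lit 1) = vl S' y + 1"
 using y assms(3,5) by simp
 qed (use I bl pos * assms(3) in simp_all)
 qed
 }
qed (use assms in auto)

text \<open>Linear search for the least solution; the cost is absorbed by the running time.\<close>

lemma sp_least:
 assumes "vl S x = a" "a <= l" "l + 1 < 2 ^ w"
 and e: "!!S' :: cst. (!!z. z ~= x ==> vl S' z = vl S z) ==> ar S' = ar S ==> vl S' x <= l ==> a <= vl S' x ==>
 ev w S' e = of_bool (vl S' x < l)"
 and Q: "Q (S(|vl := (vl S)(x := l), clk := clk S - (1 + 2 * (real l - real a))|))"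
 shows "sp (While e (Asg x ($x [+] Lit 1))) S Q"
proof (rule sp_While[where m = "%S'. l - vl S' x" and Inv = "%S'. \<exists>b. a <= b & b <= l & S' = S(|vl := (vl S)(x := b), clk := clk S - 2 * (real b - real a)|)"])
 show "\<exists>b. a <= b & b <= l & S = S(|vl := (vl S)(x := b), clk := clk S - 2 * (real b - real a)|)"
 using assms(1,2) by (intro exI[of _ a]) auto
 fix S' :: cst
 assume "\<exists>b. a <= b & b <= l & S' = S(|vl := (vl S)(x := b), clk := clk S - 2 * (real b - real a)|)"
 then obtain b where b: "a <= b" "b <= l" and S': "S' = S(|vl := (vl S)(x := b), clk := clk S - 2 * (real b - real a)|)" by blast
 have ev: "ev w S' e = of_bool (b < l)" using e[of S'] b unfolding S' by simp
 {
 assume "ev w S' e = 0"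
 thus "Q (tick S')" using ev b Q by (simp add: S' algebra_simps)
next
 assume "ev w S' e ~= 0"
 thus "sp (Asg x ($x [+] Lit 1)) (tick S') (%S''. (\<exists>b. a <= b & b <= l & S'' = S(|vl := (vl S)(x := b), clk := clk S - 2 * (real b - real a)|)) & l - vl S'' x < l - vl S' x)"
 using ev b assms(3) by (intro sp_Asg_eq[where v = "b + 1"] conjI exI[of _ "b + 1"]) (auto simp: S' mod_if)
}
qed

end

context input
begin

lemma mul_pow: "x <= U ^ i ==> y <= U ==> x * y <= U ^ Suc i"
 using mult_le_mono[of x "U ^ i" y ] by (simp add: mult.commute)

lemma prod_less:
 "a <= U ==> b <= U ==> a * b < 2 ^ w"
 "a <= U ==> b <= U ==> c <= U ==> a * b * c < 2 ^ w"
 "a <= U ==> b <= U ==> c <= U ==> d <= U ==> a * b * c * d < 2 ^ w"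
 "a <= U ==> b <= U ==> c <= U ==> d <= U ==> e <= U ==> a * b * c * d * e < 2 ^ w"
 "a <= U ==> b <= U ==> c <= U ==> d <= U ==> e <= U ==> f <= U ==> g <= U ==> a * b * c * d * e * f * g < 2 ^ w"
proof -
 have pw: "x <= U ^ i ==> i <= 20 ==> x < 2 ^ w" for x i using U_pow_less[of i] by simp
 assume a: "a <= U" and b: "b <= U"
 have 2: "a * b <= U ^ Suc (Suc 0)" using a b by (intro mul_pow) auto
 thus "a * b < 2 ^ w" by (rule pw) simp
 assume c: "c <= U"
 have 3: "a * b * c <= U ^ Suc (Suc (Suc 0))" by (rule mul_pow[OF 2 c])
 thus "a * b * c < 2 ^ w" by (rule pw) simp
 assume d: "d <= U"
 have 4: "a * b * c * d <= U ^ Suc (Suc (Suc (Suc 0)))" by (rule mul_pow[OF 3 d])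
 thus "a * b * c * d < 2 ^ w" by (rule pw) simp
 assume e: "e <= U"
 have 5: "a * b * c * d * e <= U ^ Suc (Suc (Suc (Suc (Suc 0))))" by (rule mul_pow[OF 4 e])
 thus "a * b * c * d * e < 2 ^ w" by (rule pw) simp
 assume f: "f <= U" and g: "g <= U"
 show "a * b * c * d * e * f * g < 2 ^ w" by (rule pw[OF mul_pow[OF mul_pow[OF 5 f] g]]) simp
qed

lemma params_le: "m <= U" "tu <= U" "tt <= U" "n <= U" "t <= U" "B <= U" "D <= U"
 using mm_U BD U(2) tau(3) by simp_all

lemma eval_unbalanced: "V vM = m ==> V vTau = tu ==> V vB = b ==> b <= B ==> eval w V A unbalanced_exp = of_bool (b < B)"
proof -
 assume V: "V vM = m" "V vTau = tu" "V vB = b" and b: "b <= B"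
 have bU: "b <= U" using b params_le by simp
 note P = params_le
 have bal: "balanced m tu b <-> ~b < B" using balanced_B(1) balanced_B(3)[] b by (cases "b < B") auto
 have 1: "eval w V A ($vB [*] $vB) = b * b" "eval w V A ($vM [*] $vM [*] $vM) = m * m * m"
 "eval w V A ($vB [*] $vB [*] $vB [*] $vB [*] $vB) = b * b * b * b * b"
 "eval w V A ($vM [*] $vM [*] $vM [*] $vM [*] $vM [*] $vTau [*] $vTau) = m * m * m * m * m * tu * tu"
 "eval w V A ($vB [*] $vB [*] $vB [*] $vB) = b * b * b * b"
 "eval w V A ($vM [*] $vM [*] $vTau [*] $vTau [*] $vTau) = m * m * tu * tu * tu"
 using prod_less(1)[OF bU bU] prod_less(2)[OF P(1) P(1) P(1)] prod_less(4)[OF bU bU bU bU bU] prod_less(5)[OF P(1) P(1) P(1) P(1) P(1) P(2) P(2)]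
 prod_less(3)[OF bU bU bU bU] prod_less(4)[OF P(1) P(1) P(2) P(2) P(2)]
 by (subst eval_poly; simp add: V[])+
 show "eval w V A unbalanced_exp = of_bool (b < B)"
 unfolding unbalanced_exp_def eval.simps(3)[of w V A Or] eval.simps(3)[of w V A Less] 1     using bal by (auto simp: balanced_def not_le)
qed

lemma eval_unsplit: "V vM = m ==> V vTau = tu ==> V vB = B ==> V vD = d ==> 1 <= d ==> d <= D ==> eval w V A unsplit_exp = of_bool (d < D)"
proof -
 assume V: "V vM = m" "V vTau = tu" "V vB = B" "V vD = d" and d: "1 <= d" "d <= D"
 have dU: "d <= U" using d params_le by simp
 note P = params_le
 have spl: "split_ok m tu B d <-> ~d < D" using split_D(2) split_D(4)[OF d(1)] d(2) by (cases "d < D") auto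
 have 1: "eval w V A ($vD [*] $vB) = d * B" "eval w V A ($vM [*] $vM) = m * m" "eval w V A ($vD [*] $vD [*] $vB) = d * d * B"
 "eval w V A ($vTau [*] $vM) = tu * m"
 using prod_less(1)[OF dU P(6)] prod_less(1)[OF P(1) P(1)] prod_less(2)[OF dU dU P(6)] prod_less(1)[OF P(2) P(1)]
 by (subst eval_poly; simp add: V[])+
 show "eval w V A unsplit_exp = of_bool (d < D)"
 unfolding unsplit_exp_def eval.simps(3)[of w V A Or] eval.simps(3)[of w V A Less] 1     using spl by (auto simp: split_ok_def )
qed

end

lemma written_setup:
 "wvars (read_params cr) = {vN, vM, vIn, vTmp, vBits, vR, vT, vTau, vLV}" "warrs (read_params cr) = {}"
 "wvars balance_params = {vB, vD, vBud, vJJ}" "warrs balance_params = {}"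
 "wvars read_edges = {vEdge, vTmp, vBits}" "warrs read_edges = {aEU, aEV, aPos}"
 by (auto simp: read_params_def bits_def balance_params_def read_edges_def read_edge_def put_edge_def w_For)

context input
begin

definition xs_0 :: "nat list" where "xs_0 = [n, m, t] @ concat (map (%(u, v). [u, v]) es_0)"

lemma nth_concat_pairs: "k < length es' ==> concat (map (%(u, v). [u, v]) es') ! (2 * k) = fst (es' ! k)"
 "k < length es' ==> concat (map (%(u, v). [u, v]) es') ! (2 * k + 1) = snd (es' ! k)"
proof (induction es' arbitrary: k)
 case (Cons e es')
 obtain u v where e: "e = (u, v)" by (cases e)
 { case 1 thus ?case using Cons(1)[of "k - 1"] by (cases k) (simp_all add: e) }
 { case 2 thus ?case using Cons(2)[of "k - 1"] by (cases k) (simp_all add: e) }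
qed simp_all

lemma length_concat_pairs: "length (concat (map (%(u, v). [u, v]) es')) = 2 * length es'"
 by (induction es') auto

lemma length_xs0: "length xs_0 = 3 + 2 * m"
 by (simp add: xs_0_def length_concat_pairs m_def)

lemma nth_xs0: "xs_0 ! 0 = n" "xs_0 ! 1 = m" "xs_0 ! 2 = t" "k < m ==> xs_0 ! (3 + 2 * k) = fst (es_0 ! k)" "k < m ==> xs_0 ! (4 + 2 * k) = snd (es_0 ! k)"
using nth_concat_pairs by (auto simp: xs_0_def m_def)
lemma U_less: "x <= U ==> x + U + 17 < 2 ^ w"
 using UU_less[of 1 ] U(1) by simp

lemma sp_read_params:
 assumes input: "!!i. i < length xs_0 ==> ar S 0 i = xs_0 ! i"
 shows "sp (read_params cr) S (%S'. vl S' vN = n & vl S' vM = m & vl S' vT = tt & vl S' vTau = tu & vl S' vR = rho & vl S' vLV = LV & bad S' = bad S &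
 clk S - (20 + 3 * real (blen (n + t)) + 3 * real LV) <= clk S')" (is "sp _ S ?Q")
proof -
 note P = params_le
 have in3: "ar S 0 0 = n" "ar S 0 1 = m" "ar S 0 2 = t" using input[of 0] input[of 1] input[of 2] nth_xs0(1-3) length_xs0 by simp_all
 have small: "n + t < 2 ^ w" "2 * m < 2 ^ w" "1 + blen (2 * m) < 2 ^ w" "cr * blen (n + t) < 2 ^ w" "blen (n + t) < 2 ^ w" "cr < 2 ^ w" "m * m < 2 ^ w"
 using U_less[OF P(4)] P(5) U_less[OF mm_U(3)] U_less[OF mm_U(1)] blen_le_self[of "2 * m"] U_less[OF cr(2)] blen_le_self[of "n + t"]
 less_blen[of "n + t"]     apply simp_all
 apply (cases "blen (n + t)")
 using es0(3)[of "fst (hd es_0)" "snd (hd es_0)"] hd_in_set[OF es0(1)] apply simp_all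
 done
 have w1: "1 < w"
 proof (rule ccontr)
 assume "~1 < w"
 hence "(2 :: nat) ^ w <= 2 ^ 1" by (intro power_increasing) auto
 thus False using U_less[of 0] by simp
 qed
 let ?S1 = "S(|vl := (vl S)(vN := n, vM := m, vIn := t, vTmp := n + t, vBits := 0), clk := clk S - 5|)"
 have rest: "sp (Asg vR (Lit cr [*] $vBits) ;;
 Asg vT ($vM [*] $vM) ;; Cond ($vIn [<] $vT) (Asg vT ($vIn)) Skip ;;
 Asg vTau ($vT) ;; Cond ($vT) Skip (Asg vTau (Lit 1)) ;;
 Asg vTmp (Lit 2 [*] $vM) ;; Asg vLV (Lit 1) ;; bits vTmp vLV) S2 ?Q"
 if S2: "!!z. z ~: {vTmp, vBits} ==> vl S2 z = vl ?S1 z" "vl S2 vBits = 0 + blen (n + t)" "bad S2 = bad S"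
 "clk ?S1 - (1 + 3 * real (blen (n + t))) <= clk S2" for S2 :: cst
 proof -
 have V2: "vl S2 vN = n" "vl S2 vM = m" "vl S2 vIn = t" using S2(1)[] S2(1)[] S2(1)[] by simp_all
 have last: "sp (Asg vTmp (Lit 2 [*] $vM) ;; Asg vLV (Lit 1) ;; bits vTmp vLV) S3 ?Q"
 if S3: "vl S3 vN = n" "vl S3 vM = m" "vl S3 vT = tt" "vl S3 vTau = tu" "vl S3 vR = rho" "bad S3 = bad S"
 "clk S2 - 7 <= clk S3" for S3 :: cst
 proof (rule sp_Seq, rule sp_Asg_eq[where v = "2 * m"])
 show "ev w S3 (Lit 2 [*] $vM) = 2 * m" using S3(2) small(2) by (subst eval_poly) simp_all
 let ?S4 = "(upd S3 vTmp (2 * m))"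
 show "sp (Asg vLV (Lit 1) ;; bits vTmp vLV) ?S4 ?Q"
 proof (rule sp_Seq, rule sp_Asg_eq[where v = 1], simp, rule sp_bits[where a = "2 * m" and b = 1])
 fix S' :: cst
 assume S': "!!z. z ~: {vTmp, vLV} ==> vl S' z = vl ((upd ?S4 vLV 1)) z"
 "vl S' vLV = 1 + blen (2 * m)" "bad S' = bad ((upd ?S4 vLV 1))"
 "clk ((upd ?S4 vLV 1)) - (1 + 3 * real (blen (2 * m))) <= clk S'"
 show "?Q S'" using S3 S2(4) [] S'(1)[] S'(1)[of ] S'(1)[of vTau] S'(1)[of vR] S'(2-4)
 by (simp add: LV_def)
 qed (use small w1 in simp_all)
 qed
 have cond: "sp (Cond ($vT) Skip (Asg vTau (Lit 1)) ;; Asg vTmp (Lit 2 [*] $vM) ;; Asg vLV (Lit 1) ;; bits vTmp vLV) S3 ?Q"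
 if S3: "vl S3 vN = n" "vl S3 vM = m" "vl S3 vT = tt" "vl S3 vTau = tt" "vl S3 vR = rho" "bad S3 = bad S"
 "clk S2 - 5 <= clk S3" for S3 :: cst
 proof (rule sp_Seq, rule sp_Cond)
 assume "ev w S3 ($vT) ~= 0"
 hence "tt = tu" using S3(3) by (simp add: tu_def)
 thus "sp Skip (tick S3) (%S'. sp (Asg vTmp (Lit 2 [*] $vM) ;; Asg vLV (Lit 1) ;; bits vTmp vLV) S' ?Q)"
 by (intro sp_Skip last) (use S3 in simp_all)
 next
 assume "ev w S3 ($vT) = 0"
 hence "tu = 1" using S3(3) by (simp add: tu_def)
 thus "sp (Asg vTau (Lit 1)) (tick S3) (%S'. sp (Asg vTmp (Lit 2 [*] $vM) ;; Asg vLV (Lit 1) ;; bits vTmp vLV) S' ?Q)"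
 by (intro sp_Asg_eq[where v = 1] last) (use S3 in simp_all)
 qed
 have tau: "sp (Asg vTau ($vT) ;; Cond ($vT) Skip (Asg vTau (Lit 1)) ;; Asg vTmp (Lit 2 [*] $vM) ;; Asg vLV (Lit 1) ;; bits vTmp vLV) S3 ?Q"
 if S3: "vl S3 vN = n" "vl S3 vM = m" "vl S3 vT = tt" "vl S3 vR = rho" "bad S3 = bad S"
 "clk S2 - 4 <= clk S3" for S3 :: cst
 by (rule sp_Seq, rule sp_Asg_eq[where v = tt], simp add: S3, rule cond) (use S3 in simp_all)
 show ?thesis
 proof (rule sp_Seq, rule sp_Asg_eq[where v = rho])
 show "ev w S2 (Lit cr [*] $vBits) = rho" using S2(2) small by (subst eval_poly) (simp_all add: rho_def)
 let ?S3 = "(upd S2 vR rho)"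
 let ?S4 = "(upd ?S3 vT (m * m))"
 show "sp (Asg vT ($vM [*] $vM) ;; Cond ($vIn [<] $vT) (Asg vT ($vIn)) Skip ;;
 Asg vTau ($vT) ;; Cond ($vT) Skip (Asg vTau (Lit 1)) ;; Asg vTmp (Lit 2 [*] $vM) ;; Asg vLV (Lit 1) ;; bits vTmp vLV) ?S3 ?Q"
 proof (rule sp_Seq, rule sp_Asg_eq[where v = "m * m"])
 show "ev w ?S3 ($vM [*] $vM) = m * m" using V2 small by (subst eval_poly) simp_all
 show "sp (Cond ($vIn [<] $vT) (Asg vT ($vIn)) Skip ;;
 Asg vTau ($vT) ;; Cond ($vT) Skip (Asg vTau (Lit 1)) ;; Asg vTmp (Lit 2 [*] $vM) ;; Asg vLV (Lit 1) ;; bits vTmp vLV) ?S4 ?Q"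
 proof (rule sp_Seq, rule sp_Cond)
 assume "ev w ?S4 ($vIn [<] $vT) ~= 0"
 hence "tt = t" using V2(3) by (simp add: tt_def)
 thus "sp (Asg vT ($vIn)) (tick ?S4) (%S'. sp (Asg vTau ($vT) ;; Cond ($vT) Skip (Asg vTau (Lit 1)) ;; Asg vTmp (Lit 2 [*] $vM) ;; Asg vLV (Lit 1) ;; bits vTmp vLV) S' ?Q)"
 using V2 S2(3) by (intro sp_Asg_eq[where v = t] tau) simp_all
 next
 assume "ev w ?S4 ($vIn [<] $vT) = 0"
 hence "tt = m * m" using V2(3) by (simp add: tt_def)
 thus "sp Skip (tick ?S4) (%S'. sp (Asg vTau ($vT) ;; Cond ($vT) Skip (Asg vTau (Lit 1)) ;; Asg vTmp (Lit 2 [*] $vM) ;; Asg vLV (Lit 1) ;; bits vTmp vLV) S' ?Q)"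
 using V2 S2(3) by (intro sp_Skip tau) simp_all
 qed
 qed
 qed
 qed
 show ?thesis
 unfolding read_params_def
 apply (rule sp_Seq, rule sp_Asg_eq[where v = n], simp add: in3)
 apply (rule sp_Seq, rule sp_Asg_eq[where v = m], use in3 in simp)
 apply (rule sp_Seq, rule sp_Asg_eq[where v = t], use in3 in simp)
 apply (rule sp_Seq, rule sp_Asg_eq[where v = "n + t"], use small in simp)
 apply (rule sp_Seq, rule sp_Asg_eq[where v = 0], simp)
 apply (rule sp_Seq, rule sp_bits[where a = "n + t" and b = 0])
 using small w1 rest by simp_all
qed

lemma sp_balance_params:
 assumes V: "vl S vM = m" "vl S vTau = tu" "vl S vLV = LV"
 shows "sp balance_params S (%S'. vl S' vB = B & vl S' vD = D & vl S' vBud = Bud & vl S' vJJ = 0 & bad S' = bad S &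
 clk S - (10 + 2 * real B + 2 * real D) <= clk S')" (is "sp _ S ?Q")
proof -
 note P = params_le
 have less: "B + 1 < 2 ^ w" "D + 1 < 2 ^ w" "Bud < 2 ^ w"
 using U_less[OF P(6)] U_less[OF P(7)] Bud_le U_pow_less[of 6] by simp_all
 have last: "sp (Asg vBud (Lit 15000 [*] ($vLV [*] $vLV [*] $vB)) ;; Asg vJJ (Lit 0)) S1 ?Q"
 if S1: "vl S1 vLV = LV" "vl S1 vB = B" "vl S1 vD = D" "bad S1 = bad S" "clk S - (6 + 2 * real B + 2 * real D) <= clk S1" for S1 :: cst
 proof (rule sp_Seq, rule sp_Asg_eq[where v = Bud])
 show "ev w S1 (Lit 15000 [*] ($vLV [*] $vLV [*] $vB)) = Bud"
 using S1 less(3) by (subst eval_poly) (simp_all add: Bud_def)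
 show "sp (Asg vJJ (Lit 0)) ((upd S1 vBud Bud)) ?Q"
 by (rule sp_Asg_eq[where v = 0]) (use S1 in simp_all)
 qed
 have mid: "sp (Asg vD (Lit 1) ;; While unsplit_exp (Asg vD ($vD [+] Lit 1)) ;;
 Asg vBud (Lit 15000 [*] ($vLV [*] $vLV [*] $vB)) ;; Asg vJJ (Lit 0)) S1 ?Q"
 if S1: "vl S1 vM = m" "vl S1 vTau = tu" "vl S1 vLV = LV" "vl S1 vB = B" "bad S1 = bad S" "clk S - (2 + 2 * real B) <= clk S1" for S1 :: cst
 proof (rule sp_Seq, rule sp_Asg_eq[where v = 1], simp, rule sp_Seq, rule sp_least[where a = 1 and l = D])
 let ?S2 = "(upd S1 vD 1)"
 show "ev w S' unsplit_exp = of_bool (vl S' vD < D)"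
 if "!!z. z ~= vD ==> vl S' z = vl ?S2 z" "vl S' vD <= D" "1 <= vl S' vD" for S' :: cst
 using that(1)[] that(1)[] that(1)[] that(2,3) S1 by (intro eval_unsplit) simp_all
 show "sp (Asg vBud (Lit 15000 [*] ($vLV [*] $vLV [*] $vB)) ;; Asg vJJ (Lit 0))
 (?S2(|vl := (vl ?S2)(vD := D), clk := clk ?S2 - (1 + 2 * (real D - real 1))|)) ?Q"
 by (rule last) (use S1 in simp_all)
 qed (use split_D(1) less in simp_all)
 show ?thesis
 unfolding balance_params_def
 proof (rule sp_Seq, rule sp_Asg_eq[where v = 0], simp, rule sp_Seq, rule sp_least[where a = 0 and l = B])
 let ?S2 = "(upd S vB 0)"
 show "ev w S' unbalanced_exp = of_bool (vl S' vB < B)"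
 if "!!z. z ~= vB ==> vl S' z = vl ?S2 z" "vl S' vB <= B" for S' :: cst
 using that(1)[] that(1)[] that(2) V by (intro eval_unbalanced) simp_all
 show "sp (Asg vD (Lit 1) ;; While unsplit_exp (Asg vD ($vD [+] Lit 1)) ;;
 Asg vBud (Lit 15000 [*] ($vLV [*] $vLV [*] $vB)) ;; Asg vJJ (Lit 0))
 (?S2(|vl := (vl ?S2)(vB := B), clk := clk ?S2 - (1 + 2 * (real B - real 0))|)) ?Q"
 by (rule mid) (use V in simp_all)
 qed (use less in simp_all)
qed

lemma pos_inj: "i < 2 * m ==> j < 2 * m ==> fst (es ! i) * n + snd (es ! i) = fst (es ! j) * n + snd (es ! j) ==> i = j"
proof -
 assume ij: "i < 2 * m" "j < 2 * m" and eq: "fst (es ! i) * n + snd (es ! i) = fst (es ! j) * n + snd (es ! j)"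
 have l': "snd (es ! i) < n" if "i < 2 * m" for i
 using es(3)[of "fst (es ! i)" "snd (es ! i)"] that es(1) by simp
 note l = l'[OF ij(1)] l'[OF ij(2)]
 have "es ! i = es ! j" using mult_add_eq[OF l eq] by (simp add: prod_eq_iff)
 thus "i = j" using es(1,2) ij by (simp add: nth_eq_iff_index_eq)
qed

definition eread :: "nat => (nat => nat => nat) => bool" where
 "eread j A <-> (\<forall>i<j. A aEU i = fst (es ! i) & A aEV i = snd (es ! i) & A aPos (fst (es ! i) * n + snd (es ! i)) = i)"

lemma edges_read_Suc:
 assumes "eread j A" "j < 2 * m" "es ! j = (u, v)"
 shows "eread (Suc j) (A(aEU := (A aEU)(j := u), aEV := (A aEV)(j := v), aPos := (A aPos)(u * n + v := j)))"
proof -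
 have "fst (es ! i) * n + snd (es ! i) ~= u * n + v" if "i < j" for i
 using pos_inj[of i ] assms(2,3) that by auto
 thus ?thesis using assms(1,3) by (simp add: eread_def )
qed

lemma sp_put_edge:
 assumes V: "vl S x = u" "vl S y = v" "vl S vN = n" "u < n" "v < n"
 and e: "!!A. eval w (vl S) A e = j" and j: "j < 2 * m" "es ! j = (u, v)" and I: "eread j (ar S)"
 shows "sp (put_edge x y e) S (%S'. eread (Suc j) (ar S') & bad S' = bad S & clk S - 3 <= clk S')"
proof -
 have ix: "eval w (vl S) A ($x [*] $vN [+] $y) = u * n + v" for A
 using madd_less[OF V(4,5)] n_pow_less(1) V by (subst eval_poly) simp_all
have ev: "eval w (vl S) A ($x) = u" "eval w (vl S) A ($y) = v" for A using V by simp_all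
 let ?A = "(ar S)(aEU := (ar S aEU)(j := u), aEV := (ar S aEV)(j := v), aPos := (ar S aPos)(u * n + v := j))"
 have last: "eread (Suc j) ?A" by (rule edges_read_Suc[OF I j])
 show ?thesis
 unfolding put_edge_def
 apply (rule sp_Seq, rule sp_Write_eq[where x = j and v = u], rule e, rule ev)
 apply (rule sp_Seq, rule sp_Write_eq[where x = j and v = v])
 subgoal using e by simp
 subgoal using ev by simp
 apply (rule sp_Write_eq[where x = "u * n + v" and v = j])
 subgoal using ix[] by (simp del: )
 subgoal using e by simp
 using last by simp
qed

lemma sp_read_edge:
 assumes input: "ar S 0 (3 + 2 * i) = u" "ar S 0 (4 + 2 * i) = v" and V: "vl S vN = n" "vl S vEdge = i" and i: "i < m" "es_0 ! i = (u, v)"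
 and I: "eread (2 * i) (ar S)"
 shows "sp read_edge S (%S'. eread (2 * Suc i) (ar S') & bad S' = bad S & clk S - 8 <= clk S')" (is "sp _ S ?Q")
proof -
 have uv: "u < n" "v < n" using es0(3)[] i nth_mem[of i "es_0"] by (simp_all add: m_def)
 have sm: "4 + 2 * i < 2 ^ w" "3 + 2 * i < 2 ^ w" "2 * i + 1 < 2 ^ w" "2 * i < 2 ^ w" using U_less[OF mm_U(3)] i(1) by linarith+
 have e: "es ! (2 * i) = (u, v)" "es ! (Suc (2 * i)) = (v, u)" using nth_both[of i "es_0"] i by (simp_all add: es_def m_def)
 have ev: "eval w V A (Lit 3 [+] Lit 2 [*] $vEdge) = 3 + 2 * i" "eval w V A (Lit 4 [+] Lit 2 [*] $vEdge) = 4 + 2 * i"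
 "eval w V A (Lit 2 [*] $vEdge) = 2 * i" "eval w V A (Lit 2 [*] $vEdge [+] Lit 1) = Suc (2 * i)"
 if "V vEdge = i" for V A
 using sm that by (subst eval_poly; simp)+
 let ?e1 = "Lit 2 [*] $vEdge" let ?e2 = "Lit 2 [*] $vEdge [+] Lit 1"
 have put: "sp (put_edge vTmp vBits ?e1 ;; put_edge vBits vTmp ?e2) S1 ?Q"
 if S1: "vl S1 vTmp = u" "vl S1 vBits = v" "vl S1 vN = n" "vl S1 vEdge = i" "ar S1 = ar S" "bad S1 = bad S" "clk S - 2 <= clk S1" for S1 :: cst
 proof -
 have I1: "eread (2 * i) (ar S1)" using I S1(5) by simp
 have 1: "sp (put_edge vTmp vBits ?e1) S1 (%S'. eread (Suc (2 * i)) (ar S') & bad S' = bad S1 & clk S1 - 3 <= clk S')"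
 by (rule sp_put_edge[where u = u and v = v, OF S1(1-3) uv _ _ e(1) I1], rule ev(3), rule S1(4)) (use i in simp)
 have 2: "sp (put_edge vBits vTmp ?e2) S2 ?Q"
 if fr: "frame (put_edge vTmp vBits ?e1) S1 S2" and S2: "eread (Suc (2 * i)) (ar S2)" "bad S2 = bad S1" "clk S1 - 3 <= clk S2" for S2 :: cst
 proof -
 have V2: "vl S2 = vl S1" using fr unfolding frame_def put_edge_def by auto
 have V2': "vl S2 vTmp = u" "vl S2 vBits = v" "vl S2 vN = n" "vl S2 vEdge = i" unfolding V2 by (fact )+
 have "sp (put_edge vBits vTmp ?e2) S2 (%S'. eread (Suc (Suc (2 * i))) (ar S') & bad S' = bad S2 & clk S2 - 3 <= clk S')"
 by (rule sp_put_edge[where u = v and v = u, OF V2'(2,1,3) uv(2,1) _ _ e(2) S2(1)], rule ev(4), rule V2'(4)) (use i in simp)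
 thus ?thesis
 by (rule sp_weak) (use S1(6,7) S2(2,3) in simp)
 qed
 show ?thesis by (rule sp_Seq, rule sp_weak[OF 1], rule 2, assumption) simp_all
 qed
 show ?thesis
 unfolding read_edge_def
 apply (rule sp_Seq, rule sp_Asg_eq[where v = u], subst eval.simps(4), subst ev(1), rule V(2), rule input(1))
 apply (rule sp_Seq, rule sp_Asg_eq[where v = v], subst eval.simps(4), subst ev(2), simp add: V, simp add: input)
 by (rule put) (use V in simp_all)
qed

lemma sp_read_edges:
 assumes input: "!!i. i < length xs_0 ==> ar S 0 i = xs_0 ! i" and V: "vl S vN = n" "vl S vM = m"
 shows "sp read_edges S (%S'. eread (2 * m) (ar S') & bad S' = bad S & clk S - (2 + 10 * real m) <= clk S')" (is "sp _ S ?Q")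
 unfolding read_edges_def
proof (rule sp_For_time[where n = m and t = 8 and I = "%i V A b. eread (2 * i) A & b = bad S"])
 show "vl S vM = m" by (rule V)
 fix i and S1 :: cst
 assume fr: "frame (For vEdge vM read_edge) S S1" and i: "i < m" "vl S1 vEdge = i" and I: "eread (2 * i) (ar S1) & bad S1 = bad S"
 have fx: "ar S1 0 = ar S 0" "vl S1 vN = n" using fr V by (auto simp: frame_def w_For read_edge_def put_edge_def)
 have in1: "ar S1 0 (3 + 2 * i) = fst (es_0 ! i)" "ar S1 0 (4 + 2 * i) = snd (es_0 ! i)"
 using input[of "3 + 2 * i"] input[of "4 + 2 * i"] i(1) length_xs0 nth_xs0(4,5)[] by (simp_all add: fx)
 show "sp read_edge S1 (%S''. (eread (2 * Suc i) (ar S'') & bad S'' = bad S) & clk S1 - 8 <= clk S'')"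
 by (rule sp_weak[OF sp_read_edge[OF in1 fx(2) i(2,1) _ ]]) (use I in auto)
next
 fix S1 :: cst
 assume "eread (2 * m) (ar S1) & bad S1 = bad S" "clk S - (2 + real m * (8 + 2)) <= clk S1"
 thus "?Q S1" by simp
qed (simp_all add: read_edge_def put_edge_def eread_def)

lemma sp_setup:
 assumes input: "!!i. i < length xs_0 ==> ar S 0 i = xs_0 ! i"
 shows "sp (read_params cr ;; balance_params ;; read_edges) S (%S'. env@@S' 0 & bad S' = bad S &
 clk S - (40 + 3 * real (blen (n + t)) + 3 * real LV + 2 * real B + 2 * real D + 10 * real m) <= clk S')" (is "sp _ S ?Q")
proof (rule sp_Seq, rule sp_weak[OF sp_read_params[OF input]], assumption, rule sp_Seq)
 fix S1 :: cst
 assume fr1: "frame (read_params cr) S S1" and S1: "vl S1 vN = n & vl S1 vM = m & vl S1 vT = tt & vl S1 vTau = tu & vl S1 vR = rho & vl S1 vLV = LV & bad S1 = bad S &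
 clk S - (20 + 3 * real (blen (n + t)) + 3 * real LV) <= clk S1"
 have in1: "ar S1 = ar S" using fr1 by (auto simp: frame_def written_setup)
 show "sp balance_params S1 (%S'. sp read_edges S' ?Q)"
 proof (rule sp_weak[OF sp_balance_params])
 fix S2 :: cst
 assume fr2: "frame balance_params S1 S2" and S2: "vl S2 vB = B & vl S2 vD = D & vl S2 vBud = Bud & vl S2 vJJ = 0 & bad S2 = bad S1 &
 clk S1 - (10 + 2 * real B + 2 * real D) <= clk S2"
 have fx2: "ar S2 = ar S" "x ~: {vB, vD, vBud, vJJ} ==> vl S2 x = vl S1 x" for x
 using fr2 in1 by (auto simp: frame_def written_setup)
 have V2: "vl S2 vN = n" "vl S2 vM = m" "vl S2 vT = tt" "vl S2 vTau = tu" "vl S2 vR = rho" "vl S2 vLV = LV"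
 using S1 [] fx2(2)[] fx2(2)[of ] fx2(2)[of vTau] fx2(2)[of vR] fx2(2)[of vLV] by simp_all
 show "sp read_edges S2 ?Q"
 proof (rule sp_weak[OF sp_read_edges[OF _ V2(1,2)]])
 show "i < length xs_0 ==> ar S2 0 i = xs_0 ! i" for i using input fx2 by simp
 fix S3 :: cst
 assume fr3: "frame read_edges S2 S3" and S3: "eread (2 * m) (ar S3) & bad S3 = bad S2 & clk S2 - (2 + 10 * real m) <= clk S3"
 have fx3: "x ~: {vEdge, vTmp, vBits} ==> vl S3 x = vl S2 x" for x using fr3 by (auto simp: frame_def written_setup)
 show "?Q S3" using V2 S2 S3 S1 S2 S3 unfolding env_def glob_def by (simp add: fx3 eread_def)
qed
 qed (use S1 in simp_all)
qed

end

section \<open>Bisection over prefixes of the edge list and the last edge\<close>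

abbreviation (input) "vLo == 85 :: nat"
abbreviation (input) "vHi == 86 :: nat"
abbreviation (input) "vMid == 87 :: nat"
abbreviation (input) "vIt == 88 :: nat"

definition load_edges :: com where
 "load_edges =
 Asg vCnt (Lit 0) ;; Asg vFlag (Lit 0) ;; Asg vWk (Lit 0) ;; Asg (vBc 2) ($vJJ) ;;
 For vEdge vJJ (Write (aBA 2) ($vEdge) (Read aEU ($vEdge)) ;; Write (aBB 2) ($vEdge) (Read aEV ($vEdge)))"

definition attempt :: com where "attempt = load_edges ;; solve2"

definition bisect_step :: com where
 "bisect_step = Cond (($vLo [+] Lit 1) [<] $vHi)
 (Asg vMid (Op Div ($vLo [+] $vHi) (Lit 2)) ;; Asg vJJ (Lit 2 [*] $vMid) ;; attempt ;;
 Cond ($vFlag) (Asg vHi ($vMid)) (Asg vLo ($vMid))) Skip"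

text \<open>The initial upper end \<open>m + 1\<close> is a sentinel: no prefix is known to have too
  many cliques. \<open>LV\<close> rounds suffice because
  \<open>2 * m < 2 ^ (LV - 1)\<close>.\<close>

definition bisect :: com where
 "bisect = Asg vLo (Lit 0) ;; Asg vHi ($vM [+] Lit 1) ;; For vIt vLV bisect_step"

definition last_edge_step :: com where
 "last_edge_step = Asg vE1 (Read aEU (Lit 2 [*] $vLo)) ;; Asg vE2 (Read aEV (Lit 2 [*] $vLo)) ;;
 Asg vE3 (Read aEU ($vEdge)) ;; Asg vE4 (Read aEV ($vEdge)) ;; emit"

definition last_edge :: com where
 "last_edge = Cond ($vLo [<] $vM) (Asg vJJ (Lit 2 [*] ($vLo [+] Lit 1)) ;; For vEdge vJJ last_edge_step) Skip"

text \<open>The last attempt of the bisection may concern another prefix and overwrites the output,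
  so the prefix found is searched once more before the last edge is added. Variable 0 is register 0,
  where the output length is expected.\<close>

definition main :: "nat => com" where
 "main cr = (read_params cr ;; balance_params ;; read_edges) ;; bisect ;;
 Asg vJJ (Lit 2 [*] $vLo) ;; attempt ;; last_edge ;; Asg 0 (Lit 4 [*] $vCnt)"

context input
begin

lemma written_solve2: "wvars solve2 <= {10, 11} Un {13..34} Un {50..69}" "warrs solve2 <= {1, 2, 3} Un {7..19} Un {30..49}"
proof -
 have "wvars solve2 <= insert (vLevel 2) (insert vFlag (wvars (level 2 thr_exp2 rate_exp2 act2 fill2)))"
 unfolding solve2_def by (rule s2.written_solve)
 also have "... <= insert (vLevel 2) (insert vFlag ({vFlag, vWk, vIx 2, vVc 2, vVert 2, vDg 2, vPos 2, vRN, vRR, vWN, vI} Un wvars act2 \<union>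
 wvars (search_all (aBA 2) (aBB 2) (vBc 2))))"
 by (intro insert_mono s2.written_level(1))
 also have "... <= insert (vLevel 2) (insert vFlag ({vFlag, vWk, vIx 2, vVc 2, vVert 2, vDg 2, vPos 2, vRN, vRR, vWN, vI} \<union>
 ({10, 11} Un {13..34} Un {50..59} Un {65..69}) Un wvars (search_all (aBA 2) (aBB 2) (vBc 2))))"
 by (intro insert_mono Un_mono order_refl written_act2)
 also have "... <= {10, 11} Un {13..34} Un {50..69}"
 unfolding w_search_all by auto
 finally show "wvars solve2 <= {10, 11} Un {13..34} Un {50..69}" .
 have "warrs solve2 = warrs (level 2 thr_exp2 rate_exp2 act2 fill2)"
 unfolding solve2_def by (rule s2.written_solve)
 also have "... <= {aDeg 2, aNb 2, aVl 2, aRW, aWC, aWD} Un warrs act2 Un warrs (search_all (aBA 2) (aBB 2) (vBc 2))"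
 by (rule s2.written_level(2))
 also have "... <= {aDeg 2, aNb 2, aVl 2, aRW, aWC, aWD} Un ({1, 2, 3} Un {7..19} Un {30..39}) Un warrs (search_all (aBA 2) (aBB 2) (vBc 2))"
 by (intro Un_mono order_refl written_act2)
 also have "... <= {1, 2, 3} Un {7..19} Un {30..49}"
 unfolding w_search_all by auto
 finally show "warrs solve2 <= {1, 2, 3} Un {7..19} Un {30..49}" .
qed

lemma written_attempt: "wvars attempt <= {10, 11} Un {13..34} Un {50..69} Un {84}" "warrs attempt <= {1, 2, 3} Un {7..19} Un {30..49}"
using w_For written_solve2 by (auto simp: attempt_def load_edges_def)
lemma env_jj:
 assumes "env V A k'" "k <= m" "V' vJJ = 2 * k" "!!x. x <= 9 ==> V' x = V x" "!!a. a : {4, 5, 6} ==> A' a = A a"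
 shows "env V' A' k"
 using assms(1-3) unfolding env_def glob_def by (simp add: assms(4,5))

lemma env_edges: "env V A k ==> i < 2 * m ==> A aEU i = fst (es ! i)" "env V A k ==> i < 2 * m ==> A aEV i = snd (es ! i)"
 unfolding env_def glob_def by simp_all

definition cost :: real where "cost = ka * real Bud + 20 + 30 * real LV + 8 * real m"

definition attempted :: "(nat => nat) => (nat => nat => nat) => bool => nat => bool" where
 "attempted V A b k <-> (\<exists>F. found V A k F & (~b --> (if V vFlag = 0 then F = cl k else tt < card (cl k))))"

lemma sp_attempt:
 assumes env: "env@@S k"
 shows "sp attempt S (%S'. attempted@@@S' k & clk S - cost <= clk S')" (is "sp _ S ?Q")
proof -
 have km: "k <= m" by (rule env_D(3)[OF env])
 define hl where "hl = take (2 * k) es"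
 have lenhl: "length hl = 2 * k" using km es(1) by (simp add: hl_def)
 have hl: "distinct hl" "set hl = adj k" using es(2) by (simp_all add: hl_def)
 let ?b = "Write (aBA 2) ($vEdge) (Read aEU ($vEdge)) ;; Write (aBB 2) ($vEdge) (Read aEV ($vEdge))"
 have loop: "sp (For vEdge vJJ ?b) S1 (%S'. sp solve2 S' ?Q)"
 if S1: "vl S1 vCnt = 0" "vl S1 vFlag = 0" "vl S1 vWk = 0" "vl S1 (vBc 2) = 2 * k" "!!x. x ~: {vCnt, vFlag, vWk, vBc 2} ==> vl S1 x = vl S x"
 "ar S1 = ar S" "bad S1 = bad S" "clk S - 4 <= clk S1" for S1 :: cst
 proof (rule sp_For_time[where n = "2 * k" and t = 2 and I = "%i V A b. stores (A (aBA 2)) (map fst (take i hl)) & stores (A (aBB 2)) (map snd (take i hl))"])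
 show "vl S1 vJJ = 2 * k" using S1(5)[] env_D(2)[OF env] by simp
 fix i and S2 :: cst
 assume fr: "frame (For vEdge vJJ ?b) S1 S2" and i: "i < 2 * k" "vl S2 vEdge = i"
 and I: "stores (ar S2 (aBA 2)) (map fst (take i hl)) & stores (ar S2 (aBB 2)) (map snd (take i hl))"
 have arr: "ar S2 aEU = ar S aEU" "ar S2 aEV = ar S aEV" using fr S1(6) by (auto simp: frame_def w_For)
 have im: "i < 2 * m" using i(1) km by simp
 have rd: "ar S2 aEU i = fst (hl ! i)" "ar S2 aEV i = snd (hl ! i)"
 using env_edges[OF env im] i(1) by (simp_all add: arr hl_def)
 have t: "take (Suc i) hl = take i hl @ [hl ! i]" using i(1) lenhl by (intro take_Suc_conv_app_nth) simp
 have l: "length (take i hl) = i" using i(1) lenhl by simp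
 have st: "stores ((ar S2 (aBA 2))(i := fst (hl ! i))) (map fst (take (Suc i) hl))" "stores ((ar S2 (aBB 2))(i := snd (hl ! i))) (map snd (take (Suc i) hl))"
 using stores_append[OF conjunct1[OF I], of "fst (hl ! i)"] stores_append[OF conjunct2[OF I], of "snd (hl ! i)"] l by (simp_all add: t)
 show "sp ?b S2 (%S''. (stores (ar S'' (aBA 2)) (map fst (take (Suc i) hl)) & stores (ar S'' (aBB 2)) (map snd (take (Suc i) hl))) & clk S2 - 2 <= clk S'')"
 apply (rule sp_Seq, rule sp_Write_eq[where x = i and v = "fst (hl ! i)"])
 subgoal using i by simp
 subgoal using i rd by simp
 apply (rule sp_Write_eq[where x = i and v = "snd (hl ! i)"])
 subgoal using i by simp
 subgoal using i rd by simp
 using st by simp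
 next
 fix S2 :: cst
 assume fr: "frame (For vEdge vJJ ?b) S1 S2" and I: "stores (ar S2 (aBA 2)) (map fst (take (2 * k) hl)) & stores (ar S2 (aBB 2)) (map snd (take (2 * k) hl))"
 and clk: "clk S1 - (2 + real (2 * k) * (2 + 2)) <= clk S2"
 have V2: "x ~= vEdge ==> vl S2 x = vl S1 x" "a ~: {aBA 2, aBB 2} ==> ar S2 a = ar S a" for x a
 using fr S1(6) by (auto simp: frame_def w_For)
 have env2: "env@@S2 k" by (rule env_same[OF env]) (use V2 S1(5) in auto)
 have ps: "pairs_at@@S2 (aBA 2) (aBB 2) (vBc 2) hl"
 using I V2(1)[of "vBc 2"] S1(4) lenhl by (simp add: pairs_at_def)
 have st: "status@@@S2 k 0 {}"
 using V2(1)[] S1(1) V2(1)[] V2(1)[] S1(2,3) unfolding status_def by (simp add: found_def)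
have fin: "clk S - cost <= clk S3" if "clk S2 - (ka * real Bud + 10 + 30 * real LV) <= clk S3" for S3 :: cst
 using that km clk S1 by (auto simp: cost_def)
show "sp solve2 S2 ?Q"
 by (rule sp_weak[OF sp_solve2[OF env2 ps hl st]]) (insert fin, simp add: attempted_def)
 qed (simp_all add: stores_def)
 show ?thesis
 unfolding attempt_def load_edges_def
 apply (rule sp_Seq, rule sp_Seq, rule sp_Asg_eq[where v = 0], simp, rule sp_Seq, rule sp_Asg_eq[where v = 0], simp)
 apply (rule sp_Seq, rule sp_Asg_eq[where v = 0], simp, rule sp_Seq, rule sp_Asg_eq[where v = "2 * k"])
 subgoal using env_D(2)[OF env] by simp
 apply (rule loop)
 by simp_all
qed

lemma cl_mono: "k <= k' ==> cl k <= cl k'"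
 using set_take_subset_set_take[of "2 * k" "2 * k'" es] by (auto simp: clique_set_def)

lemma cl_0: "cl 0 = {}"
proof -
 have "K ~: cl 0" for K
 proof
 assume K: "K : cl 0"
 have "card K = 4" using clqD(2)[OF K] .
 then obtain a where a: "a : K" by fastforce
 have "K ~= {a}" using \<open>card K = 4\<close> by auto
then obtain b where "b : K" "a ~= b" using a by blast
 thus False using clqD(3)[OF K a, of ] by simp
 qed
 thus ?thesis by blast
qed

definition bisecting :: "nat => (nat => nat) => (nat => nat => nat) => bool => bool" where
 "bisecting i V A b <-> (\<exists>k. env V A k) & V vLo < V vHi & V vHi <= m + 1 & V vHi - V vLo <= 2 ^ (LV - 1 - i) &
 (~b --> card (cl (V vLo)) <= tt & (V vHi <= m --> tt < card (cl (V vHi))))"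

lemma sp_bisect_step:
 assumes I: "(bisecting i)@@@S" and i: "i < LV"
 shows "sp bisect_step S (%S'. (bisecting (Suc i))@@@S' & clk S - (cost + 5) <= clk S')" (is "sp _ S ?Q")
 unfolding bisect_step_def
proof (rule sp_Cond)
 let ?lo = "vl S vLo" and ?hi = "vl S vHi" let ?mid = "(?lo + ?hi) div 2"
 have c0: "0 <= cost" using kappa_ge by (simp add: cost_def)
 obtain k where env: "env@@S k" using I by (auto simp: bisecting_def)
 have lh: "?lo < ?hi" "?hi <= m + 1" "?hi - ?lo <= 2 ^ (LV - 1 - i)" "~bad S ==> card (cl ?lo) <= tt" "~bad S ==> ?hi <= m ==> tt < card (cl ?hi)"
 using I by (auto simp: bisecting_def)
 have sm: "?lo + ?hi < 2 ^ w" "?lo + 1 < 2 ^ w" "2 * m < 2 ^ w" using lh(1,2) U_less[OF mm_U(3)] by linarith+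
 have cond: "ev w S (($vLo [+] Lit 1) [<] $vHi) = of_bool (?lo + 1 < ?hi)" using sm by simp
 {
 assume "ev w S (($vLo [+] Lit 1) [<] $vHi) = 0"
 hence "?hi - ?lo <= 1" unfolding cond by simp
 also have "1 <= (2 :: nat) ^ (LV - 1 - Suc i)" by simp
 finally have "(bisecting (Suc i))@@@S" using I by (simp add: bisecting_def)
 thus "sp Skip (tick S) ?Q" using c0 by (intro sp_Skip) simp
 }
 assume "ev w S (($vLo [+] Lit 1) [<] $vHi) ~= 0"
 hence lt: "?lo + 1 < ?hi" unfolding cond by simp
 have mid: "?lo < ?mid" "?mid < ?hi" "?mid <= m" using lt lh(2) by linarith+
 have gap: "?hi - ?mid <= 2 ^ (LV - 1 - Suc i)" "?mid - ?lo <= 2 ^ (LV - 1 - Suc i)"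
 proof -
 have "LV - 1 - i ~= 0" using lh(3) lt by (intro notI) simp
 hence "LV - 1 - i = Suc (LV - 1 - Suc i)" by simp
 hence "?hi - ?lo <= 2 * 2 ^ (LV - 1 - Suc i)" using lh(3) by simp
 thus "?hi - ?mid <= 2 ^ (LV - 1 - Suc i)" "?mid - ?lo <= 2 ^ (LV - 1 - Suc i)" by linarith+
 qed
 have att: "sp (attempt ;; Cond ($vFlag) (Asg vHi ($vMid)) (Asg vLo ($vMid))) S1 ?Q"
 if S1: "vl S1 vMid = ?mid" "vl S1 vJJ = 2 * ?mid" "!!x. x ~: {vMid, vJJ} ==> vl S1 x = vl S x" "ar S1 = ar S" "bad S1 = bad S" "clk S - 3 <= clk S1" for S1 :: cst
 proof -
 have env1: "env@@S1 ?mid" by (rule env_jj[where V = "vl S" and A = "ar S" and k' = k]) (use env mid(3) S1 in auto)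
 have "sp (Cond ($vFlag) (Asg vHi ($vMid)) (Asg vLo ($vMid))) S2 ?Q"
 if fr: "frame attempt S1 S2" and S2: "attempted@@@S2 ?mid" "clk S1 - cost <= clk S2" for S2 :: cst
 proof -
 have V2: "vl S2 x = vl S1 x" if "x : {0..9} Un {12} Un {85..90}" for x
 using fr written_attempt(1) that by (auto simp: frame_def)
 have A2: "ar S2 a = ar S1 a" if "a : {4, 5, 6}" for a
 using fr written_attempt(2) that by (auto simp: frame_def)
 have env2: "env@@S2 ?mid" by (rule env_same[OF env1]) (use V2 A2 in auto)
 have lo2: "vl S2 vLo = ?lo" "vl S2 vHi = ?hi" "vl S2 vMid = ?mid" using V2 S1 by auto
 have bad2: "bad S ==> bad S2" using fr S1(5) by (simp add: frame_def)
 obtain F where F: "found@@S2 ?mid F" "~bad S2 ==> if vl S2 vFlag = 0 then F = cl ?mid else tt < card (cl ?mid)"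
 using S2(1) by (auto simp: attempted_def)
 have cF: "card F <= tt" using found_card[] F(1) by (simp add: found_def)
 have envx: "env ((vl S2)(x := u)) (ar S2) ?mid" if "9 < x" "x ~= 12" for x u
 by (rule env_same[OF env2]) (use that in auto)
 show ?thesis
 proof (rule sp_Cond)
 assume f: "ev w S2 ($vFlag) ~= 0"
 have "bisecting (Suc i) ((vl S2)(vHi := ?mid)) (ar S2) (bad S2)"
 using envx[of vHi ?mid] lo2 mid gap lh(4) bad2 F(2) f unfolding bisecting_def by auto
 thus "sp (Asg vHi ($vMid)) (tick S2) ?Q"
 using lo2 S2(2) S1(6) by (intro sp_Asg_eq[where v = ?mid]) auto
 next
 assume f: "ev w S2 ($vFlag) = 0"
 have "bisecting (Suc i) ((vl S2)(vLo := ?mid)) (ar S2) (bad S2)"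
 using envx[of vLo ?mid] lo2 mid gap lh(2,5) bad2 F(2) f cF unfolding bisecting_def by auto
 thus "sp (Asg vLo ($vMid)) (tick S2) ?Q"
 using lo2 S2(2) S1(6) by (intro sp_Asg_eq[where v = ?mid]) auto
 qed
 qed
 thus ?thesis by (intro sp_Seq sp_weak[OF sp_attempt[OF env1]]) blast
 qed
 show "sp (Asg vMid (Op Div ($vLo [+] $vHi) (Lit 2)) ;; Asg vJJ (Lit 2 [*] $vMid) ;; attempt ;;
 Cond ($vFlag) (Asg vHi ($vMid)) (Asg vLo ($vMid))) (tick S) ?Q"
 apply (rule sp_Seq, rule sp_Asg_eq[where v = ?mid])
 subgoal using sm by simp
 apply (rule sp_Seq, rule sp_Asg_eq[where v = "2 * ?mid"])
 subgoal using sm(3) mid(3) by simp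
 by (rule att) simp_all
qed

lemma sp_bisect:
 assumes env: "env@@S 0"
 shows "sp bisect S (%S'. (bisecting LV)@@@S' & clk S - (4 + real LV * (cost + 7)) <= clk S')" (is "sp _ S ?Q")
proof -
 have nin: "vIt ~: wvars bisect_step" "vLV ~: wvars bisect_step"
 using written_attempt(1) by (auto simp: bisect_step_def)
 have loop: "sp (For vIt vLV bisect_step) S1 ?Q"
 if S1: "vl S1 vLo = 0" "vl S1 vHi = m + 1" "!!x. x ~: {vLo, vHi} ==> vl S1 x = vl S x" "ar S1 = ar S" "bad S1 = bad S" "clk S - 2 <= clk S1" for S1 :: cst
 proof (rule sp_For_time[where n = LV and t = "cost + 5" and I = bisecting])
 show "vl S1 vLV = LV" using S1(3)[] env_D(5)[OF env] by simp
 have e1: "env ((vl S1)(vIt := 0)) (ar S1) 0" by (rule env_same[OF env]) (use S1 in auto)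
 show "bisecting 0 ((vl S1)(vIt := 0)) (ar S1) (bad S1)"
 using LV_bounds(1) e1 S1(1,2) cl_0 unfolding bisecting_def by auto
fix i and S2 :: cst
 assume i: "i < LV" and I: "(bisecting i)@@@S2"
 show "sp bisect_step S2 (%S''. bisecting (Suc i) ((vl S'')(vIt := Suc i)) (ar S'') (bad S'') & clk S2 - (cost + 5) <= clk S'')"
 proof (rule sp_weak[OF sp_bisect_step[OF I i]])
 fix S3 :: cst
 assume S3: "(bisecting (Suc i))@@@S3 & clk S2 - (cost + 5) <= clk S3"
 then obtain k where "env@@S3 k" by (auto simp: bisecting_def)
 hence "env ((vl S3)(vIt := Suc i)) (ar S3) k" by (rule env_same) auto
 thus "bisecting (Suc i) ((vl S3)(vIt := Suc i)) (ar S3) (bad S3) & clk S2 - (cost + 5) <= clk S3"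
 using S3 unfolding bisecting_def by auto
 qed
 next
 fix S2 :: cst
 assume "(bisecting LV)@@@S2" "clk S1 - (2 + real LV * (cost + 5 + 2)) <= clk S2"
 thus "?Q S2" using S1(6) by (simp add: add.assoc)
 qed (use nin in auto)
 have m1: "vl S vM = m" using env_D(11)[OF env] .
 have ev: "eval w (vl ((upd S vLo 0))) (ar ((upd S vLo 0))) ($vM [+] Lit 1) = m + 1"
 using U_less[OF mm_U(3)] m1 by (subst eval_poly) simp_all
show ?thesis
 unfolding bisect_def
 apply (rule sp_Seq, rule sp_Asg_eq[where v = 0], simp, rule sp_Seq, rule sp_Asg_eq[where v = "m + 1"], rule ev)
 by (rule loop) simp_all
qed

lemma found_mono: "found V A k F ==> k <= k' ==> found V A k' F"
 using cl_mono[] unfolding found_def by blast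

lemma found_le: "found V A k F ==> V vCnt <= tt"
 by (simp add: found_def)

lemma sp_last_edge_step:
 assumes env: "env@@S (Suc l)" and V: "vl S vLo = l" "l < m" "vl S vEdge = i" "i < 2 * Suc l"
 and prog: "progress@@S (Suc l) f R"
 shows "sp last_edge_step S (%S'. progress@@S' (Suc l) f
 (insert {fst (es ! (2 * l)), snd (es ! (2 * l)), fst (es ! i), snd (es ! i)} R) & bad S' = bad S & clk S - 20 <= clk S')" (is "sp _ S ?Q")
proof -
 have im: "i < 2 * m" "2 * l < 2 * m" using V by simp_all
 have less: "fst (es ! j) < n" "snd (es ! j) < n" if "j < 2 * m" for j
 using es(3)[of "fst (es ! j)" "snd (es ! j)"] that es(1) by simp_all
 have l2: "2 * l < 2 ^ w" using U_less[OF mm_U(3)] im by linarith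
 note E = env_edges[OF env im(1)] env_edges[OF env im(2)]
 have emit: "sp emit S1 ?Q"
 if S1: "vl S1 vE1 = fst (es ! (2 * l))" "vl S1 vE2 = snd (es ! (2 * l))" "vl S1 vE3 = fst (es ! i)" "vl S1 vE4 = snd (es ! i)"
 "!!x. x ~: {vE1, vE2, vE3, vE4} ==> vl S1 x = vl S x" "ar S1 = ar S" "bad S1 = bad S" "clk S - 4 <= clk S1" for S1 :: cst
 proof -
 have env1: "env@@S1 (Suc l)" by (rule env_same[OF env]) (use S1 in auto)
 have prog1: "progress@@S1 (Suc l) f R" using prog [] S1(5)[] S1(6) by (subst progress_cong[of _ "vl S" _ "ar S"]) simp_all
 have "sp emit S1 (%S'. progress@@S' (Suc l) f
 (insert {fst (es ! (2 * l)), snd (es ! (2 * l)), fst (es ! i), snd (es ! i)} R) & bad S' = bad S1 & clk S1 - 16 <= clk S')"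
 by (rule sp_emit_progress[OF env_D(1)[OF env1] prog1 env_D(2,3)[OF env1] S1(1-4)]) (use less im in simp_all)
 thus ?thesis by (rule sp_weak) (use S1(7,8) in auto)
 qed
 show ?thesis
 unfolding last_edge_step_def
 apply (rule sp_Seq, rule sp_Asg_eq[where v = "fst (es ! (2 * l))"])
 subgoal using V l2 E by simp
 apply (rule sp_Seq, rule sp_Asg_eq[where v = "snd (es ! (2 * l))"])
 subgoal using V l2 E by simp
 apply (rule sp_Seq, rule sp_Asg_eq[where v = "fst (es ! i)"])
 subgoal using V E by simp
 apply (rule sp_Seq, rule sp_Asg_eq[where v = "snd (es ! i)"])
 subgoal using V E by simp
 by (rule emit) simp_all
qed

text \<open>A new clique must contain the new edge, and its other two vertices are the ends of an
  edge of the prefix. Hence a single pass over the edges finds all new cliques.\<close>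

lemma cl_Suc:
 assumes l: "l < m"
 shows "cl (Suc l) <= cl l Un (\<Union>i<2 * Suc l. {{fst (es ! (2 * l)), snd (es ! (2 * l)), fst (es ! i), snd (es ! i)}})"
proof
 fix K assume K: "K : cl (Suc l)"
 obtain u v where uv: "es ! (2 * l) = (u, v)" by (cases "es ! (2 * l)")
 have t: "take (2 * Suc l) es = take (2 * l) es @ [(u, v), (v, u)]"
 proof -
 have "take (2 * Suc l) es = take (Suc (Suc (2 * l))) es" by simp
 also have "... = take (2 * l) es @ [es ! (2 * l), es ! (Suc (2 * l))]"
 using l es(1) by (simp add: take_Suc_conv_app_nth)
 finally show ?thesis using es_swap[OF l] uv by simp
 qed
 show "K : cl l Un (\<Union>i<2 * Suc l. {{fst (es ! (2 * l)), snd (es ! (2 * l)), fst (es ! i), snd (es ! i)}})"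
 proof (cases "K : cl l")
 case False
 then obtain x y where xy: "x : K" "y : K" "x ~= y" "(x, y) ~: adj l"
 using clqD(1,2)[OF K] unfolding clique_set_def by blast
 have uvK: "u : K" "v : K" "u ~= v" using clqD(3)[OF K ] xy unfolding t by auto
obtain c d where cd: "K = {u, v, c, d}" "c ~= d" using clique_rest[OF K uvK] by blast
 hence "(c, d) : adj (Suc l)" using clqD(3)[OF K, of ] by blast
 then obtain i where "i < 2 * Suc l" "es ! i = (c, d)" by (auto simp: in_set_conv_nth)
 thus ?thesis using cd(1) uv by force
 qed simp
qed

lemma sp_last_edge:
 assumes env: "env@@S l" and V: "vl S vLo = l" and att: "attempted@@@S l"
 and l: "~bad S ==> card (cl l) <= tt" "~bad S ==> l < m ==> tt < card (cl (Suc l))"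
 shows "sp last_edge S (%S'. (\<exists>F. found@@S' m F & (~bad S' --> F = cl m | vl S' vCnt = tt & tt < card (cl m))) &
 clk S - (5 + 44 * real m) <= clk S')" (is "sp _ S ?Q")
 unfolding last_edge_def
proof (rule sp_Cond)
 have lm: "l <= m" by (rule env_D(3)[OF env])
 have cond: "ev w S ($vLo [<] $vM) = of_bool (l < m)" using V env_D(11)[OF env] by simp
 obtain F where F: "found@@S l F" "~bad S ==> F = cl l"
 using att l(1) unfolding attempted_def by (metis not_le)
 {
 assume "ev w S ($vLo [<] $vM) = 0"
 thus "sp Skip (tick S) ?Q" using lm F unfolding cond by (intro sp_Skip) auto
}
 assume "ev w S ($vLo [<] $vM) ~= 0"
 hence less: "l < m" unfolding cond by simp
 let ?f = "vl S vFlag" and ?e = "%i. {fst (es ! (2 * l)), snd (es ! (2 * l)), fst (es ! i), snd (es ! i)}"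
 let ?I = "%i V A b. progress V A (Suc l) ?f (F Un (\<Union>j<i. {?e j})) & b = bad S"
 have lw: "2 * (l + 1) < 2 ^ w" using less U_less[OF mm_U(3)] by simp
let ?S1 = "tick S(|vl := (vl (tick S))(vJJ := 2 * (l + 1)), clk := clk (tick S) - 1|)"
 have env1: "env@@?S1 (Suc l)" by (rule env_jj[where k' = l and V = "vl S" and A = "ar S"]) (use env less in auto)
 have prog1: "progress@@?S1 (Suc l) ?f F" using found_mono[OF F(1), of "Suc l"] unfolding progress_def by (intro exI[of _ ]) auto
have w: "wvars last_edge_step = {vE1, vE2, vE3, vE4, vFlag, vCnt, vKey, vP}" "warrs last_edge_step = {aOut, aDict, aKey, aSort}"
 by (auto simp: last_edge_step_def written_emit)
 have "sp (For vEdge vJJ last_edge_step) ?S1 ?Q"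
 proof (rule sp_For_time[where n = "2 * (l + 1)" and t = 20 and I = ?I])
 show "?I 0 ((vl ?S1)(vEdge := 0)) (ar ?S1) (bad ?S1)" using prog1 by simp
 fix i and S2 :: cst
 assume fr: "frame (For vEdge vJJ last_edge_step) ?S1 S2" and i: "i < 2 * (l + 1)" "vl S2 vEdge = i" and I: "(?I i)@@@S2"
 have env2: "env@@S2 (Suc l)" by (rule env_same[OF env1]) (insert fr, auto simp: frame_def w_For w)
 have lo2: "vl S2 vLo = l" using fr V by (auto simp: frame_def w_For w)
 have i': "i < 2 * Suc l" using i(1) by simp
 show "sp last_edge_step S2 (%S''. ?I (Suc i) ((vl S'')(vEdge := Suc i)) (ar S'') (bad S'') & clk S2 - 20 <= clk S'')"
 by (rule sp_weak[OF sp_last_edge_step[OF env2 lo2 less i(2) i' conjunct1[OF I]]]) (insert I, simp add: lessThan_Suc)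
 next
 fix S2 :: cst
 assume I: "(?I (2 * (l + 1)))@@@S2" and clk: "clk ?S1 - (2 + real (2 * (l + 1)) * (20 + 2)) <= clk S2"
 obtain F' where F': "found@@S2 (Suc l) F'" "vl S2 vFlag = ?f & (F Un (\<Union>j<2 * (l + 1). {?e j})) Int cl (Suc l) <= F' | flagged (vl S2) (Suc l)"
 using I unfolding progress_def by blast
 have "vl S2 vCnt = tt & tt < card (cl m)" if nb: "~bad S2"
 proof -
 have big: "tt < card (cl (Suc l))" using l(2) less nb I by simp
 have "card (cl (Suc l)) <= card (cl m)" using cl_mono[of "Suc l" ] less finite_clique_set by (intro card_mono) auto
 \<comment> \<open>Had the limit not been hit, all cliques of the prefix \<open>Suc l\<close> would
   be on record. These are more than \<open>tt\<close>, while at most \<open>tt\<close> are ever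
   recorded.\<close>
 moreover have "flagged (vl S2) (Suc l)"
 proof (rule ccontr)
 assume "~flagged (vl S2) (Suc l)"
 hence "(F Un (\<Union>j<2 * Suc l. {?e j})) Int cl (Suc l) <= F'" using F'(2) by simp
 moreover have "F = cl l" using F(2) nb I by simp
 ultimately have sub: "cl (Suc l) <= F'" using cl_Suc[OF less] by blast
 moreover have "F' <= cl (Suc l)" using F'(1) unfolding found_def by blast
 ultimately show False using big found_le[OF F'(1)] found_card[OF F'(1)] by simp
qed
 ultimately show ?thesis by (simp add: flagged_def)
 qed
 moreover have "found@@S2 m F'" by (rule found_mono[OF F'(1)]) (use less in simp)
 moreover have "clk S - (5 + 44 * real m) <= clk S2"
 using less clk by (auto)
ultimately show "?Q S2" by blast
 qed (simp_all add: w)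
 thus "sp (Asg vJJ (Lit 2 [*] ($vLo [+] Lit 1)) ;; For vEdge vJJ last_edge_step) (tick S) ?Q"
 apply (intro sp_Seq)
 apply (rule sp_Asg_eq[where v = "2 * (l + 1)"])
 subgoal using lw V by (subst eval_poly) simp_all
 by assumption
qed

definition tcost :: real where
 "tcost = 60 + 3 * real (blen (n + t)) + 10 * real LV + 2 * real B + 2 * real D + 54 * real m + (real LV + 1) * cost"

lemma sp_main:
 assumes input: "!!i. i < length xs_0 ==> ar S 0 i = xs_0 ! i"
 shows "sp (main cr) S (%S'. vl S' 0 = 4 * vl S' vCnt &
 (\<exists>F. found@@S' m F & (~bad S' --> F = cl m | vl S' vCnt = tt & tt < card (cl m))) &
 clk S - tcost <= clk S')" (is "sp _ S ?Q")
 unfolding main_def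
proof (rule sp_Seq, rule sp_weak[OF sp_setup[OF input]], assumption, rule sp_Seq)
 fix S1 :: cst
 assume S1: "env@@S1 0 & bad S1 = bad S &
 clk S - (40 + 3 * real (blen (n + t)) + 3 * real LV + 2 * real B + 2 * real D + 10 * real m) <= clk S1"
 show "sp bisect S1 (%S'. sp (Asg vJJ (Lit 2 [*] $vLo) ;; attempt ;; last_edge ;; Asg 0 (Lit 4 [*] $vCnt)) S' ?Q)"
 proof (rule sp_weak[OF sp_bisect[OF conjunct1[OF S1]]])
 fix S2 :: cst
 assume S2: "(bisecting LV)@@@S2 & clk S1 - (4 + real LV * (cost + 7)) <= clk S2"
 define l where "l = vl S2 vLo"
 obtain k where env2: "env@@S2 k" using S2 by (auto simp: bisecting_def)
 have lo: "l < vl S2 vHi" "vl S2 vHi <= m + 1" "vl S2 vHi - l <= 1"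
 "~bad S2 ==> card (cl l) <= tt" "~bad S2 ==> vl S2 vHi <= m ==> tt < card (cl (vl S2 vHi))"
 using S2 by (auto simp: bisecting_def l_def)
 have hi: "vl S2 vHi = Suc l" using lo(1,3) by linarith
 have lm: "l <= m" using lo(1,2) by linarith
 let ?S3 = "(upd S2 vJJ (2 * l))"
 have env3: "env@@?S3 l" by (rule env_jj[where V = "vl S2" and A = "ar S2" and k' = k]) (use env2 lm in auto)
 have lw: "2 * l < 2 ^ w" using U_less[OF mm_U(3)] lm by linarith
 have last: "sp (last_edge ;; Asg 0 (Lit 4 [*] $vCnt)) S4 ?Q"
 if fr: "frame attempt ?S3 S4" and S4: "attempted@@@S4 l" "clk ?S3 - cost <= clk S4" for S4 :: cst
 proof -
 have V4: "vl S4 x = vl ?S3 x" if "x : {0..9} Un {12} Un {85..90}" for x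
 proof -
 have "x ~: wvars attempt" using written_attempt(1) that by auto
 thus ?thesis using fr by (simp add: frame_def)
 qed
 have A4: "ar S4 a = ar ?S3 a" if "a : {4, 5, 6}" for a
 using that written_attempt fr by (auto simp: frame_def)
have env4: "env@@S4 l" by (rule env_same[OF env3]) (use V4 A4 in auto)
 have lo4: "vl S4 vLo = l" using V4[] by (simp add: l_def)
 have bad4: "~bad S4 ==> ~bad S2" using fr by (auto simp: frame_def)
 show ?thesis
 proof (rule sp_Seq, rule sp_weak[OF sp_last_edge[OF env4 lo4 S4(1)]])
 show "~bad S4 ==> card (cl l) <= tt" using bad4 lo(4) by blast
 show "~bad S4 ==> l < m ==> tt < card (cl (Suc l))" using bad4 lo(5) hi by simp
 fix S5 :: cst
 assume S5: "(\<exists>F. found@@S5 m F & (~bad S5 --> F = cl m | vl S5 vCnt = tt & tt < card (cl m))) & clk S4 - (5 + 44 * real m) <= clk S5"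
 then obtain F where F: "found@@S5 m F" "~bad S5 --> F = cl m | vl S5 vCnt = tt & tt < card (cl m)" by blast
 have "vl S5 vCnt <= tt" by (rule found_le[OF F(1)])
 hence c: "4 * vl S5 vCnt < 2 ^ w" using tau(3) U_less[OF mm_U(2)] by linarith
have "found ((vl S5)(0 := 4 * vl S5 vCnt)) (ar S5) m F" using F(1) by (subst found_cong[of _ "vl S5" _ "ar S5"]) auto
 moreover have "clk S - tcost <= clk S5 - 1"
 proof -
 show ?thesis using S1 S2 S4(2) S5 unfolding tcost_def by (simp_all add: algebra_simps)
qed
 ultimately show "sp (Asg 0 (Lit 4 [*] $vCnt)) S5 ?Q"
 using c F(2) by (intro sp_Asg_eq[where v = "4 * vl S5 vCnt"]) auto
 qed
 qed
 show "sp (Asg vJJ (Lit 2 [*] $vLo) ;; attempt ;; last_edge ;; Asg 0 (Lit 4 [*] $vCnt)) S2 ?Q"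
 apply (rule sp_Seq, rule sp_Asg_eq[where v = "2 * l"])
 subgoal using lw by (subst eval_poly) (simp_all add: l_def)
 apply (rule sp_Seq, rule sp_weak[OF sp_attempt[OF env3]])
 using last by blast
 qed
qed

section \<open>Correctness of the output\<close>

definition graph :: "nat set set" where "graph = (%(u, v). {u, v}) ` set es_0"

lemma adj_m: "(u, v) : adj m <-> {u, v} : graph & u ~= v"
proof -
 have "adj m = set es" by (simp add: es(1))
 hence "(u, v) : adj m <-> (u, v) : set (both es_0)" by (simp only: es_def)
 also have "... <-> (u, v) : set es_0 | (v, u) : set es_0" unfolding set_both by simp
 also have "... <-> {u, v} : graph & u ~= v"
 proof
 assume "(u, v) : set es_0 | (v, u) : set es_0"
 thus "{u, v} : graph & u ~= v"
 using es0 imageI insert_commute by (auto simp: graph_def)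
next
 assume "{u, v} : graph & u ~= v"
 then obtain e where e: "e : set es_0" "{u, v} = (case e of (u, v) => {u, v})" unfolding graph_def by (elim conjE imageE)
 obtain a b where "e = (a, b)" by (cases e)
 hence "(a, b) : set es_0" "{u, v} = {a, b}" using e by simp_all
 thus "(u, v) : set es_0 | (v, u) : set es_0" by (simp only: doubleton_eq_iff) blast
 qed
 finally show ?thesis .
qed

lemma cl_m: "cl m = cliques 4 n graph"
proof (rule Set.set_eqI)
 fix K
 have "(\<forall>u\<in>K. \<forall>v\<in>K. u ~= v --> (u, v) : adj m) <-> (\<forall>u\<in>K. \<forall>v\<in>K. u ~= v --> {u, v} : graph)" (is "?l = ?r")
 using conjunct1 iffD1 adj_m iffD2 by (auto)
thus "K : cl m <-> K : cliques 4 n graph" unfolding clique_set_def cliques_def mem_Collect_eq by argo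
qed

lemma card_cl_m: "card (cl m) <= m * m"
proof -
 let ?f = "%(i, j). (case es_0 ! i of (a, b) => {a, b}) Un (case es_0 ! j of (a, b) => {a, b})"
 have ed: "\<exists>i<m. (case es_0 ! i of (a, b) => {a, b}) = {u, v}" if "(u, v) : adj m" for u v
 using that conjunct1 iffD1 adj_m graph_def imageE m_def in_set_conv_nth exI by (smt (verit))
have "cl m <= ?f ` ({..<m} \<times> {..<m})"
 proof
 fix K assume K: "K : cl m"
 have K4: "card K = 4" using clqD(2)[OF K] .
 then obtain a where a: "a : K" by fastforce
 have "K ~= {a}" using K4 by auto
then obtain b where b: "b : K" "a ~= b" using a by blast
 obtain c d where cd: "K = {a, b, c, d}" "c ~= d" using clique_rest[OF K a b] by blast
 have cK: "c : K" "d : K" using cd(1) by simp_all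
 obtain i where i: "i < m" "(case es_0 ! i of (a, b) => {a, b}) = {a, b}" using ed[OF clqD(3)[OF K a b]] by (elim exE conjE)
 obtain j where j: "j < m" "(case es_0 ! j of (a, b) => {a, b}) = {c, d}" using ed[OF clqD(3)[OF K cK cd(2)]] by (elim exE conjE)
 have "K = {a, b} Un {c, d}" using cd(1) by blast
 hence "K = ?f (i, j)" unfolding prod.case i(2) j(2) .
 thus "K : ?f ` ({..<m} \<times> {..<m})" by (rule ) (use i(1) j(1) in simp)
 qed
 hence "card (cl m) <= card (?f ` ({..<m} \<times> {..<m}))" by (intro card_mono) auto
 also have "... <= card ({..<m} \<times> {..<m})" by (rule card_image_le) simp
 finally show ?thesis by simp
qed

lemma found_ok:
 assumes F: "found V A m F" "F = cl m | V vCnt = tt & tt < card (cl m)"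
 shows "listing_ok 4 (n, graph, t) (map (A 1) [0..<4 * V vCnt])"
proof -
 obtain Ks where Ks: "length Ks = V vCnt" "distinct Ks" "set Ks = F"
 "!!p i. p < V vCnt ==> i < 4 ==> A aOut (4 * p + i) = sorted_list_of_set (Ks ! p) ! i"
 using F(1) unfolding found_def by auto
 have cnt: "V vCnt <= tt" "F <= cl m" using F(1) by (auto simp: found_def)
 define cs where "cs = map sorted_list_of_set Ks"
 have cl4: "finite K" "card K = 4" if "K : F" for K
 proof -
 show 4: "card K = 4" using clqD(2) that cnt(2) by blast
 show "finite K" using 4 by (auto intro: card_ge_0_finite)
 qed
 have len4: "\<forall>c\<in>set cs. length c = 4" using cl4 Ks(3) by (auto simp: cs_def)
 have concat: "map (A 1) [0..<4 * V vCnt] = concat cs"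
 proof (rule nth_equalityI)
 have lc: "length (concat cs) = 4 * length cs" using len4 by (induction cs) auto
 thus "length (map (A 1) [0..<4 * V vCnt]) = length (concat cs)" by (simp add: cs_def Ks(1))
 fix q assume "q < length (map (A 1) [0..<4 * V vCnt])"
 hence q: "q < 4 * length cs" by (simp add: cs_def Ks(1))
 have nth: "concat cs ! q = cs ! (q div 4) ! (q mod 4)" if "\<forall>c\<in>set cs. length c = 4" "q < 4 * length cs" for cs :: "nat list list" and q
 using that
 proof (induction cs arbitrary: q)
 case (Cons c cs)
 show ?case
 proof (cases "q < 4")
 case True
 thus ?thesis using Cons.prems by (simp add: nth_append)
 next
 case False
 hence "q div 4 = Suc ((q - 4) div 4)" "q mod 4 = (q - 4) mod 4" by (simp_all add: le_mod_geq)
 moreover have "q - 4 < 4 * length cs" using Cons.prems(2) False by simp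
 ultimately show ?thesis using Cons.prems Cons.IH[of "q - 4"] False by (simp add: nth_append)
 qed
 qed simp
 have q4: "q div 4 < V vCnt" "q mod 4 < 4" "4 * (q div 4) + q mod 4 = q" using q by (simp_all add: cs_def Ks(1) )
 thus "map (A 1) [0..<4 * V vCnt] ! q = concat cs ! q"
 using nth[OF len4 ] Ks(4)[OF q4(1,2)] by (simp add: cs_def Ks(1))
 qed
 have set_cs: "map set cs = Ks" using cl4(1) Ks(3) by (auto simp: cs_def intro!: map_idI)
 \<comment> \<open>Replacing \<open>t\<close> by \<open>tt\<close> does not change the minimum
   because of \<open>card_cl_m\<close>.\<close>
 have card: "length cs = min t (card (cl m))"
 using Ks distinct_card F cnt card_cl_m split by (fastforce simp: cs_def tt_def)
show ?thesis
 unfolding listing_ok_def prod.case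
 proof (intro exI[of _ cs] conjI)
 show "distinct (map set cs)" using set_cs Ks(2) by simp
 show "length cs = min t (card (cliques 4 n graph))" using card by (simp add: cl_m)
 show "\<forall>c\<in>set cs. length c = 4 & set c : cliques 4 n graph" using set_cs Ks(3) len4 cnt(2) by (auto simp: cl_m)
qed (rule concat)
qed

end

section \<open>The running time in terms of m and t\<close>

definition ltime :: "real => real => real" where
 "ltime m t = (if t <= m powr (5/4) then m powr (3/2)
 else if t <= m powr (10/7) then m * t powr (2/5) else m powr (1/2) * t powr (3/4))"

text \<open>The bound is the maximum of its three terms: the first two agree at t = m^(5/4) and the
  last two at t = m^(10/7). The \<open>max 1\<close> accounts for \<open>tu\<close>, which is
  positive even if no clique is asked for.\<close>

lemma listing_time_ge:
 fixes m t u :: real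
 assumes m: "1 <= m" and u: "1 <= u" "u <= max 1 t"
 shows "m powr (3/2) <= ltime m t" "m * u powr (2/5) <= ltime m t" "m powr (1/2) * u powr (3/4) <= ltime m t"
proof -
 have mp: "m powr a * m powr b = m powr (a + b)" for a b by (simp add: powr_add)
 have mono: "m powr a <= m powr b" if "a <= b" for a b using m that by (intro powr_mono)   have one: "1 <= m powr a" if "0 <= a" for a using m that by (intro ge_one_powr_ge_zero)   have pp: "(m powr a) powr b = m powr (a * b)" for a b by (rule powr_powr)
 have "m powr (3/2) <= ltime m t & m * u powr (2/5) <= ltime m t & m powr (1/2) * u powr (3/4) <= ltime m t"
 proof (cases "t <= m powr (5/4)")
 case True
 hence u': "u <= m powr (5/4)" using u one[of "5/4"] by simp
 have "m * u powr (2/5) <= m * (m powr (5/4)) powr (2/5)" using u' u m by (intro mult_left_mono powr_mono2) auto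
 also have "... = m powr (3/2)" using m by (simp add: pp powr_mult_base)
 finally have 1: "m * u powr (2/5) <= m powr (3/2)" .
 have "m powr (1/2) * u powr (3/4) <= m powr (1/2) * (m powr (5/4)) powr (3/4)" using u' u by (intro mult_left_mono powr_mono2) auto
 also have "... = m powr (23/16)" by (simp add: pp mp)
 also have "... <= m powr (3/2)" by (rule mono) simp
 finally show ?thesis using 1 True by (simp add: ltime_def)
 next
 case F: False
 hence t1: "1 <= t" using one[of "5/4"] by simp
 hence ut: "u <= t" using u by simp
 have ua: "u powr a <= t powr a" if "0 <= a" for a using u ut that by (intro powr_mono2) auto
 show ?thesis
 proof (cases "t <= m powr (10/7)")
 case True
 hence lt: "ltime m t = m * t powr (2/5)" using F by (simp add: ltime_def)
 have "m powr (3/2) = m * (m powr (5/4)) powr (2/5)" using m by (simp add: pp powr_mult_base)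
 also have "... <= m * t powr (2/5)" using F m by (intro mult_left_mono powr_mono2) auto
 finally have 1: "m powr (3/2) <= m * t powr (2/5)" .
 have 2: "m * u powr (2/5) <= m * t powr (2/5)" using ua m by (intro mult_left_mono) auto
 have "m powr (1/2) * u powr (3/4) <= m powr (1/2) * t powr (3/4)" using ua by (intro mult_left_mono) auto
 \<comment> \<open>The split 3/4 = 7/20 + 2/5 is chosen because (m^(10/7))^(7/20) = m^(1/2).\<close>
 also have "t powr (3/4) = t powr (7/20) * t powr (2/5)" by (simp add: powr_add[symmetric])
 also have "m powr (1/2) * (t powr (7/20) * t powr (2/5)) <= m powr (1/2) * ((m powr (10/7)) powr (7/20) * t powr (2/5))"
 using True t1 by (intro mult_left_mono mult_right_mono powr_mono2) auto
 also have "... = m * t powr (2/5)" using m by (simp add: pp mp )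
 finally show ?thesis using 1 2 lt by simp
 next
 case F2: False
 hence lt: "ltime m t = m powr (1/2) * t powr (3/4)" using F by (simp add: ltime_def)
 have "m powr (3/2) <= m powr (11/7)" by (rule mono) simp
 also have "... = m powr (1/2) * (m powr (10/7)) powr (3/4)" by (simp add: pp mp)
 also have "... <= m powr (1/2) * t powr (3/4)" using F2 by (intro mult_left_mono powr_mono2) auto
 finally have 1: "m powr (3/2) <= m powr (1/2) * t powr (3/4)" .
 have 2: "m powr (1/2) * u powr (3/4) <= m powr (1/2) * t powr (3/4)" using ua by (intro mult_left_mono) auto
 have "m * u powr (2/5) <= m * t powr (2/5)" using ua m by (intro mult_left_mono) auto
 also have "... = m powr (1/2) * ((m powr (10/7)) powr (7/20) * t powr (2/5))" using m by (simp add: pp mp )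
 also have "... <= m powr (1/2) * (t powr (7/20) * t powr (2/5))" using F2 by (intro mult_left_mono mult_right_mono powr_mono2) auto
 also have "... = m powr (1/2) * t powr (3/4)" by (simp add: powr_add[symmetric])
 finally show ?thesis using 1 2 lt by simp
 qed
 qed
 thus "m powr (3/2) <= ltime m t" "m * u powr (2/5) <= ltime m t" "m powr (1/2) * u powr (3/4) <= ltime m t" by blast+
qed

text \<open>Raising the three bounds to the powers 2, 5 and 4 clears the fractional
  exponents.\<close>

lemma balanced_real:
 fixes m tu b :: nat
 assumes m: "1 <= m" and t: "1 <= tu"
 and b: "real m powr (3/2) <= real b" "real m * real tu powr (2/5) <= real b" "real m powr (1/2) * real tu powr (3/4) <= real b"
 shows "balanced m tu b"
proof -
 have pw: "(x powr a) ^ k = x powr (a * real k)" if "0 < x" for x a :: real and k using that by (simp add: powr_power mult.commute)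
 have "(real m powr (3/2)) ^ 2 <= real b ^ 2" using b(1) by (intro power_mono) auto
 hence 1: "real m ^ 3 <= real b ^ 2" using m by (simp add: pw )
 have "(real m * real tu powr (2/5)) ^ 5 <= real b ^ 5" using b(2) by (intro power_mono) auto
 hence 2: "real m ^ 5 * real tu ^ 2 <= real b ^ 5" using t by (simp add: pw power_mult_distrib )
 have "(real m powr (1/2) * real tu powr (3/4)) ^ 4 <= real b ^ 4" using b(3) by (intro power_mono) auto
 hence 3: "real m ^ 2 * real tu ^ 3 <= real b ^ 4" using m t by (simp add: pw power_mult_distrib )
 have "m ^ 3 <= b ^ 2" "m ^ 5 * tu ^ 2 <= b ^ 5" "m ^ 2 * tu ^ 3 <= b ^ 4"
 using 1 2 3 by (simp_all only: of_nat_power[symmetric] of_nat_mult[symmetric] )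
 thus ?thesis by (simp add: balanced_def eval_nat_numeral )
qed

context input
begin

lemma listing_time_pos: "1 <= ltime (real m) (real t)"
proof -
 have "1 <= real m powr (3/2)" using m_pos by (intro ge_one_powr_ge_zero) auto
 thus ?thesis using listing_time_ge(1)[of "real m" 1 "real t"] m_pos by simp
qed

text \<open>The time bound, rounded up, is balanced, and \<open>B\<close> is the least such number.
  The factor 2 absorbs the rounding.\<close>

lemma B_le_time: "real B <= 2 * ltime (real m) (real t)"
proof -
 let ?T = "ltime (real m) (real t)"
 define b where "b = nat \<lceil>?T\<rceil>"
 have b: "?T <= real b" "real b <= ?T + 1" using listing_time_pos unfolding b_def by linarith+
 have u: "1 <= real tu" "real tu <= max 1 (real t)" "1 <= real m" using m_pos by (auto simp: tu_def tt_def)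
 have "balanced m tu b"
 by (rule balanced_real[OF m_pos tau(1)]) (use listing_time_ge[OF u(3,1,2)] b(1) in linarith)+
 hence "B <= b" using balanced_B(3)[] by (metis not_le)
 thus ?thesis using b(2) listing_time_pos by linarith
qed

lemma blen_nt: "1 <= blen (n + t)"
proof -
 show ?thesis using es0(3)[of "fst (hd es_0)" "snd (hd es_0)"] hd_in_set[OF es0(1)] by (subst blen.simps) simp
qed

lemma cost_le: "tcost <= 4 * (real LV + 1) * ka * real Bud"
proof -
 have LV1: "1 <= LV" and B1: "1 <= B" using LV_bounds B_bounds by blast+
 have LB: "LV <= LV * LV * B" "B <= LV * LV * B"
 using mult_le_mono[OF mult_le_mono[OF LV1] B1] mult_le_mono[OF mult_le_mono[OF LV1 LV1] ] by simp_all
 have Bud: "15000 * LV <= Bud" "15000 * B <= Bud" using LB unfolding Bud_def by linarith+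
 have mB: "m <= B" and D: "D <= 2 * B"
 using B_bounds(1) D_bounds(1) mult_le_mono1[OF m_pos, of D] by linarith+
 have rk: "real (blen (n + t)) <= ka"
 proof -
 have "blen (n + t) <= rho" using mult_le_mono1[OF cr(1), of "blen (n + t)"] by (simp add: rho_def)
 hence "real (blen (n + t)) <= (real rho + 1) * 1" by simp
 also have "... <= (real rho + 1) * (2 * (20 * mu + 2000))" using mu by (intro mult_left_mono) auto
 finally show ?thesis by (simp add: ka_def ka0_def algebra_simps)
 qed
 have b1: "1 <= real Bud" using Bud(2) B1 by linarith
 have X: "ka <= ka * real Bud" "4000 * real Bud <= ka * real Bud"
 using mult_left_mono[OF b1, of ] mult_right_mono[OF kappa_ge, of "real Bud"] kappa_ge by simp_all
 define X where "X = ka * real Bud"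
 have Xb: "real LV <= X / 4000" "real B <= X / 4000" "real (blen (n + t)) <= X" "1 <= X / 4000"
 using X rk b1 Bud unfolding X_def by linarith+
 have cost: "cost <= 2 * X" using mB Xb unfolding cost_def X_def[] by linarith
have "(real LV + 1) * cost <= (real LV + 1) * (2 * X)" using cost by (intro mult_left_mono) auto
 moreover have "4 * X <= (real LV + 1) * (2 * X)"
 using LV1 Xb(4) by simp
 moreover have "tcost <= 4 * X + (real LV + 1) * cost"
 using Xb mB D unfolding tcost_def by linarith
 ultimately show ?thesis by (simp add: X_def algebra_simps)
qed

text \<open>A crude polynomial bound for the error estimate only; 11 = 2 + 3 + 6 for the number of
  attempts, the constant \<open>ka\<close> and the budget.\<close>

lemma cost_le_U: "tcost <= real (U ^ 11) * mu"
proof -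
 have U1: "1000 <= real U" using U(1) by simp
 have "ka = 2 * ((real rho + 1) * (20 * mu + 2000))" by (simp add: ka_def ka0_def)
 also have "... <= 2 * ((2 * real U) * (2020 * mu))"
 using mu U1 cr(2) by (intro mult_mono) (auto simp: rho_def[symmetric])
 also have "... = 8080 * (real U * mu)" by simp
 also have "... <= (real U * real U) * (real U * mu)"
 using mu mult_mono[OF U1 U1] by (intro mult_right_mono) auto
 finally have k: "ka <= real (U ^ 3) * mu" by (simp add: eval_nat_numeral )
 have "4 * (real LV + 1) <= real (U ^ 2)"
 proof -
 have "4 * (real LV + 1) <= 8 * real U" using LV_bounds(3) U1 by simp
also have "... <= real U * real U" using U1 by (intro mult_right_mono) auto
 finally show ?thesis by (simp add: power2_eq_square)
 qed
 moreover have "real Bud <= real (U ^ 6)" using Bud_le by (simp only: )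
 ultimately have "4 * (real LV + 1) * ka * real Bud <= real (U ^ 2) * (real (U ^ 3) * mu) * real (U ^ 6)"
 using k kappa_ge mu by (intro mult_mono) auto
 also have "... = real (U ^ 11) * mu" by (simp add: )
 finally show ?thesis using cost_le by linarith
qed

end

context input
begin

text \<open>The clock starts at \<open>tcost\<close> and is not negative at the end, so both the
  time \<open>C * tcost\<close> and the error \<open>ep * tcost\<close> suffice.\<close>

lemma fin_main:
 assumes init: "initial w xs_0 s" and C: "csize (main cr) <= C"
 shows "fin w (code M 0 (main cr)) (%s'. listing_ok 4 (n, graph, t) (result s')) s (real C * tcost) False (ep * tcost)"
proof -
 let ?P = "code M 0 (main cr)" and ?ok = "%s'. listing_ok 4 (n, graph, t) (result s')"
 define S where "S = (|vl = %x. reg s (var_reg x), ar = %a. mem s (arr a), bad = False, clk = tcost|)"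
 have S: "ar S = (%a. mem s (arr a))" "bad S = False" "clk S = tcost" by (simp_all add: S_def)
 have r: "repr w s S" using init by (auto simp: repr_def words_def initial_def S_def)
 have pc: "pc s = 0" using init by (simp add: initial_def)
 have in0: "ar S 0 i = xs_0 ! i" if "i < length xs_0" for i using init that by (simp add: S(1) initial_def arr_def)
 have "fin w ?P ?ok s (real C * clk S + 0) (bad S) (ep * clk S)"
 proof (rule spD[OF sp_main[OF in0]], assumption)
 show "placed ?P (pc s) (code M (pc s) (main cr))" by (auto simp: pc placed_def)
 show "csize (main cr) <= C" "repr w s S" by fact+
 fix s' S'
 assume r': "repr w s' S'" and pc': "pc s' = pc s + length (code M (pc s) (main cr))"
 and Q: "vl S' 0 = 4 * vl S' vCnt &
 (\<exists>F. found@@S' m F & (~bad S' --> F = cl m | vl S' vCnt = tt & tt < card (cl m))) &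
 clk S - tcost <= clk S'"
 have clk: "0 <= clk S'" using Q S(3) by simp
 have "bad S' | ?ok s'"
 proof (cases "bad S'")
 case False
 then obtain F where F: "found@@S' m F" "F = cl m | vl S' vCnt = tt & tt < card (cl m)" using Q by blast
 have "reg s' 0 = 4 * vl S' vCnt" using r' Q by (auto simp: repr_def var_reg_def dest: spec[where x = 0])
 have "mem s' (arr 1) = ar S' 1" using r' by (simp add: repr_def fun_eq_iff)
 hence "mem s' 1 = ar S' 1" by (simp add: arr_def)
 with \<open>reg s' 0 = _\<close> show ?thesis using found_ok[OF F] by (simp add: result_def)
qed simp
 moreover have "halted ?P s'" using pc' pc by (simp add: halted_def)
 ultimately show "fin w ?P ?ok s' (real C * clk S' + 0) (bad S') (ep * clk S')"
 using clk eps by (intro fin_halted) auto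
 qed
 thus ?thesis unfolding S add_0_right .
qed

lemma m_le: "m <= n * n"
proof -
 have d: "distinct es_0" using es0(2) by (simp add: distinct_map)
 have "card (set es_0) <= card ({..<n} \<times> {..<n})" using es0 mem_Times_iff by (intro card_mono) auto
thus ?thesis using distinct_card[OF d] by (simp add: m_def)
qed

text \<open>Four logarithmic factors: one from the attempts of the bisection, one from the number of
  hash functions and two from the levels of the nested searches. The constant is 24 * 16160 *
  750000.\<close>

lemma cost_le_time:
 assumes L: "1 <= L" "n <= 2 ^ L" "t <= 2 ^ L"
 shows "tcost <= 290880000000 * real cr * real L ^ 4 * mu * ltime (real m) (real t)"
proof -
 have "(2::nat) ^ (LV - 1) <= 2 ^ (2 * L + 2)"
 proof -
 have "4 * m <= 4 * (2 ^ L * 2 ^ L)" using m_le mult_le_mono[OF L(2) L(2)] by linarith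
 also have "... = (2::nat) ^ (2 * L + 2)" by (simp add: power_add mult_2)
 finally show ?thesis using LV_bounds(4) by linarith
 qed
 hence "LV - 1 <= 2 * L + 2" by (rule power_le_imp_le_exp[rotated]) simp
 hence LV: "real LV <= 5 * real L" "real LV + 1 <= 6 * real L" using L(1) by simp_all
 have "(2::nat) ^ blen (n + t) <= 2 ^ (L + 2)"
 proof -
 have "0 < n + t" using blen_nt by (cases "n + t") (simp_all add: blen.simps)
 from blen_le[OF this] show ?thesis using L(2,3) by simp
 qed
 hence "blen (n + t) <= L + 2" by (rule power_le_imp_le_exp[rotated]) simp
 hence "rho <= cr * (3 * L)" using L(1) unfolding rho_def by auto
moreover have "1 <= cr * L" using mult_le_mono[OF cr(1) L(1)] by simp
 ultimately have "real (rho + 1) <= real (4 * (cr * L))" by (simp only: )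
hence rho: "real rho + 1 <= 4 * (real cr * real L)" by simp
 have "ka = 2 * ((real rho + 1) * (20 * mu + 2000))" by (simp add: ka_def ka0_def )
 also have "... <= 2 * (4 * (real cr * real L) * (2020 * mu))"
 using rho mu by (intro mult_mono) auto
 finally have k: "ka <= 16160 * real cr * real L * mu" by simp
 have "real LV * real LV <= (5 * real L) * (5 * real L)" using LV by (intro mult_mono) auto
 hence "real LV * real LV * real B <= (5 * real L) * (5 * real L) * (2 * ltime (real m) (real t))"
 by (rule mult_mono[OF _ B_le_time]) simp_all
 hence Bud: "real Bud <= 750000 * real L * real L * ltime (real m) (real t)" by (simp add: Bud_def)
 have "4 * (real LV + 1) * ka * real Bud <=
 (4 * (6 * real L)) * (16160 * real cr * real L * mu) * (750000 * real L * real L * ltime (real m) (real t))"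
 using LV(2) k Bud kappa_ge by (intro mult_mono) auto
 also have "... = 290880000000 * real cr * real L ^ 4 * mu * ltime (real m) (real t)"
 by (simp add: power4_eq_xxxx)
 finally show ?thesis by (rule order_trans[OF cost_le])
qed

end

section \<open>Choice of the constants\<close>

lemma square_le_two_power: "4 <= s ==> s * s <= (2::nat) ^ s"
proof (induction s rule: dec_induct)
 case (step s)
 show ?case using step(1) mult_le_mono1[OF step(1), of s] step by (simp, linarith)
qed simp

text \<open>The exponent q = 2^s outgrows the polynomials in s that occur, such as
  \<open>20 * (s + 11)\<close>, which is needed for \<open>U ^ 20 < 2 ^ w\<close>. \<open>U\<close>
  has s in its exponent because it must exceed the number of hash functions, which is proportional
  to q. The 11 is 7 + 4, from \<open>24 * (m * m + t + 1) <= 2 ^ (7 + 4 * L)\<close>.\<close>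

lemma inputI:
 assumes ram: "ram w M C (1 / 2 ^ (q * L)) mu (2 ^ (q * L))"
 and w: "w = c * (q * L)" "1 <= c" and q: "q = 2 ^ s" and s: "40 <= s"
 and L: "1 <= L" "n <= 2 ^ L" "t <= 2 ^ L" "2 ^ (L - 1) < max n t"
 and es: "es ~= []" "distinct (map (%(u, v). {u, v}) es)" "!!u v. (u, v) : set es ==> u < n & v < n & u ~= v"
 and m: "length es <= n * n"
 shows "input w M C (1 / 2 ^ (q * L)) mu (2 ^ (q * L)) n t (2 ^ ((s + 11) * L)) (2 * q) es"
proof -
 interpret ram w M C "1 / 2 ^ (q * L)" mu "2 ^ (q * L)" by (rule ram)
 have sq: "20 * (s + 11) < q"
 proof -
 have "20 * (s + 11) < 40 * s" using s by simp
 also have "... <= s * s" using s by simp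
 also have "... <= q" unfolding q using s by (intro square_le_two_power) simp
 finally show ?thesis .
 qed
 have pm: "(2::nat) ^ i <= 2 ^ j" if "i <= j" for i j :: nat using that by (rule power_increasing) simp
 have s11: "11 * L <= (s + 11) * L" by simp
 have bl: "L <= blen (n + t)" "blen (n + t) <= L + 2"
 proof -
 have "(2::nat) ^ (L - 1) < 2 ^ blen (n + t)" using L(4) less_blen[of "n + t"] by linarith
 thus "L <= blen (n + t)" by simp
 have "0 < n + t" using L(4) by linarith
 from blen_le[OF this] have "(2::nat) ^ blen (n + t) <= 2 ^ (L + 2)" using L(2,3) by simp
 thus "blen (n + t) <= L + 2" by (rule power_le_imp_le_exp[rotated]) simp
 qed
 show ?thesis
 proof unfold_locales
 show "es ~= []" "distinct (map (%(u, v). {u, v}) es)" by (rule es)+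
 show "u < n & v < n & u ~= v" if "(u, v) : set es" for u v using es(3)[OF that] .
 have "(2::nat) ^ 10 <= 2 ^ ((s + 11) * L)" using s11 L(1) by (intro pm) linarith
 thus "(1000::nat) <= 2 ^ ((s + 11) * L)" by simp
 have "(2::nat) ^ L <= 2 ^ ((s + 11) * L)" by (intro pm) simp
 thus "n <= 2 ^ ((s + 11) * L)" using L(2) by linarith
 have "n * n <= 2 ^ L * 2 ^ L" using L(2) by (intro mult_le_mono)
 hence mL: "length es <= 2 ^ L * 2 ^ L" using m by linarith
 have "length es * length es <= 2 ^ L * 2 ^ L * (2 ^ L * 2 ^ L)" by (rule mult_le_mono[OF mL mL])
 moreover have "4 * L = L + L + (L + L)" by simp
 ultimately have "length es * length es <= 2 ^ (4 * L)" by (simp only: power_add)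
 moreover have "(2::nat) ^ L <= 2 ^ (4 * L)" "(2::nat) ^ 0 <= 2 ^ (4 * L)" by (rule pm; simp)+
 ultimately have "24 * (length es * length es + t + 2 ^ 0) <= 24 * (2 ^ (4 * L) + 2 ^ (4 * L) + 2 ^ (4 * L))"
 using order_trans[OF L(3)] by (intro mult_le_mono2 add_mono)
 hence "24 * (length es * length es + t + 1) <= 128 * 2 ^ (4 * L)" by simp
 also have "... = (2::nat) ^ (7 + 4 * L)" by (simp add: power_add)
 also have "... <= 2 ^ ((s + 11) * L)" using s11 L(1) by (intro pm) linarith
 finally show "24 * (length es * length es + t + 1) <= 2 ^ ((s + 11) * L)" .
 have "20 * ((s + 11) * L) < q * L" using mult_strict_right_mono[OF sq, of L] L(1) by (simp add: )
 moreover have "q * L <= w" using mult_le_mono1[OF w(2), of "q * L"] w(1) by simp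
 ultimately have 20: "20 * ((s + 11) * L) < q * L" "20 * ((s + 11) * L) < w" by linarith+
 show "((2::nat) ^ ((s + 11) * L)) ^ 20 < 2 ^ w"
 unfolding power_mult[symmetric] using 20(2) by (intro power_strict_increasing) (simp_all add: )
 show "((2::nat) ^ ((s + 11) * L)) ^ 4 <= 2 ^ (q * L)"
 unfolding power_mult[symmetric] using 20(1) by (intro pm) linarith
 show "1 <= 2 * q" using sq by simp
have "2 * q * blen (n + t) <= 2 * q * (L + 2)" using bl(2) by (intro mult_le_mono2)
 also have "... <= 2 ^ (s + 1) * 2 ^ (L + 2)" using less_exp[of "L + 2"] q by (intro mult_le_mono) auto
 also have "... = (2::nat) ^ (s + 1 + (L + 2))" by (simp only: power_add)
 also have "... <= 2 ^ ((s + 11) * L)"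
 proof (rule pm)
 have "s * 1 <= s * L" using L(1) by (intro mult_le_mono2)
 thus "s + 1 + (L + 2) <= (s + 11) * L" using L(1) unfolding add_mult_distrib by linarith
 qed
 finally show "2 * q * blen (n + t) <= 2 ^ ((s + 11) * L)" .
 \<comment> \<open>The factor 2 in the number of hash functions: one \<open>q * L\<close>
   compensates the small \<open>ep\<close>, the other the union bound over \<open>U ^ 3\<close>
   triples.\<close>
 have "3 * ((s + 11) * L) + q * L <= 2 * (q * L)" using 20(1) by linarith
 also have "... <= 2 * q * blen (n + t)" using bl(1) by simp
 finally have "real (2 ^ (3 * ((s + 11) * L) + q * L)) <= real (2 ^ (2 * q * blen (n + t)))" by auto
thus "real ((2 ^ ((s + 11) * L)) ^ 3) <= 1 / 2 ^ (q * L) * 2 ^ (2 * q * blen (n + t))"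
 by (auto simp: power_add power_mult[symmetric] mult.commute field_simps)
qed
qed

definition solved_by :: "'i set => ('i => nat) => ('i => nat list set) => ('i => nat list => bool) => ('i => real) =>
 instr list => nat => nat => real => nat => bool" where
 "solved_by I N enc ok T P c d K a <-> (\<forall>x\<in>I. \<forall>xs\<in>enc x.
 let w = c * nat \<lceil>log 2 (real (N x))\<rceil>; k = nat \<lfloor>K * T x * log 2 (real (N x)) ^ d\<rfloor>
 in (\<forall>z\<in>set xs. z < 2 ^ w) & length xs <= 2 ^ w &
 (\<forall>s. initial w xs s --> (\<forall>s'\<in>set_pmf (run w P k s). halted P s') &
 measure_pmf.prob (run w P k s) {s'. ok x (result s')} \<ge> 1 - 1 / real (N x) ^ a))"

lemma solvable_iff_solved_by:
 "solvable_in_soft_time I N enc ok T <-> (\<forall>a. \<exists>P c d K. solved_by I N enc ok T P c d K a)"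
 unfolding solvable_in_soft_time_def solved_by_def ..

text \<open>With \<open>c = 0\<close> the only word would be 0, yet the encoding of a product of 1
  by 1 matrices contains the number 1.\<close>

lemma matmul_word_length:
 assumes "solved_by matmul_instances fst matmul_enc matmul_ok T P c d K a"
 shows "1 <= c"
proof (rule ccontr)
 assume "~1 <= c"
 hence c: "c = 0" by simp
 let ?X = "mat 1 1 (%_. 0) :: nat mat"
 have "(2, ?X, ?X) : matmul_instances" by (auto simp: matmul_instances_def )
 moreover have "[1, 1, 1] @ row_major ?X @ row_major ?X : matmul_enc (2, ?X, ?X)" by (simp add: matmul_enc_def)
 ultimately have "\<forall>z\<in>set ([1, 1, 1] @ row_major ?X @ row_major ?X). z < 2 ^ (c * nat \<lceil>log 2 (real (fst (2, ?X, ?X)))\<rceil>)"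
 using assms unfolding solved_by_def Let_def by blast
 thus False by (simp add: c)
qed

text \<open>The guarantee with exponent 1 is enough: the size \<open>2 ^ l\<close> need not be the
  least bound on the matrices, so the error \<open>1 / 2 ^ l\<close> can be made as small as desired
  by the choice of \<open>l\<close>. The absolute value allows for a negative
  \<open>K\<close>.\<close>

lemma ramI:
 assumes mm: "solved_by matmul_instances fst matmul_enc matmul_ok
 (%(N, X, Y). real (dim_row X * dim_col X + dim_col X * dim_col Y + dim_row X * dim_col Y)) P c d K 1"
 and l: "1 <= l" and C: "10 <= C" and K: "\<bar>K\<bar> <= 2 ^ k"
 shows "ram (c * l) P C (1 / 2 ^ l) (2 ^ k * real l ^ d) (2 ^ l)"
proof
 show "10 <= C" by (rule C)
 show "0 < 1 / (2::real) ^ l" by simp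
 have l': "1 <= real l ^ d" using l by simp
 show "1 <= 2 ^ k * real l ^ d" using mult_mono[of 1 "2 ^ k" 1 "real l ^ d"] l' by simp
 fix X Y :: "nat mat" and xs s
 assume X: "(2 ^ l, X, Y) : matmul_instances" and xs: "xs : matmul_enc (2 ^ l, X, Y)" and s: "initial (c * l) xs s"
 let ?T = "real (dim_row X * dim_col X + dim_col X * dim_col Y + dim_row X * dim_col Y)"
 have "nat \<lfloor>K * ?T * real l ^ d\<rfloor> <= 2 ^ k * real l ^ d * ?T"
 proof -
 have "K * ?T * real l ^ d <= 2 ^ k * ?T * real l ^ d" using K by (intro mult_right_mono) auto
 moreover have "0 <= 2 ^ k * ?T * real l ^ d" by simp
 ultimately have "real (nat \<lfloor>K * ?T * real l ^ d\<rfloor>) <= 2 ^ k * ?T * real l ^ d" by linarith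
 thus ?thesis by (simp only: mult_ac)
 qed
 moreover have "(\<forall>s'\<in>set_pmf (run (c * l) P (nat \<lfloor>K * ?T * real l ^ d\<rfloor>) s). halted P s') &
 1 - 1 / real (fst ((2::nat) ^ l, X, Y)) ^ 1 <= measure_pmf.prob (run (c * l) P (nat \<lfloor>K * ?T * real l ^ d\<rfloor>) s) {s'. matmul_ok (2 ^ l, X, Y) (result s')}"
 using mm X xs s unfolding solved_by_def Let_def by (auto simp: dest!: )
 ultimately show "\<exists>k'. real k' <= 2 ^ k * real l ^ d * ?T & (\<forall>s'\<in>set_pmf (run (c * l) P k' s). halted P s') &
 1 - 1 / 2 ^ l <= measure_pmf.prob (run (c * l) P k' s) {s'. matmul_ok (2 ^ l, X, Y) (result s')}"
 by (intro exI[of _ "nat \<lfloor>K * ?T * real l ^ d\<rfloor>"]) simp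
qed

lemma log_word_length:
 fixes x :: nat
 assumes "2 <= x"
 defines "L == nat \<lceil>log 2 (real x)\<rceil>"
 shows "1 <= L" "x <= 2 ^ L" "2 ^ (L - 1) < x" "1 <= log 2 (real x)" "real L <= 2 * log 2 (real x)"
proof -
 show 1: "1 <= log 2 (real x)" using assms(1) by (simp add: )
 hence L: "log 2 (real x) <= real L" "real L < log 2 (real x) + 1" unfolding L_def by linarith+
 show L1: "1 <= L" using L 1 by linarith
 show "real L <= 2 * log 2 (real x)" using L 1 by linarith
 show "x <= 2 ^ L" using L(1) assms(1) by (auto simp: log_le_iff powr_realpow)
have "real (L - 1) < log 2 (real x)" using L(2) L1 by (simp add: )
 thus "2 ^ (L - 1) < x" using assms(1) by (auto simp: less_log_iff powr_realpow)
qed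

text \<open>All exponents are compared with \<open>q * L\<close>: \<open>11 * (s + 11)\<close> from
  \<open>cost_le_U\<close>, \<open>k\<close>, \<open>s * d\<close> and \<open>d\<close> from
  \<open>mu\<close>, and \<open>a\<close> from the required error. They fit since q = 2^s is at
  least s^2 and s exceeds d + k + a by 40.\<close>

lemma (in input) error_le:
 assumes U: "U = 2 ^ ((s + 11) * L)" and mu: "mu = 2 ^ k * real (q * L) ^ d" and eps: "ep = 1 / 2 ^ (q * L)"
 and q: "q = 2 ^ s" and s: "d + k + a + 40 <= s" and L: "1 <= L" "x <= 2 ^ L" "1 <= x"
 shows "ep * tcost <= 1 / real x ^ a"
proof -
 have exp: "11 * ((s + 11) * L) + k * L + s * d * L + d * L + a * L <= q * L"
 proof -
 have "(d + 40) * s <= s * s" using s by (intro mult_le_mono1) linarith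
 hence "d * s + 40 * s <= s * s" by (simp add: add_mult_distrib)
 moreover have "11 * (s + 11) + k + d + a <= 40 * s" using s by simp
 moreover have "s * s <= q" unfolding q using s by (intro square_le_two_power) linarith
 ultimately have "11 * (s + 11) + k + s * d + d + a <= q" by (simp add: mult.commute)
 from mult_le_mono1[OF this, of L] show ?thesis by (simp only: add_mult_distrib mult.assoc)
 qed
 have "real (q * L) ^ d <= (2 ^ s * 2 ^ L) ^ d" by (intro power_mono) (simp_all add: q )
 also have "... = 2 ^ (s * d + L * d)" by (simp add: power_mult_distrib power_mult power_add)
 also have "... <= 2 ^ (s * d * L + d * L)" using L(1) by (intro power_increasing) (simp_all add: )
 finally have 1: "real (q * L) ^ d <= 2 ^ (s * d * L + d * L)" .
 have 2: "(2::real) ^ k <= 2 ^ (k * L)" using L(1) by (intro power_increasing) simp_all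
 have "mu <= 2 ^ (k * L) * 2 ^ (s * d * L + d * L)" unfolding mu by (rule mult_mono[OF 2 1]) simp_all
 hence "real (U ^ 11) * mu <= 2 ^ (11 * ((s + 11) * L)) * (2 ^ (k * L) * 2 ^ (s * d * L + d * L))"
 by (simp add: U power_mult[symmetric] mult.commute)
 hence "tcost <= 2 ^ (11 * ((s + 11) * L) + k * L + s * d * L + d * L)"
 using cost_le_U by (simp add: power_add )
 hence "tcost * real x ^ a <= 2 ^ (11 * ((s + 11) * L) + k * L + s * d * L + d * L) * (2 ^ L) ^ a"
 proof (rule mult_mono)
 show "real x ^ a <= (2 ^ L) ^ a" using L(2) by (intro power_mono) simp_all
qed simp_all
 also have "... = 2 ^ (11 * ((s + 11) * L) + k * L + s * d * L + d * L + a * L)"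
 by (simp only: power_add power_mult[] mult.commute[])
 also have "... <= 2 ^ (q * L)" using exp by (intro power_increasing) simp_all
 finally moreover have "0 < real x ^ a" using L(3) by simp
 ultimately show ?thesis by (simp add: eps field_simps)
qed

lemma (in input) word_size_input: "(\<forall>z\<in>set xs_0. z < 2 ^ w) & length xs_0 <= 2 ^ w"
using es0 U mm_U disjE U_less length_xs0 by (fastforce simp: xs_0_def)
lemma solved_by_main:
 assumes mm: "solved_by matmul_instances fst matmul_enc matmul_ok
 (%(N, X, Y). real (dim_row X * dim_col X + dim_col X * dim_col Y + dim_row X * dim_col Y)) M c d K 1"
 and K: "\<bar>K\<bar> <= 2 ^ k" and s: "d + k + a + 40 <= s" and q: "q = 2 ^ s"
 defines "C == csize (main (2 * q)) + 10"
 shows "solved_by listing_instances listing_size listing_enc (listing_ok 4)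
 (%(n, E, t). ltime (real (card E)) (real t)) (code M 0 (main (2 * q))) (c * q) (d + 4)
 (real C * 290880000000 * real (2 * q) * 2 ^ k * real q ^ d * 2 ^ (d + 4) + 1) a"
 (is "solved_by _ _ _ _ _ ?P _ _ ?K _")
 unfolding solved_by_def Let_def
proof (intro ballI)
 fix x xs assume x: "x : listing_instances" and xs: "xs : listing_enc x"
 obtain n E t where nEt: "x = (n, E, t)" by (cases x)
 obtain es where es: "xs = [n, card E, t] @ concat (map (%(u, v). [u, v]) es)"
 "length es = card E" "(%(u, v). {u, v}) ` set es = E"
 using xs unfolding nEt listing_enc_def by auto
 have E: "!!e. e : E ==> e <= {..<n} & card e = 2" "E ~= {}"
 using x unfolding nEt listing_instances_def simple_graph_def by auto
 have es_edge: "u < n & v < n & u ~= v" if e: "(u, v) : set es" for u v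
 using imageI e es E by (fastforce)
have ne: "es ~= []" using E(2) es(3) by auto
 have dist: "distinct (map (%(u, v). {u, v}) es)" by (rule card_distinct) (simp add: es(2,3))
 have size: "listing_size x = max n t" by (simp add: nEt listing_size_def)
 obtain u v where "(u, v) : set es" using ne by (cases es) auto
 from es_edge[OF this] have "2 <= max n t" by (simp add: max_def)
 note L = log_word_length[OF this]
 define L where "L = nat \<lceil>log 2 (real (max n t))\<rceil>"
 note L = L[folded L_def]
 have nt: "n <= 2 ^ L" "t <= 2 ^ L" using L(2) by simp_all
 have "length es <= n * n"
 proof -
 have "card (set es) <= card ({..<n} \<times> {..<n})" using es_edge by (intro card_mono) auto
thus ?thesis using distinct_card[of es] dist by (simp add: distinct_map)
 qed
 define mu where "mu = 2 ^ k * real (q * L) ^ d"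
 have q1: "1 <= q" by (simp add: q)
 have qL: "1 <= q * L" using mult_le_mono[OF q1 L(1)] by simp
 have C: "csize (main (2 * q)) <= C" "10 <= C" by (simp_all add: C_def)
 have ram: "ram (c * (q * L)) M C (1 / 2 ^ (q * L)) mu (2 ^ (q * L))"
 unfolding mu_def by (rule ramI[OF mm qL C(2) K])
 have s40: "40 <= s" using s by linarith
 interpret I: input "c * (q * L)" M C "1 / 2 ^ (q * L)" mu "2 ^ (q * L)" n t "2 ^ ((s + 11) * L)" "2 * q" es
 by (rule inputI[OF ram refl matmul_word_length[OF mm] q s40 L(1) nt L(3) ne dist es_edge \<open>length es <= n * n\<close>])
 have m: "I.m = card E" and graph: "I.graph = E" by (simp_all add: I.m_def I.graph_def es)
 have xs0: "xs = I.xs_0" by (simp add: I.xs_0_def es(1) m)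
 let ?T = "ltime (real (card E)) (real t)" and ?l = "log 2 (real (max n t))"
 let ?k = "nat \<lfloor>?K * ?T * ?l ^ (d + 4)\<rfloor>"
 have T: "1 <= ?T" using I.listing_time_pos by (simp add: m)
 have "1 / 2 ^ (q * L) * I.tcost <= 1 / real (max n t) ^ a"
 by (rule I.error_le[OF refl mu_def refl q s L(1,2)]) (use \<open>2 <= max n t\<close> in linarith)
 moreover have "real C * I.tcost <= real ?k"
 proof -
 have l4: "1 <= ?l ^ (d + 4)" using L(4) by (rule one_le_power)
 have "real L ^ (d + 4) <= (2 * ?l) ^ (d + 4)" using L(5) by (intro power_mono) simp_all
 hence Ll: "real L ^ (d + 4) <= 2 ^ (d + 4) * ?l ^ (d + 4)" by (simp only: power_mult_distrib)
 let ?c = "real C * 290880000000 * real (2 * q) * 2 ^ k * real q ^ d"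
 have "real C * I.tcost <= real C * (290880000000 * real (2 * q) * real L ^ 4 * mu * ?T)"
 using I.cost_le_time[OF L(1) nt] by (intro mult_left_mono) (simp_all add: m)
 also have "... = (?c * ?T) * real L ^ (d + 4)"
 by (simp only: mu_def of_nat_mult power_mult_distrib power_add mult_ac)
 also have "... <= (?c * ?T) * (2 ^ (d + 4) * ?l ^ (d + 4))" using Ll T by (intro mult_left_mono) simp_all
 finally have 1: "real C * I.tcost <= ?c * 2 ^ (d + 4) * ?T * ?l ^ (d + 4)" by (simp only: mult_ac)
 \<comment> \<open>The summand 1 in the constant contributes at least 1 here, which makes up for
   rounding down the number of steps.\<close>
 have 2: "1 <= ?T * ?l ^ (d + 4)" using mult_mono[OF T l4 order_trans[OF zero_le_one T] ] by simp
 have "?K * ?T * ?l ^ (d + 4) = ?c * 2 ^ (d + 4) * ?T * ?l ^ (d + 4) + ?T * ?l ^ (d + 4)"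
 by (simp only: distrib_right )
 thus ?thesis using 1 2 by linarith
 qed
 moreover have "fin (c * (q * L)) ?P (%s'. listing_ok 4 (n, E, t) (result s')) s (real C * I.tcost) False (1 / 2 ^ (q * L) * I.tcost)"
 if "initial (c * q * L) xs s" for s
 using I.fin_main[OF _ C(1), of ] that unfolding xs0 graph mult.assoc by blast
 ultimately have fin: "fin (c * (q * L)) ?P (%s'. listing_ok 4 (n, E, t) (result s')) s (real C * I.tcost) False (1 / real (max n t) ^ a)"
 and k: "real C * I.tcost <= real ?k" if "initial (c * q * L) xs s" for s
 using that by (auto intro: fin_mono)
 have ws: "(\<forall>z\<in>set xs. z < 2 ^ (c * q * L)) & length xs <= 2 ^ (c * q * L)"
 using I.word_size_input unfolding xs0 mult.assoc .
 have run: "\<forall>s. initial (c * q * L) xs s --> (\<forall>s'\<in>set_pmf (run (c * q * L) ?P ?k s). halted ?P s') &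
 1 - 1 / real (max n t) ^ a <= measure_pmf.prob (run (c * q * L) ?P ?k s) {s'. listing_ok 4 (n, E, t) (result s')}"
 proof (intro allI impI)
 fix s assume "initial (c * q * L) xs s"
 from fin[OF this, unfolded fin_def, THEN conjunct2, THEN conjunct2, THEN spec, THEN mp, OF k[OF this]]
 show "(\<forall>s'\<in>set_pmf (run (c * q * L) ?P ?k s). halted ?P s') &
 1 - 1 / real (max n t) ^ a <= measure_pmf.prob (run (c * q * L) ?P ?k s) {s'. listing_ok 4 (n, E, t) (result s')}"
 unfolding simp_thms mult.assoc .
 qed
 show "(\<forall>z\<in>set xs. z < 2 ^ (c * q * nat \<lceil>log 2 (real (listing_size x))\<rceil>)) &
 length xs <= 2 ^ (c * q * nat \<lceil>log 2 (real (listing_size x))\<rceil>) &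
 (\<forall>s. initial (c * q * nat \<lceil>log 2 (real (listing_size x))\<rceil>) xs s -->
 (\<forall>s'\<in>set_pmf (run (c * q * nat \<lceil>log 2 (real (listing_size x))\<rceil>) ?P
 (nat \<lfloor>?K * (case x of (n, E, t) => ltime (real (card E)) (real t)) * log 2 (real (listing_size x)) ^ (d + 4)\<rfloor>) s). halted ?P s') &
 1 - 1 / real (listing_size x) ^ a <= measure_pmf.prob (run (c * q * nat \<lceil>log 2 (real (listing_size x))\<rceil>) ?P
 (nat \<lfloor>?K * (case x of (n, E, t) => ltime (real (card E)) (real t)) * log 2 (real (listing_size x)) ^ (d + 4)\<rfloor>) s) {s'. listing_ok 4 x (result s')})"
 unfolding size unfolding nEt prod.case L_def[symmetric]
 by (rule conjI[OF conjunct1[OF ws] conjI[OF conjunct2[OF ws] run]])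
qed

theorem theorem1p7:
  assumes omega_eq_2: "\<omega> = 2"
    and omega_convention: "\<omega> = 2 \<longrightarrow>
      rect_matmul_in_soft_time (\<lambda>A B C. real (A * B + B * C + A * C))"
  shows "clique_listing_in_soft_time 4 (\<lambda>m t.
    if t \<le> m powr (5/4) then m powr (3/2)
    else if t \<le> m powr (10/7) then m * t powr (2/5)
    else m powr (1/2) * t powr (3/4))"
proof -
 have "clique_listing_in_soft_time 4 ltime"
 unfolding clique_listing_in_soft_time_def solvable_iff_solved_by
 proof
 fix a
 obtain M c d K where mm: "solved_by matmul_instances fst matmul_enc matmul_ok
 (%(N, X, Y). real (dim_row X * dim_col X + dim_col X * dim_col Y + dim_row X * dim_col Y)) M c d K 1"
 using omega_convention omega_eq_2 unfolding rect_matmul_in_soft_time_def solvable_iff_solved_by by blast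
 obtain k where "\<bar>K\<bar> <= 2 ^ k" using real_arch_pow[of 2 "\<bar>K\<bar>"] by (auto intro: less_imp_le)
 from solved_by_main[OF mm this order_refl refl, of a]
 show "\<exists>P c d K. solved_by listing_instances listing_size listing_enc (listing_ok 4)
 (%(n, E, t). ltime (real (card E)) (real t)) P c d K a" by blast
 qed
 thus ?thesis unfolding ltime_def .
qed

end
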